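(* Let $G$ and $H$ be countable sofic groups each of which either (a) contains a w-normal amenable subgroup which is neither locally finite nor virtually cyclic, or (b) is a product of two countably infinite sofic groups at least one of which is not locally finite. Let $G\curvearrowright X$ and $H\curvearrowright Y$ be topologically free and entropy regular continuous actions on compact metrizable spaces, and suppose that they are continuously orbit equivalent. Then $$h(H\curvearrowright Y)=h(G\curvearrowright X),$$ where $h$ denotes maximum sofic topological entropy.
   Context: All groups are countable and discrete. A group is locally finite if each of its finitely generated subgroups is finite, and virtually cyclic if it has a cyclic subgroup of finite index. w-normality. A subgroup $G_0$ of $G$ is w-normal in $G$ if there are a countable ordinal $\gamma$ and subgroups $G_\lambda$ of $G$ for ordinals $0\le\lambda\le\gamma$ (the subgroup at $\lambda=0$ being $G_0$) such that $G_\lambda\subseteq G_{\lambda'}$ for $\lambda<\lambda'\le\gamma$; $G=G_\gamma$; $G_\lambda$ is normal in $G_{\lambda+1}$ for each $\lambda<\gamma$; and $G_{\lambda'}=\bigcup_{\lambda<\lambda'}G_\lambda$ for each limit ordinal $\lambda'\le\gamma$. A continuous action $G\curvearrowright X$ on a compact metrizable space is topologically free if the set of $x\in X$ with $sx\ne x$ for all $s\in G\setminus\{e_G\}$ is dense. Continuous actions $G\curvearrowright X$ and $H\curvearrowright Y$ on compact metrizable spaces are continuously orbit equivalent if there are a homeomorphism $\Phi:X\to Y$ and continuous maps $\kappa:G\times X\to H$ and $\lambda:H\times Y\to G$ with $\Phi(gx)=\kappa(g,x)\Phi(x)$ and $\Phi^{-1}(ty)=\lambda(t,y)\Phi^{-1}(y)$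 for all $g\in G,x\in X,t\in H,y\in Y$. Sofic approximations. For a nonempty finite set $V$, $\mathrm{Sym}(V)$ is its permutation group and $\rho_{\mathrm{Hamm}}(T,S)=|\{v\in V:Tv\ne Sv\}|/|V|$ for $T,S\in V^V$. A sofic approximation for $G$ is a (not necessarily multiplicative) map $\sigma:G\to\mathrm{Sym}(V)$ for some nonempty finite set $V$. It is an $(F,\delta)$-approximation ($F\subseteq G$ finite, $\delta>0$) if $\rho_{\mathrm{Hamm}}(\sigma_{st},\sigma_s\sigma_t)\le\delta$ for all $s,t\in F$ and $\rho_{\mathrm{Hamm}}(\sigma_s,\sigma_t)\ge 1-\delta$ for all distinct $s,t\in F$. A sofic approximation sequence for $G$ is a sequence $\Sigma=\{\sigma_k:G\to\mathrm{Sym}(V_k)\}_{k=1}^\infty$ such that for every finite $F\subseteq G$ and $\delta>0$, $\sigma_k$ is an $(F,\delta)$-approximation for all sufficiently large $k$. $G$ is sofic if it admits a sofic approximation sequence. Sofic topological entropy. Let $d$ be a compatible metric on $X$. For maps $\varphi,\psi:V\to X$ set $d_2(\varphi,\psi)=\big(\frac1{|V|}\sum_{v\in V}d(\varphi(v),\psi(v))^2\big)^{1/2}$ and $d_\infty(\varphi,\psi)=\max_{v\in V}d(\varphi(v),\psi(v))$. For finite $F\subseteq G$, $\delta>0$ and a sofic approximation $\sigma:G\to\mathrm{Sym}(V)$, $\mathrm{Map}_d(F,\delta,\sigma)$ is the set of all maps $\varphi:V\to X$ with $d_2(\varphi\sigma_g,g\varphi)\le\delta$ for all $g\in F$. $N_\varepsilon(\Omega,\rho)$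 is the maximum cardinality of a subset $\Omega_0$ of $\Omega$ with $\rho(\omega_1,\omega_2)\ge\varepsilon$ for all distinct $\omega_1,\omega_2\in\Omega_0$. Then $$h_\Sigma(G\curvearrowright X)=\sup_{\varepsilon>0}\inf_F\inf_{\delta>0}\limsup_{k\to\infty}\frac1{|V_k|}\log N_\varepsilon(\mathrm{Map}_d(F,\delta,\sigma_k),d_\infty),$$ with $F$ ranging over finite subsets of $G$ and $\log 0=-\infty$; this does not depend on $d$. The maximum and infimum sofic topological entropies are $h(G\curvearrowright X)=\max_\Sigma h_\Sigma(G\curvearrowright X)$ (the maximum exists) and $\underline{h}(G\curvearrowright X)=\inf_\Sigma h_\Sigma(G\curvearrowright X)$, over all sofic approximation sequences $\Sigma$ for $G$. The action is entropy regular if $h(G\curvearrowright X)=\underline{h}(G\curvearrowright X)$. *)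

theory Defs
  imports
    "HOL-Analysis.Analysis"
    "HOL-Algebra.Group_Action"
    "HOL-Algebra.Elementary_Groups"
    "HOL-Combinatorics.Permutations"
begin

section \<open>Group-theoretic notions\<close>

text \<open>A subgroup \<open>K\<close> of \<open>G\<close> is regarded as a group as \<open>G\<lparr>carrier := K\<rparr>\<close>.\<close>

definition locally_finite_group :: "('a, 'm) monoid_scheme \<Rightarrow> bool" where
  "locally_finite_group G \<longleftrightarrow>
     (\<forall>F. finite F \<and> F \<subseteq> carrier G \<longrightarrow> finite (generate G F))"

definition virtually_cyclic_group :: "('a, 'm) monoid_scheme \<Rightarrow> bool" where
  "virtually_cyclic_group G \<longleftrightarrow>
     (\<exists>C. subgroup C G \<and> cyclic_group (G\<lparr>carrier := C\<rparr>) \<and> finite (rcosets\<^bsub>G\<^esub> C))"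

text \<open>Amenability of a discrete group in von Neumann's sense: there is a left-invariant
  finitely additive probability measure defined on all subsets of the group.\<close>

definition amenable_group :: "('a, 'm) monoid_scheme \<Rightarrow> bool" where
  "amenable_group G \<longleftrightarrow>
     (\<exists>\<mu> :: 'a set \<Rightarrow> real.
        (\<forall>A. A \<subseteq> carrier G \<longrightarrow> 0 \<le> \<mu> A) \<and>
        \<mu> (carrier G) = 1 \<and>
        (\<forall>A B. A \<subseteq> carrier G \<and> B \<subseteq> carrier G \<and> A \<inter> B = {} \<longrightarrow> \<mu> (A \<union> B) = \<mu> A + \<mu> B) \<and>
        (\<forall>g\<in>carrier G. \<forall>A. A \<subseteq> carrier G \<longrightarrow> \<mu> (g <#\<^bsub>G\<^esub> A) = \<mu> A))"

text \<open>The ordinals \<open>0 \<le> \<lambda> \<le> \<gamma>\<close>, for a countable ordinal \<open>\<gamma>\<close>, are represented by the field of a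
  well-order \<open>r\<close> on a set of natural numbers having a greatest element, which plays the role
  of \<open>\<gamma>\<close>. Every countable successor ordinal \<open>\<gamma> + 1\<close> arises in this way. The ordinal \<open>0\<close> is
  \<open>wo_rel.minim r (Field r)\<close>, and \<open>\<lambda> + 1\<close> is \<open>wo_rel.suc r {\<lambda>}\<close> for \<open>\<lambda> < \<gamma>\<close>.\<close>

definition limit_element :: "'o rel \<Rightarrow> 'o \<Rightarrow> bool" where
  "limit_element r j \<longleftrightarrow>
     j \<in> Field r \<and> underS r j \<noteq> {} \<and> (\<forall>i\<in>underS r j. j \<noteq> wo_rel.suc r {i})"

definition w_normal :: "'a set \<Rightarrow> ('a, 'm) monoid_scheme \<Rightarrow> bool" where
  "w_normal G\<^sub>0 G \<longleftrightarrow>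
     (\<exists>(r :: nat rel) \<gamma> (K :: nat \<Rightarrow> 'a set).
        Well_order r \<and>
        \<gamma> \<in> Field r \<and> (\<forall>i\<in>Field r. (i, \<gamma>) \<in> r) \<and>
        (\<forall>i\<in>Field r. subgroup (K i) G) \<and>
        K (wo_rel.minim r (Field r)) = G\<^sub>0 \<and>
        K \<gamma> = carrier G \<and>
        (\<forall>(i, j)\<in>r. K i \<subseteq> K j) \<and>
        (\<forall>i\<in>Field r - {\<gamma>}. K i \<lhd> G\<lparr>carrier := K (wo_rel.suc r {i})\<rparr>) \<and>
        (\<forall>j. limit_element r j \<longrightarrow> K j = (\<Union>i\<in>underS r j. K i)))"


section \<open>Sofic approximations\<close>

text \<open>The finite sets \<open>V\<close> are taken to be sets of natural numbers. A permutation of \<open>V\<close> is a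
  function that \<open>permutes V\<close>, hence is the identity off \<open>V\<close>.\<close>

definition hamming_dist :: "'v set \<Rightarrow> ('v \<Rightarrow> 'v) \<Rightarrow> ('v \<Rightarrow> 'v) \<Rightarrow> real" where
  "hamming_dist V T S = real (card {v \<in> V. T v \<noteq> S v}) / real (card V)"

definition sofic_approximation ::
  "('a, 'm) monoid_scheme \<Rightarrow> 'v set \<Rightarrow> ('a \<Rightarrow> 'v \<Rightarrow> 'v) \<Rightarrow> bool" where
  "sofic_approximation G V \<sigma> \<longleftrightarrow>
     finite V \<and> V \<noteq> {} \<and> (\<forall>g\<in>carrier G. \<sigma> g permutes V)"

definition good_approximation ::
  "('a, 'm) monoid_scheme \<Rightarrow> 'a set \<Rightarrow> real \<Rightarrow> 'v set \<Rightarrow> ('a \<Rightarrow> 'v \<Rightarrow> 'v) \<Rightarrow> bool" where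
  "good_approximation G F \<delta> V \<sigma> \<longleftrightarrow>
     (\<forall>s\<in>F. \<forall>t\<in>F. hamming_dist V (\<sigma> (s \<otimes>\<^bsub>G\<^esub> t)) (\<sigma> s \<circ> \<sigma> t) \<le> \<delta>) \<and>
     (\<forall>s\<in>F. \<forall>t\<in>F. s \<noteq> t \<longrightarrow> hamming_dist V (\<sigma> s) (\<sigma> t) \<ge> 1 - \<delta>)"

definition sofic_approximation_sequence ::
  "('a, 'm) monoid_scheme \<Rightarrow> (nat \<Rightarrow> nat set) \<Rightarrow> (nat \<Rightarrow> 'a \<Rightarrow> nat \<Rightarrow> nat) \<Rightarrow> bool" where
  "sofic_approximation_sequence G V \<sigma> \<longleftrightarrow>
     (\<forall>k. sofic_approximation G (V k) (\<sigma> k)) \<and>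
     (\<forall>F \<delta>. finite F \<and> F \<subseteq> carrier G \<and> \<delta> > 0 \<longrightarrow>
        (\<forall>\<^sub>F k in sequentially. good_approximation G F \<delta> (V k) (\<sigma> k)))"

definition sofic_group :: "('a, 'm) monoid_scheme \<Rightarrow> bool" where
  "sofic_group G \<longleftrightarrow> group G \<and> (\<exists>V \<sigma>. sofic_approximation_sequence G V \<sigma>)"


section \<open>The two classes of groups\<close>

definition has_w_normal_amenable_subgroup :: "('a, 'm) monoid_scheme \<Rightarrow> bool" where
  "has_w_normal_amenable_subgroup G \<longleftrightarrow>
     (\<exists>K. w_normal K G \<and>
          amenable_group (G\<lparr>carrier := K\<rparr>) \<and>
          \<not> locally_finite_group (G\<lparr>carrier := K\<rparr>) \<and>
          \<not> virtually_cyclic_group (G\<lparr>carrier := K\<rparr>))"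

text \<open>A countably infinite group is isomorphic to one whose elements are natural numbers, so
  the two factors may be taken to be of that form.\<close>

definition is_product_of_infinite_sofic_groups :: "('a, 'm) monoid_scheme \<Rightarrow> bool" where
  "is_product_of_infinite_sofic_groups G \<longleftrightarrow>
     (\<exists>(A :: nat monoid) (B :: nat monoid).
        sofic_group A \<and> infinite (carrier A) \<and>
        sofic_group B \<and> infinite (carrier B) \<and>
        (\<not> locally_finite_group A \<or> \<not> locally_finite_group B) \<and>
        G \<cong> A \<times>\<times> B)"


section \<open>Continuous actions\<close>

definition continuous_action ::
  "('a, 'm) monoid_scheme \<Rightarrow> 'x topology \<Rightarrow> ('a \<Rightarrow> 'x \<Rightarrow> 'x) \<Rightarrow> bool" where
  "continuous_action G X \<alpha> \<longleftrightarrow>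
     group_action G (topspace X) \<alpha> \<and> (\<forall>g\<in>carrier G. continuous_map X X (\<alpha> g))"

definition topologically_free ::
  "('a, 'm) monoid_scheme \<Rightarrow> 'x topology \<Rightarrow> ('a \<Rightarrow> 'x \<Rightarrow> 'x) \<Rightarrow> bool" where
  "topologically_free G X \<alpha> \<longleftrightarrow>
     X closure_of {x \<in> topspace X. \<forall>s\<in>carrier G - {\<one>\<^bsub>G\<^esub>}. \<alpha> s x \<noteq> x} = topspace X"

definition continuously_orbit_equivalent ::
  "('a, 'm) monoid_scheme \<Rightarrow> 'x topology \<Rightarrow> ('a \<Rightarrow> 'x \<Rightarrow> 'x) \<Rightarrow>
   ('b, 'n) monoid_scheme \<Rightarrow> 'y topology \<Rightarrow> ('b \<Rightarrow> 'y \<Rightarrow> 'y) \<Rightarrow> bool" where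
  "continuously_orbit_equivalent G X \<alpha> H Y \<beta> \<longleftrightarrow>
     (\<exists>\<Phi> \<Phi>' \<kappa> \<theta>.
        homeomorphic_maps X Y \<Phi> \<Phi>' \<and>
        continuous_map (prod_topology (discrete_topology (carrier G)) X)
                       (discrete_topology (carrier H)) \<kappa> \<and>
        continuous_map (prod_topology (discrete_topology (carrier H)) Y)
                       (discrete_topology (carrier G)) \<theta> \<and>
        (\<forall>g\<in>carrier G. \<forall>x\<in>topspace X. \<Phi> (\<alpha> g x) = \<beta> (\<kappa> (g, x)) (\<Phi> x)) \<and>
        (\<forall>t\<in>carrier H. \<forall>y\<in>topspace Y. \<Phi>' (\<beta> t y) = \<alpha> (\<theta> (t, y)) (\<Phi>' y)))"


section \<open>Sofic topological entropy\<close>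

definition compatible_metric :: "'x topology \<Rightarrow> ('x \<Rightarrow> 'x \<Rightarrow> real) \<Rightarrow> bool" where
  "compatible_metric X d \<longleftrightarrow>
     Metric_space (topspace X) d \<and> Metric_space.mtopology (topspace X) d = X"

definition dist_2 ::
  "('x \<Rightarrow> 'x \<Rightarrow> real) \<Rightarrow> 'v set \<Rightarrow> ('v \<Rightarrow> 'x) \<Rightarrow> ('v \<Rightarrow> 'x) \<Rightarrow> real" where
  "dist_2 d V \<phi> \<psi> = sqrt ((1 / real (card V)) * (\<Sum>v\<in>V. (d (\<phi> v) (\<psi> v))\<^sup>2))"

definition dist_inf ::
  "('x \<Rightarrow> 'x \<Rightarrow> real) \<Rightarrow> 'v set \<Rightarrow> ('v \<Rightarrow> 'x) \<Rightarrow> ('v \<Rightarrow> 'x) \<Rightarrow> real" where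
  "dist_inf d V \<phi> \<psi> = Max ((\<lambda>v. d (\<phi> v) (\<psi> v)) ` V)"

text \<open>Maps \<open>V \<rightarrow> X\<close> are extensional functions, so that they are determined by their values on
  \<open>V\<close> and cardinalities of sets of maps are correct.\<close>

definition approx_maps ::
  "'x set \<Rightarrow> ('x \<Rightarrow> 'x \<Rightarrow> real) \<Rightarrow> ('a \<Rightarrow> 'x \<Rightarrow> 'x) \<Rightarrow> 'a set \<Rightarrow> real \<Rightarrow>
   'v set \<Rightarrow> ('a \<Rightarrow> 'v \<Rightarrow> 'v) \<Rightarrow> ('v \<Rightarrow> 'x) set" where
  "approx_maps S d \<alpha> F \<delta> V \<sigma> =
     {\<phi> \<in> V \<rightarrow>\<^sub>E S. \<forall>g\<in>F. dist_2 d V (\<phi> \<circ> \<sigma> g) (\<alpha> g \<circ> \<phi>) \<le> \<delta>}"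

text \<open>For compact \<open>X\<close> and \<open>\<epsilon> > 0\<close>, the cardinalities of \<open>\<epsilon>\<close>-separated sets of maps \<open>V \<rightarrow> X\<close> are
  finite and uniformly bounded, so the maximum below is a genuine one. It is \<open>0\<close> exactly
  when \<open>\<Omega>\<close> is empty.\<close>

definition separation_number :: "real \<Rightarrow> 'z set \<Rightarrow> ('z \<Rightarrow> 'z \<Rightarrow> real) \<Rightarrow> nat" where
  "separation_number \<epsilon> \<Omega> \<rho> =
     Max {card \<Omega>\<^sub>0 | \<Omega>\<^sub>0. \<Omega>\<^sub>0 \<subseteq> \<Omega> \<and> finite \<Omega>\<^sub>0 \<and>
            (\<forall>\<omega>\<^sub>1\<in>\<Omega>\<^sub>0. \<forall>\<omega>\<^sub>2\<in>\<Omega>\<^sub>0. \<omega>\<^sub>1 \<noteq> \<omega>\<^sub>2 \<longrightarrow> \<rho> \<omega>\<^sub>1 \<omega>\<^sub>2 \<ge> \<epsilon>)}"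

definition log_nat :: "nat \<Rightarrow> ereal" where
  "log_nat n = (if n = 0 then -\<infinity> else ereal (ln (real n)))"

text \<open>The metric \<open>d\<close> on \<open>X\<close> is an explicit parameter of the entropies below. For compact \<open>X\<close> their
  values are the same for all compatible metrics.\<close>

definition sofic_entropy_along ::
  "('a, 'm) monoid_scheme \<Rightarrow> 'x topology \<Rightarrow> ('x \<Rightarrow> 'x \<Rightarrow> real) \<Rightarrow> ('a \<Rightarrow> 'x \<Rightarrow> 'x) \<Rightarrow>
   (nat \<Rightarrow> nat set) \<Rightarrow> (nat \<Rightarrow> 'a \<Rightarrow> nat \<Rightarrow> nat) \<Rightarrow> ereal" where
  "sofic_entropy_along G X d \<alpha> V \<sigma> =
     (SUP \<epsilon>\<in>{0<..}. INF F\<in>{F. finite F \<and> F \<subseteq> carrier G}. INF \<delta>\<in>{0<..}.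
        limsup (\<lambda>k. ereal (1 / real (card (V k))) *
          log_nat (separation_number \<epsilon> (approx_maps (topspace X) d \<alpha> F \<delta> (V k) (\<sigma> k))
                                       (dist_inf d (V k)))))"

text \<open>The supremum over all sofic approximation sequences is attained when \<open>G\<close> is a countable
  sofic group and \<open>X\<close> is compact metrizable, so it is the maximum.\<close>

definition max_sofic_entropy ::
  "('a, 'm) monoid_scheme \<Rightarrow> 'x topology \<Rightarrow> ('x \<Rightarrow> 'x \<Rightarrow> real) \<Rightarrow> ('a \<Rightarrow> 'x \<Rightarrow> 'x) \<Rightarrow> ereal" where
  "max_sofic_entropy G X d \<alpha> =
     (SUP (V, \<sigma>)\<in>{(V, \<sigma>). sofic_approximation_sequence G V \<sigma>}. sofic_entropy_along G X d \<alpha> V \<sigma>)"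

definition inf_sofic_entropy ::
  "('a, 'm) monoid_scheme \<Rightarrow> 'x topology \<Rightarrow> ('x \<Rightarrow> 'x \<Rightarrow> real) \<Rightarrow> ('a \<Rightarrow> 'x \<Rightarrow> 'x) \<Rightarrow> ereal" where
  "inf_sofic_entropy G X d \<alpha> =
     (INF (V, \<sigma>)\<in>{(V, \<sigma>). sofic_approximation_sequence G V \<sigma>}. sofic_entropy_along G X d \<alpha> V \<sigma>)"

definition entropy_regular ::
  "('a, 'm) monoid_scheme \<Rightarrow> 'x topology \<Rightarrow> ('x \<Rightarrow> 'x \<Rightarrow> real) \<Rightarrow> ('a \<Rightarrow> 'x \<Rightarrow> 'x) \<Rightarrow> bool" where
  "entropy_regular G X d \<alpha> \<longleftrightarrow> max_sofic_entropy G X d \<alpha> = inf_sofic_entropy G X d \<alpha>"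

end

theory Submission
  imports Defs
begin

text \<open>Call a sofic approximation sequence of \<open>G\<close> sparsely connected if, for every nonnegative cost
  function on \<open>G\<close> and every finite \<open>T \<subseteq> G\<close>, almost all of \<open>V\<^sub>k\<close> is covered by a bounded number of
  translates of a set \<open>W\<close> such that points \<open>w\<close>, \<open>t w\<close> of \<open>W\<close> with \<open>t \<in> T\<close> are joined by short paths in
  a graph of small total cost. If the cost of \<open>g\<close> is \<open>ln |\<kappa>(g, X)|\<close> for the orbit cocycle \<open>\<kappa>\<close>, then
  fixing the values of \<open>\<kappa>\<close> along this graph costs a factor of only \<open>exp (\<eta> |V\<^sub>k|)\<close> in the number of
  models of \<open>G \<curvearrowright> X\<close> on \<open>V\<^sub>k\<close>. The remaining models induce one and the same approximate action of
  \<open>H\<close> on \<open>V\<^sub>k\<close>, and become models of \<open>H \<curvearrowright> Y\<close> for it. Hence \<open>h\<^sub>\<Sigma>(G \<curvearrowright> X) \<le> h(H \<curvearrowright> Y)\<close> for a sparsely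
  connected \<open>\<Sigma>\<close>, and entropy regularity replaces \<open>h\<^sub>\<Sigma>\<close> by \<open>h\<close>.

  An amenable group that is neither locally finite nor virtually cyclic contains arbitrarily long
  paths of \<open>M\<close> points whose translates by a fixed finite set cover at least \<open>N M\<close> points. These give
  sparse nets \<open>W\<close>, and hyperfiniteness gives short paths between them inside spanning forests of
  Folner tiles. Sparse connectivity passes from an infinite normal subgroup, hence along a w-normal
  chain, to the whole group. For \<open>A \<times> B\<close> take products of approximations, and let \<open>W\<close> be the product
  of the first factor with a separated set in the second.\<close>

section \<open>Good points of sofic approximations\<close>

text \<open>The obstacle is that the cocycle varies with the point: a model \<open>\<phi>\<close>
  moves v by h through \<open>l h (\<phi> v)\<close>, so different models induce different
  approximate H-actions on the same set, while entropy counts models of a single one. Prescribing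
  \<open>\<kappa> g (\<phi> v)\<close> for all v and all g in a finite set costs a factor exp (C
  |V|) with C not small. Only the values between points of a net W matter, since at
  \<open>s w\<close> the transported model is computed from w. The net may depend on the accuracy,
  but the finite set S that spreads it over V may not: S determines the labels
  \<open>\<kappa> s x\<close>, these determine the set T of elements whose cocycle value is needed,
  and the cost bound has to hold for every T. The H-action so produced lives on a sequence obtained
  by a diagonal choice, so it only bounds the maximum entropy of H; and in the product case only
  special sequences of G are shown to be sparsely connected, so a lower bound for the entropy along
  one given sequence is needed. That is what regularity supplies. Topological freeness makes
  \<open>\<kappa>\<close> a cocycle with pointwise inverse \<open>l\<close>.\<close>

definition good_points ::
  "('a, 'm) monoid_scheme \<Rightarrow> 'a set \<Rightarrow> 'v set \<Rightarrow> ('a \<Rightarrow> 'v \<Rightarrow> 'v) \<Rightarrow> 'v set" where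
  "good_points G A V \<sigma> =
     {v \<in> V. (\<forall>s\<in>A. \<forall>t\<in>A. \<sigma> (s \<otimes>\<^bsub>G\<^esub> t) v = \<sigma> s (\<sigma> t v)) \<and> inj_on (\<lambda>s. \<sigma> s v) A}"

lemma good_points_subset: "good_points G A V \<sigma> \<subseteq> V"
  by (auto simp: good_points_def)

lemma eventually_good_points:
  assumes seq: "sofic_approximation_sequence G V \<sigma>"
    and A: "finite A" "A \<subseteq> carrier G" and \<epsilon>: "\<epsilon> > 0"
  shows "\<forall>\<^sub>F k in sequentially.
    real (card (V k - good_points G A (V k) (\<sigma> k))) \<le> \<epsilon> * real (card (V k))"
proof -
  \<comment> \<open>Each pair of \<open>A \<times> A\<close> has two bad sets, one for the product
    and one for injectivity, and each gets density at most \<epsilon> / N. The summand 1 keeps N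
    positive for empty A.\<close>
  define N where "N = real (card (A \<times> A)) * 2 + 1"
  have N: "N > 0" by (simp add: N_def)
  have "\<forall>\<^sub>F k in sequentially. good_approximation G A (\<epsilon> / N) (V k) (\<sigma> k)"
    using seq A divide_pos_pos[OF \<epsilon> N] unfolding sofic_approximation_sequence_def by blast
  then show ?thesis
  proof eventually_elim
    case (elim k)
    have sa: "finite (V k)" "V k \<noteq> {}"
      using seq unfolding sofic_approximation_sequence_def sofic_approximation_def by blast+
    define n where "n = real (card (V k))"
    have n: "n > 0" using sa by (simp add: n_def card_gt_0_iff)
    let ?B1 = "\<lambda>(s, t). {v \<in> V k. \<sigma> k (s \<otimes>\<^bsub>G\<^esub> t) v \<noteq> (\<sigma> k s \<circ> \<sigma> k t) v}"
    let ?B2 = "\<lambda>(s, t). {v \<in> V k. s \<noteq> t \<and> \<sigma> k s v = \<sigma> k t v}"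
    have sub: "V k - good_points G A (V k) (\<sigma> k) \<subseteq> (\<Union>p\<in>A \<times> A. ?B1 p \<union> ?B2 p)"
      by (auto simp: good_points_def inj_on_def)
    have b1: "real (card (?B1 p)) \<le> \<epsilon> / N * n" if "p \<in> A \<times> A" for p
      using elim that n by (auto simp: good_approximation_def hamming_dist_def n_def field_simps)
    have b2: "real (card (?B2 p)) \<le> \<epsilon> / N * n" if pA: "p \<in> A \<times> A" for p
    proof -
      obtain s t where p: "p = (s, t)" "s \<in> A" "t \<in> A" using pA by auto
      show ?thesis
      proof (cases "s = t")
        case True then show ?thesis using p \<epsilon> N n by simp
      next
        case False
        have eq: "?B2 p = V k - {v \<in> V k. \<sigma> k s v \<noteq> \<sigma> k t v}" using False p by auto
        have "1 - \<epsilon> / N \<le> real (card {v \<in> V k. \<sigma> k s v \<noteq> \<sigma> k t v}) / n"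
          using elim p False by (auto simp: good_approximation_def hamming_dist_def n_def)
        then have "n - \<epsilon> / N * n \<le> real (card {v \<in> V k. \<sigma> k s v \<noteq> \<sigma> k t v})"
          using n by (simp add: field_simps)
        moreover have "real (card (?B2 p)) = n - real (card {v \<in> V k. \<sigma> k s v \<noteq> \<sigma> k t v})"
          unfolding eq n_def using sa
          by (subst card_Diff_subset) (auto intro!: of_nat_diff card_mono)
        ultimately show ?thesis by simp
      qed
    qed
    have "real (card (V k - good_points G A (V k) (\<sigma> k)))
      \<le> real (card (\<Union>p\<in>A \<times> A. ?B1 p \<union> ?B2 p))"
      using A sa by (intro of_nat_mono card_mono sub) auto
    also have "\<dots> \<le> real (\<Sum>p\<in>A \<times> A. card (?B1 p \<union> ?B2 p))"
      using A by (intro of_nat_mono card_UN_le) auto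
    also have "\<dots> = (\<Sum>p\<in>A \<times> A. real (card (?B1 p \<union> ?B2 p)))" by simp
    also have "\<dots> \<le> (\<Sum>p\<in>A \<times> A. 2 * (\<epsilon> / N * n))"
    proof (rule sum_mono)
      fix p assume p: "p \<in> A \<times> A"
      have "real (card (?B1 p \<union> ?B2 p)) \<le> real (card (?B1 p)) + real (card (?B2 p))"
        using card_Un_le[of "?B1 p" "?B2 p"] by linarith
      then show "real (card (?B1 p \<union> ?B2 p)) \<le> 2 * (\<epsilon> / N * n)"
        using b1[OF p] b2[OF p] by linarith
    qed
    also have "\<dots> = (N - 1) * (\<epsilon> / N * n)" by (simp add: N_def)
    also have "\<dots> \<le> N * (\<epsilon> / N * n)" using \<epsilon> N n by (intro mult_right_mono) auto
    also have "\<dots> = \<epsilon> * n" using N by simp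
    finally show ?case by (simp add: n_def)
  qed
qed

text \<open>The ball of radius n in the word metric of B. Balls serve as the finite windows on which
  an approximation is required to be exact; composing translations is then only a matter of adding
  radii.\<close>

primrec words :: "('a, 'm) monoid_scheme \<Rightarrow> 'a set \<Rightarrow> nat \<Rightarrow> 'a set" where
  "words G B 0 = {\<one>\<^bsub>G\<^esub>}"
| "words G B (Suc n) = words G B n \<union> (\<lambda>(x, w). x \<otimes>\<^bsub>G\<^esub> w) ` ((B \<union> m_inv G ` B) \<times> words G B n)"

context group
begin

lemma words_closed: "B \<subseteq> carrier G \<Longrightarrow> words G B n \<subseteq> carrier G"
  by (induction n) auto

lemma words_closed': "B \<subseteq> carrier G \<Longrightarrow> x \<in> words G B n \<Longrightarrow> x \<in> carrier G"
  using words_closed by blast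

lemma finite_words: "finite B \<Longrightarrow> finite (words G B n)"
  by (induction n) auto

lemma one_in_words: "\<one> \<in> words G B n"
  by (induction n) auto

lemma words_mono: "m \<le> n \<Longrightarrow> words G B m \<subseteq> words G B n"
  by (rule lift_Suc_mono_le) auto

lemma words_mult:
  assumes B: "B \<subseteq> carrier G"
  shows "x \<in> words G B i \<Longrightarrow> y \<in> words G B j \<Longrightarrow> x \<otimes> y \<in> words G B (i + j)"
proof (induction i arbitrary: x)
  case 0
  then show ?case using words_closed'[OF B] by simp
next
  case (Suc i)
  from Suc.prems(1) consider "x \<in> words G B i"
    | b w where "x = b \<otimes> w" "b \<in> B \<union> m_inv G ` B" "w \<in> words G B i" by auto
  then show ?case
  proof cases
    case 1 then show ?thesis using Suc by auto
  next
    case 2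
    have "w \<otimes> y \<in> words G B (i + j)" using Suc 2 by blast
    moreover have "x \<otimes> y = b \<otimes> (w \<otimes> y)"
      using 2 B Suc.prems words_closed'[OF B] by (auto intro!: m_assoc)
    ultimately show ?thesis using 2 by auto
  qed
qed

lemma letter_in_words_1:
  assumes "B \<subseteq> carrier G" "b \<in> B \<union> m_inv G ` B" shows "b \<in> words G B 1"
proof -
  have "b \<in> carrier G" using assms by auto
  then have "b = (\<lambda>(x, w). x \<otimes> w) (b, \<one>)" by simp
  then have "b \<in> (\<lambda>(x, w). x \<otimes> w) ` ((B \<union> m_inv G ` B) \<times> {\<one>})"
    using assms(2) by (intro image_eqI) auto
  then show ?thesis by simp
qed

lemma in_words_1: "B \<subseteq> carrier G \<Longrightarrow> b \<in> B \<Longrightarrow> b \<in> words G B 1"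
  and inv_in_words_1: "B \<subseteq> carrier G \<Longrightarrow> b \<in> B \<Longrightarrow> inv b \<in> words G B 1"
  using letter_in_words_1 by blast+

lemma words_inv:
  assumes B: "B \<subseteq> carrier G"
  shows "x \<in> words G B i \<Longrightarrow> inv x \<in> words G B i"
proof (induction i arbitrary: x)
  case 0
  then show ?case by simp
next
  case (Suc i)
  from Suc.prems(1) consider "x \<in> words G B i"
    | b w where "x = b \<otimes> w" "b \<in> B \<union> m_inv G ` B" "w \<in> words G B i" by auto
  then show ?case
  proof cases
    case 1 then show ?thesis using Suc by auto
  next
    case 2
    have "inv b \<in> words G B 1"
    proof (cases "b \<in> B")
      case True then show ?thesis using inv_in_words_1[OF B] by blast
    next
      case False
      then obtain a where "a \<in> B" "b = inv a" using 2 by blast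
      moreover have "inv (inv a) = a" using B \<open>a \<in> B\<close> by auto
      ultimately show ?thesis using in_words_1[OF B, of a] by simp
    qed
    then have "inv w \<otimes> inv b \<in> words G B (i + 1)" using words_mult[OF B] Suc 2 by blast
    moreover have "inv x = inv w \<otimes> inv b"
      using 2 B words_closed'[OF B] by (auto intro!: inv_mult_group)
    ultimately show ?thesis by simp
  qed
qed

lemma words_subset_subgroup:
  assumes "subgroup K G" "B \<subseteq> K"
  shows "words G B n \<subseteq> K"
  by (induction n) (use assms in \<open>auto intro: subgroup.one_closed subgroup.m_closed subgroup.m_inv_closed\<close>)

lemma generate_eq_words:
  assumes B: "B \<subseteq> carrier G"
  shows "generate G B = (\<Union>n. words G B n)"
proof
  show "generate G B \<subseteq> (\<Union>n. words G B n)"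
  proof
    fix x assume "x \<in> generate G B"
    then show "x \<in> (\<Union>n. words G B n)"
    proof induction
      case one then show ?case using one_in_words by blast
    next
      case (incl h) then show ?case using in_words_1[OF B] by blast
    next
      case (inv h) then show ?case using inv_in_words_1[OF B] by blast
    next
      case (eng h1 h2) then show ?case using words_mult[OF B] by blast
    qed
  qed
  show "(\<Union>n. words G B n) \<subseteq> generate G B"
    using words_subset_subgroup[OF generate_is_subgroup[OF B]] generate.incl[of _ B G]
    by (intro UN_least) blast
qed

end

section \<open>Calculus of translations at good points\<close>

locale sofic_approx = group G for G (structure) +
  fixes V :: "'v set" and \<sigma> :: "'a \<Rightarrow> 'v \<Rightarrow> 'v"
  assumes sofic_approximation: "sofic_approximation G V \<sigma>"
begin

lemma finite_V: "finite V" and V_nonempty: "V \<noteq> {}"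
  and permutes_V: "g \<in> carrier G \<Longrightarrow> \<sigma> g permutes V"
  using sofic_approximation by (auto simp: sofic_approximation_def)

lemma card_V_pos: "0 < card V"
  using finite_V V_nonempty by (simp add: card_gt_0_iff)

lemma \<sigma>_closed: "g \<in> carrier G \<Longrightarrow> v \<in> V \<Longrightarrow> \<sigma> g v \<in> V"
  using permutes_V by (simp add: permutes_in_image)

lemma \<sigma>_eq_iff: "g \<in> carrier G \<Longrightarrow> \<sigma> g v = \<sigma> g w \<longleftrightarrow> v = w"
  using permutes_V by (metis permutes_inverses(2))

abbreviation good :: "'a set \<Rightarrow> 'v set" where
  "good A \<equiv> good_points G A V \<sigma>"

lemma finite_good: "finite (good A)"
  using finite_V good_points_subset finite_subset by metis

lemma good_antimono: "A \<subseteq> B \<Longrightarrow> good B \<subseteq> good A"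
  by (auto simp: good_points_def intro: inj_on_subset)

lemma good_mult: "v \<in> good A \<Longrightarrow> s \<in> A \<Longrightarrow> t \<in> A \<Longrightarrow> \<sigma> s (\<sigma> t v) = \<sigma> (s \<otimes> t) v"
  by (simp add: good_points_def)

lemma good_inj: "v \<in> good A \<Longrightarrow> s \<in> A \<Longrightarrow> t \<in> A \<Longrightarrow> \<sigma> s v = \<sigma> t v \<Longrightarrow> s = t"
  by (auto simp: good_points_def inj_on_def)

lemma good_inj_on: "v \<in> good A \<Longrightarrow> B \<subseteq> A \<Longrightarrow> inj_on (\<lambda>s. \<sigma> s v) B"
  by (auto simp: good_points_def intro: inj_on_subset)

lemma good_one: "v \<in> good A \<Longrightarrow> \<one> \<in> A \<Longrightarrow> \<sigma> \<one> v = v"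
  using good_mult[of v A \<one> \<one>] \<sigma>_eq_iff[of \<one>] by simp

lemma good_inv:
  assumes "v \<in> good A" "\<one> \<in> A" "g \<in> A" "inv g \<in> A" "g \<in> carrier G"
  shows "\<sigma> (inv g) (\<sigma> g v) = v" "\<sigma> g (\<sigma> (inv g) v) = v"
  using good_mult[of v A "inv g" g] good_mult[of v A g "inv g"] good_one assms by auto

lemma good_inv_eq:
  assumes "v \<in> good A" "\<one> \<in> A" "g \<in> A" "inv g \<in> A" "g \<in> carrier G" "\<sigma> g u = v"
  shows "u = \<sigma> (inv g) v"
  using assms good_inv(2)[of v A g] \<sigma>_eq_iff by metis

text \<open>A product taken at \<open>\<sigma> p v\<close> is a product with p on the right taken at
  v, so translates inherit goodness on a smaller window. One exceptional set at a large radius thus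
  handles all nearby points.\<close>

lemma good_shift:
  assumes v: "v \<in> good B" and p: "p \<in> B" and A: "A \<subseteq> B" "\<And>a. a \<in> A \<Longrightarrow> a \<otimes> p \<in> B"
    and AA: "\<And>a b. a \<in> A \<Longrightarrow> b \<in> A \<Longrightarrow> a \<otimes> b \<in> B" and B: "B \<subseteq> carrier G"
  shows "\<sigma> p v \<in> good A"
proof -
  have c: "p \<in> carrier G" "A \<subseteq> carrier G" using p A B by auto
  have eq: "\<sigma> (s \<otimes> t) (\<sigma> p v) = \<sigma> s (\<sigma> t (\<sigma> p v))" if st: "s \<in> A" "t \<in> A" for s t
  proof -
    have "\<sigma> (s \<otimes> t) (\<sigma> p v) = \<sigma> (s \<otimes> t \<otimes> p) v" using good_mult[OF v AA[OF st] p] .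
    moreover have "\<sigma> s (\<sigma> t (\<sigma> p v)) = \<sigma> (s \<otimes> (t \<otimes> p)) v"
      using good_mult[OF v, of t p] good_mult[OF v, of s "t \<otimes> p"] st A p by (metis subsetD)
    moreover have "s \<otimes> t \<otimes> p = s \<otimes> (t \<otimes> p)" using st c by (auto intro!: m_assoc)
    ultimately show ?thesis by simp
  qed
  have "s = t" if st: "s \<in> A" "t \<in> A" "\<sigma> s (\<sigma> p v) = \<sigma> t (\<sigma> p v)" for s t
  proof -
    have "\<sigma> (s \<otimes> p) v = \<sigma> (t \<otimes> p) v" using st good_mult[OF v] A p by (metis subsetD)
    then have "s \<otimes> p = t \<otimes> p" using good_inj[OF v] st A by blast
    then show ?thesis using st c using right_cancel[of p s t] by blast
  qed
  then show ?thesis using eq v c \<sigma>_closed by (auto simp: good_points_def inj_on_def)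
qed

lemma good_shift_words:
  assumes v: "v \<in> good (words G B m)" and p: "p \<in> words G B i" and B: "B \<subseteq> carrier G"
    and m: "i + j \<le> m" "j + j \<le> m"
  shows "\<sigma> p v \<in> good (words G B j)"
proof (rule good_shift[OF v])
  show "p \<in> words G B m" using words_mono[of i m B] p m by auto
  show "words G B j \<subseteq> words G B m" using words_mono[of j m B] m by auto
  show "a \<otimes> p \<in> words G B m" if "a \<in> words G B j" for a
    using words_mult[OF B that p] words_mono[of "j + i" m B] m by (auto simp: add.commute)
  show "a \<otimes> b \<in> words G B m" if "a \<in> words G B j" "b \<in> words G B j" for a b
    using words_mult[OF B that] words_mono[of "j + j" m B] m by auto
  show "words G B m \<subseteq> carrier G" by (rule words_closed[OF B])
qed

lemma good_words_mult:
  assumes v: "v \<in> good (words G B m)" and s: "s \<in> words G B i" and t: "t \<in> words G B j"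
    and m: "i \<le> m" "j \<le> m"
  shows "\<sigma> s (\<sigma> t v) = \<sigma> (s \<otimes> t) v"
  using good_mult[OF v] s t words_mono[OF m(1), of B] words_mono[OF m(2), of B] by blast

lemma good_words_inj:
  assumes v: "v \<in> good (words G B m)" and s: "s \<in> words G B i" and t: "t \<in> words G B j"
    and m: "i \<le> m" "j \<le> m" and eq: "\<sigma> s v = \<sigma> t v"
  shows "s = t"
  using good_inj[OF v _ _ eq] s t words_mono[OF m(1), of B] words_mono[OF m(2), of B] by blast

lemma good_words_one:
  assumes v: "v \<in> good (words G B m)" shows "\<sigma> \<one> v = v"
  using good_one[OF v] one_in_words by blast

lemma good_words_inv:
  assumes v: "v \<in> good (words G B m)" and s: "s \<in> words G B i" and m: "i \<le> m"
    and B: "B \<subseteq> carrier G"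
  shows "\<sigma> (inv s) (\<sigma> s v) = v" "\<sigma> s (\<sigma> (inv s) v) = v"
  using good_inv[OF v one_in_words, of s] words_inv[OF B s] words_mono[OF m, of B] s
    words_closed'[OF B] by blast+

lemma good_words_inv_eq:
  assumes v: "v \<in> good (words G B m)" and s: "s \<in> words G B i" and m: "i \<le> m"
    and B: "B \<subseteq> carrier G" and eq: "\<sigma> s u = v"
  shows "u = \<sigma> (inv s) v"
  using good_inv_eq[OF v one_in_words, of s u] words_inv[OF B s] words_mono[OF m, of B] s
    words_closed'[OF B] eq by blast

end

lemma sofic_approx_of_sequence:
  assumes "group G" "sofic_approximation_sequence G V \<sigma>"
  shows "sofic_approx G (V k) (\<sigma> k)"
  using assms unfolding sofic_approx_def sofic_approx_axioms_def sofic_approximation_sequence_def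
  by blast

section \<open>Maximal separated families\<close>

text \<open>A disjoint subfamily of maximal cardinality works: a w that meets no chosen set could be
  added, and it is new because \<open>N w\<close> is nonempty. The use is always with
  \<open>N z\<close> the set of R-translates of z: disjointness bounds the number of z by |V| / |R|,
  and meeting writes w as the translate of some z by inv r times r'.\<close>

lemma exists_maximal_separated:
  assumes fin: "finite W" and ne: "\<And>w. w \<in> W \<Longrightarrow> N w \<noteq> {}"
  shows "\<exists>Z\<subseteq>W. (\<forall>z\<in>Z. \<forall>z'\<in>Z. z \<noteq> z' \<longrightarrow> N z \<inter> N z' = {}) \<and> (\<forall>w\<in>W. \<exists>z\<in>Z. N w \<inter> N z \<noteq> {})"
proof -
  define P where "P Z \<longleftrightarrow> Z \<subseteq> W \<and> (\<forall>z\<in>Z. \<forall>z'\<in>Z. z \<noteq> z' \<longrightarrow> N z \<inter> N z' = {})" for Z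
  have fin': "finite {Z. P Z}" using fin by (rule finite_subset[rotated, OF finite_Pow_iff[THEN iffD2]]) (auto simp: P_def)
  have "{} \<in> {Z. P Z}" by (simp add: P_def)
  then have "card ` {Z. P Z} \<noteq> {}" by blast
  then have "Max (card ` {Z. P Z}) \<in> card ` {Z. P Z}" using fin' by (intro Max_in) auto
  then obtain Z where Z: "P Z" and cZ: "card Z = Max (card ` {Z. P Z})" by auto
  have max: "card Z' \<le> card Z" if "P Z'" for Z' using that fin' unfolding cZ by auto
  have "\<exists>z\<in>Z. N w \<inter> N z \<noteq> {}" if w: "w \<in> W" for w
  proof (rule ccontr)
    assume neg: "\<not> ?thesis"
    then have "w \<notin> Z" using ne[OF w] by auto
    moreover have "P (insert w Z)" using neg Z w by (auto simp: P_def Int_commute)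
    moreover have "finite Z" using Z fin finite_subset by (auto simp: P_def)
    ultimately show False using max[of "insert w Z"] by auto
  qed
  then show ?thesis using Z by (auto simp: P_def)
qed

text \<open>Goodness makes the R-translates of each z exactly |R| distinct points.\<close>

lemma (in sofic_approx) card_separated_le:
  assumes Z: "Z \<subseteq> good A" and R: "finite R" "R \<subseteq> A" "A \<subseteq> carrier G" and U: "finite U"
    and sub: "\<And>z. z \<in> Z \<Longrightarrow> (\<lambda>r. \<sigma> r z) ` R \<subseteq> U"
    and sep: "\<forall>z\<in>Z. \<forall>z'\<in>Z. z \<noteq> z' \<longrightarrow> (\<lambda>r. \<sigma> r z) ` R \<inter> (\<lambda>r. \<sigma> r z') ` R = {}"
  shows "card Z * card R \<le> card U"
proof -
  have fZ: "finite Z" using Z finite_good finite_subset by metis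
  have "card (\<Union>z\<in>Z. (\<lambda>r. \<sigma> r z) ` R) = (\<Sum>z\<in>Z. card ((\<lambda>r. \<sigma> r z) ` R))"
    using sep fZ R by (intro card_UN_disjoint) auto
  also have "\<dots> = (\<Sum>z\<in>Z. card R)"
    using good_inj_on Z R by (intro sum.cong refl card_image) blast
  finally have "card Z * card R = card (\<Union>z\<in>Z. (\<lambda>r. \<sigma> r z) ` R)" by simp
  also have "\<dots> \<le> card U" by (intro card_mono U) (use sub in auto)
  finally show ?thesis .
qed

declare words.simps(2) [simp del]

lemma (in group) words_mult_le:
  assumes "B \<subseteq> carrier G" "x \<in> words G B i" "y \<in> words G B j" "i + j \<le> n"
  shows "x \<otimes> y \<in> words G B n"
  using words_mult[OF assms(1-3)] words_mono[OF assms(4)] by blast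

section \<open>Sparse connectivity\<close>

text \<open>A pair (g, v) of D is an arrow from v to \<sigma> g v. Both orientations are included,
  since a cocycle value known on an arrow is also known on its reverse.\<close>

definition edges :: "('a \<Rightarrow> 'v \<Rightarrow> 'v) \<Rightarrow> ('a \<times> 'v) set \<Rightarrow> 'v rel" where
  "edges \<sigma> D = {(v, \<sigma> g v) |g v. (g, v) \<in> D} \<union> {(\<sigma> g v, v) |g v. (g, v) \<in> D}"

definition linked :: "('a \<Rightarrow> 'v \<Rightarrow> 'v) \<Rightarrow> ('a \<times> 'v) set \<Rightarrow> nat \<Rightarrow> 'v \<Rightarrow> 'v \<Rightarrow> bool" where
  "linked \<sigma> D C u v \<longleftrightarrow> (\<exists>n\<le>C. (u, v) \<in> edges \<sigma> D ^^ n)"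

lemma sym_edges: "sym (edges \<sigma> D)"
  by (auto simp: sym_def edges_def)

lemma edges_mono: "D \<subseteq> D' \<Longrightarrow> edges \<sigma> D \<subseteq> edges \<sigma> D'"
  by (auto simp: edges_def)

lemma relpow_mono: "(r :: 'v rel) \<subseteq> s \<Longrightarrow> r ^^ n \<subseteq> s ^^ n"
  by (induction n) auto

lemma sym_relpow: "sym (r :: 'v rel) \<Longrightarrow> sym (r ^^ n)"
proof (induction n)
  case (Suc n)
  then have "(r ^^ Suc n)\<inverse> = r ^^ Suc n"
    by (metis converse_relcomp relpow.simps(2) relpow_commute sym_conv_converse_eq)
  then show ?case by (simp add: sym_conv_converse_eq)
qed (simp add: sym_def)

lemma linked_refl: "linked \<sigma> D C u u"
  by (auto simp: linked_def intro!: exI[of _ 0])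

lemma linked_sym: "linked \<sigma> D C u v \<Longrightarrow> linked \<sigma> D C v u"
  unfolding linked_def using sym_relpow[OF sym_edges] by (meson symD)

lemma linked_mono: "linked \<sigma> D C u v \<Longrightarrow> D \<subseteq> D' \<Longrightarrow> C \<le> C' \<Longrightarrow> linked \<sigma> D' C' u v"
  unfolding linked_def by (meson edges_mono order_trans relpow_mono subsetD)

lemma linked_trans: "linked \<sigma> D C u v \<Longrightarrow> linked \<sigma> D C' v w \<Longrightarrow> linked \<sigma> D (C + C') u w"
  unfolding linked_def by (metis add_le_mono relpow_add relcompI)

lemma linked_edge: "(g, v) \<in> D \<Longrightarrow> linked \<sigma> D 1 v (\<sigma> g v)"
  by (auto simp: linked_def edges_def intro!: exI[of _ 1])

text \<open>The number \<epsilon> has two roles, the density of the uncovered part and the slack in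
  the cost. The labels F and the length C do not depend on k, because models are later required to
  be accurate on one finite ball of G whose radius is determined by C.\<close>

definition sparsely_linked ::
  "('a, 'm) monoid_scheme \<Rightarrow> (nat \<Rightarrow> 'v set) \<Rightarrow> (nat \<Rightarrow> 'a \<Rightarrow> 'v \<Rightarrow> 'v) \<Rightarrow>
   ('a \<Rightarrow> real) \<Rightarrow> real \<Rightarrow> 'a set \<Rightarrow> 'a set \<Rightarrow> bool" where
  "sparsely_linked G V \<sigma> c \<eta> S T \<longleftrightarrow>
     (\<forall>\<epsilon>>0. \<exists>F C. finite F \<and> F \<subseteq> carrier G \<and>
       (\<forall>\<^sub>F k in sequentially. \<exists>W D. W \<subseteq> V k \<and> D \<subseteq> F \<times> V k \<and>
          real (card (V k - (\<Union>s\<in>S. \<sigma> k s ` W))) \<le> \<epsilon> * real (card (V k)) \<and>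
          (\<Sum>(g, v)\<in>D. c g) \<le> (\<eta> + \<epsilon>) * real (card (V k)) \<and>
          (\<forall>w\<in>W. \<forall>t\<in>T. \<sigma> k t w \<in> W \<longrightarrow> linked (\<sigma> k) D C w (\<sigma> k t w))))"

lemma sparsely_linkedE:
  assumes "sparsely_linked G V \<sigma> c \<eta> S T" "\<epsilon> > 0"
  obtains F C where "finite F" "F \<subseteq> carrier G"
    "\<forall>\<^sub>F k in sequentially. \<exists>W D. W \<subseteq> V k \<and> D \<subseteq> F \<times> V k \<and>
          real (card (V k - (\<Union>s\<in>S. \<sigma> k s ` W))) \<le> \<epsilon> * real (card (V k)) \<and>
          (\<Sum>(g, v)\<in>D. c g) \<le> (\<eta> + \<epsilon>) * real (card (V k)) \<and>
          (\<forall>w\<in>W. \<forall>t\<in>T. \<sigma> k t w \<in> W \<longrightarrow> linked (\<sigma> k) D C w (\<sigma> k t w))"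
proof -
  from assms obtain F C where "finite F \<and> F \<subseteq> carrier G \<and> (\<forall>\<^sub>F k in sequentially. \<exists>W D. W \<subseteq> V k \<and> D \<subseteq> F \<times> V k \<and>
          real (card (V k - (\<Union>s\<in>S. \<sigma> k s ` W))) \<le> \<epsilon> * real (card (V k)) \<and>
          (\<Sum>(g, v)\<in>D. c g) \<le> (\<eta> + \<epsilon>) * real (card (V k)) \<and>
          (\<forall>w\<in>W. \<forall>t\<in>T. \<sigma> k t w \<in> W \<longrightarrow> linked (\<sigma> k) D C w (\<sigma> k t w)))"
    unfolding sparsely_linked_def by blast
  then show ?thesis by (elim conjE) (rule that)
qed

definition sparsely_linked_on ::
  "('a, 'm) monoid_scheme \<Rightarrow> (nat \<Rightarrow> 'v set) \<Rightarrow> (nat \<Rightarrow> 'a \<Rightarrow> 'v \<Rightarrow> 'v) \<Rightarrow>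
   ('a \<Rightarrow> real) \<Rightarrow> real \<Rightarrow> 'a set \<Rightarrow> 'a set \<Rightarrow> bool" where
  "sparsely_linked_on G V \<sigma> c \<eta> S L \<longleftrightarrow>
     (\<forall>T. finite T \<and> T \<subseteq> L \<longrightarrow> sparsely_linked G V \<sigma> c \<eta> S T)"

text \<open>S is chosen from c and \<eta> alone, before T and \<epsilon>. In the transfer argument T
  is built from the cocycle values of S, so the reverse order would be circular.\<close>

definition sparsely_connected ::
  "('a, 'm) monoid_scheme \<Rightarrow> (nat \<Rightarrow> 'v set) \<Rightarrow> (nat \<Rightarrow> 'a \<Rightarrow> 'v \<Rightarrow> 'v) \<Rightarrow> bool" where
  "sparsely_connected G V \<sigma> \<longleftrightarrow>
     (\<forall>c \<eta>. (\<forall>g\<in>carrier G. 0 \<le> c g) \<and> 0 < \<eta> \<longrightarrow>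
        (\<exists>S. finite S \<and> S \<subseteq> carrier G \<and> sparsely_linked_on G V \<sigma> c \<eta> S (carrier G)))"

lemma sparsely_linked_on_mono:
  "sparsely_linked_on G V \<sigma> c \<eta> S L \<Longrightarrow> L' \<subseteq> L \<Longrightarrow> sparsely_linked_on G V \<sigma> c \<eta> S L'"
  unfolding sparsely_linked_on_def by blast

lemma (in sofic_approx) card_uncovered_Int_le:
  assumes "finite S" "S \<subseteq> carrier G" "W \<subseteq> V"
  shows "card (V - (\<Union>s\<in>S. \<sigma> s ` (W \<inter> U))) \<le> card (V - (\<Union>s\<in>S. \<sigma> s ` W)) + card S * card (V - U)"
proof -
  have "V - (\<Union>s\<in>S. \<sigma> s ` (W \<inter> U)) \<subseteq> (V - (\<Union>s\<in>S. \<sigma> s ` W)) \<union> (\<Union>s\<in>S. \<sigma> s ` (V - U))"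
    using assms by blast
  then have "card (V - (\<Union>s\<in>S. \<sigma> s ` (W \<inter> U)))
      \<le> card ((V - (\<Union>s\<in>S. \<sigma> s ` W)) \<union> (\<Union>s\<in>S. \<sigma> s ` (V - U)))"
    using assms finite_V by (intro card_mono) auto
  also have "\<dots> \<le> card (V - (\<Union>s\<in>S. \<sigma> s ` W)) + card (\<Union>s\<in>S. \<sigma> s ` (V - U))"
    by (rule card_Un_le)
  also have "card (\<Union>s\<in>S. \<sigma> s ` (V - U)) \<le> (\<Sum>s\<in>S. card (\<sigma> s ` (V - U)))"
    using assms by (intro card_UN_le) auto
  also have "\<dots> \<le> (\<Sum>s\<in>S. card (V - U))"
    using finite_V by (intro sum_mono card_image_le) auto
  finally show ?thesis by simp
qed

lemma sum_case_prod_fst_le: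
  assumes "finite F" "D \<subseteq> F \<times> Z" "finite Z" "\<And>g. g \<in> F \<Longrightarrow> 0 \<le> (c g :: real)"
  shows "(\<Sum>(g, v)\<in>D. c g) \<le> sum c F * real (card Z)"
proof -
  have "(\<Sum>(g, v)\<in>D. c g) \<le> (\<Sum>(g, v)\<in>F \<times> Z. c g)"
    using assms by (intro sum_mono2) auto
  also have "\<dots> = sum c F * real (card Z)"
    by (simp add: sum.cartesian_product[symmetric] sum_distrib_right mult.commute)
  finally show ?thesis .
qed

lemma sum_case_prod_Un_le:
  assumes "finite D" "finite D'" "\<And>g v. (g, v) \<in> D \<union> D' \<Longrightarrow> 0 \<le> (c g :: real)"
  shows "(\<Sum>(g, v)\<in>D \<union> D'. c g) \<le> (\<Sum>(g, v)\<in>D. c g) + (\<Sum>(g, v)\<in>D'. c g)"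
proof -
  have "0 \<le> (\<Sum>(g, v)\<in>D \<inter> D'. c g)" using assms by (intro sum_nonneg) auto
  then show ?thesis using sum_Un[of D D' "\<lambda>(g, v). c g"] assms by simp
qed

text \<open>If \<open>L\<close> is infinite and normalized by \<open>t\<close>, then a point \<open>w\<close> and its translate \<open>t w\<close> can be
  linked by walking in the \<open>L\<close>-direction to a very sparse set of places \<open>z\<close> where the \<open>t\<close>-edge
  is added, and walking back.\<close>

lemma sparsely_linked_on_normal:
  fixes G :: "('a, 'm) monoid_scheme" (structure)
  assumes seq: "sofic_approximation_sequence G V \<sigma>" and G: "group G"
    and L: "L \<subseteq> carrier G" "infinite L"
    and mult: "\<And>x y. x \<in> L \<Longrightarrow> y \<in> L \<Longrightarrow> inv\<^bsub>G\<^esub> x \<otimes>\<^bsub>G\<^esub> y \<in> L"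
    and M: "M \<subseteq> carrier G"
    and conj: "\<And>m x. m \<in> M \<Longrightarrow> x \<in> L \<Longrightarrow> m \<otimes>\<^bsub>G\<^esub> x \<otimes>\<^bsub>G\<^esub> inv\<^bsub>G\<^esub> m \<in> L"
    and c: "\<And>g. g \<in> carrier G \<Longrightarrow> 0 \<le> c g" and S: "finite S" "S \<subseteq> carrier G"
    and PL: "sparsely_linked_on G V \<sigma> c \<eta> S L"
  shows "sparsely_linked_on G V \<sigma> c \<eta> S M"
  unfolding sparsely_linked_on_def sparsely_linked_def
proof (intro allI impI, elim conjE)
  fix T \<epsilon> assume T: "finite T" "T \<subseteq> M" and \<epsilon>: "(0::real) < \<epsilon>"
  interpret group G by (rule G)
  define cT where "cT = sum c T"
  have TG: "T \<subseteq> carrier G" using T M by auto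
  have cT: "cT \<ge> 0" unfolding cT_def using c TG by (intro sum_nonneg) auto
  \<comment> \<open>The places where a t-edge is added will have disjoint R-translates, so for each
    t there are at most |V| / |R| of them. With |R| = m + 1 all these edges together cost at most
    \<epsilon> / 2 times |V|.\<close>
  obtain m :: nat where m: "cT / (\<epsilon> / 2) < real m" using reals_Archimedean2 by blast
  obtain R where R: "R \<subseteq> L" "finite R" "card R = Suc m"
    using infinite_arbitrarily_large[OF L(2), of "Suc m"] by blast
  define B where "B = R \<union> T"
  have B: "finite B" "B \<subseteq> carrier G" using R T TG L by (auto simp: B_def)
  define Q where "Q = (\<lambda>(r, r'). inv r \<otimes> r') ` (R \<times> R)"
  have QL: "Q \<subseteq> L" using R mult by (auto simp: Q_def)
  \<comment> \<open>The element q = inv r' r carries w to z, and t q inv t carries t w to t z. Both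
    must be reachable inside the old graph; the second lies in L because t conjugates L into
    itself.\<close>
  define T' where "T' = Q \<union> (\<lambda>(t, q). t \<otimes> q \<otimes> inv t) ` (T \<times> Q)"
  have fQ: "finite Q" using R by (auto simp: Q_def)
  then have T': "finite T'" "T' \<subseteq> L" using QL T conj by (auto simp: T'_def)
  have RW: "R \<subseteq> words G B 1" and TW: "T \<subseteq> words G B 1"
    using in_words_1[OF B(2)] by (auto simp: B_def)
  have QW: "Q \<subseteq> words G B 2"
  proof
    fix q assume "q \<in> Q"
    then obtain r r' where q: "q = inv r \<otimes> r'" "r \<in> R" "r' \<in> R" by (auto simp: Q_def)
    show "q \<in> words G B 2" unfolding q(1)
      using q RW by (intro words_mult_le[OF B(2), of _ 1 _ 1] words_inv[OF B(2)]) auto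
  qed
  have "sparsely_linked G V \<sigma> c \<eta> S T'" using PL T' by (auto simp: sparsely_linked_on_def)
  moreover have "\<epsilon> / 2 > 0" using \<epsilon> by simp
  ultimately obtain F C where F: "finite F" "F \<subseteq> carrier G" and ev: "\<forall>\<^sub>F k in sequentially. \<exists>W D. W \<subseteq> V k \<and> D \<subseteq> F \<times> V k \<and>
          real (card (V k - (\<Union>s\<in>S. \<sigma> k s ` W))) \<le> \<epsilon> / 2 * real (card (V k)) \<and>
          (\<Sum>(g, v)\<in>D. c g) \<le> (\<eta> + \<epsilon> / 2) * real (card (V k)) \<and>
          (\<forall>w\<in>W. \<forall>t\<in>T'. \<sigma> k t w \<in> W \<longrightarrow> linked (\<sigma> k) D C w (\<sigma> k t w))"
    by (rule sparsely_linkedE)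
  define \<epsilon>' where "\<epsilon>' = \<epsilon> / 2 / (real (card S) + 1)"
  have \<epsilon>': "\<epsilon>' > 0" "real (card S) * \<epsilon>' \<le> \<epsilon> / 2" using \<epsilon> by (auto simp: \<epsilon>'_def field_simps)
  \<comment> \<open>Radius 4 because t q inv t has length 1 + 2 + 1 in B.\<close>
  note gd = eventually_good_points[OF seq finite_words[OF B(1), of 4] words_closed[OF B(2), of 4] \<epsilon>'(1)]
  show "\<exists>F C. finite F \<and> F \<subseteq> carrier G \<and>
       (\<forall>\<^sub>F k in sequentially. \<exists>W D. W \<subseteq> V k \<and> D \<subseteq> F \<times> V k \<and>
          real (card (V k - (\<Union>s\<in>S. \<sigma> k s ` W))) \<le> \<epsilon> * real (card (V k)) \<and>
          (\<Sum>(g, v)\<in>D. c g) \<le> (\<eta> + \<epsilon>) * real (card (V k)) \<and>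
          (\<forall>w\<in>W. \<forall>t\<in>T. \<sigma> k t w \<in> W \<longrightarrow> linked (\<sigma> k) D C w (\<sigma> k t w)))"
  proof (intro exI[of _ "F \<union> T"] exI[of _ "C + 1 + C"] conjI)
    show "finite (F \<union> T)" "F \<union> T \<subseteq> carrier G" using F T TG by auto
    show "\<forall>\<^sub>F k in sequentially. \<exists>W D. W \<subseteq> V k \<and> D \<subseteq> (F \<union> T) \<times> V k \<and>
          real (card (V k - (\<Union>s\<in>S. \<sigma> k s ` W))) \<le> \<epsilon> * real (card (V k)) \<and>
          (\<Sum>(g, v)\<in>D. c g) \<le> (\<eta> + \<epsilon>) * real (card (V k)) \<and>
          (\<forall>w\<in>W. \<forall>t\<in>T. \<sigma> k t w \<in> W \<longrightarrow> linked (\<sigma> k) D (C + 1 + C) w (\<sigma> k t w))"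
      using ev gd
    proof eventually_elim
      case (elim k)
      interpret sofic_approx G "V k" "\<sigma> k" by (rule sofic_approx_of_sequence[OF G seq])
      let ?n = "real (card (V k))" and ?\<sigma> = "\<sigma> k"
      obtain W0 D0 where W0: "W0 \<subseteq> V k" and D0: "D0 \<subseteq> F \<times> V k"
        and cov: "real (card (V k - (\<Union>s\<in>S. ?\<sigma> s ` W0))) \<le> \<epsilon> / 2 * ?n"
        and cost: "(\<Sum>(g, v)\<in>D0. c g) \<le> (\<eta> + \<epsilon> / 2) * ?n"
        and link: "\<And>w t. w \<in> W0 \<Longrightarrow> t \<in> T' \<Longrightarrow> ?\<sigma> t w \<in> W0 \<Longrightarrow> linked ?\<sigma> D0 C w (?\<sigma> t w)"
        using elim(1) by blast
      define U where "U = good (words G B 4)"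
      define W where "W = W0 \<inter> U"
      have finW: "finite W" using finite_V W0 finite_subset by (metis W_def inf.coboundedI1)
      let ?N = "\<lambda>z. (\<lambda>r. ?\<sigma> r z) ` R"
      have Rne: "R \<noteq> {}" using R by auto
      define P where "P t Z \<longleftrightarrow> Z \<subseteq> {w\<in>W. ?\<sigma> t w \<in> W} \<and>
          (\<forall>z\<in>Z. \<forall>z'\<in>Z. z \<noteq> z' \<longrightarrow> ?N z \<inter> ?N z' = {}) \<and>
          (\<forall>w\<in>{w\<in>W. ?\<sigma> t w \<in> W}. \<exists>z\<in>Z. ?N w \<inter> ?N z \<noteq> {})" for t Z
      have "\<exists>Z. P t Z" for t
        unfolding P_def by (rule exists_maximal_separated) (use finW Rne in auto)
      then obtain Z where PZ: "\<And>t. P t (Z t)" by metis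
      have Z: "Z t \<subseteq> {w\<in>W. ?\<sigma> t w \<in> W}"
        and sep: "\<forall>z\<in>Z t. \<forall>z'\<in>Z t. z \<noteq> z' \<longrightarrow> ?N z \<inter> ?N z' = {}" for t
        using PZ[of t] unfolding P_def by blast+
      have max: "\<exists>z\<in>Z t. ?N w \<inter> ?N z \<noteq> {}" if "w \<in> {w\<in>W. ?\<sigma> t w \<in> W}" for t w
        using PZ[of t] that unfolding P_def by blast
      have finZ: "finite (Z t)" for t by (rule finite_subset[OF Z]) (use finW in auto)
      have cardZ: "real (card (Z t)) * real (Suc m) \<le> ?n" for t
      proof -
        have "card (Z t) * card R \<le> card (V k)"
        proof (rule card_separated_le[where A = "words G B 4"])
          show "Z t \<subseteq> good (words G B 4)" using Z by (auto simp: W_def U_def)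
          show "R \<subseteq> words G B 4" by (rule order_trans[OF RW words_mono]) simp
          show "?N z \<subseteq> V k" if "z \<in> Z t" for z
          proof -
            have "z \<in> V k" using that Z[of t] W0 by (auto simp: W_def)
            then show ?thesis using R L by (auto intro!: \<sigma>_closed)
          qed
        qed (use R finite_V words_closed[OF B(2)] sep in auto)
        then show ?thesis using R by (metis of_nat_le_iff of_nat_mult)
      qed
      define D1 where "D1 = (SIGMA t:T. Z t)"
      have finD: "finite D0" "finite D1"
        using D0 F finite_V T finZ by (auto simp: D1_def intro: finite_subset[OF D0])
      have "(\<Sum>(g, v)\<in>D1. c g) = (\<Sum>t\<in>T. c t * real (card (Z t)))"
        unfolding D1_def using T finZ by (subst sum.Sigma[symmetric]) (auto simp: mult.commute)
      also have "\<dots> \<le> (\<Sum>t\<in>T. c t * (?n / real (Suc m)))"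
        using cardZ c TG by (intro sum_mono mult_left_mono) (auto simp: field_simps)
      also have "\<dots> = cT * (?n / real (Suc m))" unfolding cT_def by (rule sum_distrib_right[symmetric])
      also have "\<dots> \<le> \<epsilon> / 2 * ?n"
      proof -
        have "cT \<le> \<epsilon> / 2 * real (Suc m)" using m \<epsilon> by (simp add: field_simps)
        then have "cT * ?n \<le> \<epsilon> / 2 * real (Suc m) * ?n" by (intro mult_right_mono) auto
        then show ?thesis by (simp add: field_simps)
      qed
      finally have cost1: "(\<Sum>(g, v)\<in>D1. c g) \<le> \<epsilon> / 2 * ?n" .
      have "linked ?\<sigma> (D0 \<union> D1) (C + 1 + C) w (?\<sigma> t w)"
        if w: "w \<in> W" and t: "t \<in> T" and tw: "?\<sigma> t w \<in> W" for w t
      proof -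
        obtain z r r' where z: "z \<in> Z t" and r: "r \<in> R" "r' \<in> R" and eq: "?\<sigma> r w = ?\<sigma> r' z"
          using max[of w t] w tw by blast
        have zW: "z \<in> W" "?\<sigma> t z \<in> W" using Z z by auto
        have cl: "t \<in> carrier G" "r \<in> carrier G" "r' \<in> carrier G" using t TG r R L by auto
        define q where "q = inv r' \<otimes> r"
        have q: "q \<in> Q" "q \<in> words G B 2" "q \<in> carrier G"
          using r QW QL L by (auto simp: q_def Q_def)
        have gw: "w \<in> good (words G B 4)" and gz: "z \<in> good (words G B 4)"
          using w zW by (auto simp: W_def U_def)
        have "z = ?\<sigma> (inv r') (?\<sigma> r' z)"
          using good_words_inv(1)[OF gz, of r' 1] r RW B by auto
        also have "\<dots> = ?\<sigma> q w" unfolding eq[symmetric] q_def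
          by (rule good_words_mult[OF gw, of _ 1 _ 1]) (use r RW words_inv[OF B(2), of r' 1] in auto)
        finally have zq: "z = ?\<sigma> q w" .
        have l1: "linked ?\<sigma> D0 C w z"
          using link[of w q] w zW q zq by (auto simp: W_def T'_def)
        have "t \<otimes> q \<in> words G B 3"
          using t TW q by (intro words_mult_le[OF B(2), of _ 1 _ 2]) auto
        then have tq: "t \<otimes> q \<otimes> inv t \<in> words G B 4"
          by (rule words_mult_le[OF B(2), of _ 3 _ 1]) (use t TW words_inv[OF B(2), of t 1] in auto)
        have "?\<sigma> t z = ?\<sigma> (t \<otimes> q) w" unfolding zq
          by (rule good_words_mult[OF gw, of _ 1 _ 2]) (use q t TW in auto)
        also have "t \<otimes> q = t \<otimes> q \<otimes> inv t \<otimes> t" using cl q by (simp add: m_assoc)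
        also have "?\<sigma> \<dots> w = ?\<sigma> (t \<otimes> q \<otimes> inv t) (?\<sigma> t w)"
          by (rule good_words_mult[OF gw, of _ 4 _ 1, symmetric]) (use tq t TW in auto)
        finally have "?\<sigma> t z = ?\<sigma> (t \<otimes> q \<otimes> inv t) (?\<sigma> t w)" .
        then have l2: "linked ?\<sigma> D0 C (?\<sigma> t w) (?\<sigma> t z)"
          using link[of "?\<sigma> t w" "t \<otimes> q \<otimes> inv t"] tw zW q t by (force simp: W_def T'_def)
        have "linked ?\<sigma> (D0 \<union> D1) 1 z (?\<sigma> t z)"
          by (rule linked_edge) (use t z in \<open>auto simp: D1_def\<close>)
        then have "linked ?\<sigma> (D0 \<union> D1) (C + 1) w (?\<sigma> t z)"
          by (rule linked_trans[OF linked_mono[OF l1], rotated 2]) auto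
        then show ?thesis
          by (rule linked_trans[OF _ linked_mono[OF linked_sym[OF l2]]]) auto
      qed
      moreover have "real (card (V k - (\<Union>s\<in>S. ?\<sigma> s ` W))) \<le> \<epsilon> * ?n"
      proof -
        have "real (card (V k - (\<Union>s\<in>S. ?\<sigma> s ` W)))
          \<le> real (card (V k - (\<Union>s\<in>S. ?\<sigma> s ` W0))) + real (card S) * real (card (V k - U))"
          using card_uncovered_Int_le[OF S W0, of U] unfolding W_def
          by (metis of_nat_add of_nat_le_iff of_nat_mult)
        also have "\<dots> \<le> \<epsilon> / 2 * ?n + real (card S) * (\<epsilon>' * ?n)"
          using elim(2) cov by (intro add_mono mult_left_mono) (auto simp: U_def)
        also have "\<dots> \<le> \<epsilon> / 2 * ?n + \<epsilon> / 2 * ?n"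
          using mult_right_mono[OF \<epsilon>'(2), of ?n] by (simp add: mult.assoc)
        finally show ?thesis by simp
      qed
      moreover have "(\<Sum>(g, v)\<in>D0 \<union> D1. c g) \<le> (\<eta> + \<epsilon>) * ?n"
      proof -
        have "(\<Sum>(g, v)\<in>D0 \<union> D1. c g) \<le> (\<Sum>(g, v)\<in>D0. c g) + (\<Sum>(g, v)\<in>D1. c g)"
          using finD D0 F TG c by (intro sum_case_prod_Un_le) (auto simp: D1_def)
        then show ?thesis using cost cost1 by (simp add: algebra_simps)
      qed
      moreover have "D0 \<union> D1 \<subseteq> (F \<union> T) \<times> V k" using D0 Z W0 by (fastforce simp: D1_def W_def)
      moreover have "W \<subseteq> V k" using W0 by (auto simp: W_def)
      ultimately show ?case by blast
    qed
  qed
qed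

text \<open>Transfinite induction along the chain. The same S and \<eta> survive every step, since
  the normal step adds only arbitrarily small cost, which the slack \<epsilon> absorbs. Limit stages
  are free: only finite T occur, and a finite subset of an increasing union lies in one of its
  members.\<close>

lemma sparsely_linked_on_w_normal:
  fixes G :: "('a, 'm) monoid_scheme" (structure)
  assumes seq: "sofic_approximation_sequence G V \<sigma>" and G: "group G"
    and wn: "w_normal K\<^sub>0 G" and inf: "infinite K\<^sub>0"
    and c: "\<And>g. g \<in> carrier G \<Longrightarrow> 0 \<le> c g" and S: "finite S" "S \<subseteq> carrier G"
    and PK: "sparsely_linked_on G V \<sigma> c \<eta> S K\<^sub>0"
  shows "sparsely_linked_on G V \<sigma> c \<eta> S (carrier G)"
proof -
  obtain r :: "nat rel" and \<gamma> K where r: "Well_order r" and \<gamma>: "\<gamma> \<in> Field r"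
    and top: "\<forall>i\<in>Field r. (i, \<gamma>) \<in> r"
    and sub: "\<forall>i\<in>Field r. subgroup (K i) G"
    and K0: "K (wo_rel.minim r (Field r)) = K\<^sub>0" and K\<gamma>: "K \<gamma> = carrier G"
    and mono: "\<forall>(i, j)\<in>r. K i \<subseteq> K j" 
    and nor: "\<forall>i\<in>Field r - {\<gamma>}. K i \<lhd> G\<lparr>carrier := K (wo_rel.suc r {i})\<rparr>"
    and lim: "\<forall>j. limit_element r j \<longrightarrow> K j = (\<Union>i\<in>underS r j. K i)"
    using wn unfolding w_normal_def by (elim exE conjE) (rule that, assumption+)
  have top: "(i, \<gamma>) \<in> r" and sub: "subgroup (K i) G" if "i \<in> Field r" for i
    using that top sub by auto
  have mono: "K i \<subseteq> K j" if "(i, j) \<in> r" for i j using that mono by auto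
  have nor: "K i \<lhd> G\<lparr>carrier := K (wo_rel.suc r {i})\<rparr>" if "i \<in> Field r" "i \<noteq> \<gamma>" for i
    using that nor by auto
  interpret W: wo_rel r using r by (simp add: wo_rel_def)
  interpret group G by (rule G)
  have inv_m: "inv\<^bsub>G\<lparr>carrier := A\<rparr>\<^esub> x = inv x" if "subgroup A G" "x \<in> A" for A x
    using m_inv_consistent[OF that] by simp
  have "sparsely_linked_on G V \<sigma> c \<eta> S (K j)" if "j \<in> Field r" for j
    using that
  proof (induction j rule: W.well_order_induct)
    case (1 j)
    note j = \<open>j \<in> Field r\<close>
    have IH: "sparsely_linked_on G V \<sigma> c \<eta> S (K i)" if "i \<in> underS r j" for i
      using 1 that by (auto simp: underS_def Field_def)
    have KK: "K\<^sub>0 \<subseteq> K i" if "i \<in> Field r" for i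
      using mono[of "W.minim (Field r)" i] W.minim_least[of "Field r" i] that K0 by auto
    show ?case
    proof (cases "underS r j = {}")
      case True
      have "W.minim (Field r) = j"
      proof (rule ccontr)
        assume "W.minim (Field r) \<noteq> j"
        moreover have "(W.minim (Field r), j) \<in> r" using W.minim_least[of "Field r" j] j by auto
        ultimately have "W.minim (Field r) \<in> underS r j" by (auto simp: underS_def)
        then show False using True by simp
      qed
      then show ?thesis using PK K0 by simp
    next
      case ne: False
      show ?thesis
      proof (cases "limit_element r j")
        case True
        show ?thesis unfolding sparsely_linked_on_def
        proof (intro allI impI, elim conjE)
          fix T assume T: "finite T" "T \<subseteq> K j"
          have "\<exists>i\<in>underS r j. T \<subseteq> K i" using T
          proof (induction T rule: finite_induct)
            case empty then show ?case using ne by auto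
          next
            case (insert x T)
            then obtain i i' where i: "i \<in> underS r j" "T \<subseteq> K i" "i' \<in> underS r j" "x \<in> K i'"
              using lim True by auto
            then have "i \<in> Field r" "i' \<in> Field r" by (auto simp: underS_def Field_def)
            then have "(i, i') \<in> r \<or> (i', i) \<in> r"
              using W.TOTALS by auto
            then show ?case using i mono by (metis insert_subset subset_trans subsetD)
          qed
          then show "sparsely_linked G V \<sigma> c \<eta> S T"
            using IH T by (auto simp: sparsely_linked_on_def)
        qed
      next
        case False
        then obtain i where i: "i \<in> underS r j" "j = W.suc {i}"
          using j ne by (auto simp: limit_element_def)
        have iF: "i \<in> Field r" "i \<noteq> j" "(i, j) \<in> r" using i by (auto simp: underS_def Field_def)
        have "i \<noteq> \<gamma>"
          using top[OF j] iF W.ANTISYM by (auto simp: antisym_def)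
        then interpret N: normal "K i" "G\<lparr>carrier := K j\<rparr>" using nor iF i by auto
        note subi = sub[OF iF(1)] and subj = sub[OF j]
        show ?thesis
        proof (rule sparsely_linked_on_normal[OF seq G _ _ _ _ _ c S IH[OF i(1)]])
          show "K i \<subseteq> carrier G" using subi subgroup.subset by blast
          show "infinite (K i)" using KK[OF iF(1)] inf finite_subset by blast
          show "inv x \<otimes> y \<in> K i" if "x \<in> K i" "y \<in> K i" for x y
            using that subi by (simp add: subgroup.m_closed subgroup.m_inv_closed)
          show "K j \<subseteq> carrier G" using subj subgroup.subset by blast
          show "m \<otimes> x \<otimes> inv m \<in> K i" if "m \<in> K j" "x \<in> K i" for m x
            using N.inv_op_closed2[of m x] that inv_m[OF subj] by simp
        qed
      qed
    qed
  qed
  then show ?thesis using \<gamma> K\<gamma> by metis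
qed

lemma (in group) left_cancel:
  "x \<in> carrier G \<Longrightarrow> y \<in> carrier G \<Longrightarrow> z \<in> carrier G \<Longrightarrow> x \<otimes> y = x \<otimes> z \<longleftrightarrow> y = z"
  by (simp add: Units_l_cancel Units_eq)

section \<open>Hall's theorem and Folner sets\<close>

text \<open>Induction on |I| after Halmos and Vaughan. If no nonempty proper J is tight, every Hall
  inequality survives the loss of one value, so any index may be matched first. If J is tight, I - J
  still satisfies Hall's condition outside the values available to J, and the two matchings have
  disjoint ranges.\<close>

lemma hall_finite:
  assumes "finite I" "\<And>i. i \<in> I \<Longrightarrow> finite (N i)"
    and "\<And>J. J \<subseteq> I \<Longrightarrow> card J \<le> card (\<Union>j\<in>J. N j)"
  shows "\<exists>f. inj_on f I \<and> (\<forall>i\<in>I. f i \<in> N i)"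
  using assms
proof (induction "card I" arbitrary: I N rule: less_induct)
  case less
  note fin = \<open>finite I\<close> and finN = less.prems(2) and hall = less.prems(3)
  show ?case
  proof (cases "I = {}")
    case True then show ?thesis by simp
  next
    case ne: False
    show ?thesis
    proof (cases "\<exists>J. J \<subset> I \<and> J \<noteq> {} \<and> card J = card (\<Union>j\<in>J. N j)")
      case False
      obtain i where i: "i \<in> I" using ne by auto
      have "card {i} \<le> card (\<Union>j\<in>{i}. N j)" using i by (intro hall) auto
      then have "N i \<noteq> {}" by auto
      then obtain x where x: "x \<in> N i" by auto
      have "\<exists>f. inj_on f (I - {i}) \<and> (\<forall>j\<in>I - {i}. f j \<in> N j - {x})"
      proof (rule less.hyps)
        show "card (I - {i}) < card I" using fin i by (rule card_Diff1_less)
        show "card J \<le> card (\<Union>j\<in>J. N j - {x})" if J: "J \<subseteq> I - {i}" for J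
        proof (cases "J = {}")
          case nJ: False
          have fU: "finite (\<Union>j\<in>J. N j)" using J fin finN finite_subset by blast
          have "card J \<le> card (\<Union>j\<in>J. N j)" using J by (intro hall) auto
          moreover have "card J \<noteq> card (\<Union>j\<in>J. N j)" using False J nJ i by blast
          ultimately have "card J < card (\<Union>j\<in>J. N j)" by simp
          moreover have "(\<Union>j\<in>J. N j - {x}) = (\<Union>j\<in>J. N j) - {x}" by auto
          moreover have "card (\<Union>j\<in>J. N j) \<le> Suc (card ((\<Union>j\<in>J. N j) - {x}))"
            using fU card_Suc_Diff1[OF fU, of x] by (cases "x \<in> (\<Union>j\<in>J. N j)") auto
          ultimately show ?thesis by simp
        qed simp
      qed (use fin finN in auto)
      then obtain f where f: "inj_on f (I - {i})" "\<forall>j\<in>I - {i}. f j \<in> N j - {x}" by blast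
      have "inj_on (f(i := x)) I" using f by (auto simp: inj_on_def)
      then show ?thesis using f x by (intro exI[of _ "f(i := x)"]) auto
    next
      case True
      then obtain J where J: "J \<subset> I" "J \<noteq> {}" "card J = card (\<Union>j\<in>J. N j)" by blast
      have fJ: "finite J" using J fin finite_subset by blast
      have "\<exists>f. inj_on f J \<and> (\<forall>j\<in>J. f j \<in> N j)"
      proof (rule less.hyps)
        show "card J < card I" by (rule psubset_card_mono[OF fin J(1)])
      qed (use fJ J finN hall in auto)
      then obtain f where f: "inj_on f J" "\<forall>j\<in>J. f j \<in> N j" by blast
      let ?U = "\<Union>j\<in>J. N j"
      have fU: "finite ?U" using J fJ finN by blast
      have "\<exists>g. inj_on g (I - J) \<and> (\<forall>j\<in>I - J. g j \<in> N j - ?U)"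
      proof (rule less.hyps)
        show "card (I - J) < card I" using J fin by (intro psubset_card_mono) auto
        show "card L \<le> card (\<Union>j\<in>L. N j - ?U)" if L: "L \<subseteq> I - J" for L
        proof -
          have fL: "finite L" using L fin finite_subset by blast
          have fV: "finite (\<Union>j\<in>L. N j - ?U)" using L fL finN by blast
          have "card J + card L = card (J \<union> L)"
            using fJ fL L by (subst card_Un_disjoint) auto
          also have "\<dots> \<le> card (\<Union>j\<in>J \<union> L. N j)" using J L by (intro hall) auto
          also have "(\<Union>j\<in>J \<union> L. N j) = ?U \<union> (\<Union>j\<in>L. N j - ?U)" by auto
          also have "card \<dots> = card ?U + card (\<Union>j\<in>L. N j - ?U)"
            using fU fV by (subst card_Un_disjoint) auto
          finally show ?thesis using J by simp
        qed
      qed (use fin finN in auto)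
      then obtain g where g: "inj_on g (I - J)" "\<forall>j\<in>I - J. g j \<in> N j - ?U" by blast
      let ?h = "\<lambda>i. if i \<in> J then f i else g i"
      have "inj_on ?h I"
      proof (rule inj_onI)
        fix x y assume xy: "x \<in> I" "y \<in> I" "?h x = ?h y"
        have ne: "g u \<noteq> f v" if uv: "u \<in> I - J" "v \<in> J" for u v
        proof -
          have "g u \<notin> ?U" using g(2) uv(1) by simp
          moreover have "f v \<in> ?U" using f(2) uv(2) by auto
          ultimately show ?thesis by metis
        qed
        consider "x \<in> J" "y \<in> J" | "x \<in> J" "y \<in> I - J" | "x \<in> I - J" "y \<in> J" | "x \<in> I - J" "y \<in> I - J"
          using xy by blast
        then show "x = y"
        proof cases
          case 1 then show ?thesis using xy inj_onD[OF f(1)] by simp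
        next
          case 2 then show ?thesis using xy ne[of y x] by auto
        next
          case 3 then show ?thesis using xy ne[of x y] by auto
        next
          case 4 then show ?thesis using xy inj_onD[OF g(1)] by simp
        qed
      qed
      then show ?thesis using f g by (intro exI[of _ ?h]) auto
    qed
  qed
qed

text \<open>Compactness: the product of the finite sets \<open>N i\<close> is compact by Tychonoff,
  the condition that f takes different values at i and j is closed, and finitely many such
  conditions are met by matching the finitely many indices involved.\<close>

lemma hall_locally_finite:
  assumes finN: "\<And>i. i \<in> I \<Longrightarrow> finite (N i)"
    and hall: "\<And>J. finite J \<Longrightarrow> J \<subseteq> I \<Longrightarrow> card J \<le> card (\<Union>j\<in>J. N j)"
  shows "\<exists>f. inj_on f I \<and> (\<forall>i\<in>I. f i \<in> N i)"
proof -
  let ?X = "product_topology (\<lambda>i. discrete_topology (N i)) I"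
  let ?C = "\<lambda>(i, j). {f \<in> topspace ?X. f i \<noteq> f j}"
  define P where "P = {(i, j). i \<in> I \<and> j \<in> I \<and> i \<noteq> j}"
  have comp: "compact_space ?X"
    using finN by (simp add: compact_space_product_topology compact_space_discrete_topology)
  have ne: "N i \<noteq> {}" if "i \<in> I" for i
    using hall[of "{i}"] that by auto
  have cl: "closedin ?X (?C p)" if pP: "p \<in> P" for p
  proof -
    obtain i j where p: "p = (i, j)" "i \<in> I" "j \<in> I" using pP by (auto simp: P_def)
    have pre: "openin ?X {f \<in> topspace ?X. f l \<in> {x}}" if "l \<in> I" "x \<in> N l" for l x
      by (rule openin_continuous_map_preimage[OF continuous_map_product_projection[OF that(1)]])
        (use that in auto)
    have "topspace ?X - ?C p = (\<Union>x\<in>N i \<inter> N j. {f \<in> topspace ?X. f i \<in> {x}} \<inter> {f \<in> topspace ?X. f j \<in> {x}})"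
      using p by (auto simp: PiE_iff intro: extensional_arb)
    also have "openin ?X \<dots>" using pre p by (intro openin_Union) (auto intro!: openin_Int)
    finally show ?thesis using p by (auto simp: closedin_def)
  qed
  have fip: "\<Inter>\<F> \<noteq> {}" if F: "finite \<F>" "\<F> \<subseteq> insert (topspace ?X) (?C ` P)" for \<F>
  proof -
    have "finite (\<F> - {topspace ?X})" "\<F> - {topspace ?X} \<subseteq> ?C ` P" using F by auto
    from finite_subset_image[OF this]
    obtain Q where Q: "Q \<subseteq> P" "finite Q" "\<F> - {topspace ?X} = ?C ` Q" by (elim exE conjE) (rule that)
    define J where "J = fst ` Q \<union> snd ` Q"
    have J: "finite J" "J \<subseteq> I" using Q by (auto simp: J_def P_def)
    have "\<exists>f. inj_on f J \<and> (\<forall>i\<in>J. f i \<in> N i)"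
    proof (rule hall_finite[OF J(1)])
      show "finite (N i)" if "i \<in> J" for i using that J finN by blast
      show "card J' \<le> card (\<Union>j\<in>J'. N j)" if "J' \<subseteq> J" for J'
        using that J finite_subset[OF that J(1)] by (intro hall) auto
    qed
    then obtain f where f: "inj_on f J" "\<forall>i\<in>J. f i \<in> N i" by blast
    define g where "g = (\<lambda>i\<in>I. if i \<in> J then f i else (SOME x. x \<in> N i))"
    have g: "g \<in> topspace ?X"
      using f ne by (auto simp: g_def some_in_eq)
    have gC: "g \<in> ?C p" if pQ: "p \<in> Q" for p
    proof -
      obtain i j where p: "p = (i, j)" "i \<in> J" "j \<in> J" "i \<noteq> j"
        using pQ Q(1) by (force simp: J_def P_def)
      then have "f i \<noteq> f j" using f(1) by (auto dest: inj_onD)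
      then show ?thesis using p J g by (auto simp: g_def)
    qed
    have "g \<in> A" if A: "A \<in> \<F>" for A
    proof (cases "A = topspace ?X")
      case False
      then have "A \<in> \<F> - {topspace ?X}" using A by simp
      then have "A \<in> ?C ` Q" unfolding Q(3) .
      then obtain p where "A = ?C p" "p \<in> Q" by (rule imageE)
      then show ?thesis using gC[of p] by (simp only:)
    qed (use g in simp)
    then show ?thesis by blast
  qed
  let ?U = "insert (topspace ?X) (?C ` P)"
  have "\<forall>C\<in>?U. closedin ?X C" using cl closedin_topspace[of ?X] by blast
  moreover have "\<forall>\<F>. finite \<F> \<and> \<F> \<subseteq> ?U \<longrightarrow> \<Inter>\<F> \<noteq> {}" using fip by simp
  ultimately have "\<Inter>?U \<noteq> {}" using comp[unfolded compact_space_fip, THEN spec, of ?U] by blast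
  then obtain f where f: "f \<in> \<Inter>?U" by blast
  have f1: "f \<in> topspace ?X" using f by blast
  have f2: "f i \<noteq> f j" if "i \<in> I" "j \<in> I" "i \<noteq> j" for i j
  proof -
    have "(i, j) \<in> P" using that by (simp add: P_def)
    then have "f \<in> ?C (i, j)" using f by blast
    then show ?thesis by simp
  qed
  have "inj_on f I" using f2 by (auto simp: inj_on_def)
  then show ?thesis using f1 by (auto simp: PiE_iff)
qed

section \<open>From invariant means to Folner sets\<close>

lemma additive_finite_UN:
  fixes \<mu> :: "'a set \<Rightarrow> real"
  assumes add: "\<And>A B. A \<subseteq> \<Omega> \<Longrightarrow> B \<subseteq> \<Omega> \<Longrightarrow> A \<inter> B = {} \<Longrightarrow> \<mu> (A \<union> B) = \<mu> A + \<mu> B"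
    and I: "finite I" "\<And>i. i \<in> I \<Longrightarrow> A i \<subseteq> \<Omega>" "disjoint_family_on A I"
  shows "\<mu> (\<Union>i\<in>I. A i) = (\<Sum>i\<in>I. \<mu> (A i))"
  using I
proof (induction I rule: finite_induct)
  case empty
  then show ?case using add[of "{}" "{}"] by simp
next
  case (insert i I)
  have "\<mu> (\<Union>j\<in>insert i I. A j) = \<mu> (A i \<union> (\<Union>j\<in>I. A j))" by simp
  also have "\<dots> = \<mu> (A i) + \<mu> (\<Union>j\<in>I. A j)"
  proof (rule add)
    show "A i \<inter> (\<Union>j\<in>I. A j) = {}"
      using insert.prems(2) insert.hyps(2) by (fastforce simp: disjoint_family_on_def)
  qed (use insert.prems in auto)
  also have "\<mu> (\<Union>j\<in>I. A j) = (\<Sum>i\<in>I. \<mu> (A i))"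
    using insert.prems by (intro insert.IH) (auto simp: disjoint_family_on_def)
  finally show ?case using insert.hyps by simp
qed

text \<open>If every nonempty finite \<open>F\<close> satisfies \<open>|PF| \<ge> 2|F|\<close>, then Hall's theorem yields two
  piecewise translations with disjoint images, which no invariant mean allows.\<close>

lemma amenable_not_doubling:
  fixes G :: "('a, 'm) monoid_scheme" (structure)
  assumes "group G" and am: "amenable_group G" and P: "finite P" "P \<subseteq> carrier G"
  shows "\<exists>F. finite F \<and> F \<subseteq> carrier G \<and> card (\<Union>f\<in>F. (\<lambda>p. p \<otimes> f) ` P) < 2 * card F"
proof (rule ccontr)
  assume "\<not> ?thesis"
  then have dbl: "2 * card F \<le> card (\<Union>f\<in>F. (\<lambda>p. p \<otimes> f) ` P)" if "finite F" "F \<subseteq> carrier G" for F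
    using that by (meson not_less)
  interpret group G by (rule assms)
  obtain \<mu> :: "'a set \<Rightarrow> real" where pos': "\<forall>A. A \<subseteq> carrier G \<longrightarrow> 0 \<le> \<mu> A"
    and one: "\<mu> (carrier G) = 1"
    and add': "\<forall>A B. A \<subseteq> carrier G \<and> B \<subseteq> carrier G \<and> A \<inter> B = {} \<longrightarrow> \<mu> (A \<union> B) = \<mu> A + \<mu> B"
    and inv': "\<forall>g\<in>carrier G. \<forall>A. A \<subseteq> carrier G \<longrightarrow> \<mu> (g <# A) = \<mu> A"
    using am unfolding amenable_group_def by (elim exE conjE) (rule that, assumption+)
  have pos: "0 \<le> \<mu> A" if "A \<subseteq> carrier G" for A using pos' that by blast
  have add: "\<mu> (A \<union> B) = \<mu> A + \<mu> B" if "A \<subseteq> carrier G" "B \<subseteq> carrier G" "A \<inter> B = {}" for A B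
    using add' that by blast
  have inv: "\<mu> (g <# A) = \<mu> A" if "g \<in> carrier G" "A \<subseteq> carrier G" for g A using inv' that by blast
  \<comment> \<open>The boolean makes two copies of every group element. Expansion of finite sets by
    the factor 2 is precisely Hall's condition for this doubled index set.\<close>
  let ?N = "\<lambda>(x, b :: bool). (\<lambda>p. p \<otimes> x) ` P"
  have "\<exists>f. inj_on f (carrier G \<times> UNIV) \<and> (\<forall>i\<in>carrier G \<times> UNIV. f i \<in> ?N i)"
  proof (rule hall_locally_finite)
    fix J :: "('a \<times> bool) set" assume J: "finite J" "J \<subseteq> carrier G \<times> UNIV"
    have "card J \<le> card (fst ` J \<times> (UNIV :: bool set))"
      using J by (intro card_mono) (auto intro: rev_image_eqI)
    also have "\<dots> = 2 * card (fst ` J)" by (simp add: card_cartesian_product)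
    also have "\<dots> \<le> card (\<Union>f\<in>fst ` J. (\<lambda>p. p \<otimes> f) ` P)" using J by (intro dbl) auto
    also have "(\<Union>f\<in>fst ` J. (\<lambda>p. p \<otimes> f) ` P) = (\<Union>j\<in>J. ?N j)" by (auto simp: split_beta)
    finally show "card J \<le> card (\<Union>j\<in>J. ?N j)" .
  qed (use P in auto)
  then obtain f :: "'a \<times> bool \<Rightarrow> 'a" where f: "inj_on f (carrier G \<times> UNIV)"
    and fN: "\<And>x b. x \<in> carrier G \<Longrightarrow> f (x, b) \<in> (\<lambda>p. p \<otimes> x) ` P" by fastforce
  define p where "p x b = (SOME q. q \<in> P \<and> f (x, b) = q \<otimes> x)" for x and b :: bool
  have p: "p x b \<in> P \<and> f (x, b) = p x b \<otimes> x" if "x \<in> carrier G" for x b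
    unfolding p_def by (rule someI_ex) (use fN[OF that] in blast)
  \<comment> \<open>Copy b is cut according to the translating element q, so on the piece
    \<open>A (b, q)\<close> the map f is left translation by q, and \<open>A'\<close> lists the
    images. Each copy has mass 1 and the images are disjoint, so their union would have mass
    2.\<close>
  define A where "A = (\<lambda>(b, q). {x \<in> carrier G. p x b = q})"
  have Asub: "A i \<subseteq> carrier G" for i by (auto simp: A_def split_beta)
  define A' where "A' = (\<lambda>i. snd i <# A i)"
  have A'eq: "A' (b, q) = {f (x, b) |x. x \<in> carrier G \<and> p x b = q}" for b q
  proof -
    have "A' (b, q) = (\<lambda>x. q \<otimes> x) ` {x \<in> carrier G. p x b = q}" by (auto simp: A'_def A_def l_coset_def)
    also have "\<dots> = (\<lambda>x. f (x, b)) ` {x \<in> carrier G. p x b = q}" by (intro image_cong) (auto simp: p)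
    finally show ?thesis by (simp add: setcompr_eq_image)
  qed
  have A'sub: "A' i \<subseteq> carrier G" if "i \<in> (UNIV :: bool set) \<times> P" for i
  proof -
    have "snd i \<in> carrier G" using that P by auto
    then show ?thesis using Asub[of i] by (auto simp: A'_def l_coset_def subset_iff)
  qed
  have "disjoint_family_on A' ((UNIV :: bool set) \<times> P)"
    unfolding disjoint_family_on_def
  proof (intro ballI impI)
    fix i j :: "bool \<times> 'a" assume ij: "i \<in> (UNIV :: bool set) \<times> P" "j \<in> (UNIV :: bool set) \<times> P" "i \<noteq> j"
    obtain b q c r where e: "i = (b, q)" "j = (c, r)" by (metis surj_pair)
    have False if yi: "y \<in> A' i" "y \<in> A' j" for y
    proof -
      obtain x x' where x: "y = f (x, b)" "x \<in> carrier G" "p x b = q" "y = f (x', c)" "x' \<in> carrier G" "p x' c = r"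
        using yi unfolding e A'eq by blast
      then have "(x, b) = (x', c)" using inj_onD[OF f, of "(x, b)" "(x', c)"] by simp
      then show False using x ij e by auto
    qed
    then show "A' i \<inter> A' j = {}" by blast
  qed
  then have "\<mu> (\<Union>i\<in>(UNIV :: bool set) \<times> P. A' i) = (\<Sum>i\<in>(UNIV :: bool set) \<times> P. \<mu> (A' i))"
    using P A'sub by (intro additive_finite_UN[OF add]) auto
  also have "\<dots> = (\<Sum>i\<in>(UNIV :: bool set) \<times> P. \<mu> (A i))"
    unfolding A'_def using P Asub by (intro sum.cong refl inv) auto
  also have "\<dots> = (\<Sum>b\<in>UNIV. \<Sum>q\<in>P. \<mu> (A (b, q)))" by (simp add: sum.cartesian_product)
  also have "\<dots> = (\<Sum>b\<in>(UNIV :: bool set). 1)"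
  proof (rule sum.cong[OF refl])
    fix b :: bool
    have "(\<Sum>q\<in>P. \<mu> (A (b, q))) = \<mu> (\<Union>q\<in>P. A (b, q))"
      using P Asub by (intro additive_finite_UN[OF add, symmetric]) (auto simp: disjoint_family_on_def A_def)
    also have "(\<Union>q\<in>P. A (b, q)) = carrier G" using p by (auto simp: A_def)
    finally show "(\<Sum>q\<in>P. \<mu> (A (b, q))) = 1" using one by simp
  qed
  finally have two: "\<mu> (\<Union>i\<in>(UNIV :: bool set) \<times> P. A' i) = 2" by simp
  let ?U = "\<Union>i\<in>(UNIV :: bool set) \<times> P. A' i"
  have "\<mu> (?U \<union> (carrier G - ?U)) = \<mu> ?U + \<mu> (carrier G - ?U)" using A'sub by (intro add) auto
  moreover have "?U \<union> (carrier G - ?U) = carrier G" using A'sub by blast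
  moreover have "0 \<le> \<mu> (carrier G - ?U)" by (rule pos) auto
  ultimately show False using one two by simp
qed

text \<open>Without a Folner set every finite F grows by a factor 1 + \<epsilon> under
  multiplication by the unit ball of T, because some t moves more than \<epsilon> |F| points out of
  F. Iteration gives, for one fixed radius, growth by more than 2 of every nonempty F, which the
  preceding lemma excludes for the ball of that radius.\<close>

lemma folner:
  fixes G :: "('a, 'm) monoid_scheme" (structure)
  assumes "group G" and am: "amenable_group G" and T: "finite T" "T \<subseteq> carrier G" and \<epsilon>: "0 < \<epsilon>"
  shows "\<exists>F. finite F \<and> F \<noteq> {} \<and> F \<subseteq> carrier G \<and> (\<forall>t\<in>T. real (card {f\<in>F. t \<otimes> f \<notin> F}) \<le> \<epsilon> * real (card F))"
proof (rule ccontr)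
  assume neg: "\<not> ?thesis"
  interpret group G by (rule assms)
  define N where "N n F = (\<Union>f\<in>F. (\<lambda>p. p \<otimes> f) ` words G T n)" for n F
  have step: "(1 + \<epsilon>) * real (card F) \<le> real (card (N 1 F))" if F: "finite F" "F \<subseteq> carrier G" for F
  proof (cases "F = {}")
    case False
    then have "\<not> (\<forall>t\<in>T. real (card {f\<in>F. t \<otimes> f \<notin> F}) \<le> \<epsilon> * real (card F))" using neg F by blast
    then obtain t where t: "t \<in> T" "\<epsilon> * real (card F) < real (card {f\<in>F. t \<otimes> f \<notin> F})"
      by (auto simp: not_le)
    let ?B = "{f\<in>F. t \<otimes> f \<notin> F}"
    have tc: "t \<in> carrier G" using t T by auto
    have c: "card ((\<lambda>f. t \<otimes> f) ` ?B) = card ?B"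
      using F tc by (intro card_image inj_onI) (auto simp: left_cancel subset_iff)
    have sub: "F \<union> (\<lambda>f. t \<otimes> f) ` ?B \<subseteq> N 1 F"
    proof -
      have "p \<otimes> f \<in> N 1 F" if "f \<in> F" "p \<in> words G T 1" for p f
        unfolding N_def using that by blast
      from this[OF _ one_in_words] have "f \<in> N 1 F" if "f \<in> F" for f
        using that F(2) l_one[of f] by (metis subsetD)
      moreover have "t \<otimes> f \<in> N 1 F" if "f \<in> F" for f
        using that \<open>\<And>p f. f \<in> F \<Longrightarrow> p \<in> words G T 1 \<Longrightarrow> p \<otimes> f \<in> N 1 F\<close> in_words_1[OF T(2) t(1)] by blast
      ultimately show ?thesis by blast
    qed
    have "finite (N 1 F)" using F T finite_words by (auto simp: N_def)
    then have "card (F \<union> (\<lambda>f. t \<otimes> f) ` ?B) \<le> card (N 1 F)" using sub by (rule card_mono)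
    moreover have "card (F \<union> (\<lambda>f. t \<otimes> f) ` ?B) = card F + card ((\<lambda>f. t \<otimes> f) ` ?B)"
      using F by (intro card_Un_disjoint) auto
    ultimately have "card F + card ?B \<le> card (N 1 F)" unfolding c by linarith
    then have "real (card F) + real (card ?B) \<le> real (card (N 1 F))" by linarith
    moreover have "(1 + \<epsilon>) * real (card F) = real (card F) + \<epsilon> * real (card F)"
      by (rule trans[OF distrib_right]) simp
    ultimately show ?thesis using t(2) by linarith
  qed simp
  have NN: "finite (N n F)" "N n F \<subseteq> carrier G" if "finite F" "F \<subseteq> carrier G" for n F
    using that T finite_words words_closed'[OF T(2)] by (auto simp: N_def subset_iff)
  have pow: "(1 + \<epsilon>) ^ n * real (card F) \<le> real (card (N n F))" if F: "finite F" "F \<subseteq> carrier G" for n F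
  proof (induction n)
    case 0
    have "N 0 F = F" using F by (force simp: N_def)
    then show ?case by simp
  next
    case (Suc n)
    have "(1 + \<epsilon>) ^ Suc n * real (card F) = (1 + \<epsilon>) * ((1 + \<epsilon>) ^ n * real (card F))" by simp
    also have "\<dots> \<le> (1 + \<epsilon>) * real (card (N n F))" using Suc \<epsilon> by (intro mult_left_mono) auto
    also have "\<dots> \<le> real (card (N 1 (N n F)))" using NN[OF F] by (rule step)
    also have "\<dots> \<le> real (card (N (Suc n) F))"
    proof (intro of_nat_mono card_mono NN[OF F])
      show "N 1 (N n F) \<subseteq> N (Suc n) F"
      proof
        fix y assume "y \<in> N 1 (N n F)"
        then obtain a b f where y: "y = a \<otimes> (b \<otimes> f)" "a \<in> words G T 1" "b \<in> words G T n" "f \<in> F"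
          by (auto simp: N_def)
        then have "y = (a \<otimes> b) \<otimes> f" using words_closed'[OF T(2)] F
            by (auto intro!: m_assoc[symmetric])
        moreover have "a \<otimes> b \<in> words G T (Suc n)" using y by (intro words_mult_le[OF T(2)]) auto
        ultimately show "y \<in> N (Suc n) F" using y by (auto simp: N_def)
      qed
    qed
    finally show ?case .
  qed
  obtain n where n: "2 < (1 + \<epsilon>) ^ n" using real_arch_pow[of "1 + \<epsilon>" 2] \<epsilon> by auto
  obtain F where F: "finite F" "F \<subseteq> carrier G" "card (N n F) < 2 * card F"
    using amenable_not_doubling[OF \<open>group G\<close> am finite_words[OF T(1)] words_closed[OF T(2)]]
    unfolding N_def by blast
  have "2 * real (card F) \<le> (1 + \<epsilon>) ^ n * real (card F)" using n by (intro mult_right_mono) auto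
  also have "\<dots> \<le> real (card (N n F))" using F by (intro pow) auto
  also have "\<dots> < 2 * real (card F)" using F(3) by linarith
  finally show False by simp
qed

section \<open>Growth and thin paths\<close>

context group
begin

definition eval_word :: "(nat \<Rightarrow> 'a) \<Rightarrow> nat list \<Rightarrow> 'a" where
  "eval_word e w = foldr (\<lambda>i y. e i \<otimes> y) w \<one>"

lemma eval_word_simps [simp]:
  "eval_word e [] = \<one>" "eval_word e (i # w) = e i \<otimes> eval_word e w"
  by (simp_all add: eval_word_def)

text \<open>Shortlex normal forms: \<open>lenlex\<close> compares lengths first, so a normal word is
  geodesic in the letters \<open>e i\<close> as well as unique for its value.\<close>

definition normal_words :: "(nat \<Rightarrow> 'a) \<Rightarrow> nat \<Rightarrow> nat list set" where
  "normal_words e m = {w. set w \<subseteq> {..<m} \<and>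
     (\<forall>w'. set w' \<subseteq> {..<m} \<and> eval_word e w' = eval_word e w \<longrightarrow> (w', w) \<notin> lenlex less_than)}"

end

locale alphabet = group G for G (structure) +
  fixes e :: "nat \<Rightarrow> 'a" and m :: nat
  assumes e_closed: "\<And>i. i < m \<Longrightarrow> e i \<in> carrier G"
begin

abbreviation ev where "ev \<equiv> eval_word e"
abbreviation L where "L \<equiv> normal_words e m"

lemma ev_closed: "set w \<subseteq> {..<m} \<Longrightarrow> ev w \<in> carrier G"
  by (induction w) (auto simp: e_closed)

lemma ev_append: "set u \<subseteq> {..<m} \<Longrightarrow> set v \<subseteq> {..<m} \<Longrightarrow> ev (u @ v) = ev u \<otimes> ev v"
  by (induction u) (auto simp: e_closed ev_closed m_assoc)

lemma L_set: "w \<in> L \<Longrightarrow> set w \<subseteq> {..<m}"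
  by (simp add: normal_words_def)

text \<open>Replacing a factor by a shortlex smaller word of the same value makes the whole word
  smaller without changing its value.\<close>

lemma L_factor:
  assumes "u @ v @ x \<in> L"
  shows "v \<in> L"
proof -
  have s: "set u \<subseteq> {..<m}" "set v \<subseteq> {..<m}" "set x \<subseteq> {..<m}" using L_set[OF assms] by auto
  have "(v', v) \<notin> lenlex less_than" if v': "set v' \<subseteq> {..<m}" "ev v' = ev v" for v'
  proof
    assume "(v', v) \<in> lenlex less_than"
    then have "(v' @ x, v @ x) \<in> lenlex less_than" by (rule lenlex_append1) simp
    then have less: "(u @ v' @ x, u @ v @ x) \<in> lenlex less_than" by (simp add: irrefl_def)
    have "ev (u @ v' @ x) = ev (u @ v @ x)" using s v' by (simp add: ev_append)
    moreover have "set (u @ v' @ x) \<subseteq> {..<m}" using s v' by auto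
    ultimately show False using assms less unfolding normal_words_def by blast
  qed
  then show ?thesis using s by (simp add: normal_words_def)
qed

lemma L_prefix: "u @ v \<in> L \<Longrightarrow> u \<in> L"
  using L_factor[of "[]" u v] by simp

lemma L_suffix: "u @ v \<in> L \<Longrightarrow> v \<in> L"
  using L_factor[of u v "[]"] by simp

lemma L_take: "w \<in> L \<Longrightarrow> take n w \<in> L"
  using L_prefix[of "take n w" "drop n w"] by simp

lemma L_drop: "w \<in> L \<Longrightarrow> drop n w \<in> L"
  using L_suffix[of "take n w" "drop n w"] by simp

lemma L_inj: "inj_on ev L"
proof (rule inj_onI)
  fix w w' assume w: "w \<in> L" "w' \<in> L" "ev w = ev w'"
  then have "(w, w') \<notin> lenlex less_than" "(w', w) \<notin> lenlex less_than"
    unfolding normal_words_def by auto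
  moreover have "total (lenlex less_than)" by (rule total_lenlex) (rule total_less_than)
  ultimately show "w = w'" unfolding total_on_def by blast
qed

lemma L_exists:
  assumes "set w \<subseteq> {..<m}"
  shows "\<exists>w'\<in>L. ev w' = ev w"
proof -
  let ?Q = "{w'. set w' \<subseteq> {..<m} \<and> ev w' = ev w}"
  have "wf (lenlex less_than)" by (rule wf_lenlex) (rule wf_less_than)
  moreover have "w \<in> ?Q" using assms by simp
  ultimately obtain z where z: "z \<in> ?Q" "\<And>y. (y, z) \<in> lenlex less_than \<Longrightarrow> y \<notin> ?Q"
    by (rule wfE_min) auto
  then have "z \<in> L" unfolding normal_words_def by auto
  then show ?thesis using z(1) by auto
qed

lemma L_length: "w \<in> L \<Longrightarrow> set w' \<subseteq> {..<m} \<Longrightarrow> ev w' = ev w \<Longrightarrow> length w \<le> length w'"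
  unfolding normal_words_def lenlex_conv by (auto simp: not_less)

definition Ln :: "nat \<Rightarrow> nat list set" where
  "Ln n = {w \<in> L. length w = n}"

lemma finite_Ln: "finite (Ln n)"
  by (rule finite_subset[OF _ finite_lists_length_eq[of "{..<m}" n]]) (auto simp: Ln_def dest: L_set)

text \<open>Prefixes of normal words are normal, so a missing length would bound all lengths, and
  there are finitely many words of bounded length.\<close>

lemma Ln_nonempty:
  assumes inf: "infinite L"
  shows "Ln n \<noteq> {}"
proof
  assume empty: "Ln n = {}"
  have "length w \<le> n" if "w \<in> L" for w
  proof (rule ccontr)
    assume "\<not> ?thesis"
    then have "take n w \<in> Ln n" using L_take[OF that] by (simp add: Ln_def)
    then show False using empty by simp
  qed
  then have "L \<subseteq> {w. set w \<subseteq> {..<m} \<and> length w \<le> n}" using L_set by blast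
  then show False using inf finite_lists_length_le[of "{..<m}" n] finite_subset by blast
qed

text \<open>Morse and Hedlund's argument: an infinite word with at most \<open>n\<close> factors of length \<open>n\<close> is
  eventually periodic, and a normal word \<open>u\<^sup>k\<close> cannot represent the identity.\<close>

lemma exists_non_torsion_of_small_sphere:
  assumes inf: "infinite L" and small: "card (Ln n) \<le> n"
    and torsion: "\<And>x. x \<in> carrier G \<Longrightarrow> \<exists>k>0::nat. x [^] k = \<one>"
  shows False
proof -
  \<comment> \<open>Only words are kept that extend to the right to normal words of every length. By
    Koenig's argument each of them then extends by one letter inside the class, which may fail in L
    itself.\<close>
  define L' where "L' = {w. \<forall>k. \<exists>v. length v = k \<and> w @ v \<in> L}"
  define L'n where "L'n i = {w \<in> L'. length w = i}" for i
  have L'D: "\<exists>v. length v = k \<and> w @ v \<in> L" if "w \<in> L'" for w k using that by (simp add: L'_def)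
  have L'L: "w \<in> L" if "w \<in> L'" for w using L'D[OF that, of 0] by simp
  have prefix: "u \<in> L'" if uv: "u @ v \<in> L'" for u v
    unfolding L'_def
  proof (rule CollectI, rule allI)
    fix k
    obtain x where x: "length x = k" "(u @ v) @ x \<in> L" using L'D[OF uv] by blast
    have "u @ take k (v @ x) @ drop k (v @ x) \<in> L" using x by (simp only: append_take_drop_id append_assoc)
    then have "(u @ take k (v @ x)) @ drop k (v @ x) \<in> L" by (simp only: append_assoc)
    then have "u @ take k (v @ x) \<in> L" by (rule L_prefix)
    moreover have "length (take k (v @ x)) = k" using x by simp
    ultimately show "\<exists>v. length v = k \<and> u @ v \<in> L" by blast
  qed
  have suffix: "v \<in> L'" if uv: "u @ v \<in> L'" for u v
    unfolding L'_def
  proof (rule CollectI, rule allI)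
    fix k
    obtain x where x: "length x = k" "(u @ v) @ x \<in> L" using L'D[OF uv] by blast
    then have "v @ x \<in> L" using L_suffix[of u "v @ x"] by simp
    then show "\<exists>w. length w = k \<and> v @ w \<in> L" using x by blast
  qed
  have nil: "[] \<in> L'"
    unfolding L'_def
  proof (rule CollectI, rule allI)
    fix k
    obtain w where "w \<in> Ln k" using Ln_nonempty[OF inf] by blast
    then show "\<exists>v. length v = k \<and> [] @ v \<in> L" by (auto simp: Ln_def)
  qed
  have ext: "\<exists>a. w @ [a] \<in> L'" if w: "w \<in> L'" for w
  proof (rule ccontr)
    assume neg: "\<nexists>a. w @ [a] \<in> L'"
    then have "\<forall>a. \<exists>k. \<forall>v. length v = k \<longrightarrow> (w @ [a]) @ v \<notin> L" by (simp add: L'_def)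
    then obtain k where k: "\<And>a v. length v = k a \<Longrightarrow> (w @ [a]) @ v \<notin> L" by metis
    obtain v where v: "length v = Suc (\<Sum>a<m. k a)" "w @ v \<in> L" using L'D[OF w] by blast
    then obtain a v' where av: "v = a # v'" "length v' = (\<Sum>a<m. k a)" by (cases v) auto
    have "a < m" using L_set[OF v(2)] av by auto
    then have "k a \<le> length v'" unfolding av(2) by (intro member_le_sum) auto
    then have len: "length (take (k a) v') = k a" by simp
    have "((w @ [a]) @ take (k a) v') @ drop (k a) v' \<in> L" using v(2) av by simp
    then have "(w @ [a]) @ take (k a) v' \<in> L" by (rule L_prefix)
    then show False using k[OF len] by blast
  qed
  have sub: "L'n i \<subseteq> Ln i" for i using L'L by (auto simp: L'n_def Ln_def)
  then have fin: "finite (L'n i)" for i using finite_Ln finite_subset by blast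
  have but: "butlast ` L'n (Suc i) = L'n i" for i
  proof
    show "butlast ` L'n (Suc i) \<subseteq> L'n i"
    proof
      fix u assume "u \<in> butlast ` L'n (Suc i)"
      then obtain w where w: "w \<in> L'n (Suc i)" "u = butlast w" by blast
      then have "w \<noteq> []" by (auto simp: L'n_def)
      then have "u @ [last w] \<in> L'" using w by (simp add: L'n_def)
      then show "u \<in> L'n i" using prefix w by (auto simp: L'n_def)
    qed
    show "L'n i \<subseteq> butlast ` L'n (Suc i)"
    proof
      fix u assume u: "u \<in> L'n i"
      then obtain a where "u @ [a] \<in> L'" using ext[of u] by (auto simp: L'n_def)
      then have "u @ [a] \<in> L'n (Suc i)" "u = butlast (u @ [a])" using u by (auto simp: L'n_def)
      then show "u \<in> butlast ` L'n (Suc i)" by blast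
    qed
  qed
  \<comment> \<open>Sizes that increased strictly from at least 1 at length 0 would exceed n at
    length n. Where the size does not grow, \<open>butlast\<close> is a bijection, so the last
    letter of a word in \<open>L'n (Suc i)\<close> is determined by the i letters before it.\<close>
  have "\<exists>i<n. card (L'n (Suc i)) \<le> card (L'n i)"
  proof (rule ccontr)
    assume "\<not> ?thesis"
    then have inc: "card (L'n i) < card (L'n (Suc i))" if "i < n" for i using that by (auto simp: not_le)
    have "i < card (L'n i)" if "i \<le> n" for i
      using that
    proof (induction i)
      case 0
      have "[] \<in> L'n 0" using nil by (simp add: L'n_def)
      then show ?case using fin[of 0] by (auto simp: card_gt_0_iff)
    next
      case (Suc i) then show ?case using inc[of i] by simp
    qed
    then have "n < card (L'n n)" by simp
    moreover have "card (L'n n) \<le> card (Ln n)" by (rule card_mono[OF finite_Ln sub])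
    ultimately show False using small by simp
  qed
  then obtain i where i: "card (L'n (Suc i)) \<le> card (L'n i)" by blast
  have "card (butlast ` L'n (Suc i)) = card (L'n (Suc i))"
    using i card_image_le[OF fin[of "Suc i"], of butlast] unfolding but by simp
  then have inj: "inj_on butlast (L'n (Suc i))" by (rule eq_card_imp_inj_on[OF fin])
  have uniq: "a = b" if "w @ [a] \<in> L'" "w @ [b] \<in> L'" "length w = i" for w a b
    using inj_onD[OF inj, of "w @ [a]" "w @ [b]"] that by (simp add: L'n_def)
  define W where "W = rec_nat [] (\<lambda>k w. w @ [SOME a. w @ [a] \<in> L'])"
  define s where "s k = (SOME a. W k @ [a] \<in> L')" for k
  have W_simps: "W 0 = []" "\<And>k. W (Suc k) = W k @ [s k]" by (simp_all add: W_def s_def)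
  have W_L': "W k \<in> L'" for k
  proof (induction k)
    case 0 then show ?case using nil by (simp add: W_simps)
  next
    case (Suc k)
    then show ?case unfolding W_simps s_def by (rule someI_ex[OF ext])
  qed
  have W_map: "W k = map s [0..<k]" for k
    by (induction k) (simp_all add: W_simps)
  have win: "map s [a..<a + k] \<in> L'" for a k
  proof -
    have "map s [0..<a] @ map s [a..<a + k] = map s [0..<a + k]"
      using upt_add_eq_append[of 0 a k] by simp
    then show ?thesis using W_L'[of "a + k"] suffix by (metis W_map)
  qed
  \<comment> \<open>Some window of length i occurs twice. As a window determines the next letter,
    the infinite word is periodic from there on, with period d = b - a.\<close>
  let ?f = "\<lambda>a. map s [a..<a + i]"
  have "range ?f \<subseteq> L'n i" using win by (auto simp: L'n_def)
  then have "finite (range ?f)" using fin finite_subset by blast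
  then have "\<not> inj ?f" using finite_imageD infinite_UNIV_nat by blast
  then obtain a b where ab: "?f a = ?f b" "a < b"
    unfolding inj_def by (metis linorder_neqE_nat)
  have shift: "map s [Suc c..<Suc c + i] = tl (map s [c..<c + i] @ [s (c + i)])" for c
  proof -
    have "map s [c..<c + i] @ [s (c + i)] = map s [c..<Suc (c + i)]" by simp
    also have "\<dots> = s c # map s [Suc c..<Suc (c + i)]" by (simp add: upt_conv_Cons del: upt_Suc)
    finally show ?thesis by simp
  qed
  have app: "map s [c..<c + i] @ [s (c + i)] \<in> L'" for c
    using win[of c "Suc i"] by simp
  have per: "?f (a + t) = ?f (b + t)" for t
  proof (induction t)
    case 0 then show ?case using ab by simp
  next
    case (Suc t)
    have "s (a + t + i) = s (b + t + i)"
      by (rule uniq[of "?f (a + t)"]) (use app[of "a + t"] app[of "b + t"] Suc in auto)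
    then show ?case using shift[of "a + t"] shift[of "b + t"] Suc by simp
  qed
  have per': "s (a + t + i) = s (b + t + i)" for t
    by (rule uniq[of "?f (a + t)"]) (use app[of "a + t"] app[of "b + t"] per[of t] in auto)
  define c where "c = a + i"
  define d where "d = b - a"
  have d: "d > 0" using ab by (simp add: d_def)
  have sd: "s (j + d) = s j" if "c \<le> j" for j
    using per'[of "j - c"] that ab by (simp add: c_def d_def add.commute add.left_commute)
  let ?u = "map s [c..<c + d]"
  have set_win: "set (map s [j..<j + k]) \<subseteq> {..<m}" for j k using L_set[OF L'L[OF win]] .
  have pow: "ev (map s [c..<c + k * d]) = ev ?u [^] k" for k
  proof (induction k)
    case 0 then show ?case by simp
  next
    case (Suc k)
    have "map s [c..<c + Suc k * d] = ?u @ map s [c + d..<c + d + k * d]"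
      using upt_add_eq_append[of c "c + d" "k * d"] by (simp add: add.assoc)
    also have "map s [c + d..<c + d + k * d] = map s [c..<c + k * d]"
    proof (rule nth_equalityI)
      fix j assume "j < length (map s [c + d..<c + d + k * d])"
      then show "map s [c + d..<c + d + k * d] ! j = map s [c..<c + k * d] ! j"
        using sd[of "c + j"] by (simp add: add.commute add.left_commute)
    qed simp
    finally have "ev (map s [c..<c + Suc k * d]) = ev ?u \<otimes> ev (map s [c..<c + k * d])"
      using set_win by (simp only: ev_append)
    also have "\<dots> = ev ?u [^] Suc k"
      unfolding Suc using ev_closed[OF set_win[of c d]] by (rule nat_pow_Suc2[symmetric])
    finally show ?case .
  qed
  \<comment> \<open>A factor made of k full periods is normal, but if k is an exponent that kills
    the value of one period it has the value of the empty word. Normal words of equal value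
    coincide.\<close>
  obtain k :: nat where k: "k > 0" "ev ?u [^] k = \<one>" using torsion[OF ev_closed[OF set_win[of c d]]] by blast
  have "ev (map s [c..<c + k * d]) = ev []" using pow[of k] k by simp
  then have "map s [c..<c + k * d] = []"
    using inj_onD[OF L_inj] L'L[OF win] L'L[OF nil] by blast
  then show False using k d by simp
qed

end

section \<open>Growth of balls and geodesic paths\<close>

locale symmetric_alphabet = alphabet +
  fixes B assumes B: "B = e ` {..<m}" and B_inv: "m_inv G ` B \<subseteq> B"
begin

lemma B_closed: "B \<subseteq> carrier G"
  using e_closed by (auto simp: B)

lemma words_eq_ev: "words G B n = ev ` {w. set w \<subseteq> {..<m} \<and> length w \<le> n}"
proof
  have BB: "B \<union> m_inv G ` B = B" using B_inv by blast
  show "words G B n \<subseteq> ev ` {w. set w \<subseteq> {..<m} \<and> length w \<le> n}"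
  proof (induction n)
    case 0 then show ?case by auto
  next
    case (Suc n)
    show ?case
    proof
      fix x assume "x \<in> words G B (Suc n)"
      then consider "x \<in> words G B n" | b y where "x = b \<otimes> y" "b \<in> B" "y \<in> words G B n"
        by (auto simp: words.simps BB)
      then show "x \<in> ev ` {w. set w \<subseteq> {..<m} \<and> length w \<le> Suc n}"
      proof cases
        case 1
        then obtain w where "x = ev w" "set w \<subseteq> {..<m}" "length w \<le> n" using Suc by blast
        then show ?thesis by auto
      next
        case 2
        then obtain w where w: "y = ev w" "set w \<subseteq> {..<m}" "length w \<le> n" using Suc by blast
        obtain i where i: "i < m" "b = e i" using 2 B by auto
        have "x = ev (i # w)" using 2 w i by simp
        moreover have "set (i # w) \<subseteq> {..<m}" "length (i # w) \<le> Suc n" using w i by auto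
        ultimately show ?thesis by blast
      qed
    qed
  qed
  show "ev ` {w. set w \<subseteq> {..<m} \<and> length w \<le> n} \<subseteq> words G B n"
  proof
    fix x assume "x \<in> ev ` {w. set w \<subseteq> {..<m} \<and> length w \<le> n}"
    then obtain w where w: "x = ev w" "set w \<subseteq> {..<m}" "length w \<le> n" by blast
    have "ev w \<in> words G B (length w)"
      using w(2)
    proof (induction w)
      case Nil then show ?case by simp
    next
      case (Cons i w)
      then have "e i \<in> words G B 1" using in_words_1[OF B_closed] by (auto simp: B)
      then show ?case using Cons words_mult_le[OF B_closed, of "e i" 1 "ev w" "length w"] by simp
    qed
    then show "x \<in> words G B n" using w words_mono by blast
  qed
qed

lemma normal_length_le: "w \<in> L \<Longrightarrow> ev w \<in> words G B n \<Longrightarrow> length w \<le> n"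
  unfolding words_eq_ev using L_length by fastforce

lemma infinite_L: assumes "infinite (generate G B)" shows "infinite L"
proof
  assume fin: "finite L"
  have "generate G B \<subseteq> ev ` L"
  proof
    fix x assume "x \<in> generate G B"
    then obtain n where "x \<in> words G B n" unfolding generate_eq_words[OF B_closed] by blast
    then obtain w where "x = ev w" "set w \<subseteq> {..<m}" unfolding words_eq_ev by blast
    then show "x \<in> ev ` L" using L_exists[of w] by (metis image_eqI)
  qed
  then show False using assms fin finite_subset by blast
qed

text \<open>The ball contains the disjoint sets of values of normal words of length i for i up to r,
  each with at least i + 1 elements; hence quadratic growth.\<close>

lemma card_words_ge:
  assumes "\<And>n. n < card (Ln n)"
  shows "(r + 1) * (r + 1) \<le> 2 * card (words G B r)"
proof -
  have "(\<Sum>i\<le>r. Suc i) \<le> (\<Sum>i\<le>r. card (Ln i))" using assms by (intro sum_mono) (simp add: Suc_leI)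
  also have "\<dots> = card (\<Union>i\<in>{..r}. Ln i)"
    using finite_Ln by (intro card_UN_disjoint[symmetric]) (auto simp: Ln_def)
  also have "\<dots> = card (ev ` (\<Union>i\<in>{..r}. Ln i))"
    by (rule card_image[symmetric]) (rule inj_on_subset[OF L_inj], auto simp: Ln_def)
  also have "\<dots> \<le> card (words G B r)"
  proof (rule card_mono)
    show "finite (words G B r)" by (rule finite_words) (simp add: B)
    show "ev ` (\<Union>i\<in>{..r}. Ln i) \<subseteq> words G B r"
      unfolding words_eq_ev by (rule image_mono) (auto simp: Ln_def dest: L_set)
  qed
  finally have "(\<Sum>i\<le>r. Suc i) \<le> card (words G B r)" .
  moreover have "(r + 1) * (r + 1) \<le> 2 * (\<Sum>i\<le>r. Suc i)" by (induction r) auto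
  ultimately show ?thesis by linarith
qed

text \<open>Balls of radius \<open>r\<close> around every \<open>(2r+1)\<close>-st point of a geodesic are disjoint.\<close>

lemma geodesic_thin_path:
  assumes inf: "infinite L" and r: "N * (2 * r + 1) \<le> card (words G B r)"
  shows "\<exists>x :: nat \<Rightarrow> 'a. x 0 = \<one> \<and> (\<forall>i<M. x i \<in> carrier G) \<and> inj_on x {..<M} \<and>
           (\<forall>i. Suc i < M \<longrightarrow> x (Suc i) \<otimes> inv (x i) \<in> B) \<and>
           N * M \<le> card ((\<lambda>(s, i). s \<otimes> x i) ` (words G B r \<times> {..<M}))"
proof -
  obtain w where w: "w \<in> Ln M" using Ln_nonempty[OF inf] by blast
  then have wL: "w \<in> L" and len: "length w = M" by (auto simp: Ln_def)
  \<comment> \<open>Suffixes rather than prefixes, so that passing from x i to x (i + 1) multiplies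
    by a letter on the left, the side on which approximations act.\<close>
  define x where "x i = ev (drop (M - i) w)" for i
  have dL: "drop (M - i) w \<in> L" for i using wL by (rule L_drop)
  have xc: "x i \<in> carrier G" for i unfolding x_def by (rule ev_closed[OF L_set[OF dL]])
  have geo: "i \<le> n" if "x i \<in> words G B n" "i \<le> M" for i n
    using normal_length_le[OF dL, of i n] that len by (simp add: x_def)
  have xw: "x i \<in> words G B i" if "i \<le> M" for i
    unfolding words_eq_ev x_def using L_set[OF dL[of i]] len that by (intro imageI) auto
  have far: "s = s' \<and> i = j" if eq: "s \<otimes> x i = s' \<otimes> x j" and ij: "i \<le> j" "j \<le> M" "i = j \<or> i + 2 * r < j"
    and s: "s \<in> words G B r" "s' \<in> words G B r" for s s' i j
  proof -
    have sc: "s \<in> carrier G" "s' \<in> carrier G" using s words_closed'[OF B_closed] by auto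
    have "x j = inv s' \<otimes> (s' \<otimes> x j)" using sc xc by (simp add: m_assoc[symmetric])
    also have "\<dots> = inv s' \<otimes> s \<otimes> x i" unfolding eq[symmetric] using sc xc by (simp add: m_assoc)
    finally have xj: "x j = inv s' \<otimes> s \<otimes> x i" .
    have "inv s' \<otimes> s \<in> words G B (2 * r)"
      by (rule words_mult_le[OF B_closed words_inv[OF B_closed s(2)] s(1)]) simp
    then have "x j \<in> words G B (2 * r + i)"
      unfolding xj using ij by (intro words_mult_le[OF B_closed _ xw]) auto
    then have "j \<le> 2 * r + i" using geo ij by simp
    then have "i = j" using ij by simp
    then show ?thesis using eq sc xc by simp
  qed
  define d where "d = 2 * r + 1"
  \<comment> \<open>M / d rounded up, which is the number of multiples of d below M.\<close>
  define Q where "Q = (M + 2 * r) div d"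
  have d: "d > 0" by (simp add: d_def)
  have Qd: "Q * d + (M + 2 * r) mod d = M + 2 * r" unfolding Q_def by (rule div_mult_mod_eq)
  have "(M + 2 * r) mod d < d" using d by simp
  then have "M + 2 * r < Q * d + d" using Qd by linarith
  moreover have d2: "d = 2 * r + 1" by (simp add: d_def)
  ultimately have MQ: "M \<le> Q * d" by linarith
  have qM: "q * d < M" if "q < Q" for q
  proof -
    have "Suc q * d \<le> Q * d" using that by (intro mult_le_mono1) simp
    then have "q * d + d \<le> Q * d" by simp
    then show ?thesis using Qd d2 by linarith
  qed
  let ?h = "\<lambda>(s, q). s \<otimes> x (q * d)"
  have "inj_on ?h (words G B r \<times> {..<Q})"
  proof (rule inj_onI)
    fix p p' assume p: "p \<in> words G B r \<times> {..<Q}" "p' \<in> words G B r \<times> {..<Q}" "?h p = ?h p'"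
    obtain s q s' q' where e: "p = (s, q)" "p' = (s', q')" by (metis surj_pair)
    have lt: "u * d = v * d \<or> u * d + 2 * r < v * d" if "u \<le> v" for u v
    proof (cases "u = v")
      case False
      then have "Suc u * d \<le> v * d" using that by (intro mult_le_mono1) simp
      then show ?thesis by (simp add: d_def)
    qed simp
    have qq: "q * d < M" "q' * d < M" using p e qM by auto
    have "s = s' \<and> q * d = q' * d"
    proof (cases "q \<le> q'")
      case True
      then show ?thesis using far[of s "q * d" s' "q' * d"] lt[OF True] p e qq d by auto
    next
      case False
      then have "q' \<le> q" by simp
      then show ?thesis using far[of s' "q' * d" s "q * d"] lt[of q' q] p e qq d by auto
    qed
    then show "p = p'" using e d by simp
  qed
  then have "card (?h ` (words G B r \<times> {..<Q})) = card (words G B r) * Q"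
    by (simp add: card_image card_cartesian_product)
  moreover have "?h ` (words G B r \<times> {..<Q}) \<subseteq> (\<lambda>(s, i). s \<otimes> x i) ` (words G B r \<times> {..<M})"
    using qM by auto
  moreover have "finite ((\<lambda>(s, i). s \<otimes> x i) ` (words G B r \<times> {..<M}))"
    using finite_words[of B r] by (simp add: B)
  ultimately have "card (words G B r) * Q \<le> card ((\<lambda>(s, i). s \<otimes> x i) ` (words G B r \<times> {..<M}))"
    by (metis card_mono)
  moreover have "N * M \<le> card (words G B r) * Q"
  proof -
    have "N * M \<le> N * (Q * d)" using MQ by simp
    also have "\<dots> = N * d * Q" by simp
    also have "\<dots> \<le> card (words G B r) * Q" using r by (intro mult_le_mono1) (simp add: d_def)
    finally show ?thesis .
  qed
  moreover have "inj_on x {..<M}"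
  proof (rule inj_onI)
    fix i j assume ij: "i \<in> {..<M}" "j \<in> {..<M}" "x i = x j"
    then have "x i \<in> words G B j" "x j \<in> words G B i" using xw[of i] xw[of j] by auto
    then show "i = j" using geo[of i j] geo[of j i] ij by simp
  qed
  moreover have "x (Suc i) \<otimes> inv (x i) \<in> B" if i: "Suc i < M" for i
  proof -
    have "M - Suc i < length w" using len i by simp
    then have "drop (M - Suc i) w = w ! (M - Suc i) # drop (Suc (M - Suc i)) w" by (rule Cons_nth_drop_Suc[symmetric])
    moreover have "Suc (M - Suc i) = M - i" using i by simp
    ultimately have "x (Suc i) = e (w ! (M - Suc i)) \<otimes> x i" by (simp add: x_def)
    moreover have "w ! (M - Suc i) < m" using L_set[OF wL] \<open>M - Suc i < length w\<close> nth_mem by blast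
    ultimately show ?thesis using xc e_closed by (simp add: m_assoc B)
  qed
  moreover have "x 0 = \<one>" using len by (simp add: x_def)
  ultimately show ?thesis using xc by (intro exI[of _ x]) auto
qed

end

text \<open>The path consists of the powers of a. The cyclic subgroup C generated by a has infinite
  index, so there are N cosets C y; the corresponding left cosets of C by the elements inv y are
  disjoint, and these N elements form S.\<close>

lemma (in group) thin_paths_of_infinite_order:
  assumes a: "a \<in> carrier G" "inj (\<lambda>n::nat. a [^] n)"
    and nvc: "\<not> virtually_cyclic_group G"
  shows "\<exists>S. finite S \<and> S \<subseteq> carrier G \<and>
     (\<forall>M. \<exists>x :: nat \<Rightarrow> 'a. x 0 = \<one> \<and> (\<forall>i<M. x i \<in> carrier G) \<and> inj_on x {..<M} \<and>
           (\<forall>i. Suc i < M \<longrightarrow> x (Suc i) \<otimes> inv (x i) \<in> {a}) \<and>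
           N * M \<le> card ((\<lambda>(s, i). s \<otimes> x i) ` (S \<times> {..<M})))"
proof -
  let ?C = "generate G {a}"
  have subC: "subgroup ?C G" using a by (intro generate_is_subgroup) auto
  have "subgroup_generated G {a} = G\<lparr>carrier := ?C\<rparr>"
    using a by (simp add: subgroup_generated_def)
  then have "cyclic_group (G\<lparr>carrier := ?C\<rparr>)" using cyclic_group_generated[of a] by simp
  then have "infinite (rcosets ?C)" using nvc subC by (auto simp: virtually_cyclic_group_def)
  then obtain R where R: "R \<subseteq> rcosets ?C" "finite R" "card R = N"
    using infinite_arbitrarily_large by blast
  have "\<exists>y. y \<in> carrier G \<and> A = ?C #> y" if "A \<in> R" for A using that R by (auto simp: RCOSETS_def)
  then obtain y where y: "\<And>A. A \<in> R \<Longrightarrow> y A \<in> carrier G" "\<And>A. A \<in> R \<Longrightarrow> A = ?C #> y A" by metis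
  define S where "S = (\<lambda>A. inv (y A)) ` R"
  have S: "finite S" "S \<subseteq> carrier G" using R y by (auto simp: S_def)
  have apow: "a [^] (n::nat) \<in> ?C" for n
    by (induction n) (auto intro: generate.intros)
  show ?thesis
  proof (intro exI[of _ S] conjI allI S)
    fix M
    let ?x = "\<lambda>i::nat. a [^] i"
    let ?h = "\<lambda>(A, i). inv (y A) \<otimes> a [^] (i::nat)"
    have "inj_on ?h (R \<times> {..<M})"
    proof (rule inj_onI)
      fix p p' assume p: "p \<in> R \<times> {..<M}" "p' \<in> R \<times> {..<M}" "?h p = ?h p'"
      obtain A i A' j where e: "p = (A, i)" "p' = (A', j)" by (metis surj_pair)
      have A: "A \<in> R" "A' \<in> R" using p e by auto
      have eq: "inv (y A) \<otimes> a [^] i = inv (y A') \<otimes> a [^] j" using p e by simp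
      have "y A' = a [^] j \<otimes> inv (a [^] i) \<otimes> y A"
      proof -
        have "y A' \<otimes> (inv (y A) \<otimes> a [^] i) = a [^] j"
          unfolding eq using y(1)[OF A(2)] a by (simp add: m_assoc[symmetric])
        then have "y A' \<otimes> (inv (y A) \<otimes> a [^] i) \<otimes> (inv (a [^] i) \<otimes> y A) = a [^] j \<otimes> (inv (a [^] i) \<otimes> y A)"
          by simp
        moreover have "inv (y A) \<otimes> a [^] i \<otimes> (inv (a [^] i) \<otimes> y A) = \<one>"
          using y(1)[OF A(1)] a by (metis inv_closed inv_mult_group inv_inv m_closed nat_pow_closed r_inv)
        ultimately show ?thesis using y(1)[OF A(1)] y(1)[OF A(2)] a by (simp add: m_assoc)
      qed
      moreover have "a [^] j \<otimes> inv (a [^] i) \<in> ?C"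
        using apow subC by (simp add: subgroup.m_closed subgroup.m_inv_closed)
      ultimately have "y A' \<in> ?C #> y A" by (auto simp: r_coset_def)
      then have "?C #> y A = ?C #> y A'" using repr_independence[OF _ _ subC] y(1)[OF A(1)] by blast
      then have AA: "A = A'" using y(2)[OF A(1)] y(2)[OF A(2)] by simp
      then have "a [^] i = a [^] j" using eq y(1)[OF A(1)] a by (simp add: left_cancel)
      then have "i = j" using a(2) by (simp add: inj_def)
      then show "p = p'" using e AA by simp
    qed
    then have "card (?h ` (R \<times> {..<M})) = N * M" using R by (simp add: card_image card_cartesian_product)
    moreover have "?h ` (R \<times> {..<M}) \<subseteq> (\<lambda>(s, i). s \<otimes> ?x i) ` (S \<times> {..<M})" by (force simp: S_def)
    moreover have "finite ((\<lambda>(s, i). s \<otimes> ?x i) ` (S \<times> {..<M}))" using S by simp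
    ultimately have "N * M \<le> card ((\<lambda>(s, i). s \<otimes> ?x i) ` (S \<times> {..<M}))" by (metis card_mono)
    moreover have "?x (Suc i) \<otimes> inv (?x i) \<in> {a}" for i
      using a nat_pow_Suc2[of a i] by (simp add: m_assoc del: nat_pow_Suc)
    ultimately show "\<exists>x :: nat \<Rightarrow> 'a. x 0 = \<one> \<and> (\<forall>i<M. x i \<in> carrier G) \<and> inj_on x {..<M} \<and>
           (\<forall>i. Suc i < M \<longrightarrow> x (Suc i) \<otimes> inv (x i) \<in> {a}) \<and>
           N * M \<le> card ((\<lambda>(s, i). s \<otimes> x i) ` (S \<times> {..<M}))"
      using a by (intro exI[of _ ?x]) (auto intro: inj_on_subset)
  qed
qed

text \<open>Either some element has infinite order, or the group is torsion. In the torsion case an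
  infinite finitely generated subgroup has quadratic growth by the sphere estimate, so its balls
  outgrow every multiple of their radius. E is independent of N because N will be chosen from the
  cost of E, and S is independent of the length M.\<close>

lemma (in group) exists_thin_paths:
  assumes nlf: "\<not> locally_finite_group G" and nvc: "\<not> virtually_cyclic_group G"
  shows "\<exists>E. finite E \<and> E \<subseteq> carrier G \<and> (\<forall>N. \<exists>S. finite S \<and> S \<subseteq> carrier G \<and>
     (\<forall>M. \<exists>x :: nat \<Rightarrow> 'a. x 0 = \<one> \<and> (\<forall>i<M. x i \<in> carrier G) \<and> inj_on x {..<M} \<and>
           (\<forall>i. Suc i < M \<longrightarrow> x (Suc i) \<otimes> inv (x i) \<in> E) \<and>
           N * M \<le> card ((\<lambda>(s, i). s \<otimes> x i) ` (S \<times> {..<M}))))"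
proof (cases "\<exists>a\<in>carrier G. inj (\<lambda>n::nat. a [^] n)")
  case True
  then obtain a where a: "a \<in> carrier G" "inj (\<lambda>n::nat. a [^] n)" by blast
  show ?thesis
    using a thin_paths_of_infinite_order[OF a nvc] by (intro exI[of _ "{a}"]) auto
next
  case False
  have torsion: "\<exists>k>0::nat. x [^] k = \<one>" if x: "x \<in> carrier G" for x
  proof -
    obtain i j :: nat where ij: "x [^] i = x [^] j" "i < j"
      using False x unfolding inj_def by (metis linorder_neqE_nat)
    have "x [^] (j - i) \<otimes> x [^] i = x [^] (j - i + i)" using x by (rule nat_pow_mult)
    also have "\<dots> = \<one> \<otimes> x [^] i" using ij x by simp
    finally have "x [^] (j - i) \<otimes> x [^] i = \<one> \<otimes> x [^] i" .
    then have "x [^] (j - i) = \<one>" using x by simp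
    then show ?thesis using ij by (intro exI[of _ "j - i"]) simp
  qed
  obtain E0 where E0: "finite E0" "E0 \<subseteq> carrier G" "infinite (generate G E0)"
    using nlf by (auto simp: locally_finite_group_def)
  define B where "B = E0 \<union> m_inv G ` E0"
  have finB: "finite B" "B \<subseteq> carrier G" using E0 by (auto simp: B_def)
  obtain e :: "nat \<Rightarrow> 'a" and m where em: "B = e ` {..<m}"
    using finite_imp_nat_seg_image_inj_on[OF finB(1)] by (metis lessThan_def)
  interpret symmetric_alphabet G e m B
  proof unfold_locales
    show "e i \<in> carrier G" if "i < m" for i using that finB em by auto
    show "m_inv G ` B \<subseteq> B" using E0 by (auto simp: B_def)
  qed (rule em)
  have "generate G E0 \<subseteq> generate G B" by (rule mono_generate) (auto simp: B_def)
  then have inf: "infinite L" using E0 finite_subset by (intro infinite_L) blast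
  have big: "n < card (Ln n)" for n
    using exists_non_torsion_of_small_sphere[OF inf _ torsion, of n] by (meson not_less)
  have "\<exists>S. finite S \<and> S \<subseteq> carrier G \<and>
     (\<forall>M. \<exists>x :: nat \<Rightarrow> 'a. x 0 = \<one> \<and> (\<forall>i<M. x i \<in> carrier G) \<and> inj_on x {..<M} \<and>
           (\<forall>i. Suc i < M \<longrightarrow> x (Suc i) \<otimes> inv (x i) \<in> B) \<and>
           N * M \<le> card ((\<lambda>(s, i). s \<otimes> x i) ` (S \<times> {..<M})))" for N
  proof -
    \<comment> \<open>Chosen so that 2 N (2 r + 1) = 16 N^2 + 2 N is at most (4 N + 1)^2.\<close>
    define r where "r = 4 * N"
    have "2 * (N * (2 * r + 1)) \<le> (r + 1) * (r + 1)" by (simp add: r_def algebra_simps)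
    also have "\<dots> \<le> 2 * card (words G B r)" by (rule card_words_ge[OF big])
    finally have r: "N * (2 * r + 1) \<le> card (words G B r)" by simp
    show ?thesis
      using geodesic_thin_path[OF inf r] finite_words[OF finB(1)] words_closed[OF finB(2)]
      by (intro exI[of _ "words G B r"]) blast
  qed
  then show ?thesis using finB by (intro exI[of _ B]) blast
qed

section \<open>Hyperfiniteness\<close>

lemma double_count:
  assumes "finite A" "finite B"
  shows "(\<Sum>a\<in>A. card {b\<in>B. R a b}) = (\<Sum>b\<in>B. card {a\<in>A. R a b})"
  using sum_multicount_gen[OF assms, of R "\<lambda>b. card {a\<in>A. R a b}"] by simp

lemma (in sofic_approx) good_in_V: "v \<in> good A \<Longrightarrow> v \<in> V"
  by (simp add: good_points_def)

lemma (in sofic_approx) card_preimages_le: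
  assumes "finite F" "F \<subseteq> carrier G"
  shows "card {v\<in>V. u \<in> (\<lambda>f. \<sigma> f v) ` F} \<le> card F"
proof -
  have "{v\<in>V. u \<in> (\<lambda>f. \<sigma> f v) ` F} \<subseteq> (\<lambda>f. THE v. \<sigma> f v = u) ` F"
  proof
    fix v assume "v \<in> {v\<in>V. u \<in> (\<lambda>f. \<sigma> f v) ` F}"
    then obtain f where f: "f \<in> F" "u = \<sigma> f v" by blast
    then have "(THE v. \<sigma> f v = u) = v" using assms \<sigma>_eq_iff[of f] by (intro the_equality) auto
    then show "v \<in> (\<lambda>f. THE v. \<sigma> f v = u) ` F" using f by force
  qed
  then have "card {v\<in>V. u \<in> (\<lambda>f. \<sigma> f v) ` F} \<le> card ((\<lambda>f. THE v. \<sigma> f v = u) ` F)"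
    using assms by (intro card_mono) auto
  also have "\<dots> \<le> card F" using assms by (intro card_image_le) auto
  finally show ?thesis .
qed

text \<open>At a good u the points \<sigma> (inv f) u are |F| different centres v whose piece F v
  contains u. This bounds the average size of \<open>U \<inter> F v\<close> from below.\<close>

lemma (in sofic_approx) card_preimages_good:
  assumes F: "finite F" "F \<subseteq> words G B 1" and B: "B \<subseteq> carrier G" and u: "u \<in> good (words G B 3)"
  shows "card F \<le> card {v\<in>V. u \<in> (\<lambda>f. \<sigma> f v) ` F}"
proof -
  have inF: "inv f \<in> words G B 1" if "f \<in> F" for f using words_inv[OF B] F that by blast
  have uV: "u \<in> V" by (rule good_in_V[OF u])
  have "inj_on (\<lambda>f. \<sigma> (inv f) u) F"
  proof (rule inj_onI)
    fix f g assume fg: "f \<in> F" "g \<in> F" "\<sigma> (inv f) u = \<sigma> (inv g) u"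
    have "inv f = inv g" by (rule good_words_inj[OF u inF inF _ _ fg(3)]) (use fg in auto)
    moreover have fgc: "f \<in> carrier G" "g \<in> carrier G" using fg F words_closed'[OF B] by auto
    ultimately have "inv (inv f) = inv (inv g)" by simp
    then show "f = g" using fgc by simp
  qed
  then have "card F = card ((\<lambda>f. \<sigma> (inv f) u) ` F)" by (simp add: card_image)
  also have "\<dots> \<le> card {v\<in>V. u \<in> (\<lambda>f. \<sigma> f v) ` F}"
  proof (rule card_mono)
    show "finite {v\<in>V. u \<in> (\<lambda>f. \<sigma> f v) ` F}" using finite_V by simp
    show "(\<lambda>f. \<sigma> (inv f) u) ` F \<subseteq> {v\<in>V. u \<in> (\<lambda>f. \<sigma> f v) ` F}"
    proof
      fix v assume "v \<in> (\<lambda>f. \<sigma> (inv f) u) ` F"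
      then obtain f where f: "f \<in> F" "v = \<sigma> (inv f) u" by blast
      have "\<sigma> f v = u" unfolding f(2) by (rule good_words_inv(2)[OF u _ _ B]) (use f F in auto)
      moreover have "v \<in> V" unfolding f(2) using words_closed'[OF B inF[OF f(1)]] uV by (rule \<sigma>_closed)
      ultimately show "v \<in> {v\<in>V. u \<in> (\<lambda>f. \<sigma> f v) ` F}" using f by force
    qed
  qed
  finally show ?thesis .
qed

text \<open>If u = f v then t u = (t f) v, so the piece F v separates u from t u only if t f leaves
  F or, reading the edge backwards, if inv t f does. Each exceptional f accounts for one v.\<close>

lemma (in sofic_approx) card_boundary_le:
  assumes B: "B \<subseteq> carrier G" and F: "finite F" "F \<subseteq> words G B 1" and t: "t \<in> words G B 1"
    and fol: "real (card {f\<in>F. t \<otimes> f \<notin> F}) \<le> \<epsilon> * real (card F)"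
      "real (card {f\<in>F. inv t \<otimes> f \<notin> F}) \<le> \<epsilon> * real (card F)"
    and u: "u \<in> good (words G B 3)"
  shows "real (card {v\<in>V. (u \<in> (\<lambda>f. \<sigma> f v) ` F) \<noteq> (\<sigma> t u \<in> (\<lambda>f. \<sigma> f v) ` F)}) \<le> 2 * \<epsilon> * real (card F)"
proof -
  let ?A1 = "{f\<in>F. t \<otimes> f \<notin> F}" and ?A2 = "{f\<in>F. inv t \<otimes> f \<notin> F}"
  have tc: "t \<in> carrier G" using words_closed'[OF B t] .
  have Fc: "f \<in> carrier G" if "f \<in> F" for f using words_closed'[OF B] F that by blast
  have inF: "inv f \<in> words G B 1" if "f \<in> F" for f using words_inv[OF B] F that by blast
  have "{v\<in>V. (u \<in> (\<lambda>f. \<sigma> f v) ` F) \<noteq> (\<sigma> t u \<in> (\<lambda>f. \<sigma> f v) ` F)}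
     \<subseteq> (\<lambda>f. \<sigma> (inv f) u) ` ?A1 \<union> (\<lambda>f. \<sigma> (inv f \<otimes> t) u) ` ?A2"
  proof
    fix v assume v: "v \<in> {v\<in>V. (u \<in> (\<lambda>f. \<sigma> f v) ` F) \<noteq> (\<sigma> t u \<in> (\<lambda>f. \<sigma> f v) ` F)}"
    then consider f where "f \<in> F" "u = \<sigma> f v" "\<sigma> t u \<notin> (\<lambda>f. \<sigma> f v) ` F"
      | f where "f \<in> F" "\<sigma> t u = \<sigma> f v" "u \<notin> (\<lambda>f. \<sigma> f v) ` F" by blast
    then show "v \<in> (\<lambda>f. \<sigma> (inv f) u) ` ?A1 \<union> (\<lambda>f. \<sigma> (inv f \<otimes> t) u) ` ?A2"
    proof cases
      case 1
      have v1: "v = \<sigma> (inv f) u"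
        by (rule good_words_inv_eq[OF u _ _ B, of f 1]) (use 1 F in auto)
      have "\<sigma> (t \<otimes> f) v = \<sigma> (t \<otimes> f \<otimes> inv f) u" unfolding v1
      proof (rule good_words_mult[OF u, of _ 2 _ 1])
        show "t \<otimes> f \<in> words G B 2" using t F 1 by (intro words_mult_le[OF B, of _ 1 _ 1]) auto
      qed (use inF 1 in auto)
      also have "t \<otimes> f \<otimes> inv f = t" using tc Fc[OF 1(1)] by (simp add: m_assoc)
      finally have "t \<otimes> f \<notin> F" using 1 by (metis image_eqI)
      then show ?thesis using 1(1) v1 by blast
    next
      case 2
      have if2: "inv f \<otimes> t \<in> words G B 2"
        using t inF[OF 2(1)] by (intro words_mult_le[OF B, of _ 1 _ 1]) auto
      have "\<sigma> f (\<sigma> (inv f \<otimes> t) u) = \<sigma> (f \<otimes> (inv f \<otimes> t)) u"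
        by (rule good_words_mult[OF u, of _ 1 _ 2]) (use if2 2 F in auto)
      also have "f \<otimes> (inv f \<otimes> t) = t" using tc Fc[OF 2(1)] by (simp add: m_assoc[symmetric])
      finally have v2: "v = \<sigma> (inv f \<otimes> t) u"
        using 2 \<sigma>_eq_iff[OF Fc[OF 2(1)]] by metis
      have ti: "inv t \<otimes> f \<in> words G B 2"
        using words_inv[OF B t] F 2 by (intro words_mult_le[OF B, of _ 1 _ 1]) auto
      have "\<sigma> (inv t \<otimes> f) v = \<sigma> (inv t \<otimes> f \<otimes> (inv f \<otimes> t)) u" unfolding v2
        by (rule good_words_mult[OF u, of _ 2 _ 2]) (use if2 ti in auto)
      also have "inv t \<otimes> f \<otimes> (inv f \<otimes> t) = \<one>"
        using tc Fc[OF 2(1)] by (metis inv_closed inv_mult_group inv_inv m_closed r_inv)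
      finally have "\<sigma> (inv t \<otimes> f) v = u" using good_words_one[OF u] by simp
      then have "inv t \<otimes> f \<notin> F" using 2 by (metis image_eqI)
      then show ?thesis using 2(1) v2 by blast
    qed
  qed
  then have "card {v\<in>V. (u \<in> (\<lambda>f. \<sigma> f v) ` F) \<noteq> (\<sigma> t u \<in> (\<lambda>f. \<sigma> f v) ` F)}
     \<le> card ((\<lambda>f. \<sigma> (inv f) u) ` ?A1 \<union> (\<lambda>f. \<sigma> (inv f \<otimes> t) u) ` ?A2)"
    using F by (intro card_mono) auto
  also have "\<dots> \<le> card ((\<lambda>f. \<sigma> (inv f) u) ` ?A1) + card ((\<lambda>f. \<sigma> (inv f \<otimes> t) u) ` ?A2)"
    by (rule card_Un_le)
  also have "\<dots> \<le> card ?A1 + card ?A2" using F by (intro add_mono card_image_le) auto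
  finally have "real (card {v\<in>V. (u \<in> (\<lambda>f. \<sigma> f v) ` F) \<noteq> (\<sigma> t u \<in> (\<lambda>f. \<sigma> f v) ` F)})
     \<le> real (card ?A1) + real (card ?A2)" by linarith
  then show ?thesis using fol by linarith
qed

text \<open>On average over \<open>v\<close>, the piece \<open>U \<inter> Fv\<close> has small boundary inside \<open>U\<close>, whatever the
  subset \<open>U\<close> is, as long as \<open>U\<close> is not too small.\<close>

lemma (in sofic_approx) exists_piece:
  assumes B: "B \<subseteq> carrier G" and F: "finite F" "F \<noteq> {}" "F \<subseteq> words G B 1"
    and T: "finite T" "T \<subseteq> words G B 1"
    and fol: "\<And>t. t \<in> T \<Longrightarrow> real (card {f\<in>F. t \<otimes> f \<notin> F}) \<le> \<epsilon> * real (card F)"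
      "\<And>t. t \<in> T \<Longrightarrow> real (card {f\<in>F. inv t \<otimes> f \<notin> F}) \<le> \<epsilon> * real (card F)"
    and \<epsilon>: "0 < \<epsilon>" "\<epsilon> \<le> 1 / 2"
    and U: "U \<subseteq> V" "U \<noteq> {}" and bad: "real (card (V - good (words G B 3))) \<le> \<epsilon> * real (card U)"
  shows "\<exists>P\<subseteq>U. P \<noteq> {} \<and> card P \<le> card F \<and>
    real (card {(t, u). t \<in> T \<and> u \<in> U \<and> \<sigma> t u \<in> U \<and> (u \<in> P) \<noteq> (\<sigma> t u \<in> P)}) \<le> 8 * \<epsilon> * real (card T) * real (card P)"
proof -
  let ?G = "good (words G B 3)"
  define I where "I v = (\<lambda>f. \<sigma> f v) ` F" for v
  define P where "P v = U \<inter> I v" for v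
  define bd where "bd v = {(t, u). t \<in> T \<and> u \<in> U \<and> \<sigma> t u \<in> U \<and> (u \<in> P v) \<noteq> (\<sigma> t u \<in> P v)}" for v
  define f u and n where "f = real (card F)" and "u = real (card U)" and "n = real (card T)"
  have finU: "finite U" using U finite_V finite_subset by blast
  have Fc: "F \<subseteq> carrier G" using F words_closed[OF B] by blast
  have f: "f > 0" using F by (simp add: f_def card_gt_0_iff)
  have u: "u > 0" using U finU by (simp add: u_def card_gt_0_iff)
  have cbad: "real (card (U - ?G)) \<le> \<epsilon> * u"
  proof -
    have "card (U - ?G) \<le> card (V - ?G)" using finite_V U by (intro card_mono) auto
    then show ?thesis using bad by (simp add: u_def)
  qed
  have bd_sub: "bd v \<subseteq> {p \<in> T \<times> U. (snd p \<in> I v) \<noteq> (\<sigma> (fst p) (snd p) \<in> I v)}" for v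
    by (auto simp: bd_def P_def)
  \<comment> \<open>Both sums over v are double counted: the boundaries total at most 4 \<epsilon>
    |T| |F| |U|, the pieces at least |F| |U| / 2. The quotient is 8 \<epsilon> |T|, so some nonempty
    piece is at least as good as this.\<close>
  have "(\<Sum>v\<in>V. real (card (bd v))) \<le> (\<Sum>v\<in>V. real (card {p \<in> T \<times> U. (snd p \<in> I v) \<noteq> (\<sigma> (fst p) (snd p) \<in> I v)}))"
    using T finU by (intro sum_mono of_nat_mono card_mono bd_sub) auto
  also have "\<dots> = real (\<Sum>v\<in>V. card {p \<in> T \<times> U. (snd p \<in> I v) \<noteq> (\<sigma> (fst p) (snd p) \<in> I v)})"
    by (rule of_nat_sum[symmetric])
  also have "\<dots> = real (\<Sum>p\<in>T \<times> U. card {v\<in>V. (snd p \<in> I v) \<noteq> (\<sigma> (fst p) (snd p) \<in> I v)})"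
    by (rule arg_cong[OF double_count]) (use finite_V T finU in auto)
  also have "\<dots> = (\<Sum>t\<in>T. \<Sum>x\<in>U. real (card {v\<in>V. (x \<in> I v) \<noteq> (\<sigma> t x \<in> I v)}))"
    by (simp add: sum.cartesian_product split_beta)
  also have "\<dots> \<le> (\<Sum>t\<in>T. 4 * \<epsilon> * f * u)"
  proof (rule sum_mono)
    fix t assume t: "t \<in> T"
    have "(\<Sum>x\<in>U. real (card {v\<in>V. (x \<in> I v) \<noteq> (\<sigma> t x \<in> I v)}))
      \<le> (\<Sum>x\<in>U. 2 * \<epsilon> * f + (if x \<in> ?G then 0 else 2 * f))"
    proof (rule sum_mono)
      fix x assume x: "x \<in> U"
      show "real (card {v\<in>V. (x \<in> I v) \<noteq> (\<sigma> t x \<in> I v)}) \<le> 2 * \<epsilon> * f + (if x \<in> ?G then 0 else 2 * f)"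
      proof (cases "x \<in> ?G")
        case True
        have "t \<in> words G B 1" using t T by auto
        then show ?thesis
          using card_boundary_le[OF B F(1,3) _ fol(1)[OF t] fol(2)[OF t] True] True
          by (simp add: I_def f_def)
      next
        case False
        have "card {v\<in>V. (x \<in> I v) \<noteq> (\<sigma> t x \<in> I v)} \<le> card ({v\<in>V. x \<in> I v} \<union> {v\<in>V. \<sigma> t x \<in> I v})"
          using finite_V by (intro card_mono) auto
        also have "\<dots> \<le> card {v\<in>V. x \<in> I v} + card {v\<in>V. \<sigma> t x \<in> I v}" by (rule card_Un_le)
        also have "\<dots> \<le> card F + card F"
          unfolding I_def by (intro add_mono card_preimages_le F Fc)
        finally have "real (card {v\<in>V. (x \<in> I v) \<noteq> (\<sigma> t x \<in> I v)}) \<le> 2 * f" by (simp add: f_def)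
        moreover have "0 \<le> 2 * \<epsilon> * f" using \<epsilon> f by simp
        ultimately show ?thesis using False by simp
      qed
    qed
    also have "\<dots> = 2 * \<epsilon> * f * u + 2 * f * real (card (U - ?G))"
    proof -
      have "(\<Sum>x\<in>U. if x \<in> ?G then 0 else 2 * f) = (\<Sum>x\<in>U - ?G. 2 * f)"
        using finU by (intro sum.mono_neutral_cong_right) auto
      then show ?thesis by (simp add: sum.distrib u_def)
    qed
    also have "\<dots> \<le> 2 * \<epsilon> * f * u + 2 * f * (\<epsilon> * u)"
      using cbad f by (intro add_left_mono mult_left_mono) auto
    finally show "(\<Sum>x\<in>U. real (card {v\<in>V. (x \<in> I v) \<noteq> (\<sigma> t x \<in> I v)})) \<le> 4 * \<epsilon> * f * u" by simp
  qed
  finally have tot_bd: "(\<Sum>v\<in>V. real (card (bd v))) \<le> n * (4 * \<epsilon> * f * u)" by (simp add: n_def)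
  have "f * (u / 2) \<le> f * real (card (U \<inter> ?G))"
  proof (rule mult_left_mono)
    have "card U = card (U \<inter> ?G) + card (U - ?G)"
      using finU by (metis card_Int_Diff)
    then have "u - \<epsilon> * u \<le> real (card (U \<inter> ?G))" using cbad by (simp add: u_def)
    moreover have "\<epsilon> * u \<le> 1 / 2 * u" using \<epsilon> u by (intro mult_right_mono) auto
    ultimately show "u / 2 \<le> real (card (U \<inter> ?G))" by simp
  qed (use f in simp)
  also have "\<dots> = (\<Sum>x\<in>U \<inter> ?G. f)" by simp
  also have "\<dots> \<le> (\<Sum>x\<in>U \<inter> ?G. real (card {v\<in>V. x \<in> I v}))"
    unfolding f_def I_def by (intro sum_mono of_nat_mono card_preimages_good[OF F(1,3) B]) auto
  also have "\<dots> \<le> (\<Sum>x\<in>U. real (card {v\<in>V. x \<in> I v}))"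
    using finU by (intro sum_mono2) auto
  also have "\<dots> = real (\<Sum>x\<in>U. card {v\<in>V. x \<in> I v})" by (rule of_nat_sum[symmetric])
  also have "\<dots> = real (\<Sum>v\<in>V. card {x\<in>U. x \<in> I v})"
    by (rule arg_cong[OF double_count[OF finU finite_V]])
  also have "\<dots> = (\<Sum>v\<in>V. real (card (P v)))" by (simp add: P_def Int_def)
  finally have tot_P: "f * (u / 2) \<le> (\<Sum>v\<in>V. real (card (P v)))" .
  have "\<exists>v\<in>V. P v \<noteq> {} \<and> real (card (bd v)) \<le> 8 * \<epsilon> * n * real (card (P v))"
  proof (rule ccontr)
    assume "\<not> ?thesis"
    then have big: "8 * \<epsilon> * n * real (card (P v)) < real (card (bd v))" if "v \<in> V" "P v \<noteq> {}" for v
      using that by (auto simp: not_le)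
    then have le: "8 * \<epsilon> * n * real (card (P v)) \<le> real (card (bd v))" if "v \<in> V" for v
      using that by (cases "P v = {}") (auto simp: less_imp_le)
    have "\<exists>v\<in>V. P v \<noteq> {}"
    proof (rule ccontr)
      assume "\<not> ?thesis"
      then have "(\<Sum>v\<in>V. real (card (P v))) = 0" by simp
      then show False using tot_P f u by (simp add: mult_le_0_iff)
    qed
    then obtain v where v: "v \<in> V" "P v \<noteq> {}" by blast
    have "(\<Sum>v\<in>V. 8 * \<epsilon> * n * real (card (P v))) < (\<Sum>v\<in>V. real (card (bd v)))"
      by (rule sum_strict_mono_ex1[OF finite_V]) (use le big v in auto)
    moreover have "(\<Sum>v\<in>V. 8 * \<epsilon> * n * real (card (P v))) = 8 * \<epsilon> * n * (\<Sum>v\<in>V. real (card (P v)))"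
      by (simp add: sum_distrib_left)
    moreover have "8 * \<epsilon> * n * (f * (u / 2)) \<le> 8 * \<epsilon> * n * (\<Sum>v\<in>V. real (card (P v)))"
      using tot_P \<epsilon> by (intro mult_left_mono) (auto simp: n_def)
    ultimately have "8 * \<epsilon> * n * (f * (u / 2)) < n * (4 * \<epsilon> * f * u)" using tot_bd by linarith
    then show False by simp
  qed
  then obtain v where v: "v \<in> V" "P v \<noteq> {}" "real (card (bd v)) \<le> 8 * \<epsilon> * n * real (card (P v))" by blast
  have "card (P v) \<le> card (I v)" using F by (intro card_mono) (auto simp: P_def I_def)
  also have "\<dots> \<le> card F" unfolding I_def using F by (intro card_image_le) auto
  finally show ?thesis using v by (intro exI[of _ "P v"]) (auto simp: P_def bd_def n_def)
qed

text \<open>Greedy: pieces are cut off from what remains until fewer than \<theta> points are left,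
  and these become singletons. A cut T-edge is charged to the piece at whose removal it is cut, or
  to the remainder, which contributes at most |T| \<theta>. The partition is encoded by p, which
  sends a point to a representative of its class.\<close>

lemma (in sofic_approx) exists_partition:
  assumes B: "B \<subseteq> carrier G" and F: "finite F" "F \<noteq> {}" "F \<subseteq> words G B 1"
    and T: "finite T" "T \<subseteq> words G B 1"
    and fol: "\<And>t. t \<in> T \<Longrightarrow> real (card {f\<in>F. t \<otimes> f \<notin> F}) \<le> \<epsilon> * real (card F)"
      "\<And>t. t \<in> T \<Longrightarrow> real (card {f\<in>F. inv t \<otimes> f \<notin> F}) \<le> \<epsilon> * real (card F)"
    and \<epsilon>: "0 < \<epsilon>" "\<epsilon> \<le> 1 / 2" and \<theta>: "0 < \<theta>" and bad: "real (card (V - good (words G B 3))) \<le> \<epsilon> * \<theta>"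
    and U: "U \<subseteq> V"
  shows "\<exists>p. p ` U \<subseteq> U \<and> (\<forall>w. card {u\<in>U. p u = w} \<le> card F) \<and>
    real (card {(t, u). t \<in> T \<and> u \<in> U \<and> \<sigma> t u \<in> U \<and> p u \<noteq> p (\<sigma> t u)})
      \<le> 8 * \<epsilon> * real (card T) * real (card U) + real (card T) * \<theta>"
  using U
proof (induction "card U" arbitrary: U rule: less_induct)
  case less
  have finU: "finite U" using less.prems finite_V finite_subset by blast
  have F1: "1 \<le> card F" using F by (simp add: Suc_leI card_gt_0_iff)
  show ?case
  proof (cases "real (card U) < \<theta>")
    case True
    have "card {u\<in>U. id u = w} \<le> card F" for w
    proof -
      have "card {u\<in>U. id u = w} \<le> card {w}" by (intro card_mono) auto
      then show ?thesis using F1 by simp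
    qed
    moreover have "real (card {(t, u). t \<in> T \<and> u \<in> U \<and> \<sigma> t u \<in> U \<and> id u \<noteq> id (\<sigma> t u)})
      \<le> 8 * \<epsilon> * real (card T) * real (card U) + real (card T) * \<theta>"
    proof -
      have "card {(t, u). t \<in> T \<and> u \<in> U \<and> \<sigma> t u \<in> U \<and> id u \<noteq> id (\<sigma> t u)} \<le> card (T \<times> U)"
        using T finU by (intro card_mono) auto
      then have "real (card {(t, u). t \<in> T \<and> u \<in> U \<and> \<sigma> t u \<in> U \<and> id u \<noteq> id (\<sigma> t u)}) \<le> real (card T) * real (card U)"
        by (simp only: card_cartesian_product of_nat_le_iff flip: of_nat_mult)
      also have "\<dots> \<le> real (card T) * \<theta>" using True by (intro mult_left_mono) auto
      also have "\<dots> \<le> 8 * \<epsilon> * real (card T) * real (card U) + real (card T) * \<theta>" using \<epsilon> by simp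
      finally show ?thesis .
    qed
    ultimately show ?thesis by (intro exI[of _ id]) simp
  next
    case False
    then have Une: "U \<noteq> {}" using \<theta> by auto
    have "\<epsilon> * \<theta> \<le> \<epsilon> * real (card U)" using False \<epsilon> by (intro mult_left_mono) auto
    then have badU: "real (card (V - good (words G B 3))) \<le> \<epsilon> * real (card U)" using bad by linarith
    note ep = exists_piece[OF B F T _ _ \<epsilon> less.prems Une badU]
    obtain P where P: "P \<subseteq> U" "P \<noteq> {}" "card P \<le> card F" and bd:
      "real (card {(t, u). t \<in> T \<and> u \<in> U \<and> \<sigma> t u \<in> U \<and> (u \<in> P) \<noteq> (\<sigma> t u \<in> P)}) \<le> 8 * \<epsilon> * real (card T) * real (card P)"
      using ep[OF fol] by auto
    let ?U = "U - P"
    have finP: "finite P" using P(1) finU by (rule finite_subset)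
    have cU: "card U = card P + card ?U"
      using card_Diff_subset[OF finP P(1)] card_mono[OF finU P(1)] by linarith
    have "card P > 0" using P finP by (simp add: card_gt_0_iff)
    then have "card ?U < card U" using cU by simp
    moreover have "?U \<subseteq> V" using less.prems by auto
    ultimately obtain q where q: "q ` ?U \<subseteq> ?U" "\<forall>w. card {u\<in>?U. q u = w} \<le> card F"
      and qc: "real (card {(t, u). t \<in> T \<and> u \<in> ?U \<and> \<sigma> t u \<in> ?U \<and> q u \<noteq> q (\<sigma> t u)})
      \<le> 8 * \<epsilon> * real (card T) * real (card ?U) + real (card T) * \<theta>"
      using less.hyps[of ?U] by auto
    obtain w0 where w0: "w0 \<in> P" using P by blast
    define p where "p u = (if u \<in> P then w0 else q u)" for u
    have "p ` U \<subseteq> U" using q(1) P w0 by (auto simp: p_def)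
    moreover have "card {u\<in>U. p u = w} \<le> card F" for w
    proof (cases "w \<in> P")
      case True
      have "{u\<in>U. p u = w} \<subseteq> P" using q(1) True by (auto simp: p_def split: if_splits)
      then have "card {u\<in>U. p u = w} \<le> card P" using P finU finite_subset by (intro card_mono) auto
      then show ?thesis using P by simp
    next
      case False
      have "{u\<in>U. p u = w} \<subseteq> {u\<in>?U. q u = w}" using False w0 by (auto simp: p_def split: if_splits)
      then have "card {u\<in>U. p u = w} \<le> card {u\<in>?U. q u = w}" using finU by (intro card_mono) auto
      then show ?thesis using q(2) by (meson le_trans)
    qed
    moreover have "real (card {(t, u). t \<in> T \<and> u \<in> U \<and> \<sigma> t u \<in> U \<and> p u \<noteq> p (\<sigma> t u)})
      \<le> 8 * \<epsilon> * real (card T) * real (card U) + real (card T) * \<theta>"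
    proof -
      let ?A = "{(t, u). t \<in> T \<and> u \<in> U \<and> \<sigma> t u \<in> U \<and> (u \<in> P) \<noteq> (\<sigma> t u \<in> P)}"
      let ?B = "{(t, u). t \<in> T \<and> u \<in> ?U \<and> \<sigma> t u \<in> ?U \<and> q u \<noteq> q (\<sigma> t u)}"
      have fin: "finite ?A" "finite ?B" by (rule finite_subset[of _ "T \<times> U"]; use T finU in auto)+
      have "{(t, u). t \<in> T \<and> u \<in> U \<and> \<sigma> t u \<in> U \<and> p u \<noteq> p (\<sigma> t u)} \<subseteq> ?A \<union> ?B"
        by (auto simp: p_def split: if_splits)
      then have "card {(t, u). t \<in> T \<and> u \<in> U \<and> \<sigma> t u \<in> U \<and> p u \<noteq> p (\<sigma> t u)} \<le> card (?A \<union> ?B)"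
        using fin by (intro card_mono) auto
      also have "\<dots> \<le> card ?A + card ?B" by (rule card_Un_le)
      finally have "real (card {(t, u). t \<in> T \<and> u \<in> U \<and> \<sigma> t u \<in> U \<and> p u \<noteq> p (\<sigma> t u)}) \<le> real (card ?A) + real (card ?B)"
        by linarith
      also have "\<dots> \<le> 8 * \<epsilon> * real (card T) * real (card P) + (8 * \<epsilon> * real (card T) * real (card ?U) + real (card T) * \<theta>)"
        using bd qc by (rule add_mono)
      also have "\<dots> = 8 * \<epsilon> * real (card T) * real (card U) + real (card T) * \<theta>"
        unfolding cU by (simp add: algebra_simps)
      finally show ?thesis .
    qed
    ultimately show ?thesis by blast
  qed
qed

text \<open>The class size R is that of one Folner set of K, hence uniform in k.\<close>

lemma hyperfinite:
  fixes G :: "('a, 'm) monoid_scheme" (structure)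
  assumes seq: "sofic_approximation_sequence G V \<sigma>" and G: "group G"
    and K: "subgroup K G" "amenable_group (G\<lparr>carrier := K\<rparr>)" and T: "finite T" "T \<subseteq> K" and \<epsilon>: "0 < \<epsilon>"
  shows "\<exists>R. \<forall>\<^sub>F k in sequentially. \<exists>p :: nat \<Rightarrow> nat. (\<forall>w. card {u\<in>V k. p u = w} \<le> R) \<and>
    real (card {(t, u). t \<in> T \<and> u \<in> V k \<and> p u \<noteq> p (\<sigma> k t u)}) \<le> \<epsilon> * real (card (V k))"
proof -
  interpret group G by (rule G)
  have KG: "K \<subseteq> carrier G" using K subgroup.subset by blast
  define \<epsilon>' where "\<epsilon>' = min (1 / 2) (\<epsilon> / (9 * (real (card T) + 1)))"
  have "0 < \<epsilon> / (9 * (real (card T) + 1))" using \<epsilon> by simp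
  then have \<epsilon>': "0 < \<epsilon>'" "\<epsilon>' \<le> 1 / 2" "\<epsilon>' \<le> \<epsilon> / (9 * (real (card T) + 1))"
    unfolding \<epsilon>'_def by (simp_all only: min.cobounded1 min.cobounded2 min_less_iff_conj) simp
  have "\<epsilon>' * (9 * (real (card T) + 1)) \<le> \<epsilon>" using \<epsilon>'(3) by (subst (asm) pos_le_divide_eq) auto
  then have \<epsilon>'T: "9 * \<epsilon>' * real (card T) \<le> \<epsilon>" using \<epsilon>'(1) by (simp add: algebra_simps)
  define T' where "T' = T \<union> m_inv G ` T"
  have T': "finite T'" "T' \<subseteq> K" using T K by (auto simp: T'_def subgroup.m_inv_closed)
  have "\<exists>F. finite F \<and> F \<noteq> {} \<and> F \<subseteq> carrier (G\<lparr>carrier := K\<rparr>) \<and>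
    (\<forall>t\<in>T'. real (card {f\<in>F. t \<otimes>\<^bsub>G\<lparr>carrier := K\<rparr>\<^esub> f \<notin> F}) \<le> \<epsilon>' * real (card F))"
    by (rule folner) (use K T' \<epsilon>' subgroup.subgroup_is_group[OF K(1) G] in auto)
  then obtain F where F: "finite F" "F \<noteq> {}" "F \<subseteq> K"
    and fol: "\<And>t. t \<in> T' \<Longrightarrow> real (card {f\<in>F. t \<otimes> f \<notin> F}) \<le> \<epsilon>' * real (card F)" by auto
  define B where "B = F \<union> T"
  have B: "finite B" "B \<subseteq> carrier G" using F T KG by (auto simp: B_def)
  \<comment> \<open>The greedy partition is applied with \<theta> = \<epsilon>' |V|, so the bad set
    must have at most \<epsilon>' \<theta> points. The cut edges then number at most (8 + 1)
    \<epsilon>' |T| |V|, which explains the 9 in \<epsilon>'.\<close>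
  have "\<epsilon>' * \<epsilon>' > 0" using \<epsilon>' by simp
  note gd = eventually_good_points[OF seq finite_words[OF B(1), of 3] words_closed[OF B(2), of 3] this]
  show ?thesis
  proof (rule exI[of _ "card F"], use gd in eventually_elim)
    case (elim k)
    interpret sofic_approx G "V k" "\<sigma> k" by (rule sofic_approx_of_sequence[OF G seq])
    have n: "real (card (V k)) > 0" using card_V_pos by simp
    have "\<exists>p. p ` V k \<subseteq> V k \<and> (\<forall>w. card {u\<in>V k. p u = w} \<le> card F) \<and>
      real (card {(t, u). t \<in> T \<and> u \<in> V k \<and> \<sigma> k t u \<in> V k \<and> p u \<noteq> p (\<sigma> k t u)})
        \<le> 8 * \<epsilon>' * real (card T) * real (card (V k)) + real (card T) * (\<epsilon>' * real (card (V k)))"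
    proof (rule exists_partition[OF B(2) F(1,2) _ T(1)])
      show "F \<subseteq> words G B 1" "T \<subseteq> words G B 1" using in_words_1[OF B(2)] by (auto simp: B_def)
      show "real (card (V k - good (words G B 3))) \<le> \<epsilon>' * (\<epsilon>' * real (card (V k)))"
        using elim by (simp add: mult.assoc)
    qed (use fol \<epsilon>' n in \<open>auto simp: T'_def\<close>)
    then obtain p where "p ` V k \<subseteq> V k" and p: "\<forall>w. card {u\<in>V k. p u = w} \<le> card F" and
      c: "real (card {(t, u). t \<in> T \<and> u \<in> V k \<and> \<sigma> k t u \<in> V k \<and> p u \<noteq> p (\<sigma> k t u)})
        \<le> 8 * \<epsilon>' * real (card T) * real (card (V k)) + real (card T) * (\<epsilon>' * real (card (V k)))"
      by (elim exE conjE) (rule that, assumption+)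
    have eq: "{(t, u). t \<in> T \<and> u \<in> V k \<and> \<sigma> k t u \<in> V k \<and> p u \<noteq> p (\<sigma> k t u)}
      = {(t, u). t \<in> T \<and> u \<in> V k \<and> p u \<noteq> p (\<sigma> k t u)}" using T KG \<sigma>_closed by blast
    have "real (card {(t, u). t \<in> T \<and> u \<in> V k \<and> p u \<noteq> p (\<sigma> k t u)}) \<le> 9 * \<epsilon>' * real (card T) * real (card (V k))"
      using c unfolding eq by (simp add: algebra_simps)
    also have "\<dots> \<le> \<epsilon> * real (card (V k))" using \<epsilon>'T n by (intro mult_right_mono) auto
    finally have cross: "real (card {(t, u). t \<in> T \<and> u \<in> V k \<and> p u \<noteq> p (\<sigma> k t u)}) \<le> \<epsilon> * real (card (V k))" .
    show ?case by (intro exI[of _ p] conjI p cross)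
  qed
qed

section \<open>Spanning forests\<close>

definition comps :: "'v rel \<Rightarrow> 'v set \<Rightarrow> 'v set set" where
  "comps r W = (\<lambda>w. r\<^sup>* `` {w}) ` W"

lemma comps_eq:
  assumes "sym r" "(x, y) \<in> r\<^sup>*"
  shows "r\<^sup>* `` {x} = r\<^sup>* `` {y}"
proof -
  have "(y, x) \<in> r\<^sup>*" using assms sym_rtrancl by (metis symD)
  then show ?thesis using assms(2) by (auto intro: rtrancl_trans)
qed

lemma card_comps_less:
  assumes W: "finite W" and r: "sym r" "sym r'" "r \<subseteq> r'"
    and xy: "x \<in> W" "y \<in> W" "(x, y) \<notin> r\<^sup>*" "(x, y) \<in> r'\<^sup>*"
  shows "card (comps r' W) < card (comps r W)"
proof -
  let ?c = "\<lambda>w. r\<^sup>* `` {w}" and ?c' = "\<lambda>w. r'\<^sup>* `` {w}"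
  have mono: "r\<^sup>* \<subseteq> r'\<^sup>*" using r(3) by (rule rtrancl_mono)
  have im: "r'\<^sup>* `` ?c w = ?c' w" for w
    using mono by (auto intro: rtrancl_trans)
  have fin: "finite (comps r W)" using W by (simp add: comps_def)
  have ne: "?c x \<noteq> ?c y" using xy(3) by auto
  have cc: "?c' x = ?c' y" by (rule comps_eq[OF r(2) xy(4)])
  have "comps r' W \<subseteq> (\<lambda>C. r'\<^sup>* `` C) ` (comps r W - {?c y})"
  proof
    fix C assume "C \<in> comps r' W"
    then obtain w where w: "w \<in> W" "C = ?c' w" by (auto simp: comps_def)
    show "C \<in> (\<lambda>C. r'\<^sup>* `` C) ` (comps r W - {?c y})"
    proof (cases "?c w = ?c y")
      case True
      then have "C = r'\<^sup>* `` ?c x" using im[of w] im[of y] im[of x] cc w by simp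
      moreover have "?c x \<in> comps r W - {?c y}" using xy ne by (auto simp: comps_def)
      ultimately show ?thesis by (rule image_eqI)
    next
      case False
      then have "?c w \<in> comps r W - {?c y}" using w by (auto simp: comps_def)
      moreover have "C = r'\<^sup>* `` ?c w" using im w by simp
      ultimately show ?thesis by (intro image_eqI)
    qed
  qed
  then have "card (comps r' W) \<le> card ((\<lambda>C. r'\<^sup>* `` C) ` (comps r W - {?c y}))"
    using fin by (intro card_mono) auto
  also have "\<dots> \<le> card (comps r W - {?c y})" using fin by (intro card_image_le) auto
  also have "\<dots> < card (comps r W)"
    using fin xy by (intro card_Diff1_less) (auto simp: comps_def)
  finally show ?thesis .
qed

lemma edges_insert: "edges \<sigma> (insert (t, w) I) = edges \<sigma> I \<union> {(w, \<sigma> t w), (\<sigma> t w, w)}"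
  by (auto simp: edges_def)

text \<open>Kruskal's procedure relative to r, whose edges are free: an edge is accepted only if its
  ends are not yet connected, and each accepted edge lowers the number of components. In particular
  |I'| is at most the number of components to begin with.\<close>

lemma spanning_forest:
  assumes I: "finite I" "\<And>t w. (t, w) \<in> I \<Longrightarrow> w \<in> W \<and> \<sigma> t w \<in> W" and W: "finite W" and r: "sym r"
  shows "\<exists>I'\<subseteq>I. card I' + card (comps (r \<union> edges \<sigma> I') W) \<le> card (comps r W) \<and>
    (\<forall>(t, w)\<in>I. (w, \<sigma> t w) \<in> (r \<union> edges \<sigma> I')\<^sup>*)"
  using I
proof (induction I rule: finite_induct)
  case empty
  have "r \<union> edges \<sigma> {} = r" by (simp add: edges_def)
  then show ?case by simp
next
  case (insert i I)
  obtain t w where i: "i = (t, w)" by (metis surj_pair)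
  have "\<exists>I'\<subseteq>I. card I' + card (comps (r \<union> edges \<sigma> I') W) \<le> card (comps r W) \<and>
    (\<forall>(t, w)\<in>I. (w, \<sigma> t w) \<in> (r \<union> edges \<sigma> I')\<^sup>*)"
    by (rule insert.IH) (use insert.prems in auto)
  then obtain I' where I': "I' \<subseteq> I" "card I' + card (comps (r \<union> edges \<sigma> I') W) \<le> card (comps r W)"
    "\<forall>(t, w)\<in>I. (w, \<sigma> t w) \<in> (r \<union> edges \<sigma> I')\<^sup>*" by (elim exE conjE) (rule that)
  let ?r = "r \<union> edges \<sigma> I'"
  have W': "w \<in> W" "\<sigma> t w \<in> W" using insert.prems i by auto
  have sym: "sym (r \<union> edges \<sigma> J)" for J using r sym_edges by (rule sym_Un)
  show ?case
  proof (cases "(w, \<sigma> t w) \<in> ?r\<^sup>*")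
    case True
    then show ?thesis using I' i by (intro exI[of _ I']) auto
  next
    case False
    let ?r' = "r \<union> edges \<sigma> (insert i I')"
    have sub: "?r \<subseteq> ?r'" using edges_mono[of I' "insert i I'" \<sigma>] by auto
    have ein: "(w, \<sigma> t w) \<in> ?r'" by (simp add: i edges_insert)
    then have "(w, \<sigma> t w) \<in> ?r'\<^sup>*" by (rule r_into_rtrancl)
    then have less: "card (comps ?r' W) < card (comps ?r W)"
      by (rule card_comps_less[OF W sym sym sub W' False])
    have fI': "finite I'" using I'(1) insert.hyps(1) finite_subset by blast
    have "card (insert i I') \<le> Suc (card I')" using fI' by (simp add: card_insert_if)
    then have "card (insert i I') + card (comps ?r' W) \<le> card (comps r W)" using less I'(2) by linarith
    moreover have "(w', \<sigma> t' w') \<in> ?r'\<^sup>*" if "(t', w') \<in> insert i I" for t' w'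
    proof (cases "(t', w') = i")
      case True then show ?thesis using ein i by auto
    next
      case False
      then have "(w', \<sigma> t' w') \<in> ?r\<^sup>*" using that I'(3) by auto
      then show ?thesis using rtrancl_mono[OF sub] by blast
    qed
    ultimately show ?thesis using I'(1) by (intro exI[of _ "insert i I'"]) auto
  qed
qed

text \<open>At most |X| components meet X, and the others are disjoint sets of size at least M. In
  the application X consists of the ends of edges cut by a partition.\<close>

lemma card_comps_le:
  assumes V: "finite V" "W \<subseteq> V" and r: "sym r" "r \<subseteq> V \<times> V" and X: "X \<subseteq> V" and M: "0 < M"
    and big: "\<And>w. w \<in> W \<Longrightarrow> r\<^sup>* `` {w} \<inter> X = {} \<Longrightarrow> M \<le> card (r\<^sup>* `` {w})"
  shows "M * card (comps r W) \<le> M * card X + card V"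
proof -
  have sub: "C \<subseteq> V" if C: "C \<in> comps r W" for C
  proof -
    obtain w where w: "w \<in> W" "C = r\<^sup>* `` {w}" using C by (auto simp: comps_def)
    have "u \<in> V" if "(w, u) \<in> r\<^sup>*" for u using that
      by (induction rule: rtrancl_induct) (use w V r in auto)
    then show ?thesis using w by auto
  qed
  have fin: "finite (comps r W)" using V finite_subset by (auto simp: comps_def)
  have disj: "C \<inter> C' = {}" if CC: "C \<in> comps r W" "C' \<in> comps r W" "C \<noteq> C'" for C C'
  proof (rule ccontr)
    assume "C \<inter> C' \<noteq> {}"
    then obtain u where u: "u \<in> C" "u \<in> C'" by blast
    obtain w w' where w: "C = r\<^sup>* `` {w}" "C' = r\<^sup>* `` {w'}" using CC by (auto simp: comps_def)
    have "C = r\<^sup>* `` {u}" "C' = r\<^sup>* `` {u}"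
      using comps_eq[OF r(1), of w u] comps_eq[OF r(1), of w' u] u w by auto
    then show False using CC by simp
  qed
  have finC: "finite C" if "C \<in> comps r W" for C using sub[OF that] V(1) by (rule finite_subset)
  have one: "M \<le> M * card (C \<inter> X) + card C" if C: "C \<in> comps r W" for C
  proof (cases "C \<inter> X = {}")
    case True then show ?thesis using big C by (auto simp: comps_def)
  next
    case False
    then have "1 \<le> card (C \<inter> X)" using finC[OF C] by (simp add: Suc_leI card_gt_0_iff)
    then have "M * 1 \<le> M * card (C \<inter> X)" by (rule mult_le_mono2)
    then show ?thesis by linarith
  qed
  have "M * card (comps r W) = (\<Sum>C\<in>comps r W. M)" by simp
  also have "\<dots> \<le> (\<Sum>C\<in>comps r W. M * card (C \<inter> X) + card C)" by (rule sum_mono[OF one])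
  also have "\<dots> = M * (\<Sum>C\<in>comps r W. card (C \<inter> X)) + (\<Sum>C\<in>comps r W. card C)"
    by (simp add: sum.distrib sum_distrib_left)
  also have "(\<Sum>C\<in>comps r W. card (C \<inter> X)) = card (\<Union>C\<in>comps r W. C \<inter> X)"
  proof (rule card_UN_disjoint[symmetric, OF fin])
    show "\<forall>C\<in>comps r W. \<forall>C'\<in>comps r W. C \<noteq> C' \<longrightarrow> C \<inter> X \<inter> (C' \<inter> X) = {}" using disj by blast
  qed (use finC in simp)
  also have "(\<Sum>C\<in>comps r W. card C) = card (\<Union>C\<in>comps r W. C)"
  proof (rule card_UN_disjoint[symmetric, OF fin])
    show "\<forall>C\<in>comps r W. \<forall>C'\<in>comps r W. C \<noteq> C' \<longrightarrow> C \<inter> C' = {}" using disj by blast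
  qed (use finC in simp)
  also have "M * card (\<Union>C\<in>comps r W. C \<inter> X) + card (\<Union>C\<in>comps r W. C) \<le> M * card X + card V"
  proof (intro add_mono mult_le_mono2 card_mono)
    show "finite X" using X V(1) by (rule finite_subset)
    show "(\<Union>C\<in>comps r W. C) \<subseteq> V" using sub by blast
  qed (use V in auto)
  finally show ?thesis .
qed

text \<open>A path all of whose edges preserve \<open>p\<close> stays in a fibre of \<open>p\<close>, so it can be shortened to
  a path whose length is bounded in terms of the size of the fibres.\<close>

lemma short_path_in_fibre:
  assumes V: "finite V" and r: "r \<subseteq> V \<times> V" and p: "\<And>u v. (u, v) \<in> r \<Longrightarrow> p u = p v"
    and R: "\<And>w. card {u\<in>V. p u = w} \<le> R" and xy: "(x, y) \<in> r\<^sup>*" "x \<in> V"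
  shows "\<exists>n\<le>R * R. (x, y) \<in> r ^^ n"
proof -
  let ?P = "{u\<in>V. p u = p x}"
  let ?r = "r \<inter> ?P \<times> ?P"
  have finP: "finite ?P" using V by simp
  have fin: "finite ?r" by (rule finite_subset[OF _ finite_cartesian_product[OF finP finP]]) auto
  have "(x, y) \<in> ?r\<^sup>* \<and> p y = p x \<and> y \<in> V"
    using xy(1)
  proof (induction rule: rtrancl_induct)
    case base then show ?case using xy(2) by simp
  next
    case (step y z)
    then have "(y, z) \<in> ?r" "p z = p x" "z \<in> V" using p[OF step.hyps(2)] r by auto
    then show ?case using step.IH by (auto intro: rtrancl_into_rtrancl)
  qed
  then have "(x, y) \<in> ?r\<^sup>*" by blast
  then obtain n where n: "n \<le> card ?r" "(x, y) \<in> ?r ^^ n"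
    unfolding rtrancl_finite_eq_relpow[OF fin] by blast
  have "card ?r \<le> card (?P \<times> ?P)" by (rule card_mono) (use finP in auto)
  also have "\<dots> \<le> R * R" unfolding card_cartesian_product using R by (intro mult_le_mono) auto
  finally have "n \<le> R * R" using n by simp
  moreover have "(x, y) \<in> r ^^ n" using n relpow_mono[of ?r r n] by auto
  ultimately show ?thesis by blast
qed

section \<open>Greedy covers\<close>

text \<open>J minimizes the number of uncovered points plus a penalty \<eta> D for each chosen set.
  Comparison with the empty family bounds |J|. Comparison with one more set shows that no
  \<open>C i\<close> contains more than \<eta> D uncovered points, and double counting turns this
  into the bound on the uncovered part.\<close>

lemma exists_sparse_cover:
  assumes A: "finite A" and I: "finite I" and D: "0 < (D::real)" and \<eta>: "0 < \<eta>"
    and cov: "\<And>v. v \<in> A \<Longrightarrow> D \<le> real (card {i\<in>I. v \<in> C i})"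
  shows "\<exists>J\<subseteq>I. real (card J) * (\<eta> * D) \<le> real (card A) \<and>
    real (card (A - (\<Union>j\<in>J. C j))) \<le> \<eta> * real (card I)"
proof -
  define f where "f J = real (card (A - (\<Union>j\<in>J. C j))) + real (card J) * (\<eta> * D)" for J
  have fin: "finite (f ` Pow I)" "f ` Pow I \<noteq> {}" using I by auto
  obtain J where J: "J \<subseteq> I" "f J = Min (f ` Pow I)"
    using Min_in[OF fin] by auto
  have min: "f J \<le> f J'" if "J' \<subseteq> I" for J'
    unfolding J(2) using fin that by (intro Min_le) auto
  let ?U = "A - (\<Union>j\<in>J. C j)"
  have finJ: "finite J" and finU: "finite ?U" using J I A finite_subset by auto
  have "f J \<le> f {}" by (rule min) simp
  then have J1: "real (card J) * (\<eta> * D) \<le> real (card A)" by (simp add: f_def)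
  have gain: "real (card {v\<in>?U. v \<in> C i}) \<le> \<eta> * D" if i: "i \<in> I" for i
  proof (cases "i \<in> J")
    case True
    then have "{v\<in>?U. v \<in> C i} = {}" by auto
    then have "card {v\<in>?U. v \<in> C i} = 0" by (simp only: card.empty)
    then show ?thesis using \<eta> D by simp
  next
    case False
    define Y where "Y = {v\<in>?U. v \<in> C i}"
    have Y: "Y \<subseteq> ?U" by (auto simp: Y_def)
    have "f J \<le> f (insert i J)" using J i by (intro min) auto
    moreover have "A - (\<Union>j\<in>insert i J. C j) = ?U - Y" by (auto simp: Y_def)
    moreover have "card (?U - Y) = card ?U - card Y" using finite_subset[OF Y finU] Y by (rule card_Diff_subset)
    moreover have "card Y \<le> card ?U" using finU Y by (rule card_mono)
    ultimately have "real (card ?U) + real (card J) * (\<eta> * D)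
      \<le> real (card ?U) - real (card Y) + (real (card J) + 1) * (\<eta> * D)"
    proof -
      assume le: "f J \<le> f (insert i J)" and e: "A - (\<Union>j\<in>insert i J. C j) = ?U - Y"
        "card (?U - Y) = card ?U - card Y" "card Y \<le> card ?U"
      have "real (card (insert i J)) = real (card J) + 1" using False finJ by simp
      then show ?thesis using le unfolding f_def e(1,2) of_nat_diff[OF e(3)] by simp
    qed
    then have "real (card Y) \<le> \<eta> * D" by (simp add: algebra_simps)
    then show ?thesis by (simp only: Y_def)
  qed
  have "D * real (card ?U) = (\<Sum>v\<in>?U. D)" by simp
  also have "\<dots> \<le> (\<Sum>v\<in>?U. real (card {i\<in>I. v \<in> C i}))" by (rule sum_mono) (use cov in auto)
  also have "\<dots> = real (\<Sum>v\<in>?U. card {i\<in>I. v \<in> C i})" by (rule of_nat_sum[symmetric])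
  also have "\<dots> = real (\<Sum>i\<in>I. card {v\<in>?U. v \<in> C i})" by (rule arg_cong[OF double_count[OF finU I]])
  also have "\<dots> = (\<Sum>i\<in>I. real (card {v\<in>?U. v \<in> C i}))" by (rule of_nat_sum)
  also have "\<dots> \<le> (\<Sum>i\<in>I. \<eta> * D)" by (rule sum_mono[OF gain])
  also have "\<dots> = D * (\<eta> * real (card I))" by simp
  finally have "real (card ?U) \<le> \<eta> * real (card I)" using D by simp
  then show ?thesis using J J1 by blast
qed

section \<open>Sparse nets\<close>

text \<open>A copy of the path x starts at every j in J; these copies form the \<open>net\<close>,
  and the \<open>S\<^sub>0\<close>-translates of their points form the \<open>covered\<close> part.
  R serves to pack points deep inside the uncovered part, and its size controls the price of
  attaching new paths there to the net.\<close>

locale thin_path = sofic_approx G V \<sigma> for G (structure) and V :: "'v set" and \<sigma> +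
  fixes B E S\<^sub>0 R :: "'a set" and x :: "nat \<Rightarrow> 'a" and M :: nat and J :: "'v set"
  assumes B: "B \<subseteq> carrier G"
    and fin: "finite E" "finite S\<^sub>0" "finite R" "finite J"
    and sub: "E \<subseteq> words G B 1" "S\<^sub>0 \<subseteq> words G B 1" "R \<subseteq> words G B 1"
    and R_ne: "R \<noteq> {}" and M: "0 < M"
    and x0: "x 0 = \<one>" and xw: "\<And>i. i < M \<Longrightarrow> x i \<in> words G B 1" and x_inj: "inj_on x {..<M}"
    and step: "\<And>i. Suc i < M \<Longrightarrow> x (Suc i) \<otimes> inv (x i) \<in> E"
    and J: "J \<subseteq> good (words G B 4)"
begin

definition covered where "covered = (\<Union>j\<in>J. (\<lambda>p. \<sigma> p j) ` (\<lambda>(s, i). s \<otimes> x i) ` (S\<^sub>0 \<times> {..<M}))"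
definition uncovered where "uncovered = V - covered"
definition net where "net = (\<lambda>(i, j). \<sigma> (x i) j) ` ({..<M} \<times> J)"
definition deep where "deep = {v \<in> good (words G B 8). (\<lambda>r. \<sigma> r v) ` R \<subseteq> uncovered}"

lemma xc: "i < M \<Longrightarrow> x i \<in> carrier G"
  using words_closed'[OF B xw] .

lemma carrier_sub: "s \<in> S\<^sub>0 \<Longrightarrow> s \<in> carrier G" "r \<in> R \<Longrightarrow> r \<in> carrier G" "e \<in> E \<Longrightarrow> e \<in> carrier G"
  using sub words_closed'[OF B, of _ 1] by auto

lemma J_good: "j \<in> J \<Longrightarrow> j \<in> good (words G B 4)"
  using J by auto

lemma net_V: "net \<subseteq> V"
proof -
  have "\<sigma> (x i) j \<in> V" if "i < M" "j \<in> J" for i j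
    using \<sigma>_closed[OF xc[OF that(1)] good_in_V[OF J_good[OF that(2)]]] .
  then show ?thesis by (auto simp: net_def)
qed

lemma card_net: "card net \<le> M * card J"
proof -
  have "card net \<le> card ({..<M} \<times> J)" unfolding net_def using fin by (intro card_image_le) auto
  then show ?thesis by (simp add: card_cartesian_product)
qed

lemma coveredE:
  assumes "u \<in> covered"
  obtains s i j where "s \<in> S\<^sub>0" "i < M" "j \<in> J" "u = \<sigma> (s \<otimes> x i) j" "u = \<sigma> s (\<sigma> (x i) j)" "\<sigma> (x i) j \<in> net"
proof -
  obtain s i j where s: "s \<in> S\<^sub>0" "i < M" "j \<in> J" "u = \<sigma> (s \<otimes> x i) j"
    using assms by (auto simp: covered_def)
  have "\<sigma> s (\<sigma> (x i) j) = \<sigma> (s \<otimes> x i) j"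
    by (rule good_words_mult[OF J_good[OF s(3)], of _ 1 _ 1]) (use s sub xw[OF s(2)] in auto)
  moreover have "\<sigma> (x i) j \<in> net" using s by (auto simp: net_def)
  ultimately show ?thesis using that s by simp
qed

lemma chain:
  assumes v: "v \<in> good (words G B 4)" and D: "E \<times> A \<subseteq> D"
  shows "k < M \<Longrightarrow> (\<And>i. i < k \<Longrightarrow> \<sigma> (x i) v \<in> A) \<Longrightarrow> linked \<sigma> D k (\<sigma> (x 0) v) (\<sigma> (x k) v)"
proof (induction k)
  case 0 then show ?case by (simp add: linked_refl)
next
  case (Suc k)
  let ?e = "x (Suc k) \<otimes> inv (x k)"
  have e: "?e \<in> E" using step Suc.prems by simp
  have k: "k < M" using Suc.prems by simp
  have "\<sigma> ?e (\<sigma> (x k) v) = \<sigma> (?e \<otimes> x k) v"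
    by (rule good_words_mult[OF v, of _ 1 _ 1]) (use e sub xw[OF k] in auto)
  also have "?e \<otimes> x k = x (Suc k)" using xc[OF k] xc[OF Suc.prems(1)] by (simp add: m_assoc)
  finally have "\<sigma> (x (Suc k)) v = \<sigma> ?e (\<sigma> (x k) v)" by simp
  moreover have "linked \<sigma> D 1 (\<sigma> (x k) v) (\<sigma> ?e (\<sigma> (x k) v))"
    by (rule linked_edge) (use D e Suc.prems(2)[of k] in auto)
  moreover have "linked \<sigma> D k (\<sigma> (x 0) v) (\<sigma> (x k) v)" using Suc k by simp
  ultimately show ?case using linked_trans[of \<sigma> D k _ _ 1] by simp
qed

lemma chain2:
  assumes v: "v \<in> good (words G B 4)" and D: "E \<times> A \<subseteq> D" and A: "\<And>i. i < k \<Longrightarrow> \<sigma> (x i) v \<in> A"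
    and k: "k < M" "i \<le> k" "j \<le> k"
  shows "linked \<sigma> D (2 * M) (\<sigma> (x i) v) (\<sigma> (x j) v)"
proof -
  have "linked \<sigma> D i (\<sigma> (x 0) v) (\<sigma> (x i) v)" "linked \<sigma> D j (\<sigma> (x 0) v) (\<sigma> (x j) v)"
    using k A by (intro chain[OF v D]; simp)+
  then have "linked \<sigma> D (i + j) (\<sigma> (x i) v) (\<sigma> (x j) v)"
    using linked_sym linked_trans by metis
  then show ?thesis by (rule linked_mono) (use k in auto)
qed

lemma many_linked:
  assumes v: "v \<in> good (words G B 4)" and D: "E \<times> A \<subseteq> D" and A: "\<And>i. i < M \<Longrightarrow> \<sigma> (x i) v \<in> A"
    and i: "i < M" and l: "linked \<sigma> D C w (\<sigma> (x i) v)"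
  shows "M \<le> card {u\<in>V. linked \<sigma> D (C + 2 * M) w u}"
proof -
  have inj: "inj_on (\<lambda>i. \<sigma> (x i) v) {..<M}"
  proof (rule inj_onI)
    fix a b assume ab: "a \<in> {..<M}" "b \<in> {..<M}" "\<sigma> (x a) v = \<sigma> (x b) v"
    have "x a = x b" by (rule good_words_inj[OF v, of _ 1 _ 1]) (use ab xw in auto)
    then show "a = b" using x_inj ab by (simp add: inj_on_def)
  qed
  have "M = card ((\<lambda>i. \<sigma> (x i) v) ` {..<M})" using card_image[OF inj] by simp
  also have "\<dots> \<le> card {u\<in>V. linked \<sigma> D (C + 2 * M) w u}"
  proof (rule card_mono)
    show "finite {u\<in>V. linked \<sigma> D (C + 2 * M) w u}" using finite_V by simp
    have "linked \<sigma> D (2 * M) (\<sigma> (x i) v) (\<sigma> (x j) v)" if "j < M" for j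
      by (rule chain2[OF v D, of "M - 1"]) (use A i that in auto)
    then have "linked \<sigma> D (C + 2 * M) w (\<sigma> (x j) v)" if "j < M" for j
      using linked_trans[OF l] that by blast
    moreover have "\<sigma> (x j) v \<in> V" if "j < M" for j
      using \<sigma>_closed[OF xc[OF that] good_in_V[OF v]] .
    ultimately show "(\<lambda>i. \<sigma> (x i) v) ` {..<M} \<subseteq> {u\<in>V. linked \<sigma> D (C + 2 * M) w u}" by auto
  qed
  finally show ?thesis .
qed

text \<open>The value M stands for a path that never leaves the uncovered part. All its M points are
  then walked, which is as good as reaching the net.\<close>

definition exit_time where
  "exit_time z = (if \<exists>i<M. \<sigma> (x i) z \<notin> uncovered then LEAST i. \<sigma> (x i) z \<notin> uncovered else M)"

lemma before_exit: "i < exit_time z \<Longrightarrow> i < M \<Longrightarrow> \<sigma> (x i) z \<in> uncovered"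
  unfolding exit_time_def by (auto split: if_splits dest: not_less_Least)

lemma at_exit:
  assumes "exit_time z < M" shows "\<sigma> (x (exit_time z)) z \<notin> uncovered"
proof -
  have ex: "\<exists>i<M. \<sigma> (x i) z \<notin> uncovered" using assms by (auto simp: exit_time_def split: if_splits)
  then have "\<exists>i. \<sigma> (x i) z \<notin> uncovered" by blast
  then show ?thesis using LeastI_ex[of "\<lambda>i. \<sigma> (x i) z \<notin> uncovered"] ex by (simp add: exit_time_def)
qed

text \<open>The net is enlarged by walking along the thin path from a very sparse set \<open>Z\<close> of points deep
  inside the uncovered part until that part is left.\<close>

lemma exists_sparse_net:
  assumes c: "\<And>g. g \<in> carrier G \<Longrightarrow> 0 \<le> (c g :: real)"
  shows "\<exists>W D n. W \<subseteq> V \<and> D \<subseteq> (E \<union> S\<^sub>0) \<times> V \<and> n * card R \<le> card uncovered \<and>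
    (\<Sum>(g, v)\<in>D. c g) \<le> sum c E * real (M * card J + card uncovered + n) + sum c S\<^sub>0 * real n \<and>
    good (words G B 8) \<subseteq> (\<Union>s\<in>S\<^sub>0 \<union> (\<lambda>(r, s). inv r \<otimes> s) ` (R \<times> (S\<^sub>0 \<union> R)). \<sigma> s ` W) \<and>
    (\<forall>w\<in>W. M \<le> card {u\<in>V. linked \<sigma> D (5 * M + 1) w u})"
proof -
  let ?N = "\<lambda>z. (\<lambda>r. \<sigma> r z) ` R"
  have G84: "v \<in> good (words G B 4)" if "v \<in> good (words G B 8)" for v
    using good_antimono[OF words_mono[of 4 8 B]] that by auto
  have deepV: "deep \<subseteq> good (words G B 8)" by (auto simp: deep_def)
  have fdeep: "finite deep" by (rule finite_subset[OF deepV finite_good])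
  have "\<exists>Z\<subseteq>deep. (\<forall>z\<in>Z. \<forall>z'\<in>Z. z \<noteq> z' \<longrightarrow> ?N z \<inter> ?N z' = {}) \<and> (\<forall>w\<in>deep. \<exists>z\<in>Z. ?N w \<inter> ?N z \<noteq> {})"
    by (rule exists_maximal_separated) (use fdeep R_ne in auto)
  then obtain Z where Z: "Z \<subseteq> deep" and sep: "\<forall>z\<in>Z. \<forall>z'\<in>Z. z \<noteq> z' \<longrightarrow> ?N z \<inter> ?N z' = {}"
    and max: "\<forall>w\<in>deep. \<exists>z\<in>Z. ?N w \<inter> ?N z \<noteq> {}" by (elim exE conjE) (rule that)
  have finZ: "finite Z" using Z fdeep by (rule finite_subset)
  have Z8: "z \<in> good (words G B 8)" if "z \<in> Z" for z using that Z deepV by auto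
  have finU: "finite uncovered" using finite_V by (auto simp: uncovered_def)
  have cardZ: "card Z * card R \<le> card uncovered"
  proof (rule card_separated_le[where A = "words G B 8"])
    show "Z \<subseteq> good (words G B 8)" using Z deepV by auto
    show "R \<subseteq> words G B 8" by (rule order_trans[OF sub(3) words_mono]) simp
    show "?N z \<subseteq> uncovered" if "z \<in> Z" for z using that Z by (auto simp: deep_def)
  qed (use fin finU words_closed[OF B] sep in auto)
  \<comment> \<open>The exit point is included: it is covered, hence an
    \<open>S\<^sub>0\<close>-translate of a net point, to which one extra edge leads. All other
    points of the walk are uncovered, so the walks use at most the uncovered part plus one point for
    each z, however much they overlap.\<close>
  define walk where "walk = {\<sigma> (x i) z |i z. z \<in> Z \<and> i \<le> exit_time z \<and> i < M}"
  have xV: "\<sigma> (x i) z \<in> V" if "z \<in> Z" "i < M" for i z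
    using \<sigma>_closed[OF xc[OF that(2)] good_in_V[OF Z8[OF that(1)]]] .
  have walkV: "walk \<subseteq> V" using xV by (auto simp: walk_def)
  have card_walk: "card walk \<le> card uncovered + card Z"
  proof -
    have "walk \<subseteq> uncovered \<union> (\<lambda>z. \<sigma> (x (exit_time z)) z) ` Z"
      using before_exit by (auto simp: walk_def le_less)
    then have "card walk \<le> card (uncovered \<union> (\<lambda>z. \<sigma> (x (exit_time z)) z) ` Z)"
      using finU finZ by (intro card_mono) auto
    also have "\<dots> \<le> card uncovered + card ((\<lambda>z. \<sigma> (x (exit_time z)) z) ` Z)" by (rule card_Un_le)
    also have "\<dots> \<le> card uncovered + card Z" using finZ by (intro add_left_mono card_image_le)
    finally show ?thesis .
  qed
  have exit: "\<exists>p. fst p \<in> S\<^sub>0 \<and> snd p \<in> net \<and> \<sigma> (x (exit_time z)) z = \<sigma> (fst p) (snd p)"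
    if z: "z \<in> Z" "exit_time z < M" for z
  proof -
    have "\<sigma> (x (exit_time z)) z \<in> covered" using at_exit[OF z(2)] xV[OF z] by (simp add: uncovered_def)
    then show ?thesis
    proof (rule coveredE)
      fix s i j assume s: "s \<in> S\<^sub>0" "\<sigma> (x (exit_time z)) z = \<sigma> s (\<sigma> (x i) j)" "\<sigma> (x i) j \<in> net"
      show ?thesis by (rule exI[of _ "(s, \<sigma> (x i) j)"]) (use s in simp)
    qed
  qed
  define q where "q z = (SOME p. fst p \<in> S\<^sub>0 \<and> snd p \<in> net \<and> \<sigma> (x (exit_time z)) z = \<sigma> (fst p) (snd p))" for z
  have q: "fst (q z) \<in> S\<^sub>0 \<and> snd (q z) \<in> net \<and> \<sigma> (x (exit_time z)) z = \<sigma> (fst (q z)) (snd (q z))"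
    if "z \<in> Z" "exit_time z < M" for z
    unfolding q_def by (rule someI_ex[OF exit[OF that]])
  define W where "W = net \<union> walk"
  define Z' where "Z' = {z\<in>Z. exit_time z < M}"
  \<comment> \<open>E-edges at all points of W contain the paths, and the arrows \<open>q z\<close>
    attach exit points to the net. From a point of the walk there are at most 2 M steps to the exit,
    1 to the net and 2 M along a net path, within 5 M + 1.\<close>
  define D where "D = E \<times> W \<union> q ` Z'"
  have WV: "W \<subseteq> V" using net_V walkV by (auto simp: W_def)
  have finW: "finite W" using WV finite_V by (rule finite_subset)
  have finZ': "finite Z'" using finZ by (simp add: Z'_def)
  have qE: "q z \<in> S\<^sub>0 \<times> net" if "z \<in> Z'" for z
    using q[of z] that by (auto simp: Z'_def mem_Times_iff)
  then have qsub: "q ` Z' \<subseteq> S\<^sub>0 \<times> net" by blast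
  have EW: "E \<times> W \<subseteq> D" by (auto simp: D_def)
  have cost: "(\<Sum>(g, v)\<in>D. c g) \<le> sum c E * real (M * card J + card uncovered + card Z) + sum c S\<^sub>0 * real (card Z)"
  proof -
    have cE: "0 \<le> sum c E" using c carrier_sub(3) by (intro sum_nonneg) auto
    have cS: "c s \<le> sum c S\<^sub>0" if "s \<in> S\<^sub>0" for s
      using that fin c carrier_sub(1) by (intro member_le_sum) auto
    have cS0: "0 \<le> sum c S\<^sub>0" using c carrier_sub(1) by (intro sum_nonneg) auto
    have "(\<Sum>(g, v)\<in>D. c g) \<le> (\<Sum>(g, v)\<in>E \<times> W. c g) + (\<Sum>(g, v)\<in>q ` Z'. c g)"
      unfolding D_def
    proof (rule sum_case_prod_Un_le)
      show "0 \<le> c g" if "(g, v) \<in> E \<times> W \<union> q ` Z'" for g v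
      proof -
        have "g \<in> E \<union> S\<^sub>0" using that qsub by auto
        then show ?thesis using c carrier_sub by auto
      qed
    qed (use fin finW finZ' in auto)
    also have "(\<Sum>(g, v)\<in>E \<times> W. c g) \<le> sum c E * real (card W)"
      by (rule sum_case_prod_fst_le) (use fin finW c carrier_sub in auto)
    also have "(\<Sum>(g, v)\<in>q ` Z'. c g) \<le> real (card (q ` Z')) * sum c S\<^sub>0"
      by (rule sum_bounded_above) (use qE cS in force)
    also have "real (card (q ` Z')) * sum c S\<^sub>0 \<le> real (card Z) * sum c S\<^sub>0"
    proof (rule mult_right_mono[OF _ cS0])
      have "card (q ` Z') \<le> card Z'" using finZ' by (rule card_image_le)
      also have "\<dots> \<le> card Z" using finZ by (intro card_mono) (auto simp: Z'_def)
      finally show "real (card (q ` Z')) \<le> real (card Z)" by simp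
    qed
    also have "sum c E * real (card W) \<le> sum c E * real (M * card J + card uncovered + card Z)"
    proof (rule mult_left_mono[OF _ cE])
      have "card W \<le> card net + card walk" unfolding W_def by (rule card_Un_le)
      then show "real (card W) \<le> real (M * card J + card uncovered + card Z)"
        using card_net card_walk by linarith
    qed
    finally show ?thesis by (simp add: mult.commute)
  qed
  have xJ_W: "\<sigma> (x i) j \<in> W" if "i < M" "j \<in> J" for i j
    using that by (auto simp: W_def net_def)
  have many_net: "M \<le> card {u\<in>V. linked \<sigma> D (C + 2 * M) w u}" if "w' \<in> net" "linked \<sigma> D C w w'" for C w w'
  proof -
    obtain i j where ij: "i < M" "j \<in> J" "w' = \<sigma> (x i) j" using \<open>w' \<in> net\<close> by (auto simp: net_def)
    show ?thesis
      by (rule many_linked[OF J_good[OF ij(2)] EW _ ij(1)]) (use that ij xJ_W in auto)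
  qed
  have mono: "M \<le> card {u\<in>V. linked \<sigma> D (5 * M + 1) w u}"
    if "M \<le> card {u\<in>V. linked \<sigma> D C w u}" "C \<le> 5 * M + 1" for C w
  proof -
    have "card {u\<in>V. linked \<sigma> D C w u} \<le> card {u\<in>V. linked \<sigma> D (5 * M + 1) w u}"
      using finite_V linked_mono[OF _ order_refl that(2)] by (intro card_mono) auto
    then show ?thesis using that(1) by simp
  qed
  have many: "M \<le> card {u\<in>V. linked \<sigma> D (5 * M + 1) w u}" if w: "w \<in> W" for w
  proof (cases "w \<in> net")
    case True
    show ?thesis by (rule mono[OF many_net[OF True linked_refl, of 0]]) simp
  next
    case False
    then obtain i z where iz: "w = \<sigma> (x i) z" "z \<in> Z" "i \<le> exit_time z" "i < M"
      using w by (auto simp: W_def walk_def)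
    have zw: "\<sigma> (x k) z \<in> W" if "k \<le> exit_time z" "k < M" for k
      using that iz(2) by (auto simp: W_def walk_def)
    show ?thesis
    proof (cases "exit_time z < M")
      case True
      have l1: "linked \<sigma> D (2 * M) w (\<sigma> (x (exit_time z)) z)"
        unfolding iz(1)
        by (rule chain2[OF G84[OF Z8[OF iz(2)]] EW, of "exit_time z"]) (use zw True iz in auto)
      have zq: "z \<in> Z'" using iz True by (simp add: Z'_def)
      have "linked \<sigma> D 1 (snd (q z)) (\<sigma> (fst (q z)) (snd (q z)))"
        by (rule linked_edge) (use zq in \<open>auto simp: D_def\<close>)
      then have "linked \<sigma> D 1 (\<sigma> (x (exit_time z)) z) (snd (q z))"
        using q[OF iz(2) True] linked_sym by metis
      then have "linked \<sigma> D (2 * M + 1) w (snd (q z))" using linked_trans[OF l1] by blast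
      then have "M \<le> card {u\<in>V. linked \<sigma> D (2 * M + 1 + 2 * M) w u}"
        using many_net q[OF iz(2) True] by blast
      then show ?thesis by (rule mono) simp
    next
      case False
      have "M \<le> card {u\<in>V. linked \<sigma> D (0 + 2 * M) w u}"
        by (rule many_linked[OF G84[OF Z8[OF iz(2)]] EW _ iz(4)]) (use iz zw False linked_refl in auto)
      then show ?thesis by (rule mono) simp
    qed
  qed
  have cover: "good (words G B 8) \<subseteq> (\<Union>s\<in>S\<^sub>0 \<union> (\<lambda>(r, s). inv r \<otimes> s) ` (R \<times> (S\<^sub>0 \<union> R)). \<sigma> s ` W)"
  proof
    fix v assume v: "v \<in> good (words G B 8)"
    have vV: "v \<in> V" using v by (rule good_in_V)
    have inR: "inv r \<in> words G B 1" if "r \<in> R" for r using words_inv[OF B] sub that by blast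
    \<comment> \<open>Either v is covered, or some r v is, or v is deep and its R-translates meet
      those of some z. These cases produce the three kinds of elements s, inv r s and inv r r' of
      the covering set.\<close>
    consider "v \<in> covered" | r where "r \<in> R" "\<sigma> r v \<in> covered" | "v \<in> deep"
      using v \<sigma>_closed[OF carrier_sub(2) vV] by (auto simp: deep_def uncovered_def)
    then show "v \<in> (\<Union>s\<in>S\<^sub>0 \<union> (\<lambda>(r, s). inv r \<otimes> s) ` (R \<times> (S\<^sub>0 \<union> R)). \<sigma> s ` W)"
    proof cases
      case 1
      then show ?thesis
      proof (rule coveredE)
        fix s i j assume "s \<in> S\<^sub>0" "v = \<sigma> s (\<sigma> (x i) j)" "\<sigma> (x i) j \<in> net"
        then show ?thesis by (auto simp: W_def)
      qed
    next
      case 2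
      from 2(2) show ?thesis
      proof (rule coveredE)
        fix s i j assume s: "s \<in> S\<^sub>0" "i < M" "j \<in> J" "\<sigma> r v = \<sigma> (s \<otimes> x i) j" "\<sigma> (x i) j \<in> net"
        note jg = J_good[OF s(3)]
        have sx: "s \<otimes> x i \<in> words G B 2" by (rule words_mult_le[OF B, of _ 1 _ 1]) (use s sub xw in auto)
        have rs: "inv r \<otimes> s \<in> words G B 2" by (rule words_mult_le[OF B, of _ 1 _ 1]) (use s sub inR 2 in auto)
        have "v = \<sigma> (inv r) (\<sigma> r v)"
          by (rule good_words_inv(1)[OF v _ _ B, of r 1, symmetric]) (use 2 sub in auto)
        also have "\<dots> = \<sigma> (inv r \<otimes> (s \<otimes> x i)) j"
          unfolding s(4) by (rule good_words_mult[OF jg, of _ 1 _ 2]) (use inR 2 sx in auto)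
        also have "inv r \<otimes> (s \<otimes> x i) = (inv r \<otimes> s) \<otimes> x i"
          using carrier_sub s 2 xc by (simp add: m_assoc)
        also have "\<sigma> \<dots> j = \<sigma> (inv r \<otimes> s) (\<sigma> (x i) j)"
          by (rule good_words_mult[OF jg, of _ 2 _ 1, symmetric]) (use rs xw s in auto)
        finally have "v \<in> \<sigma> (inv r \<otimes> s) ` W" using s(5) by (auto simp: W_def)
        moreover have "inv r \<otimes> s \<in> (\<lambda>(r, s). inv r \<otimes> s) ` (R \<times> (S\<^sub>0 \<union> R))" using 2(1) s(1) by force
        ultimately show ?thesis by blast
      qed
    next
      case 3
      then obtain z r r' where z: "z \<in> Z" "r \<in> R" "r' \<in> R" "\<sigma> r v = \<sigma> r' z" using max by blast
      have "v = \<sigma> (inv r) (\<sigma> r v)"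
        by (rule good_words_inv(1)[OF v _ _ B, of r 1, symmetric]) (use z sub in auto)
      also have "\<dots> = \<sigma> (inv r \<otimes> r') z"
        unfolding z(4) by (rule good_words_mult[OF Z8[OF z(1)], of _ 1 _ 1]) (use inR z sub in auto)
      finally have "v = \<sigma> (inv r \<otimes> r') z" .
      moreover have "z = \<sigma> (x 0) z" using good_words_one[OF Z8[OF z(1)]] x0 by simp
      then have "z \<in> W" unfolding W_def walk_def using z(1) M by blast
      moreover have "inv r \<otimes> r' \<in> (\<lambda>(r, s). inv r \<otimes> s) ` (R \<times> (S\<^sub>0 \<union> R))" using z by force
      ultimately show ?thesis by blast
    qed
  qed
  have "E \<times> W \<subseteq> (E \<union> S\<^sub>0) \<times> V" "S\<^sub>0 \<times> net \<subseteq> (E \<union> S\<^sub>0) \<times> V" using WV net_V by auto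
  then have "D \<subseteq> (E \<union> S\<^sub>0) \<times> V" unfolding D_def using qsub by (meson Un_least order_trans)
  then show ?thesis using WV cardZ cost cover many
    by (intro exI[of _ W] exI[of _ D] exI[of _ "card Z"] conjI ballI)
qed

end

text \<open>The centres are \<sigma> (inv p) v. Goodness of v at radius 8 passes to them at radius
  4, since 2 + 4 and 4 + 4 are at most 8.\<close>

lemma (in sofic_approx) card_covering_points:
  assumes B: "B \<subseteq> carrier G" and P: "finite P" "P \<subseteq> words G B 2" and v: "v \<in> good (words G B 8)"
  shows "card P \<le> card {i\<in>good (words G B 4). v \<in> (\<lambda>p. \<sigma> p i) ` P}"
proof -
  have inP: "inv p \<in> words G B 2" if "p \<in> P" for p using words_inv[OF B] P that by blast
  have "inj_on (\<lambda>p. \<sigma> (inv p) v) P"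
  proof (rule inj_onI)
    fix p q assume pq: "p \<in> P" "q \<in> P" "\<sigma> (inv p) v = \<sigma> (inv q) v"
    have "inv p = inv q" by (rule good_words_inj[OF v inP inP _ _ pq(3)]) (use pq in auto)
    moreover have pqc: "p \<in> carrier G" "q \<in> carrier G" using pq P words_closed'[OF B] by auto
    ultimately have "inv (inv p) = inv (inv q)" by simp
    then show "p = q" using pqc by simp
  qed
  then have "card P = card ((\<lambda>p. \<sigma> (inv p) v) ` P)" by (simp add: card_image)
  also have "\<dots> \<le> card {i\<in>good (words G B 4). v \<in> (\<lambda>p. \<sigma> p i) ` P}"
  proof (rule card_mono)
    show "finite {i\<in>good (words G B 4). v \<in> (\<lambda>p. \<sigma> p i) ` P}" using finite_good by simp
    show "(\<lambda>p. \<sigma> (inv p) v) ` P \<subseteq> {i\<in>good (words G B 4). v \<in> (\<lambda>p. \<sigma> p i) ` P}"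
    proof
      fix i assume "i \<in> (\<lambda>p. \<sigma> (inv p) v) ` P"
      then obtain p where p: "p \<in> P" "i = \<sigma> (inv p) v" by blast
      have "\<sigma> p i = v" unfolding p(2) by (rule good_words_inv(2)[OF v, of _ 2]) (use p P B in auto)
      moreover have "i \<in> good (words G B 4)"
        unfolding p(2) by (rule good_shift_words[OF v inP[OF p(1)] B]) simp_all
      ultimately show "i \<in> {i\<in>good (words G B 4). v \<in> (\<lambda>p. \<sigma> p i) ` P}" using p by force
    qed
  qed
  finally show ?thesis .
qed

text \<open>The points covered from one path number at least N M, so a greedy choice needs only
  about |V| / (\<open>\<eta>1\<close> N M) paths of M points each, and a large N makes the net
  sparse. S is determined by N and R, which come from c and \<eta>, hence it does not depend on M
  and \<epsilon>.\<close>

lemma sparse_net_sequence: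
  fixes G :: "('a, 'm) monoid_scheme" (structure)
  assumes seq: "sofic_approximation_sequence G V \<sigma>" and G: "group G"
    and K: "subgroup K G" "infinite K" and E: "finite E" "E \<subseteq> K"
    and thin: "\<And>N. \<exists>S. finite S \<and> S \<subseteq> K \<and> (\<forall>M. \<exists>x :: nat \<Rightarrow> 'a. x 0 = \<one> \<and> (\<forall>i<M. x i \<in> K) \<and>
        inj_on x {..<M} \<and> (\<forall>i. Suc i < M \<longrightarrow> x (Suc i) \<otimes> inv (x i) \<in> E) \<and>
        N * M \<le> card ((\<lambda>(s, i). s \<otimes> x i) ` (S \<times> {..<M})))"
    and c: "\<And>g. g \<in> carrier G \<Longrightarrow> 0 \<le> (c g :: real)" and \<eta>: "0 < \<eta>"
  shows "\<exists>S. finite S \<and> S \<subseteq> K \<and> (\<forall>M>0. \<forall>\<epsilon>>0. \<exists>F. finite F \<and> F \<subseteq> K \<and>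
     (\<forall>\<^sub>F k in sequentially. \<exists>W D. W \<subseteq> V k \<and> D \<subseteq> F \<times> V k \<and>
        real (card (V k - (\<Union>s\<in>S. \<sigma> k s ` W))) \<le> \<epsilon> * real (card (V k)) \<and>
        (\<Sum>(g, v)\<in>D. c g) \<le> \<eta> * real (card (V k)) \<and>
        (\<forall>w\<in>W. M \<le> card {u\<in>V k. linked (\<sigma> k) D (5 * M + 1) w u})))"
proof -
  interpret group G by (rule G)
  have KG: "K \<subseteq> carrier G" using K subgroup.subset by blast
  define cE where "cE = sum c E + 1"
  have sumE: "0 \<le> sum c E" using c E KG by (intro sum_nonneg) auto
  then have cE: "1 \<le> cE" by (simp add: cE_def)
  \<comment> \<open>The net has at most \<open>\<eta>1\<close> |V| points, the uncovered part and
    the number of attached paths are at most 2 \<open>\<eta>1\<close> |V| each, so the E-edges cost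
    at most 5 \<open>cE\<close> \<open>\<eta>1\<close> |V|. The attaching edges cost at most 2
    \<open>\<eta>1\<close> |V|. The factor 10 leaves room for both.\<close>
  define \<eta>1 where "\<eta>1 = \<eta> / (10 * cE)"
  have \<eta>1: "0 < \<eta>1" using \<eta> cE by (simp add: \<eta>1_def)
  have \<eta>1': "10 * cE * \<eta>1 = \<eta>" using cE by (simp add: \<eta>1_def)
  \<comment> \<open>The greedy cover yields only \<open>\<eta>1\<close> N M |J| at most |V|; the
    second factor \<open>\<eta>1\<close> turns this into M |J| at most \<open>\<eta>1\<close>
    |V|.\<close>
  obtain N0 :: nat where N0: "1 / (\<eta>1 * \<eta>1) < real N0" using reals_Archimedean2 by blast
  define N where "N = Suc N0"
  have N: "1 \<le> \<eta>1 * \<eta>1 * real N"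
  proof -
    have "1 / (\<eta>1 * \<eta>1) \<le> real N" using N0 by (simp add: N_def)
    then show ?thesis using \<eta>1 by (simp add: pos_divide_le_eq mult.commute)
  qed
  obtain S0 where S0: "finite S0" "S0 \<subseteq> K" and path: "\<forall>M. \<exists>x :: nat \<Rightarrow> 'a. x 0 = \<one> \<and> (\<forall>i<M. x i \<in> K) \<and>
        inj_on x {..<M} \<and> (\<forall>i. Suc i < M \<longrightarrow> x (Suc i) \<otimes> inv (x i) \<in> E) \<and>
        N * M \<le> card ((\<lambda>(s, i). s \<otimes> x i) ` (S0 \<times> {..<M}))"
    using thin[of N] by (elim exE conjE) (rule that)
  define cS where "cS = sum c S0"
  have cS: "0 \<le> cS" unfolding cS_def using c S0 KG by (intro sum_nonneg) auto
  \<comment> \<open>With |R| above the cost of \<open>S0\<close>, the attaching edges, one for each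
    packed translate of R, cost no more than the size of the uncovered part.\<close>
  obtain m :: nat where m: "cS < real m" using reals_Archimedean2 by blast
  obtain R where R: "R \<subseteq> K" "finite R" "card R = Suc m"
    using infinite_arbitrarily_large[OF K(2), of "Suc m"] by blast
  have R_ne: "R \<noteq> {}" using R by auto
  define S where "S = S0 \<union> (\<lambda>(r, s). inv r \<otimes> s) ` (R \<times> (S0 \<union> R))"
  have finS: "finite S" using S0 R by (simp add: S_def)
  have SK: "S \<subseteq> K"
    using S0 R K by (auto simp: S_def subset_iff subgroup.m_closed subgroup.m_inv_closed)
  have main: "\<exists>F. finite F \<and> F \<subseteq> K \<and>
     (\<forall>\<^sub>F k in sequentially. \<exists>W D. W \<subseteq> V k \<and> D \<subseteq> F \<times> V k \<and>
        real (card (V k - (\<Union>s\<in>S. \<sigma> k s ` W))) \<le> \<epsilon> * real (card (V k)) \<and>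
        (\<Sum>(g, v)\<in>D. c g) \<le> \<eta> * real (card (V k)) \<and>
        (\<forall>w\<in>W. M \<le> card {u\<in>V k. linked (\<sigma> k) D (5 * M + 1) w u}))"
    if M: "M > 0" and \<epsilon>: "0 < \<epsilon>" for M and \<epsilon> :: real
  proof -
    obtain x :: "nat \<Rightarrow> 'a" where x: "x 0 = \<one>" "\<forall>i<M. x i \<in> K" "inj_on x {..<M}"
      "\<forall>i. Suc i < M \<longrightarrow> x (Suc i) \<otimes> inv (x i) \<in> E"
      and big: "N * M \<le> card ((\<lambda>(s, i). s \<otimes> x i) ` (S0 \<times> {..<M}))"
      using path[THEN spec, of M] by (elim exE conjE) (rule that)
    define B where "B = E \<union> S0 \<union> R \<union> x ` {..<M}"
    have B: "finite B" "B \<subseteq> carrier G" using E S0 R x KG by (auto simp: B_def)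
    have subw: "E \<subseteq> words G B 1" "S0 \<subseteq> words G B 1" "R \<subseteq> words G B 1" "\<And>i. i < M \<Longrightarrow> x i \<in> words G B 1"
      using in_words_1[OF B(2)] by (auto simp: B_def)
    define P where "P = (\<lambda>(s, i). s \<otimes> x i) ` (S0 \<times> {..<M})"
    have P: "finite P" "P \<subseteq> words G B 2"
      using S0 subw by (auto simp: P_def intro!: words_mult_le[OF B(2), of _ 1 _ 1])
    have NM: "real N * real M \<le> real (card P)" using big unfolding P_def by (metis of_nat_le_iff of_nat_mult)
    moreover have "real N * real M > 0" using M by (simp add: N_def)
    ultimately have Ppos: "0 < real (card P)" by linarith
    define \<epsilon>' where "\<epsilon>' = min \<epsilon> \<eta>1"
    have \<epsilon>': "0 < \<epsilon>'" "\<epsilon>' \<le> \<epsilon>" "\<epsilon>' \<le> \<eta>1" using \<epsilon> \<eta>1 by (auto simp: \<epsilon>'_def)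
    note gd = eventually_good_points[OF seq finite_words[OF B(1), of 8] words_closed[OF B(2), of 8] \<epsilon>'(1)]
    show ?thesis
    proof (intro exI[of _ "E \<union> S0"] conjI)
      show "finite (E \<union> S0)" "E \<union> S0 \<subseteq> K" using E S0 by auto
      show "\<forall>\<^sub>F k in sequentially. \<exists>W D. W \<subseteq> V k \<and> D \<subseteq> (E \<union> S0) \<times> V k \<and>
        real (card (V k - (\<Union>s\<in>S. \<sigma> k s ` W))) \<le> \<epsilon> * real (card (V k)) \<and>
        (\<Sum>(g, v)\<in>D. c g) \<le> \<eta> * real (card (V k)) \<and>
        (\<forall>w\<in>W. M \<le> card {u\<in>V k. linked (\<sigma> k) D (5 * M + 1) w u})"
        using gd
      proof eventually_elim
        case (elim k)
        interpret sofic_approx G "V k" "\<sigma> k" by (rule sofic_approx_of_sequence[OF G seq])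
        define n where "n = real (card (V k))"
        have n: "n > 0" using card_V_pos by (simp add: n_def)
        let ?G8 = "good (words G B 8)" and ?G4 = "good (words G B 4)"
        have cardg: "real (card ?G8) \<le> n" "real (card ?G4) \<le> n"
          unfolding n_def using card_mono[OF finite_V good_points_subset] by auto
        let ?C = "\<lambda>j. (\<lambda>p. \<sigma> k p j) ` P"
        have "\<exists>J\<subseteq>?G4. real (card J) * (\<eta>1 * real (card P)) \<le> real (card ?G8) \<and>
          real (card (?G8 - (\<Union>j\<in>J. ?C j))) \<le> \<eta>1 * real (card ?G4)"
          by (rule exists_sparse_cover[OF finite_good finite_good Ppos \<eta>1])
            (rule of_nat_mono[OF card_covering_points[OF B(2) P]])
        then obtain J where J: "J \<subseteq> ?G4" and cJ: "real (card J) * (\<eta>1 * real (card P)) \<le> real (card ?G8)"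
          and unc: "real (card (?G8 - (\<Union>j\<in>J. ?C j))) \<le> \<eta>1 * real (card ?G4)"
          by (elim exE conjE) (rule that)
        interpret thin_path G "V k" "\<sigma> k" B E S0 R x M J
        proof unfold_locales
          show "finite J" using J finite_good by (rule finite_subset)
        qed (use B E S0 R R_ne M x subw J in auto)
        have covd: "covered = (\<Union>j\<in>J. ?C j)" by (simp add: covered_def P_def)
        have cardU: "real (card uncovered) \<le> 2 * \<eta>1 * n"
        proof -
          have "card uncovered \<le> card ((V k - ?G8) \<union> (?G8 - (\<Union>j\<in>J. ?C j)))"
            unfolding uncovered_def covd using finite_V finite_good by (intro card_mono) auto
          also have "\<dots> \<le> card (V k - ?G8) + card (?G8 - (\<Union>j\<in>J. ?C j))" by (rule card_Un_le)
          finally have "real (card uncovered) \<le> real (card (V k - ?G8)) + real (card (?G8 - (\<Union>j\<in>J. ?C j)))"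
            by linarith
          also have "\<dots> \<le> \<epsilon>' * n + \<eta>1 * real (card ?G4)" using elim unc by (simp add: n_def)
          also have "\<dots> \<le> \<eta>1 * n + \<eta>1 * n"
            using \<epsilon>' \<eta>1 n cardg by (intro add_mono mult_right_mono mult_left_mono) auto
          finally show ?thesis by simp
        qed
        have cardJ: "real (M * card J) \<le> \<eta>1 * n"
        proof -
          let ?j = "real (card J)" and ?m = "real M"
          have "?j * (\<eta>1 * (real N * ?m)) \<le> ?j * (\<eta>1 * real (card P))"
            using NM \<eta>1 by (intro mult_left_mono) auto
          also have "\<dots> \<le> n" using cJ cardg by linarith
          finally have "?j * (\<eta>1 * (real N * ?m)) \<le> n" .
          then have "\<eta>1 * (?j * (\<eta>1 * (real N * ?m))) \<le> \<eta>1 * n" using \<eta>1 by (intro mult_left_mono) auto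
          moreover have "\<eta>1 * (?j * (\<eta>1 * (real N * ?m))) = (\<eta>1 * \<eta>1 * real N) * (?m * ?j)" by simp
          moreover have "1 * (?m * ?j) \<le> (\<eta>1 * \<eta>1 * real N) * (?m * ?j)"
            using N by (intro mult_right_mono) auto
          ultimately show ?thesis by simp
        qed
        obtain W D z where W: "W \<subseteq> V k" and D: "D \<subseteq> (E \<union> S0) \<times> V k" and z: "z * card R \<le> card uncovered"
          and cost: "(\<Sum>(g, v)\<in>D. c g) \<le> sum c E * real (M * card J + card uncovered + z) + sum c S0 * real z"
          and cov: "?G8 \<subseteq> (\<Union>s\<in>S0 \<union> (\<lambda>(r, s). inv r \<otimes> s) ` (R \<times> (S0 \<union> R)). \<sigma> k s ` W)"
          and many: "\<forall>w\<in>W. M \<le> card {u\<in>V k. linked (\<sigma> k) D (5 * M + 1) w u}"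
          by (rule exE[OF exists_sparse_net[of c]], erule c, elim exE conjE, rule that, assumption+)
        have zR: "real z * real (Suc m) \<le> 2 * \<eta>1 * n"
          using z cardU unfolding R(3) by (metis of_nat_le_iff of_nat_mult order_trans)
        have z1: "real z \<le> 2 * \<eta>1 * n"
        proof -
          have "real z * 1 \<le> real z * real (Suc m)" by (intro mult_left_mono) auto
          then show ?thesis using zR by simp
        qed
        have z2: "cS * real z \<le> 2 * \<eta>1 * n"
        proof -
          have "real z * cS \<le> real z * real (Suc m)" using m by (intro mult_left_mono) auto
          then show ?thesis using zR by (simp add: mult.commute)
        qed
        have "(\<Sum>(g, v)\<in>D. c g) \<le> \<eta> * n"
        proof -
          have "real (M * card J + card uncovered + z) \<le> 5 * \<eta>1 * n" using cardJ cardU z1 by simp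
          then have "sum c E * real (M * card J + card uncovered + z) \<le> sum c E * (5 * \<eta>1 * n)"
            using sumE by (rule mult_left_mono)
          also have "\<dots> \<le> cE * (5 * \<eta>1 * n)" using \<eta>1 n by (intro mult_right_mono) (auto simp: cE_def)
          finally have a: "sum c E * real (M * card J + card uncovered + z) \<le> 5 * (cE * \<eta>1 * n)" by simp
          have "1 * (\<eta>1 * n) \<le> cE * (\<eta>1 * n)" using cE \<eta>1 n by (intro mult_right_mono) auto
          then have b: "cS * real z \<le> 2 * (cE * \<eta>1 * n)" using z2 by simp
          have "0 \<le> cE * \<eta>1 * n" using cE \<eta>1 n by simp
          then have "(\<Sum>(g, v)\<in>D. c g) \<le> 10 * (cE * \<eta>1 * n)" using cost a b by (simp add: cS_def)
          also have "\<dots> = (10 * cE * \<eta>1) * n" by simp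
          finally show ?thesis unfolding \<eta>1' .
        qed
        moreover have "real (card (V k - (\<Union>s\<in>S. \<sigma> k s ` W))) \<le> \<epsilon> * n"
        proof -
          have "card (V k - (\<Union>s\<in>S. \<sigma> k s ` W)) \<le> card (V k - ?G8)"
            using cov finite_V unfolding S_def by (intro card_mono) auto
          then have "real (card (V k - (\<Union>s\<in>S. \<sigma> k s ` W))) \<le> \<epsilon>' * n" using elim by (simp add: n_def)
          also have "\<dots> \<le> \<epsilon> * n" using \<epsilon>' n by (intro mult_right_mono) auto
          finally show ?thesis .
        qed
        ultimately show ?case using W D many unfolding n_def
          by (intro exI[of _ W] exI[of _ D] conjI)
      qed
    qed
  qed
  show ?thesis by (intro exI[of _ S] conjI allI impI finS SK main)
qed

section \<open>Amenable subgroups\<close>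

text \<open>Every net point can reach at least M points in the graph of the net. Cutting along a
  partition into bounded classes spoils this only near the ends of few cut edges, so little more
  than |V| / M components remain, and a spanning forest of T-edges joining them is cheap for large
  M. Inside a class, connectedness already bounds the length of paths.\<close>

lemma sparsely_linked_on_amenable:
  fixes G :: "('a, 'm) monoid_scheme" (structure)
  assumes seq: "sofic_approximation_sequence G V \<sigma>" and G: "group G"
    and K: "subgroup K G" "amenable_group (G\<lparr>carrier := K\<rparr>)"
      "\<not> locally_finite_group (G\<lparr>carrier := K\<rparr>)" "\<not> virtually_cyclic_group (G\<lparr>carrier := K\<rparr>)"
      "infinite K"
    and c: "\<And>g. g \<in> carrier G \<Longrightarrow> 0 \<le> (c g :: real)" and \<eta>: "0 < \<eta>"
  shows "\<exists>S. finite S \<and> S \<subseteq> K \<and> sparsely_linked_on G V \<sigma> c \<eta> S K"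
proof -
  interpret group G by (rule G)
  have KG: "K \<subseteq> carrier G" using K subgroup.subset by blast
  interpret GK: group "G\<lparr>carrier := K\<rparr>" by (rule subgroup.subgroup_is_group[OF K(1) G])
  have invK: "inv\<^bsub>G\<lparr>carrier := K\<rparr>\<^esub> y = inv y" if "y \<in> K" for y
    using m_inv_consistent[OF K(1) that] by simp
  obtain E where E: "finite E" "E \<subseteq> carrier (G\<lparr>carrier := K\<rparr>)" and thin: "\<forall>N. \<exists>S. finite S \<and> S \<subseteq> carrier (G\<lparr>carrier := K\<rparr>) \<and>
     (\<forall>M. \<exists>x :: nat \<Rightarrow> 'a. x 0 = \<one>\<^bsub>G\<lparr>carrier := K\<rparr>\<^esub> \<and> (\<forall>i<M. x i \<in> carrier (G\<lparr>carrier := K\<rparr>)) \<and> inj_on x {..<M} \<and>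
           (\<forall>i. Suc i < M \<longrightarrow> x (Suc i) \<otimes>\<^bsub>G\<lparr>carrier := K\<rparr>\<^esub> inv\<^bsub>G\<lparr>carrier := K\<rparr>\<^esub> (x i) \<in> E) \<and>
           N * M \<le> card ((\<lambda>(s, i). s \<otimes>\<^bsub>G\<lparr>carrier := K\<rparr>\<^esub> x i) ` (S \<times> {..<M})))"
    using GK.exists_thin_paths[OF K(3,4)] by (elim exE conjE) (rule that)
  have thin': "\<exists>S. finite S \<and> S \<subseteq> K \<and> (\<forall>M. \<exists>x :: nat \<Rightarrow> 'a. x 0 = \<one> \<and> (\<forall>i<M. x i \<in> K) \<and>
        inj_on x {..<M} \<and> (\<forall>i. Suc i < M \<longrightarrow> x (Suc i) \<otimes> inv (x i) \<in> E) \<and>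
        N * M \<le> card ((\<lambda>(s, i). s \<otimes> x i) ` (S \<times> {..<M})))" for N
  proof -
    obtain S where S: "finite S" "S \<subseteq> K" and path: "\<forall>M. \<exists>x :: nat \<Rightarrow> 'a. x 0 = \<one> \<and> (\<forall>i<M. x i \<in> K) \<and>
        inj_on x {..<M} \<and> (\<forall>i. Suc i < M \<longrightarrow> x (Suc i) \<otimes> inv\<^bsub>G\<lparr>carrier := K\<rparr>\<^esub> (x i) \<in> E) \<and>
        N * M \<le> card ((\<lambda>(s, i). s \<otimes> x i) ` (S \<times> {..<M}))"
      using thin[THEN spec, of N] by (elim exE conjE) (rule that, simp_all)
    have "\<exists>x :: nat \<Rightarrow> 'a. x 0 = \<one> \<and> (\<forall>i<M. x i \<in> K) \<and>
        inj_on x {..<M} \<and> (\<forall>i. Suc i < M \<longrightarrow> x (Suc i) \<otimes> inv (x i) \<in> E) \<and>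
        N * M \<le> card ((\<lambda>(s, i). s \<otimes> x i) ` (S \<times> {..<M}))" for M
    proof -
      obtain x :: "nat \<Rightarrow> 'a" where x: "x 0 = \<one>" "\<forall>i<M. x i \<in> K" "inj_on x {..<M}"
        "\<forall>i. Suc i < M \<longrightarrow> x (Suc i) \<otimes> inv\<^bsub>G\<lparr>carrier := K\<rparr>\<^esub> (x i) \<in> E"
        "N * M \<le> card ((\<lambda>(s, i). s \<otimes> x i) ` (S \<times> {..<M}))"
        using path[THEN spec, of M] by (elim exE conjE) (rule that)
      have stepE: "x (Suc i) \<otimes> inv (x i) \<in> E" if i: "Suc i < M" for i
      proof -
        have "x i \<in> K" using x(2) i by simp
        then show ?thesis using x(4)[THEN spec, of i] i invK by simp
      qed
      show ?thesis by (intro exI[of _ x] conjI x(1,2,3,5)) (use stepE in blast)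
    qed
    then show ?thesis using S by (intro exI[of _ S] conjI allI)
  qed
  have EK: "E \<subseteq> K" using E by simp
  obtain S where S: "finite S" "S \<subseteq> K" and net: "\<forall>M>0. \<forall>\<epsilon>>0. \<exists>F. finite F \<and> F \<subseteq> K \<and>
     (\<forall>\<^sub>F k in sequentially. \<exists>W D. W \<subseteq> V k \<and> D \<subseteq> F \<times> V k \<and>
        real (card (V k - (\<Union>s\<in>S. \<sigma> k s ` W))) \<le> \<epsilon> * real (card (V k)) \<and>
        (\<Sum>(g, v)\<in>D. c g) \<le> \<eta> * real (card (V k)) \<and>
        (\<forall>w\<in>W. M \<le> card {u\<in>V k. linked (\<sigma> k) D (5 * M + 1) w u}))"
    by (rule exE[OF sparse_net_sequence[OF seq G K(1,5) E(1) EK thin', of c \<eta>]], erule c, rule \<eta>,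
        elim exE conjE, rule that, assumption+)
  have "sparsely_linked_on G V \<sigma> c \<eta> S K"
    unfolding sparsely_linked_on_def sparsely_linked_def
  proof (intro allI impI, elim conjE)
    fix T \<epsilon> assume T: "finite T" "T \<subseteq> K" and \<epsilon>: "(0::real) < \<epsilon>"
    define cT where "cT = sum c T + 1"
    have cT0: "0 \<le> sum c T" using c T KG by (intro sum_nonneg) auto
    then have cT: "1 \<le> cT" by (simp add: cT_def)
    have cTt: "c t \<le> cT" if "t \<in> T" for t
    proof -
      have "0 \<le> c y" if "y \<in> T" for y using that c T KG by blast
      then have "c t \<le> sum c T" using that T(1) by (intro member_le_sum) auto
      then show ?thesis by (simp add: cT_def)
    qed
    \<comment> \<open>The forest has at most |V| / M edges on account of large components, and with
      this M they cost at most \<epsilon> / 2 times |V|.\<close>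
    obtain m :: nat where m: "2 * cT / \<epsilon> < real m" using reals_Archimedean2 by blast
    define M where "M = Suc m"
    have M: "M > 0" "2 * cT \<le> \<epsilon> * real M"
      using m \<epsilon> by (auto simp: M_def pos_divide_less_eq algebra_simps)
    obtain F where F: "finite F" "F \<subseteq> K" and ev1: "\<forall>\<^sub>F k in sequentially. \<exists>W D. W \<subseteq> V k \<and> D \<subseteq> F \<times> V k \<and>
        real (card (V k - (\<Union>s\<in>S. \<sigma> k s ` W))) \<le> \<epsilon> * real (card (V k)) \<and>
        (\<Sum>(g, v)\<in>D. c g) \<le> \<eta> * real (card (V k)) \<and>
        (\<forall>w\<in>W. M \<le> card {u\<in>V k. linked (\<sigma> k) D (5 * M + 1) w u})"
      using net[THEN spec, of M, THEN mp, OF M(1), THEN spec, of \<epsilon>, THEN mp, OF \<epsilon>]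
      by (elim exE conjE) (rule that)
    \<comment> \<open>A cut edge is paid for three times: twice through its two ends in X, which may
      give extra components, and once when the cut T-edges are added themselves. Three times
      \<open>cT\<close> \<delta> is \<epsilon> / 2.\<close>
    define \<delta> where "\<delta> = \<epsilon> / (6 * cT)"
    have \<delta>: "0 < \<delta>" "6 * (cT * \<delta>) = \<epsilon>" using \<epsilon> cT by (auto simp: \<delta>_def)
    have "finite (F \<union> T)" "F \<union> T \<subseteq> K" using F T by auto
    note hyp = hyperfinite[OF seq G K(1,2) this \<delta>(1)]
    obtain R where ev2: "\<forall>\<^sub>F k in sequentially. \<exists>p :: nat \<Rightarrow> nat. (\<forall>w. card {u\<in>V k. p u = w} \<le> R) \<and>
        real (card {(t, u). t \<in> F \<union> T \<and> u \<in> V k \<and> p u \<noteq> p (\<sigma> k t u)}) \<le> \<delta> * real (card (V k))"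
      using hyp by (elim exE) (rule that)
    show "\<exists>F C. finite F \<and> F \<subseteq> carrier G \<and>
       (\<forall>\<^sub>F k in sequentially. \<exists>W D. W \<subseteq> V k \<and> D \<subseteq> F \<times> V k \<and>
          real (card (V k - (\<Union>s\<in>S. \<sigma> k s ` W))) \<le> \<epsilon> * real (card (V k)) \<and>
          (\<Sum>(g, v)\<in>D. c g) \<le> (\<eta> + \<epsilon>) * real (card (V k)) \<and>
          (\<forall>w\<in>W. \<forall>t\<in>T. \<sigma> k t w \<in> W \<longrightarrow> linked (\<sigma> k) D C w (\<sigma> k t w)))"
    proof (intro exI[of _ "F \<union> T"] exI[of _ "R * R + 1"] conjI)
      show "finite (F \<union> T)" "F \<union> T \<subseteq> carrier G" using F T KG by auto
      show "\<forall>\<^sub>F k in sequentially. \<exists>W D. W \<subseteq> V k \<and> D \<subseteq> (F \<union> T) \<times> V k \<and>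
          real (card (V k - (\<Union>s\<in>S. \<sigma> k s ` W))) \<le> \<epsilon> * real (card (V k)) \<and>
          (\<Sum>(g, v)\<in>D. c g) \<le> (\<eta> + \<epsilon>) * real (card (V k)) \<and>
          (\<forall>w\<in>W. \<forall>t\<in>T. \<sigma> k t w \<in> W \<longrightarrow> linked (\<sigma> k) D (R * R + 1) w (\<sigma> k t w))"
        using ev1 ev2
      proof eventually_elim
        case (elim k)
        interpret sofic_approx G "V k" "\<sigma> k" by (rule sofic_approx_of_sequence[OF G seq])
        let ?\<sigma> = "\<sigma> k"
        define n where "n = real (card (V k))"
        have n: "n > 0" using card_V_pos by (simp add: n_def)
        obtain W D where W: "W \<subseteq> V k" and D: "D \<subseteq> F \<times> V k"
          and cov: "real (card (V k - (\<Union>s\<in>S. ?\<sigma> s ` W))) \<le> \<epsilon> * real (card (V k))"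
          and cost: "(\<Sum>(g, v)\<in>D. c g) \<le> \<eta> * real (card (V k))"
          and many: "\<forall>w\<in>W. M \<le> card {u\<in>V k. linked ?\<sigma> D (5 * M + 1) w u}"
          using elim(1) by (elim exE conjE) (rule that)
        obtain p :: "nat \<Rightarrow> nat" where p: "\<forall>w. card {u\<in>V k. p u = w} \<le> R"
          and cross: "real (card {(t, u). t \<in> F \<union> T \<and> u \<in> V k \<and> p u \<noteq> p (?\<sigma> t u)}) \<le> \<delta> * real (card (V k))"
          using elim(2) by (elim exE conjE) (rule that)
        define Y where "Y = {(t, u). t \<in> F \<union> T \<and> u \<in> V k \<and> p u \<noteq> p (?\<sigma> t u)}"
        have finY: "finite Y"
          by (rule finite_subset[of _ "(F \<union> T) \<times> V k"]) (use F T finite_V in \<open>auto simp: Y_def\<close>)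
        have cY: "real (card Y) \<le> \<delta> * n" using cross by (simp add: Y_def n_def)
        define X where "X = snd ` Y \<union> (\<lambda>(t, u). ?\<sigma> t u) ` Y"
        have XV: "X \<subseteq> V k" using F T KG \<sigma>_closed by (auto simp: X_def Y_def)
        have cX: "card X \<le> 2 * card Y"
        proof -
          have "card X \<le> card (snd ` Y) + card ((\<lambda>(t, u). ?\<sigma> t u) ` Y)" unfolding X_def by (rule card_Un_le)
          also have "\<dots> \<le> card Y + card Y" using finY by (intro add_mono card_image_le)
          finally show ?thesis by simp
        qed
        have finW: "finite W" using W finite_V by (rule finite_subset)
        \<comment> \<open>Without the cut edges Y, every path of r, and later of the forest, stays
          inside one class of p. This bounds path lengths independently of k.\<close>
        define r where "r = edges ?\<sigma> (D - Y)"
        define I where "I = {(t, w). t \<in> T \<and> w \<in> W \<and> ?\<sigma> t w \<in> W} - Y"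
        have finI: "finite I"
          by (rule finite_subset[of _ "T \<times> W"]) (use T finW in \<open>auto simp: I_def\<close>)
        have edgesV: "edges ?\<sigma> A \<subseteq> V k \<times> V k" if "A \<subseteq> (F \<union> T) \<times> V k" for A
        proof
          fix e assume "e \<in> edges ?\<sigma> A"
          then obtain g v where gv: "(g, v) \<in> A" "e = (v, ?\<sigma> g v) \<or> e = (?\<sigma> g v, v)"
            by (auto simp: edges_def)
          have gvc: "g \<in> F \<union> T" "v \<in> V k" using subsetD[OF that gv(1)] by simp_all
          have "F \<union> T \<subseteq> carrier G" using F T KG by auto
          then have "?\<sigma> g v \<in> V k" using gvc by (intro \<sigma>_closed) auto
          then show "e \<in> V k \<times> V k" using gv(2) gvc(2) by auto
        qed
        have edges_p: "p u = p v" if uvA: "(u, v) \<in> edges ?\<sigma> A" "A \<subseteq> (F \<union> T) \<times> V k" "A \<inter> Y = {}" for u v A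
        proof -
          obtain g w where gw: "(g, w) \<in> A" "u = w \<and> v = ?\<sigma> g w \<or> u = ?\<sigma> g w \<and> v = w"
            using uvA(1) by (auto simp: edges_def)
          have "g \<in> F \<union> T" "w \<in> V k" "(g, w) \<notin> Y" using uvA(2,3) gw(1) by blast+
          then have "p w = p (?\<sigma> g w)" unfolding Y_def by auto
          then show ?thesis using gw(2) by auto
        qed
        have rV: "r \<subseteq> V k \<times> V k" unfolding r_def using D by (intro edgesV) auto
        \<comment> \<open>A component that misses the ends X of cut edges loses nothing by the cut,
          so it still contains everything within 5 M + 1 steps of w in D.\<close>
        have comp: "M \<le> card (r\<^sup>* `` {w})" if w: "w \<in> W" "r\<^sup>* `` {w} \<inter> X = {}" for w
        proof -
          have reach: "(w, u) \<in> r\<^sup>*" if "(w, u) \<in> edges ?\<sigma> D ^^ i" for i u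
            using that
          proof (induction i arbitrary: u)
            case 0 then show ?case by simp
          next
            case (Suc i)
            then obtain u' where u': "(w, u') \<in> edges ?\<sigma> D ^^ i" "(u', u) \<in> edges ?\<sigma> D" by auto
            then have wu: "(w, u') \<in> r\<^sup>*" using Suc.IH by blast
            then have uX: "u' \<notin> X" using w(2) by blast
            have "(u', u) \<in> r"
            proof (rule ccontr)
              assume notr: "(u', u) \<notin> r"
              obtain g v where gv: "(g, v) \<in> D" "u' = v \<and> u = ?\<sigma> g v \<or> u' = ?\<sigma> g v \<and> u = v"
                using u'(2) by (auto simp: edges_def)
              have gvY: "(g, v) \<in> Y"
              proof (rule ccontr)
                assume "(g, v) \<notin> Y"
                then have "(g, v) \<in> D - Y" using gv(1) by simp
                then have "(u', u) \<in> r" using gv(2) by (auto simp: r_def edges_def)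
                then show False using notr by simp
              qed
              have "v \<in> X" "?\<sigma> g v \<in> X" using gvY by (force simp: X_def)+
              then show False using uX gv(2) by auto
            qed
            then show ?case using wu by (rule rtrancl_into_rtrancl[rotated])
          qed
          have wV: "w \<in> V k" using w W by auto
          have sub: "{u\<in>V k. linked ?\<sigma> D (5 * M + 1) w u} \<subseteq> r\<^sup>* `` {w}"
            using reach by (auto simp: linked_def)
          have "r\<^sup>* `` {w} \<subseteq> V k"
          proof
            fix u assume "u \<in> r\<^sup>* `` {w}"
            then have "(w, u) \<in> r\<^sup>*" by simp
            then show "u \<in> V k" by (induction rule: rtrancl_induct) (use wV rV in auto)
          qed
          then have "finite (r\<^sup>* `` {w})" using finite_V by (rule finite_subset)
          then have "card {u\<in>V k. linked ?\<sigma> D (5 * M + 1) w u} \<le> card (r\<^sup>* `` {w})"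
            using sub by (rule card_mono)
          moreover have "M \<le> card {u\<in>V k. linked ?\<sigma> D (5 * M + 1) w u}" using many w(1) by (rule bspec)
          ultimately show ?thesis by (rule order_trans[rotated])
        qed
        have symr: "sym r" unfolding r_def by (rule sym_edges)
        have comps: "M * card (comps r W) \<le> M * card X + card (V k)"
          by (rule card_comps_le[OF finite_V W symr rV XV M(1) comp])
        have "\<exists>I'\<subseteq>I. card I' + card (comps (r \<union> edges ?\<sigma> I') W) \<le> card (comps r W) \<and>
          (\<forall>(t, w)\<in>I. (w, ?\<sigma> t w) \<in> (r \<union> edges ?\<sigma> I')\<^sup>*)"
          by (rule spanning_forest[OF finI _ finW symr]) (auto simp: I_def)
        then obtain I' where I': "I' \<subseteq> I" "card I' + card (comps (r \<union> edges ?\<sigma> I') W) \<le> card (comps r W)"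
          "\<forall>(t, w)\<in>I. (w, ?\<sigma> t w) \<in> (r \<union> edges ?\<sigma> I')\<^sup>*" by (elim exE conjE) (rule that)
        have finI': "finite I'" using I'(1) finI by (rule finite_subset)
        \<comment> \<open>Cut T-edges cannot be replaced by paths inside a class. They are few and
          enter the graph directly; the summand 1 in \<open>R * R + 1\<close> admits them.\<close>
        define Y' where "Y' = {(t, u)\<in>Y. t \<in> T}"
        have finY': "finite Y'" using finY by (rule finite_subset[rotated]) (auto simp: Y'_def)
        have cI': "real (card I') \<le> 2 * (\<delta> * n) + n / real M"
        proof -
          have "M * card I' \<le> M * card (comps r W)" using I'(2) by (intro mult_le_mono2) simp
          also have "\<dots> \<le> M * card X + card (V k)" by (rule comps)
          also have "\<dots> \<le> M * (2 * card Y) + card (V k)" using cX by simp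
          finally have "real (M * card I') \<le> real (M * (2 * card Y) + card (V k))" by (rule of_nat_mono)
          then have "real M * real (card I') \<le> real M * (2 * real (card Y)) + n" by (simp add: n_def)
          then have "real (card I') \<le> 2 * real (card Y) + n / real M"
            using M(1) by (simp add: field_simps)
          then show ?thesis using cY by simp
        qed
        have costT: "(\<Sum>(g, v)\<in>A. c g) \<le> cT * real (card A)" if "A \<subseteq> T \<times> V k" for A
        proof -
          have "(\<Sum>(g, v)\<in>A. c g) \<le> real (card A) * cT"
            by (rule sum_bounded_above) (use that cTt in auto)
          then show ?thesis by (simp add: mult.commute)
        qed
        have I'T: "I' \<subseteq> T \<times> V k" using I'(1) W by (auto simp: I_def)
        have Y'T: "Y' \<subseteq> T \<times> V k" by (auto simp: Y'_def Y_def)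
        define D' where "D' = D \<union> (I' \<union> Y')"
        have D': "D' \<subseteq> (F \<union> T) \<times> V k" using D I'T Y'T by (auto simp: D'_def)
        have finD: "finite D" using D F(1) finite_V by (auto intro: finite_subset)
        have "(\<Sum>(g, v)\<in>D'. c g) \<le> (\<eta> + \<epsilon>) * n"
        proof -
          have nonneg: "0 \<le> c g" if gv: "(g, v) \<in> D'" for g v
          proof -
            have "g \<in> F \<union> T" using subsetD[OF D' gv] by simp
            then have "g \<in> carrier G" using F T KG by auto
            then show ?thesis by (rule c)
          qed
          have "(\<Sum>(g, v)\<in>D'. c g) \<le> (\<Sum>(g, v)\<in>D. c g) + (\<Sum>(g, v)\<in>I' \<union> Y'. c g)"
            unfolding D'_def using finD finI' finY' nonneg by (intro sum_case_prod_Un_le) (auto simp: D'_def)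
          also have "(\<Sum>(g, v)\<in>I' \<union> Y'. c g) \<le> (\<Sum>(g, v)\<in>I'. c g) + (\<Sum>(g, v)\<in>Y'. c g)"
            using finI' finY' nonneg by (intro sum_case_prod_Un_le) (auto simp: D'_def)
          also have "\<dots> \<le> cT * real (card I') + cT * real (card Y')"
            using costT[OF I'T] costT[OF Y'T] by (rule add_mono)
          also have "\<dots> \<le> cT * (2 * (\<delta> * n) + n / real M) + cT * (\<delta> * n)"
          proof (intro add_mono mult_left_mono)
            have "card Y' \<le> card Y" using finY by (intro card_mono) (auto simp: Y'_def)
            then show "real (card Y') \<le> \<delta> * n" using cY by linarith
          qed (use cI' cT in auto)
          also have "\<dots> = 3 * (cT * \<delta>) * n + cT / real M * n" by (simp add: algebra_simps)
          also have "\<dots> \<le> 3 * (cT * \<delta>) * n + \<epsilon> / 2 * n"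
          proof -
            have "cT / real M \<le> \<epsilon> / 2" using M by (simp add: pos_divide_le_eq)
            then show ?thesis using n by (intro add_left_mono mult_right_mono) auto
          qed
          also have "3 * (cT * \<delta>) = \<epsilon> / 2" using \<delta>(2) by simp
          finally show ?thesis using cost by (simp add: n_def algebra_simps)
        qed
        moreover have "linked ?\<sigma> D' (R * R + 1) w (?\<sigma> t w)"
          if w: "w \<in> W" and t: "t \<in> T" and tw: "?\<sigma> t w \<in> W" for w t
        proof (cases "(t, w) \<in> Y")
          case True
          then have "(t, w) \<in> D'" using t by (auto simp: D'_def Y'_def)
          then have "linked ?\<sigma> D' 1 w (?\<sigma> t w)" by (rule linked_edge)
          then show ?thesis by (rule linked_mono) auto
        next
          case False
          then have path: "(w, ?\<sigma> t w) \<in> (r \<union> edges ?\<sigma> I')\<^sup>*" using I'(3) w t tw by (auto simp: I_def)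
          have re: "r \<union> edges ?\<sigma> I' = edges ?\<sigma> ((D - Y) \<union> I')" by (auto simp: r_def edges_def)
          have sub: "(D - Y) \<union> I' \<subseteq> (F \<union> T) \<times> V k" using D I'T by auto
          have dis: "((D - Y) \<union> I') \<inter> Y = {}" using I'(1) by (auto simp: I_def)
          have "\<exists>i\<le>R * R. (w, ?\<sigma> t w) \<in> (r \<union> edges ?\<sigma> I') ^^ i"
          proof (rule short_path_in_fibre[OF finite_V _ _ _ path])
            show "r \<union> edges ?\<sigma> I' \<subseteq> V k \<times> V k" unfolding re by (rule edgesV[OF sub])
            show "p u = p v" if "(u, v) \<in> r \<union> edges ?\<sigma> I'" for u v
              using edges_p[OF _ sub dis] that unfolding re by blast
          qed (use p w W in auto)
          then have "linked ?\<sigma> ((D - Y) \<union> I') (R * R) w (?\<sigma> t w)" unfolding re linked_def .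
          then show ?thesis by (rule linked_mono) (auto simp: D'_def)
        qed
        ultimately show ?case using W D' cov unfolding n_def
          by (intro exI[of _ W] exI[of _ D'] conjI ballI impI)
      qed
    qed
  qed
  then show ?thesis using S by blast
qed

lemma sparsely_connected_of_w_normal_amenable:
  fixes G :: "('a, 'm) monoid_scheme" (structure)
  assumes seq: "sofic_approximation_sequence G V \<sigma>" and G: "group G"
    and w: "has_w_normal_amenable_subgroup G"
  shows "sparsely_connected G V \<sigma>"
proof -
  interpret group G by (rule G)
  obtain K where K: "w_normal K G" "amenable_group (G\<lparr>carrier := K\<rparr>)"
    "\<not> locally_finite_group (G\<lparr>carrier := K\<rparr>)" "\<not> virtually_cyclic_group (G\<lparr>carrier := K\<rparr>)"
    using w unfolding has_w_normal_amenable_subgroup_def by (elim exE conjE) (rule that)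
  have subK: "subgroup K G"
  proof -
    obtain r :: "nat rel" and \<gamma> H where r: "Well_order r" "\<gamma> \<in> Field r"
      and sub: "\<forall>i\<in>Field r. subgroup (H i) G" and H0: "H (wo_rel.minim r (Field r)) = K"
      using K(1) unfolding w_normal_def by (elim exE conjE) (rule that)
    interpret W: wo_rel r using r by (simp add: wo_rel_def)
    have "W.minim (Field r) \<in> Field r" using r by (intro W.minim_in) auto
    then show ?thesis using sub H0 by auto
  qed
  have inf: "infinite K"
  proof
    assume fin: "finite K"
    interpret GK: group "G\<lparr>carrier := K\<rparr>" by (rule subgroup.subgroup_is_group[OF subK G])
    have "finite (generate (G\<lparr>carrier := K\<rparr>) F)" if "F \<subseteq> K" for F
      using GK.generate_incl[of F] that fin finite_subset by auto
    then show False using K(3) by (simp add: locally_finite_group_def)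
  qed
  show ?thesis
    unfolding sparsely_connected_def
  proof (intro allI impI, elim conjE)
    fix c :: "'a \<Rightarrow> real" and \<eta> :: real assume c: "\<forall>g\<in>carrier G. 0 \<le> c g" and \<eta>: "0 < \<eta>"
    have c': "0 \<le> c g" if "g \<in> carrier G" for g using c that by simp
    have "\<exists>S. finite S \<and> S \<subseteq> K \<and> sparsely_linked_on G V \<sigma> c \<eta> S K"
      by (rule sparsely_linked_on_amenable[OF seq G subK K(2-4) inf _ \<eta>]) (rule c')
    then obtain S where S: "finite S" "S \<subseteq> K" "sparsely_linked_on G V \<sigma> c \<eta> S K" by blast
    have SG: "S \<subseteq> carrier G" using S(2) subK subgroup.subset by blast
    have "sparsely_linked_on G V \<sigma> c \<eta> S (carrier G)"
      by (rule sparsely_linked_on_w_normal[OF seq G K(1) inf _ S(1) SG S(3)]) (rule c')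
    then show "\<exists>S. finite S \<and> S \<subseteq> carrier G \<and> sparsely_linked_on G V \<sigma> c \<eta> S (carrier G)"
      using S(1) SG by blast
  qed
qed

section \<open>Products\<close>

text \<open>The way back from good points to Hamming distances, by which product maps are recognized
  as sofic approximations.\<close>

lemma good_approximation_of_good_points:
  assumes V: "finite V" "V \<noteq> {}" and bad: "real (card (V - good_points G F V \<sigma>)) \<le> \<delta> * real (card V)"
  shows "good_approximation G F \<delta> V \<sigma>"
proof -
  have n: "real (card V) > 0" using V by (simp add: card_gt_0_iff)
  have le: "real (card X) \<le> \<delta> * real (card V)" if "X \<subseteq> V - good_points G F V \<sigma>" for X
  proof -
    have "card X \<le> card (V - good_points G F V \<sigma>)" by (rule card_mono[OF _ that]) (use V in simp)
    then show ?thesis using bad by linarith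
  qed
  have "hamming_dist V (\<sigma> (s \<otimes>\<^bsub>G\<^esub> t)) (\<sigma> s \<circ> \<sigma> t) \<le> \<delta>" if "s \<in> F" "t \<in> F" for s t
  proof -
    have "real (card {v \<in> V. \<sigma> (s \<otimes>\<^bsub>G\<^esub> t) v \<noteq> (\<sigma> s \<circ> \<sigma> t) v}) \<le> \<delta> * real (card V)"
      by (rule le) (use that in \<open>auto simp: good_points_def\<close>)
    then show ?thesis using n by (simp add: hamming_dist_def pos_divide_le_eq)
  qed
  moreover have "1 - \<delta> \<le> hamming_dist V (\<sigma> s) (\<sigma> t)" if st: "s \<in> F" "t \<in> F" "s \<noteq> t" for s t
  proof -
    let ?D = "{v \<in> V. \<sigma> s v \<noteq> \<sigma> t v}"
    have "V - ?D \<subseteq> V - good_points G F V \<sigma>" using st by (auto simp: good_points_def inj_on_def)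
    then have "real (card (V - ?D)) \<le> \<delta> * real (card V)" by (rule le)
    moreover have "card V = card ?D + card (V - ?D)"
      using V card_Diff_subset[of ?D V] card_mono[of V ?D] by simp
    ultimately have "(1 - \<delta>) * real (card V) \<le> real (card ?D)" by (simp add: left_diff_distrib)
    then show ?thesis unfolding hamming_dist_def using n by (subst pos_le_divide_eq) auto
  qed
  ultimately show ?thesis by (simp add: good_approximation_def)
qed

locale product_approx = A: group A + B: group B + group G
  for A :: "'p monoid" and B :: "'q monoid" and G :: "('a, 'm) monoid_scheme" (structure) +
  fixes f and V\<^sub>A V\<^sub>B :: "nat \<Rightarrow> nat set" and \<sigma>\<^sub>A \<sigma>\<^sub>B
  assumes iso: "f \<in> iso G (A \<times>\<times> B)"
    and seqA: "sofic_approximation_sequence A V\<^sub>A \<sigma>\<^sub>A" and seqB: "sofic_approximation_sequence B V\<^sub>B \<sigma>\<^sub>B"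
begin

definition pA where "pA g = fst (f g)"
definition pB where "pB g = snd (f g)"
definition lift where "lift a b = inv_into (carrier G) f (a, b)"
text \<open>Pairs are coded because approximating sets are sets of naturals. Correspondingly the
  maps \<sigma> are the identity off \<open>V k\<close>, as \<open>permutes\<close> demands.\<close>

definition V where "V k = prod_encode ` (V\<^sub>A k \<times> V\<^sub>B k)"
definition \<sigma> where "\<sigma> k g v = (if v \<in> V k then
   prod_encode (\<sigma>\<^sub>A k (pA g) (fst (prod_decode v)), \<sigma>\<^sub>B k (pB g) (snd (prod_decode v))) else v)"

lemma f_bij: "bij_betw f (carrier G) (carrier A \<times> carrier B)"
  using iso by (simp add: iso_def DirProd_def)

lemma p_closed: "g \<in> carrier G \<Longrightarrow> pA g \<in> carrier A" "g \<in> carrier G \<Longrightarrow> pB g \<in> carrier B"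
  using bij_betwE[OF f_bij] by (auto simp: pA_def pB_def mem_Times_iff)

lemma p_mult: "g \<in> carrier G \<Longrightarrow> h \<in> carrier G \<Longrightarrow> pA (g \<otimes> h) = pA g \<otimes>\<^bsub>A\<^esub> pA h"
  "g \<in> carrier G \<Longrightarrow> h \<in> carrier G \<Longrightarrow> pB (g \<otimes> h) = pB g \<otimes>\<^bsub>B\<^esub> pB h"
proof -
  assume "g \<in> carrier G" "h \<in> carrier G"
  then have "f (g \<otimes> h) = f g \<otimes>\<^bsub>A \<times>\<times> B\<^esub> f h" using iso by (auto simp: iso_def hom_def)
  then show "pA (g \<otimes> h) = pA g \<otimes>\<^bsub>A\<^esub> pA h" "pB (g \<otimes> h) = pB g \<otimes>\<^bsub>B\<^esub> pB h"
    by (simp_all add: pA_def pB_def DirProd_def split_beta)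
qed

lemma p_eqD: "g \<in> carrier G \<Longrightarrow> h \<in> carrier G \<Longrightarrow> pA g = pA h \<Longrightarrow> pB g = pB h \<Longrightarrow> g = h"
  using bij_betw_imp_inj_on[OF f_bij] by (auto simp: pA_def pB_def inj_on_def prod_eq_iff)

lemma p_hom: "pA \<in> hom G A" "pB \<in> hom G B"
  using p_closed p_mult by (auto simp: hom_def)

lemma p_inv: "g \<in> carrier G \<Longrightarrow> pA (inv g) = inv\<^bsub>A\<^esub> (pA g)" "g \<in> carrier G \<Longrightarrow> pB (inv g) = inv\<^bsub>B\<^esub> (pB g)"
proof -
  assume g: "g \<in> carrier G"
  interpret hA: group_hom G A pA by unfold_locales (rule p_hom)
  interpret hB: group_hom G B pB by unfold_locales (rule p_hom)
  show "pA (inv g) = inv\<^bsub>A\<^esub> (pA g)" "pB (inv g) = inv\<^bsub>B\<^esub> (pB g)"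
    using g by (rule hA.hom_inv, intro hB.hom_inv)
qed

lemma lift:
  assumes "a \<in> carrier A" "b \<in> carrier B"
  shows "lift a b \<in> carrier G" "pA (lift a b) = a" "pB (lift a b) = b"
proof -
  have ab: "(a, b) \<in> f ` carrier G" using assms f_bij by (simp add: bij_betw_def)
  show "lift a b \<in> carrier G" unfolding lift_def by (rule inv_into_into[OF ab])
  have "f (lift a b) = (a, b)" unfolding lift_def by (rule f_inv_into_f[OF ab])
  then show "pA (lift a b) = a" "pB (lift a b) = b" by (simp_all add: pA_def pB_def)
qed

lemma sofic_A: "sofic_approx A (V\<^sub>A k) (\<sigma>\<^sub>A k)" and sofic_B: "sofic_approx B (V\<^sub>B k) (\<sigma>\<^sub>B k)"
  using sofic_approx_of_sequence[OF A.is_group seqA] sofic_approx_of_sequence[OF B.is_group seqB] .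

lemma \<sigma>_encode: "a \<in> V\<^sub>A k \<Longrightarrow> b \<in> V\<^sub>B k \<Longrightarrow>
    \<sigma> k g (prod_encode (a, b)) = prod_encode (\<sigma>\<^sub>A k (pA g) a, \<sigma>\<^sub>B k (pB g) b)"
  by (simp add: \<sigma>_def V_def)

lemma encode_V: "a \<in> V\<^sub>A k \<Longrightarrow> b \<in> V\<^sub>B k \<Longrightarrow> prod_encode (a, b) \<in> V k"
  by (simp add: V_def)

lemma card_encode: "card (prod_encode ` X) = card X"
  by (rule card_image[OF inj_prod_encode])

lemma card_V: "card (V k) = card (V\<^sub>A k) * card (V\<^sub>B k)"
  unfolding V_def card_encode by (rule card_cartesian_product)

lemma finite_VAB: "finite (V\<^sub>A k)" "finite (V\<^sub>B k)" "V\<^sub>A k \<noteq> {}" "V\<^sub>B k \<noteq> {}"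
  using sofic_approx.finite_V[OF sofic_A] sofic_approx.finite_V[OF sofic_B]
    sofic_approx.V_nonempty[OF sofic_A] sofic_approx.V_nonempty[OF sofic_B] by auto

lemma \<sigma>AB_closed: "g \<in> carrier A \<Longrightarrow> a \<in> V\<^sub>A k \<Longrightarrow> \<sigma>\<^sub>A k g a \<in> V\<^sub>A k"
    "h \<in> carrier B \<Longrightarrow> b \<in> V\<^sub>B k \<Longrightarrow> \<sigma>\<^sub>B k h b \<in> V\<^sub>B k"
  using sofic_approx.\<sigma>_closed[OF sofic_A] sofic_approx.\<sigma>_closed[OF sofic_B] by auto

lemma sofic_approximation_product: "sofic_approximation G (V k) (\<sigma> k)"
proof -
  have "\<sigma> k g permutes V k" if g: "g \<in> carrier G" for g
  proof (rule bij_imp_permutes)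
    have into: "\<sigma> k g ` V k \<subseteq> V k"
      using p_closed[OF g] by (auto simp: V_def \<sigma>_encode[unfolded V_def] intro!: imageI \<sigma>AB_closed \<sigma>_encode)
    have "inj_on (\<sigma> k g) (V k)"
    proof (rule inj_onI)
      fix v w assume vw: "v \<in> V k" "w \<in> V k" "\<sigma> k g v = \<sigma> k g w"
      obtain a b where v: "v = prod_encode (a, b)" "a \<in> V\<^sub>A k" "b \<in> V\<^sub>B k" using vw(1) by (auto simp: V_def)
      obtain a' b' where w: "w = prod_encode (a', b')" "a' \<in> V\<^sub>A k" "b' \<in> V\<^sub>B k" using vw(2) by (auto simp: V_def)
      have "\<sigma>\<^sub>A k (pA g) a = \<sigma>\<^sub>A k (pA g) a'" "\<sigma>\<^sub>B k (pB g) b = \<sigma>\<^sub>B k (pB g) b'"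
        using vw(3) v w by (simp_all add: \<sigma>_encode)
      then show "v = w" using v w p_closed[OF g] sofic_approx.\<sigma>_eq_iff[OF sofic_A] sofic_approx.\<sigma>_eq_iff[OF sofic_B]
        by simp
    qed
    moreover have "finite (V k)" using finite_VAB by (simp add: V_def)
    ultimately show "bij_betw (\<sigma> k g) (V k) (V k)"
      using into by (simp add: bij_betw_def endo_inj_surj)
  qed (simp add: \<sigma>_def)
  then show ?thesis using finite_VAB by (auto simp: sofic_approximation_def V_def)
qed

lemma good_product:
  assumes F: "F \<subseteq> carrier G"
  shows "prod_encode ` (good_points A (pA ` F) (V\<^sub>A k) (\<sigma>\<^sub>A k) \<times> good_points B (pB ` F) (V\<^sub>B k) (\<sigma>\<^sub>B k))
    \<subseteq> good_points G F (V k) (\<sigma> k)"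
proof
  fix v assume "v \<in> prod_encode ` (good_points A (pA ` F) (V\<^sub>A k) (\<sigma>\<^sub>A k) \<times> good_points B (pB ` F) (V\<^sub>B k) (\<sigma>\<^sub>B k))"
  then obtain a b where v: "v = prod_encode (a, b)"
    and a: "a \<in> good_points A (pA ` F) (V\<^sub>A k) (\<sigma>\<^sub>A k)" and b: "b \<in> good_points B (pB ` F) (V\<^sub>B k) (\<sigma>\<^sub>B k)" by blast
  have aV: "a \<in> V\<^sub>A k" and bV: "b \<in> V\<^sub>B k" using a b by (simp_all add: good_points_def)
  have ma: "\<sigma>\<^sub>A k (pA s \<otimes>\<^bsub>A\<^esub> pA t) a = \<sigma>\<^sub>A k (pA s) (\<sigma>\<^sub>A k (pA t) a)" if "s \<in> F" "t \<in> F" for s t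
    using a that by (auto simp: good_points_def)
  have mb: "\<sigma>\<^sub>B k (pB s \<otimes>\<^bsub>B\<^esub> pB t) b = \<sigma>\<^sub>B k (pB s) (\<sigma>\<^sub>B k (pB t) b)" if "s \<in> F" "t \<in> F" for s t
    using b that by (auto simp: good_points_def)
  have ia: "pA s = pA t" if "s \<in> F" "t \<in> F" "\<sigma>\<^sub>A k (pA s) a = \<sigma>\<^sub>A k (pA t) a" for s t
    using a that unfolding good_points_def inj_on_def by blast
  have ib: "pB s = pB t" if "s \<in> F" "t \<in> F" "\<sigma>\<^sub>B k (pB s) b = \<sigma>\<^sub>B k (pB t) b" for s t
    using b that unfolding good_points_def inj_on_def by blast
  have "\<sigma> k (s \<otimes> t) v = \<sigma> k s (\<sigma> k t v)" if st: "s \<in> F" "t \<in> F" for s t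
  proof -
    have c: "s \<in> carrier G" "t \<in> carrier G" using st F by auto
    have "\<sigma>\<^sub>A k (pA t) a \<in> V\<^sub>A k" "\<sigma>\<^sub>B k (pB t) b \<in> V\<^sub>B k" using \<sigma>AB_closed p_closed c aV bV by auto
    then show ?thesis using ma[OF st] mb[OF st] c aV bV by (simp add: v \<sigma>_encode p_mult)
  qed
  moreover have "inj_on (\<lambda>s. \<sigma> k s v) F"
  proof (rule inj_onI)
    fix s t assume st: "s \<in> F" "t \<in> F" "\<sigma> k s v = \<sigma> k t v"
    then have "\<sigma>\<^sub>A k (pA s) a = \<sigma>\<^sub>A k (pA t) a" "\<sigma>\<^sub>B k (pB s) b = \<sigma>\<^sub>B k (pB t) b"
      using aV bV by (simp_all add: v \<sigma>_encode)
    then show "s = t" using ia[OF st(1,2)] ib[OF st(1,2)] p_eqD st F by blast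
  qed
  moreover have "v \<in> V k" using v aV bV by (simp add: encode_V)
  ultimately show "v \<in> good_points G F (V k) (\<sigma> k)" by (simp add: good_points_def)
qed

lemma card_product_complement:
  assumes a: "real (card (V\<^sub>A k - X)) \<le> \<delta> * real (card (V\<^sub>A k))"
    and b: "real (card (V\<^sub>B k - Y)) \<le> \<delta> * real (card (V\<^sub>B k))"
  shows "real (card (V k - prod_encode ` (X \<times> Y))) \<le> 2 * \<delta> * real (card (V k))"
proof -
  let ?U = "(V\<^sub>A k - X) \<times> V\<^sub>B k \<union> V\<^sub>A k \<times> (V\<^sub>B k - Y)"
  have fin: "finite ?U" using finite_VAB by simp
  have "V k - prod_encode ` (X \<times> Y) \<subseteq> prod_encode ` ?U" by (auto simp: V_def)
  then have "card (V k - prod_encode ` (X \<times> Y)) \<le> card (prod_encode ` ?U)" using fin by (intro card_mono) auto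
  also have "\<dots> \<le> card ((V\<^sub>A k - X) \<times> V\<^sub>B k) + card (V\<^sub>A k \<times> (V\<^sub>B k - Y))"
    unfolding card_encode by (rule card_Un_le)
  finally have "real (card (V k - prod_encode ` (X \<times> Y)))
      \<le> real (card ((V\<^sub>A k - X) \<times> V\<^sub>B k) + card (V\<^sub>A k \<times> (V\<^sub>B k - Y)))" by (rule of_nat_mono)
  also have "\<dots> = real (card (V\<^sub>A k - X)) * real (card (V\<^sub>B k)) + real (card (V\<^sub>A k)) * real (card (V\<^sub>B k - Y))"
    by (simp add: card_cartesian_product)
  also have "\<dots> \<le> \<delta> * real (card (V\<^sub>A k)) * real (card (V\<^sub>B k)) + real (card (V\<^sub>A k)) * (\<delta> * real (card (V\<^sub>B k)))"
    using a b by (intro add_mono mult_right_mono mult_left_mono) auto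
  finally show ?thesis by (simp add: card_V algebra_simps)
qed

lemma sofic_sequence_product: "sofic_approximation_sequence G V \<sigma>"
  unfolding sofic_approximation_sequence_def
proof (intro conjI allI impI, rule sofic_approximation_product, elim conjE)
  fix F \<delta> assume F: "finite F" "F \<subseteq> carrier G" and \<delta>: "(0::real) < \<delta>"
  have d: "0 < \<delta> / 2" using \<delta> by simp
  have pF: "finite (pA ` F)" "pA ` F \<subseteq> carrier A" "finite (pB ` F)" "pB ` F \<subseteq> carrier B"
    using F p_closed by auto
  show "\<forall>\<^sub>F k in sequentially. good_approximation G F \<delta> (V k) (\<sigma> k)"
    using eventually_good_points[OF seqA pF(1,2) d] eventually_good_points[OF seqB pF(3,4) d]
  proof eventually_elim
    case (elim k)
    let ?A = "good_points A (pA ` F) (V\<^sub>A k) (\<sigma>\<^sub>A k)" and ?B = "good_points B (pB ` F) (V\<^sub>B k) (\<sigma>\<^sub>B k)"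
    have fV: "finite (V k)" "V k \<noteq> {}" using finite_VAB by (simp_all add: V_def)
    have "card (V k - good_points G F (V k) (\<sigma> k)) \<le> card (V k - prod_encode ` (?A \<times> ?B))"
      using good_product[OF F(2), of k] fV by (intro card_mono) auto
    then have "real (card (V k - good_points G F (V k) (\<sigma> k))) \<le> 2 * (\<delta> / 2) * real (card (V k))"
      using card_product_complement[OF elim] by linarith
    then show ?case by (intro good_approximation_of_good_points fV) simp
  qed
qed

text \<open>In the fibre over z every arrow labelled by a letter of \<open>E\<^sub>0\<close> belongs
  to D, so reading a word letter by letter is walking along edges. An inverse letter is an arrow
  traversed backwards.\<close>

lemma linked_in_fibre:
  assumes E0: "E\<^sub>0 \<subseteq> carrier A" and a: "a \<in> good_points A (words A E\<^sub>0 (Suc m)) (V\<^sub>A k) (\<sigma>\<^sub>A k)"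
    and z: "z \<in> V\<^sub>B k" "\<sigma>\<^sub>B k \<one>\<^bsub>B\<^esub> z = z"
    and D: "\<And>e u. e \<in> E\<^sub>0 \<Longrightarrow> u \<in> V\<^sub>A k \<Longrightarrow> (lift e \<one>\<^bsub>B\<^esub>, prod_encode (u, z)) \<in> D"
  shows "i \<le> m \<Longrightarrow> p \<in> words A E\<^sub>0 i \<Longrightarrow> linked (\<sigma> k) D i (prod_encode (a, z)) (prod_encode (\<sigma>\<^sub>A k p a, z))"
proof (induction i arbitrary: p)
  interpret a: sofic_approx A "V\<^sub>A k" "\<sigma>\<^sub>A k" by (rule sofic_A)
  case 0
  then show ?case using a.good_words_one[OF a] by (simp add: linked_refl)
next
  interpret a: sofic_approx A "V\<^sub>A k" "\<sigma>\<^sub>A k" by (rule sofic_A)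
  case (Suc i)
  have aV: "a \<in> V\<^sub>A k" using a by (rule a.good_in_V)
  have edge: "linked (\<sigma> k) D 1 (prod_encode (u, z)) (prod_encode (\<sigma>\<^sub>A k e u, z))" if "e \<in> E\<^sub>0" "u \<in> V\<^sub>A k" for e u
  proof -
    have "\<sigma> k (lift e \<one>\<^bsub>B\<^esub>) (prod_encode (u, z)) = prod_encode (\<sigma>\<^sub>A k e u, z)"
      using lift[of e "\<one>\<^bsub>B\<^esub>"] that E0 z by (simp add: \<sigma>_encode subsetD)
    then show ?thesis using linked_edge[OF D[OF that], of "\<sigma> k"] by simp
  qed
  from Suc.prems(2) consider "p \<in> words A E\<^sub>0 i" | e y where "e \<in> E\<^sub>0" "y \<in> words A E\<^sub>0 i" "p = e \<otimes>\<^bsub>A\<^esub> y"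
    | e y where "e \<in> E\<^sub>0" "y \<in> words A E\<^sub>0 i" "p = inv\<^bsub>A\<^esub> e \<otimes>\<^bsub>A\<^esub> y"
    by (auto simp: words.simps)
  then show ?case
  proof cases
    case 1
    then have "linked (\<sigma> k) D i (prod_encode (a, z)) (prod_encode (\<sigma>\<^sub>A k p a, z))" using Suc by simp
    then show ?thesis by (rule linked_mono) auto
  next
    case 2
    have yc: "y \<in> carrier A" using A.words_closed'[OF E0 2(2)] .
    have l: "linked (\<sigma> k) D i (prod_encode (a, z)) (prod_encode (\<sigma>\<^sub>A k y a, z))" using Suc 2 by simp
    have "\<sigma>\<^sub>A k p a = \<sigma>\<^sub>A k e (\<sigma>\<^sub>A k y a)"
      unfolding 2(3) by (rule a.good_words_mult[OF a, of _ 1 _ i, symmetric]) (use 2 Suc A.in_words_1[OF E0] in auto)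
    then have "linked (\<sigma> k) D 1 (prod_encode (\<sigma>\<^sub>A k y a, z)) (prod_encode (\<sigma>\<^sub>A k p a, z))"
      using edge[OF 2(1) a.\<sigma>_closed[OF yc aV]] by simp
    then show ?thesis using linked_trans[OF l] by fastforce
  next
    case 3
    have ec: "e \<in> carrier A" using 3 E0 by auto
    have yc: "y \<in> carrier A" using A.words_closed'[OF E0 3(2)] .
    have l: "linked (\<sigma> k) D i (prod_encode (a, z)) (prod_encode (\<sigma>\<^sub>A k y a, z))" using Suc 3 by simp
    have "\<sigma>\<^sub>A k e (\<sigma>\<^sub>A k p a) = \<sigma>\<^sub>A k (e \<otimes>\<^bsub>A\<^esub> p) a"
      by (rule a.good_words_mult[OF a, of _ 1 _ "Suc i"]) (use 3 Suc A.in_words_1[OF E0] in auto)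
    also have "e \<otimes>\<^bsub>A\<^esub> p = y" using ec yc by (simp add: 3(3) A.m_assoc[symmetric])
    finally have "\<sigma>\<^sub>A k y a = \<sigma>\<^sub>A k e (\<sigma>\<^sub>A k p a)" by simp
    moreover have "\<sigma>\<^sub>A k p a \<in> V\<^sub>A k" using a.\<sigma>_closed[OF A.words_closed'[OF E0 Suc.prems(2)] aV] .
    ultimately have "linked (\<sigma> k) D 1 (prod_encode (\<sigma>\<^sub>A k y a, z)) (prod_encode (\<sigma>\<^sub>A k p a, z))"
      using linked_sym[OF edge[OF 3(1), of "\<sigma>\<^sub>A k p a"]] by simp
    then show ?thesis using linked_trans[OF l] by fastforce
  qed
qed

text \<open>The graph consists of full fibres over a maximal R-separated set Z in the second factor.
  Z has density at most 1 / |R|, which makes the cost small, and the elements inv r r' in the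
  B-direction spread the fibres over V. Only directions inside the fibres are linked at this
  stage.\<close>

lemma sparsely_linked_on_factor:
  assumes E0: "finite E\<^sub>0" "E\<^sub>0 \<subseteq> carrier A" and inf: "infinite (carrier B)"
    and c: "\<And>g. g \<in> carrier G \<Longrightarrow> 0 \<le> (c g :: real)" and \<eta>: "0 < \<eta>"
  shows "\<exists>S. finite S \<and> S \<subseteq> carrier G \<and>
    sparsely_linked_on G V \<sigma> c \<eta> S {g \<in> carrier G. pB g = \<one>\<^bsub>B\<^esub> \<and> pA g \<in> generate A E\<^sub>0}"
proof -
  define E where "E = (\<lambda>e. lift e \<one>\<^bsub>B\<^esub>) ` E\<^sub>0"
  have E: "finite E" "E \<subseteq> carrier G" using E0 lift(1) by (auto simp: E_def)
  obtain m :: nat where m: "sum c E / \<eta> < real m" using reals_Archimedean2 by blast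
  obtain R where R: "R \<subseteq> carrier B" "finite R" "card R = Suc m"
    using infinite_arbitrarily_large[OF inf, of "Suc m"] by blast
  have Rne: "R \<noteq> {}" using R by auto
  define S where "S = (\<lambda>(r, r'). lift \<one>\<^bsub>A\<^esub> (inv\<^bsub>B\<^esub> r \<otimes>\<^bsub>B\<^esub> r')) ` (R \<times> R)"
  have S: "finite S" "S \<subseteq> carrier G" using R lift(1) by (auto simp: S_def subset_iff)
  have "sparsely_linked_on G V \<sigma> c \<eta> S {g \<in> carrier G. pB g = \<one>\<^bsub>B\<^esub> \<and> pA g \<in> generate A E\<^sub>0}"
    unfolding sparsely_linked_on_def sparsely_linked_def
  proof (intro allI impI, elim conjE)
    fix T and \<epsilon> :: real
    assume T: "finite T" "T \<subseteq> {g \<in> carrier G. pB g = \<one>\<^bsub>B\<^esub> \<and> pA g \<in> generate A E\<^sub>0}" and \<epsilon>: "0 < \<epsilon>"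
    have "\<exists>i. \<forall>t\<in>T. pA t \<in> words A E\<^sub>0 i"
      using T
    proof (induction T rule: finite_induct)
      case (insert t T)
      then obtain i where i: "\<forall>t\<in>T. pA t \<in> words A E\<^sub>0 i" by auto
      obtain j where j: "pA t \<in> words A E\<^sub>0 j" using insert.prems by (auto simp: A.generate_eq_words[OF E0(2)])
      have "words A E\<^sub>0 i \<subseteq> words A E\<^sub>0 (max i j)" "words A E\<^sub>0 j \<subseteq> words A E\<^sub>0 (max i j)"
        by (rule A.words_mono, simp)+
      then show ?case using i j by (intro exI[of _ "max i j"]) auto
    qed simp
    then obtain C where C: "\<forall>t\<in>T. pA t \<in> words A E\<^sub>0 C" by blast
    have d: "0 < \<epsilon> / 2" using \<epsilon> by simp
    note gA = eventually_good_points[OF seqA A.finite_words[OF E0(1)] A.words_closed[OF E0(2)] d, of "Suc C"]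
    note gB = eventually_good_points[OF seqB B.finite_words[OF R(2)] B.words_closed[OF R(1)] d, of 3]
    show "\<exists>F C. finite F \<and> F \<subseteq> carrier G \<and>
       (\<forall>\<^sub>F k in sequentially. \<exists>W D. W \<subseteq> V k \<and> D \<subseteq> F \<times> V k \<and>
          real (card (V k - (\<Union>s\<in>S. \<sigma> k s ` W))) \<le> \<epsilon> * real (card (V k)) \<and>
          (\<Sum>(g, v)\<in>D. c g) \<le> (\<eta> + \<epsilon>) * real (card (V k)) \<and>
          (\<forall>w\<in>W. \<forall>t\<in>T. \<sigma> k t w \<in> W \<longrightarrow> linked (\<sigma> k) D C w (\<sigma> k t w)))"
    proof (intro exI[of _ E] exI[of _ C] conjI E)
      show "\<forall>\<^sub>F k in sequentially. \<exists>W D. W \<subseteq> V k \<and> D \<subseteq> E \<times> V k \<and>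
          real (card (V k - (\<Union>s\<in>S. \<sigma> k s ` W))) \<le> \<epsilon> * real (card (V k)) \<and>
          (\<Sum>(g, v)\<in>D. c g) \<le> (\<eta> + \<epsilon>) * real (card (V k)) \<and>
          (\<forall>w\<in>W. \<forall>t\<in>T. \<sigma> k t w \<in> W \<longrightarrow> linked (\<sigma> k) D C w (\<sigma> k t w))"
        using gA gB
      proof eventually_elim
        case (elim k)
        interpret a: sofic_approx A "V\<^sub>A k" "\<sigma>\<^sub>A k" by (rule sofic_A)
        interpret b: sofic_approx B "V\<^sub>B k" "\<sigma>\<^sub>B k" by (rule sofic_B)
        let ?GA = "a.good (words A E\<^sub>0 (Suc C))" and ?GB = "b.good (words B R 3)"
        let ?N = "\<lambda>z. (\<lambda>r. \<sigma>\<^sub>B k r z) ` R"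
        have "\<exists>Z\<subseteq>?GB. (\<forall>z\<in>Z. \<forall>z'\<in>Z. z \<noteq> z' \<longrightarrow> ?N z \<inter> ?N z' = {}) \<and> (\<forall>w\<in>?GB. \<exists>z\<in>Z. ?N w \<inter> ?N z \<noteq> {})"
          by (rule exists_maximal_separated) (use b.finite_good Rne in auto)
        then obtain Z where Z: "Z \<subseteq> ?GB" and sep: "\<forall>z\<in>Z. \<forall>z'\<in>Z. z \<noteq> z' \<longrightarrow> ?N z \<inter> ?N z' = {}"
          and max: "\<forall>w\<in>?GB. \<exists>z\<in>Z. ?N w \<inter> ?N z \<noteq> {}" by (elim exE conjE) (rule that)
        have RW: "R \<subseteq> words B R 1" using B.in_words_1[OF R(1)] by blast
        have ZV: "z \<in> V\<^sub>B k" if "z \<in> Z" for z using b.good_in_V that Z by blast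
        have finZ: "finite Z" using Z b.finite_good by (rule finite_subset)
        have cardZ: "card Z * card R \<le> card (V\<^sub>B k)"
        proof (rule b.card_separated_le[where A = "words B R 3"])
          show "R \<subseteq> words B R 3" by (rule order_trans[OF RW B.words_mono]) simp
          show "?N z \<subseteq> V\<^sub>B k" if "z \<in> Z" for z using ZV[OF that] R b.\<sigma>_closed by auto
        qed (use Z R finite_VAB B.words_closed[OF R(1)] sep in auto)
        define W where "W = prod_encode ` (?GA \<times> Z)"
        define D where "D = E \<times> prod_encode ` (V\<^sub>A k \<times> Z)"
        have W: "W \<subseteq> V k" using ZV a.good_in_V by (auto simp: W_def intro!: encode_V)
        have D: "D \<subseteq> E \<times> V k" using ZV by (auto simp: D_def intro!: encode_V)
        have cost: "(\<Sum>(g, v)\<in>D. c g) \<le> (\<eta> + \<epsilon>) * real (card (V k))"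
        proof -
          have "(\<Sum>(g, v)\<in>D. c g) \<le> sum c E * real (card (prod_encode ` (V\<^sub>A k \<times> Z)))"
            unfolding D_def by (rule sum_case_prod_fst_le) (use E finZ finite_VAB c in auto)
          also have "\<dots> = sum c E * real (card Z) * real (card (V\<^sub>A k))"
            by (simp add: card_encode card_cartesian_product)
          also have "\<dots> \<le> \<eta> * real (card (V\<^sub>B k)) * real (card (V\<^sub>A k))"
          proof (rule mult_right_mono)
            have "sum c E \<le> \<eta> * real (Suc m)" using m \<eta> by (simp add: pos_divide_less_eq algebra_simps)
            then have "sum c E * real (card Z) \<le> \<eta> * real (Suc m) * real (card Z)" by (intro mult_right_mono) auto
            also have "\<dots> = \<eta> * real (card Z * card R)" using R(3) by (simp add: algebra_simps)
            also have "\<dots> \<le> \<eta> * real (card (V\<^sub>B k))" using cardZ \<eta> by (intro mult_left_mono of_nat_mono) auto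
            finally show "sum c E * real (card Z) \<le> \<eta> * real (card (V\<^sub>B k))" .
          qed simp
          also have "\<dots> = \<eta> * real (card (V k))" by (simp add: card_V)
          also have "\<dots> \<le> (\<eta> + \<epsilon>) * real (card (V k))" using \<epsilon> by (intro mult_right_mono) auto
          finally show ?thesis .
        qed
        have "prod_encode ` (?GA \<times> ?GB) \<subseteq> (\<Union>s\<in>S. \<sigma> k s ` W)"
        proof
          fix v assume "v \<in> prod_encode ` (?GA \<times> ?GB)"
          then obtain u w where v: "v = prod_encode (u, w)" and u: "u \<in> ?GA" and w: "w \<in> ?GB" by blast
          obtain z r r' where z: "z \<in> Z" "r \<in> R" "r' \<in> R" "\<sigma>\<^sub>B k r w = \<sigma>\<^sub>B k r' z" using max w by blast
          have zg: "z \<in> ?GB" using z Z by blast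
          have "w = \<sigma>\<^sub>B k (inv\<^bsub>B\<^esub> r) (\<sigma>\<^sub>B k r w)"
            by (rule b.good_words_inv(1)[OF w, of r 1, symmetric]) (use z RW R in auto)
          also have "\<dots> = \<sigma>\<^sub>B k (inv\<^bsub>B\<^esub> r \<otimes>\<^bsub>B\<^esub> r') z"
            unfolding z(4) by (rule b.good_words_mult[OF zg, of _ 1 _ 1]) (use z RW B.words_inv[OF R(1), of r 1] in auto)
          finally have wz: "w = \<sigma>\<^sub>B k (inv\<^bsub>B\<^esub> r \<otimes>\<^bsub>B\<^esub> r') z" .
          have qc: "inv\<^bsub>B\<^esub> r \<otimes>\<^bsub>B\<^esub> r' \<in> carrier B" using z R by auto
          have "\<sigma> k (lift \<one>\<^bsub>A\<^esub> (inv\<^bsub>B\<^esub> r \<otimes>\<^bsub>B\<^esub> r')) (prod_encode (u, z)) = v"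
            using lift[OF A.one_closed qc] a.good_in_V[OF u] ZV[OF z(1)] a.good_words_one[OF u]
            by (simp add: \<sigma>_encode v wz[symmetric])
          moreover have "prod_encode (u, z) \<in> W" using u z by (auto simp: W_def)
          moreover have "lift \<one>\<^bsub>A\<^esub> (inv\<^bsub>B\<^esub> r \<otimes>\<^bsub>B\<^esub> r') \<in> S" using z by (force simp: S_def)
          ultimately show "v \<in> (\<Union>s\<in>S. \<sigma> k s ` W)" by blast
        qed
        then have "card (V k - (\<Union>s\<in>S. \<sigma> k s ` W)) \<le> card (V k - prod_encode ` (?GA \<times> ?GB))"
          using finite_VAB by (intro card_mono) (auto simp: V_def)
        then have cov: "real (card (V k - (\<Union>s\<in>S. \<sigma> k s ` W))) \<le> \<epsilon> * real (card (V k))"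
          using card_product_complement[OF elim] by linarith
        have link: "linked (\<sigma> k) D C w (\<sigma> k t w)" if w: "w \<in> W" and t: "t \<in> T" for w t
        proof -
          obtain u z where uz: "w = prod_encode (u, z)" "u \<in> ?GA" "z \<in> Z" using w by (auto simp: W_def)
          have z1: "\<sigma>\<^sub>B k \<one>\<^bsub>B\<^esub> z = z" using uz Z by (intro b.good_words_one) auto
          have "\<sigma> k t w = prod_encode (\<sigma>\<^sub>A k (pA t) u, z)"
            using t T(2) z1 a.good_in_V[OF uz(2)] ZV[OF uz(3)] by (auto simp: uz(1) \<sigma>_encode)
          moreover have "linked (\<sigma> k) D C (prod_encode (u, z)) (prod_encode (\<sigma>\<^sub>A k (pA t) u, z))"
            by (rule linked_in_fibre[OF E0(2) uz(2) ZV[OF uz(3)] z1])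
              (use C t uz in \<open>auto simp: D_def E_def\<close>)
          ultimately show ?thesis using uz by simp
        qed
        show ?case using W D cov cost link by (intro exI[of _ W] exI[of _ D] conjI ballI impI)
      qed
    qed
  qed
  then show ?thesis using S by blast
qed

text \<open>Two applications of the step for normalized sets. The failure of local finiteness gives
  an infinite, finitely generated subgroup A0 of A. A0 x 1 is normalized by A0 x B, which contains 1
  x B, and 1 x B is infinite and normal in the whole group.\<close>

lemma sparsely_connected_product:
  assumes nlf: "\<not> locally_finite_group A" and inf: "infinite (carrier B)"
  shows "sparsely_connected G V \<sigma>"
  unfolding sparsely_connected_def
proof (intro allI impI, elim conjE)
  fix c :: "'a \<Rightarrow> real" and \<eta> :: real assume c: "\<forall>g\<in>carrier G. 0 \<le> c g" and \<eta>: "0 < \<eta>"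
  have c': "0 \<le> c g" if "g \<in> carrier G" for g using c that by simp
  obtain E0 where E0: "finite E0" "E0 \<subseteq> carrier A" "infinite (generate A E0)"
    using nlf by (auto simp: locally_finite_group_def)
  let ?A0 = "generate A E0"
  have sA0: "subgroup ?A0 A" by (rule A.generate_is_subgroup[OF E0(2)])
  let ?L0 = "{g \<in> carrier G. pB g = \<one>\<^bsub>B\<^esub> \<and> pA g \<in> ?A0}"
  let ?M0 = "{g \<in> carrier G. pA g \<in> ?A0}"
  let ?L1 = "{g \<in> carrier G. pA g = \<one>\<^bsub>A\<^esub>}"
  have "\<exists>S. finite S \<and> S \<subseteq> carrier G \<and> sparsely_linked_on G V \<sigma> c \<eta> S ?L0"
    by (rule sparsely_linked_on_factor[OF E0(1,2) inf _ \<eta>]) (rule c')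
  then obtain S where S: "finite S" "S \<subseteq> carrier G" "sparsely_linked_on G V \<sigma> c \<eta> S ?L0" by blast
  have A0c: "a \<in> carrier A" if "a \<in> ?A0" for a using that sA0 subgroup.subset by blast
  have "sparsely_linked_on G V \<sigma> c \<eta> S ?M0"
  proof (rule sparsely_linked_on_normal[OF sofic_sequence_product is_group _ _ _ _ _ _ S])
    show "infinite ?L0"
    proof
      assume "finite ?L0"
      then have "finite (pA ` ?L0)" by simp
      moreover have "?A0 \<subseteq> pA ` ?L0"
      proof
        fix a assume a: "a \<in> ?A0"
        then show "a \<in> pA ` ?L0" using lift[OF A0c[OF a] B.one_closed] by (intro image_eqI[of _ _ "lift a \<one>\<^bsub>B\<^esub>"]) auto
      qed
      ultimately show False using E0(3) finite_subset by blast
    qed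
    show "inv x \<otimes> y \<in> ?L0" if "x \<in> ?L0" "y \<in> ?L0" for x y
      using that sA0 by (auto simp: p_mult p_inv subgroup.m_closed subgroup.m_inv_closed)
    show "h \<otimes> x \<otimes> inv h \<in> ?L0" if "h \<in> ?M0" "x \<in> ?L0" for h x
      using that sA0 p_closed by (auto simp: p_mult p_inv subgroup.m_closed subgroup.m_inv_closed)
  qed (use c' in auto)
  then have P1: "sparsely_linked_on G V \<sigma> c \<eta> S ?L1"
    by (rule sparsely_linked_on_mono) (use subgroup.one_closed[OF sA0] in auto)
  have "sparsely_linked_on G V \<sigma> c \<eta> S (carrier G)"
  proof (rule sparsely_linked_on_normal[OF sofic_sequence_product is_group _ _ _ _ _ _ S(1,2) P1])
    show "infinite ?L1"
    proof
      assume "finite ?L1"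
      then have "finite (pB ` ?L1)" by simp
      moreover have "carrier B \<subseteq> pB ` ?L1"
      proof
        fix b assume b: "b \<in> carrier B"
        then show "b \<in> pB ` ?L1" using lift[OF A.one_closed b] by (intro image_eqI[of _ _ "lift \<one>\<^bsub>A\<^esub> b"]) auto
      qed
      ultimately show False using inf finite_subset by blast
    qed
    show "inv x \<otimes> y \<in> ?L1" if "x \<in> ?L1" "y \<in> ?L1" for x y
      using that by (auto simp: p_mult p_inv)
    show "h \<otimes> x \<otimes> inv h \<in> ?L1" if "h \<in> carrier G" "x \<in> ?L1" for h x
      using that p_closed by (auto simp: p_mult p_inv)
  qed (use c' in auto)
  then show "\<exists>S. finite S \<and> S \<subseteq> carrier G \<and> sparsely_linked_on G V \<sigma> c \<eta> S (carrier G)"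
    using S(1,2) by blast
qed

end

text \<open>In the w-normal case any sofic approximation sequence serves. In the product case the
  sequence is itself a product, with the factors ordered so that the first is not locally
  finite.\<close>

lemma exists_sparsely_connected_sequence:
  assumes G: "sofic_group G"
    and cases: "has_w_normal_amenable_subgroup G \<or> is_product_of_infinite_sofic_groups G"
  shows "\<exists>V \<sigma>. sofic_approximation_sequence G V \<sigma> \<and> sparsely_connected G V \<sigma>"
  using cases
proof
  assume "has_w_normal_amenable_subgroup G"
  then show ?thesis
    using G sparsely_connected_of_w_normal_amenable unfolding sofic_group_def by blast
next
  have prod: ?thesis if AB: "sofic_group A" "sofic_group B" "infinite (carrier B)" "\<not> locally_finite_group A"
    "G \<cong> A \<times>\<times> B" for A :: "nat monoid" and B :: "nat monoid"
  proof -
    obtain f where f: "f \<in> iso G (A \<times>\<times> B)" using AB(5) by (auto simp: is_iso_def)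
    obtain VA \<sigma>A where A: "group A" "sofic_approximation_sequence A VA \<sigma>A" using AB(1) unfolding sofic_group_def by blast
    obtain VB \<sigma>B where B: "group B" "sofic_approximation_sequence B VB \<sigma>B" using AB(2) unfolding sofic_group_def by blast
    interpret product_approx A B G f VA VB \<sigma>A \<sigma>B
      using A B G f by (simp add: product_approx_def product_approx_axioms_def sofic_group_def)
    show ?thesis using sofic_sequence_product sparsely_connected_product[OF AB(4,3)] by blast
  qed
  assume "is_product_of_infinite_sofic_groups G"
  then obtain A B :: "nat monoid" where A: "sofic_group A" "infinite (carrier A)"
    and B: "sofic_group B" "infinite (carrier B)" and nlf: "\<not> locally_finite_group A \<or> \<not> locally_finite_group B"
    and iso: "G \<cong> A \<times>\<times> B"
    unfolding is_product_of_infinite_sofic_groups_def by (elim exE conjE) (rule that)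
  have "G \<cong> B \<times>\<times> A"
    using iso DirProd_commute_iso[of A B] iso_trans by blast
  then show ?thesis using prod[OF A(1) B] prod[OF B(1) A] nlf iso by blast
qed

section \<open>Transferring models along an orbit equivalence\<close>

lemma exists_permutation_extending:
  assumes V: "finite V" and A: "A \<subseteq> V" "f ` A \<subseteq> V" "inj_on f A"
  shows "\<exists>\<pi>. \<pi> permutes V \<and> (\<forall>v\<in>A. \<pi> v = f v)"
proof -
  have fin: "finite A" "finite (f ` A)" using A V finite_subset by auto
  have "card (V - A) = card (V - f ` A)"
    using card_Diff_subset[OF fin(1) A(1)] card_Diff_subset[OF fin(2) A(2)] card_image[OF A(3)] by simp
  then obtain g where g: "bij_betw g (V - A) (V - f ` A)"
    using finite_same_card_bij[of "V - A" "V - f ` A"] V by auto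
  have fA: "bij_betw f A (f ` A)" using A(3) by (rule inj_on_imp_bij_betw)
  define \<pi> where "\<pi> v = (if v \<in> A then f v else if v \<in> V then g v else v)" for v
  have "bij_betw \<pi> A (f ` A)" using fA by (rule bij_betw_cong[THEN iffD1, rotated]) (simp add: \<pi>_def)
  moreover have "bij_betw \<pi> (V - A) (V - f ` A)"
    using g by (rule bij_betw_cong[THEN iffD1, rotated]) (simp add: \<pi>_def)
  ultimately have "bij_betw \<pi> (A \<union> (V - A)) (f ` A \<union> (V - f ` A))"
    by (rule bij_betw_combine) auto
  moreover have "A \<union> (V - A) = V" "f ` A \<union> (V - f ` A) = V" using A by auto
  ultimately have "bij_betw \<pi> V V" by simp
  then have "\<pi> permutes V" by (rule bij_imp_permutes) (use A in \<open>auto simp: \<pi>_def\<close>)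
  then show ?thesis by (intro exI[of _ \<pi>]) (simp add: \<pi>_def)
qed

text \<open>The algebra of an orbit equivalence, pulled back to X: \<open>b\<close> is the action of
  H transported by \<open>\<Phi>\<close>, and at each x the maps \<open>\<kappa> _ x\<close> and
  \<open>l _ x\<close> are mutually inverse bijections between G and H.\<close>

locale cocycle_pair = group G + H: group H for G :: "('a, 'm) monoid_scheme" (structure)
    and H :: "('b, 'n) monoid_scheme" +
  fixes X :: "'x set" and d and Y :: "'y set" and d' and \<alpha> \<beta> b \<Phi> and \<kappa> :: "'a \<Rightarrow> 'x \<Rightarrow> 'b"
    and l :: "'b \<Rightarrow> 'x \<Rightarrow> 'a"
  assumes MX: "Metric_space X d" and MY: "Metric_space Y d'"
    and \<alpha>_closed: "\<And>g x. g \<in> carrier G \<Longrightarrow> x \<in> X \<Longrightarrow> \<alpha> g x \<in> X"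
    and \<alpha>_one: "\<And>x. x \<in> X \<Longrightarrow> \<alpha> \<one> x = x"
    and \<alpha>_mult: "\<And>g h x. g \<in> carrier G \<Longrightarrow> h \<in> carrier G \<Longrightarrow> x \<in> X \<Longrightarrow> \<alpha> (g \<otimes> h) x = \<alpha> g (\<alpha> h x)"
    and b_closed: "\<And>h x. h \<in> carrier H \<Longrightarrow> x \<in> X \<Longrightarrow> b h x \<in> X"
    and b_one: "\<And>x. x \<in> X \<Longrightarrow> b \<one>\<^bsub>H\<^esub> x = x"
    and b_mult: "\<And>g h x. g \<in> carrier H \<Longrightarrow> h \<in> carrier H \<Longrightarrow> x \<in> X \<Longrightarrow> b (g \<otimes>\<^bsub>H\<^esub> h) x = b g (b h x)"
    and \<Phi>_closed: "\<And>x. x \<in> X \<Longrightarrow> \<Phi> x \<in> Y"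
    and \<beta>_\<Phi>: "\<And>h x. h \<in> carrier H \<Longrightarrow> x \<in> X \<Longrightarrow> \<beta> h (\<Phi> x) = \<Phi> (b h x)"
    and \<kappa>_closed: "\<And>g x. g \<in> carrier G \<Longrightarrow> x \<in> X \<Longrightarrow> \<kappa> g x \<in> carrier H"
    and l_closed: "\<And>h x. h \<in> carrier H \<Longrightarrow> x \<in> X \<Longrightarrow> l h x \<in> carrier G"
    and \<kappa>_mult: "\<And>g h x. g \<in> carrier G \<Longrightarrow> h \<in> carrier G \<Longrightarrow> x \<in> X \<Longrightarrow>
      \<kappa> (g \<otimes> h) x = \<kappa> g (\<alpha> h x) \<otimes>\<^bsub>H\<^esub> \<kappa> h x"
    and b_\<kappa>: "\<And>g x. g \<in> carrier G \<Longrightarrow> x \<in> X \<Longrightarrow> b (\<kappa> g x) x = \<alpha> g x"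
    and l_\<kappa>: "\<And>g x. g \<in> carrier G \<Longrightarrow> x \<in> X \<Longrightarrow> l (\<kappa> g x) x = g"
    and \<kappa>_l: "\<And>h x. h \<in> carrier H \<Longrightarrow> x \<in> X \<Longrightarrow> \<kappa> (l h x) x = h"
begin

lemma \<alpha>_l: "h \<in> carrier H \<Longrightarrow> x \<in> X \<Longrightarrow> \<alpha> (l h x) x = b h x"
  using b_\<kappa>[OF l_closed] \<kappa>_l by metis

text \<open>The cocycle identity for \<open>l\<close> is derived from that of
  \<open>\<kappa>\<close>: both sides have the same image under \<open>\<kappa> _ x\<close>, which
  \<open>l _ x\<close> inverts.\<close>

lemma l_mult:
  assumes "g \<in> carrier H" "h \<in> carrier H" "x \<in> X"
  shows "l (g \<otimes>\<^bsub>H\<^esub> h) x = l g (b h x) \<otimes> l h x"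
proof -
  have c: "b h x \<in> X" "l h x \<in> carrier G" "l g (b h x) \<in> carrier G"
    using assms b_closed l_closed by auto
  have "\<kappa> (l g (b h x) \<otimes> l h x) x = g \<otimes>\<^bsub>H\<^esub> h"
    using assms c by (simp add: \<kappa>_mult \<alpha>_l \<kappa>_l)
  then have "l (\<kappa> (l g (b h x) \<otimes> l h x) x) x = l (g \<otimes>\<^bsub>H\<^esub> h) x" by simp
  then show ?thesis using assms c by (simp add: l_\<kappa>)
qed

lemma \<kappa>_one: "x \<in> X \<Longrightarrow> \<kappa> \<one> x = \<one>\<^bsub>H\<^esub>"
  using \<kappa>_mult[of \<one> \<one> x] \<kappa>_closed[of \<one> x] \<alpha>_one[of x] by (simp add: H.l_cancel_one)

lemma \<kappa>_inv:
  assumes "g \<in> carrier G" "x \<in> X"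
  shows "\<kappa> (inv g) (\<alpha> g x) = inv\<^bsub>H\<^esub> (\<kappa> g x)"
proof -
  have "\<kappa> (inv g) (\<alpha> g x) \<otimes>\<^bsub>H\<^esub> \<kappa> g x = \<one>\<^bsub>H\<^esub>"
    using \<kappa>_mult[of "inv g" g x] assms \<kappa>_one by simp
  then show ?thesis using assms \<kappa>_closed \<alpha>_closed by (intro H.inv_equality[symmetric]) auto
qed

lemma l_inv:
  assumes "h \<in> carrier H" "x \<in> X"
  shows "l (inv\<^bsub>H\<^esub> h) (b h x) = inv (l h x)"
proof -
  have "l \<one>\<^bsub>H\<^esub> x = \<one>" using l_\<kappa>[of \<one> x] \<kappa>_one assms by simp
  then have "l (inv\<^bsub>H\<^esub> h) (b h x) \<otimes> l h x = \<one>"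
    using l_mult[of "inv\<^bsub>H\<^esub> h" h x] assms by simp
  then show ?thesis using assms l_closed b_closed by (intro inv_equality[symmetric]) auto
qed

end

text \<open>\<open>\<Omega>\<close> is a family of models with a common exceptional set
  \<open>bad\<close> and common cocycle values on D, and \<open>\<phi>\<^sub>0\<close> is the member
  taken as reference. At scale \<open>\<tau>\<close> the cocycle values on the window are constant.
  The radius C + 4 accommodates path words of length up to C and words inv s g' s' of length
  3.\<close>

locale transfer = cocycle_pair G H X d Y d' \<alpha> \<beta> b \<Phi> \<kappa> l + sofic_approx G V \<sigma>
  for G :: "('a, 'm) monoid_scheme" (structure) and H :: "('b, 'n) monoid_scheme"
    and X :: "'x set" and d and Y :: "'y set" and d' and \<alpha> \<beta> b \<Phi> \<kappa> l
    and V :: "'v set" and \<sigma> +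
  fixes B S T E :: "'a set" and F FF HS :: "'b set" and C :: nat and \<tau> \<delta> \<epsilon> \<epsilon>' :: real
    and D :: "('a \<times> 'v) set" and W bad :: "'v set" and \<Omega> :: "('v \<Rightarrow> 'x) set" and \<phi>\<^sub>0 :: "'v \<Rightarrow> 'x"
  assumes B: "B \<subseteq> carrier G"
    and sub: "S \<subseteq> words G B 1" "T \<subseteq> words G B 1" "E \<subseteq> words G B 1"
    and D: "D \<subseteq> E \<times> V" and W: "W \<subseteq> V"
    and F: "F \<subseteq> FF" "FF \<subseteq> carrier H" and FF: "\<And>s t. s \<in> F \<Longrightarrow> t \<in> F \<Longrightarrow> s \<otimes>\<^bsub>H\<^esub> t \<in> FF"
    and l_words: "\<And>h x. h \<in> FF \<Longrightarrow> x \<in> X \<Longrightarrow> l h x \<in> words G B 1"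
    and HS: "HS \<subseteq> carrier H" "\<And>s x. s \<in> S \<Longrightarrow> x \<in> X \<Longrightarrow> \<kappa> s x \<in> HS"
    and l_T: "\<And>h h' f x. h \<in> HS \<Longrightarrow> h' \<in> HS \<Longrightarrow> f \<in> F \<Longrightarrow> x \<in> X \<Longrightarrow> l (inv\<^bsub>H\<^esub> h' \<otimes>\<^bsub>H\<^esub> (f \<otimes>\<^bsub>H\<^esub> h)) x \<in> T"
    and \<tau>_\<kappa>: "\<And>g x y. g \<in> words G B (C + 4) \<Longrightarrow> x \<in> X \<Longrightarrow> y \<in> X \<Longrightarrow> d x y < \<tau> \<Longrightarrow> \<kappa> g x = \<kappa> g y"
    and \<tau>_l: "\<And>h x y. h \<in> FF \<union> m_inv H ` FF \<Longrightarrow> x \<in> X \<Longrightarrow> y \<in> X \<Longrightarrow> d x y < \<tau> \<Longrightarrow> l h x = l h y"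
    and \<tau>_\<Phi>: "\<And>h x y. h \<in> HS \<Longrightarrow> x \<in> X \<Longrightarrow> y \<in> X \<Longrightarrow> d x y < \<tau> \<Longrightarrow> d' (\<Phi> (b h x)) (\<Phi> (b h y)) < \<delta>"
    and \<tau>_\<epsilon>: "\<tau> \<le> \<epsilon> / 4"
    and \<epsilon>': "\<And>h s x y. h \<in> HS \<Longrightarrow> s \<in> S \<Longrightarrow> x \<in> X \<Longrightarrow> y \<in> X \<Longrightarrow> d' (\<Phi> (b h x)) (\<Phi> (b h y)) < \<epsilon>' \<Longrightarrow>
        d (\<alpha> s x) (\<alpha> s y) < \<epsilon> / 4"
    and \<Omega>: "\<And>\<phi> v. \<phi> \<in> \<Omega> \<Longrightarrow> v \<in> V \<Longrightarrow> \<phi> v \<in> X" and \<phi>\<^sub>0: "\<phi>\<^sub>0 \<in> \<Omega>"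
    and eqv: "\<And>\<phi> v g. \<phi> \<in> \<Omega> \<Longrightarrow> v \<in> V \<Longrightarrow> v \<notin> bad \<Longrightarrow> g \<in> words G B (C + 4) \<Longrightarrow> d (\<phi> (\<sigma> g v)) (\<alpha> g (\<phi> v)) < \<tau>"
    and known: "\<And>\<phi> g v. \<phi> \<in> \<Omega> \<Longrightarrow> (g, v) \<in> D \<Longrightarrow> \<kappa> g (\<phi> v) = \<kappa> g (\<phi>\<^sub>0 v)"
    and link: "\<And>w t. w \<in> W \<Longrightarrow> t \<in> T \<Longrightarrow> \<sigma> t w \<in> W \<Longrightarrow> linked \<sigma> D C w (\<sigma> t w)"
begin

interpretation MX: Metric_space X d by (rule MX)

definition tame where "tame = good (words G B (C + 4)) - bad"

lemma tameD: "v \<in> tame \<Longrightarrow> v \<in> V" "v \<in> tame \<Longrightarrow> v \<notin> bad" "v \<in> tame \<Longrightarrow> v \<in> good (words G B (C + 4))"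
  by (auto simp: tame_def good_points_def)

lemma wordc: "g \<in> words G B i \<Longrightarrow> g \<in> carrier G"
  by (rule words_closed'[OF B])

lemma word_le: "g \<in> words G B i \<Longrightarrow> i \<le> j \<Longrightarrow> g \<in> words G B j"
  using words_mono by blast

lemma \<kappa>_model:
  assumes \<phi>: "\<phi> \<in> \<Omega>" and w: "w \<in> tame" and p: "p \<in> words G B (C + 4)" and g: "g \<in> words G B (C + 4)"
  shows "\<kappa> g (\<alpha> p (\<phi> w)) = \<kappa> g (\<phi> (\<sigma> p w))"
proof -
  have x: "\<phi> w \<in> X" "\<phi> (\<sigma> p w) \<in> X" "\<alpha> p (\<phi> w) \<in> X"
    using \<Omega>[OF \<phi>] tameD(1)[OF w] \<sigma>_closed[OF wordc[OF p]] \<alpha>_closed[OF wordc[OF p]] by auto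
  have "d (\<phi> (\<sigma> p w)) (\<alpha> p (\<phi> w)) < \<tau>" by (rule eqv[OF \<phi> tameD(1)[OF w] tameD(2)[OF w] p])
  then show ?thesis using \<tau>_\<kappa>[OF g x(2,3)] by simp
qed

text \<open>Induction along the path. The cocycle identity splits off the value on the new arrow,
  which D fixes for all models, once \<open>\<alpha> p (\<phi> w)\<close> is replaced by the nearby
  point \<open>\<phi> (\<sigma> p w)\<close>. For a reversed arrow its value is cancelled in
  H.\<close>

lemma path_word:
  assumes w: "w \<in> tame"
  shows "(w, u) \<in> edges \<sigma> D ^^ n \<Longrightarrow> n \<le> C \<Longrightarrow>
    \<exists>p\<in>words G B n. u = \<sigma> p w \<and> (\<forall>\<phi>\<in>\<Omega>. \<kappa> p (\<phi> w) = \<kappa> p (\<phi>\<^sub>0 w))"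
proof (induction n arbitrary: u)
  case 0
  have "\<sigma> \<one> w = w" using good_words_one[OF tameD(3)[OF w]] .
  then show ?case using 0 \<Omega> tameD(1)[OF w] \<phi>\<^sub>0 by (auto simp: \<kappa>_one)
next
  case (Suc n)
  then obtain u' where u': "(w, u') \<in> edges \<sigma> D ^^ n" "(u', u) \<in> edges \<sigma> D" by auto
  obtain p where p: "p \<in> words G B n" "u' = \<sigma> p w" and \<kappa>p: "\<forall>\<phi>\<in>\<Omega>. \<kappa> p (\<phi> w) = \<kappa> p (\<phi>\<^sub>0 w)"
    using Suc.IH[OF u'(1)] Suc.prems(2) by auto
  have n: "n \<le> C" using Suc.prems(2) by simp
  have pc: "p \<in> carrier G" using wordc[OF p(1)] .
  have p4: "p \<in> words G B (C + 4)" using word_le[OF p(1)] n by simp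
  from u'(2) obtain g v where gv: "(g, v) \<in> D" "u' = v \<and> u = \<sigma> g v \<or> u' = \<sigma> g v \<and> u = v"
    by (auto simp: edges_def)
  have g1: "g \<in> words G B 1" using gv(1) D sub by auto
  have gc: "g \<in> carrier G" using wordc[OF g1] .
  have g4: "g \<in> words G B (C + 4)" using word_le[OF g1] by simp
  have xw: "\<phi> w \<in> X" if "\<phi> \<in> \<Omega>" for \<phi> using \<Omega>[OF that tameD(1)[OF w]] .
  from gv(2) show ?case
  proof
    assume e: "u' = v \<and> u = \<sigma> g v"
    have "\<sigma> (g \<otimes> p) w = \<sigma> g (\<sigma> p w)"
      by (rule good_words_mult[OF tameD(3)[OF w] g1 p(1), symmetric]) (use n in auto)
    then have u: "u = \<sigma> (g \<otimes> p) w" using e p(2) by simp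
    have "\<kappa> (g \<otimes> p) (\<phi> w) = \<kappa> (g \<otimes> p) (\<phi>\<^sub>0 w)" if \<phi>: "\<phi> \<in> \<Omega>" for \<phi>
    proof -
      have "\<kappa> g (\<phi> v) = \<kappa> g (\<phi>\<^sub>0 v)" by (rule known[OF \<phi> gv(1)])
      then show ?thesis
        using \<kappa>_model[OF \<phi> w p4 g4] \<kappa>_model[OF \<phi>\<^sub>0 w p4 g4] \<kappa>p \<phi> xw[OF \<phi>] xw[OF \<phi>\<^sub>0] e p(2) gc pc
        by (simp add: \<kappa>_mult)
    qed
    moreover have "g \<otimes> p \<in> words G B (Suc n)" by (rule words_mult_le[OF B g1 p(1)]) simp
    ultimately show ?thesis using u by blast
  next
    assume e: "u' = \<sigma> g v \<and> u = v"
    define q where "q = inv g \<otimes> p"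
    have qw: "q \<in> words G B (Suc n)" unfolding q_def
      by (rule words_mult_le[OF B words_inv[OF B g1] p(1)]) simp
    have qc: "q \<in> carrier G" using wordc[OF qw] .
    have q4: "q \<in> words G B (C + 4)" using word_le[OF qw] n by simp
    have gq: "g \<otimes> q = p" using gc pc by (simp add: q_def m_assoc[symmetric])
    have "\<sigma> g (\<sigma> q w) = \<sigma> (g \<otimes> q) w"
      by (rule good_words_mult[OF tameD(3)[OF w] g1 qw]) (use n in auto)
    then have "\<sigma> g (\<sigma> q w) = \<sigma> g v" using gq p(2) e by simp
    then have vq: "\<sigma> q w = v" using \<sigma>_eq_iff[OF gc] by simp
    have "\<kappa> q (\<phi> w) = \<kappa> q (\<phi>\<^sub>0 w)" if \<phi>: "\<phi> \<in> \<Omega>" for \<phi>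
    proof -
      have k: "\<kappa> p (\<psi> w) = \<kappa> g (\<psi> v) \<otimes>\<^bsub>H\<^esub> \<kappa> q (\<psi> w)" if \<psi>: "\<psi> \<in> \<Omega>" for \<psi>
        using \<kappa>_mult[OF gc qc xw[OF \<psi>]] \<kappa>_model[OF \<psi> w q4 g4] gq vq by simp
      have vV: "v \<in> V" using gv(1) D by auto
      have "\<kappa> g (\<phi>\<^sub>0 v) \<otimes>\<^bsub>H\<^esub> \<kappa> q (\<phi> w) = \<kappa> g (\<phi>\<^sub>0 v) \<otimes>\<^bsub>H\<^esub> \<kappa> q (\<phi>\<^sub>0 w)"
        using k[OF \<phi>] k[OF \<phi>\<^sub>0] \<kappa>p \<phi> known[OF \<phi> gv(1)] by simp
      then show ?thesis
        using \<kappa>_closed[OF gc \<Omega>[OF \<phi>\<^sub>0 vV]] \<kappa>_closed[OF qc xw[OF \<phi>]] \<kappa>_closed[OF qc xw[OF \<phi>\<^sub>0]]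
        by (simp add: H.left_cancel)
    qed
    then show ?thesis using qw vq e by blast
  qed
qed

text \<open>The path from w to t w spells a word p with p w = t w, and injectivity on the window at
  w forces p = t.\<close>

lemma \<kappa>_known:
  assumes w: "w \<in> tame" "w \<in> W" and t: "t \<in> T" "\<sigma> t w \<in> W" and \<phi>: "\<phi> \<in> \<Omega>"
  shows "\<kappa> t (\<phi> w) = \<kappa> t (\<phi>\<^sub>0 w)"
proof -
  obtain n where n: "n \<le> C" "(w, \<sigma> t w) \<in> edges \<sigma> D ^^ n"
    using link[OF w(2) t] by (auto simp: linked_def)
  obtain p where p: "p \<in> words G B n" "\<sigma> t w = \<sigma> p w" "\<forall>\<phi>\<in>\<Omega>. \<kappa> p (\<phi> w) = \<kappa> p (\<phi>\<^sub>0 w)"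
    using path_word[OF w(1) n(2,1)] by auto
  have "t = p"
    by (rule good_words_inj[OF tameD(3)[OF w(1)] _ p(1) _ _ p(2), of 1]) (use t sub n in auto)
  then show ?thesis using p \<phi> by simp
qed

text \<open>The approximate action of H on V read off from the reference model. It is shown to be
  injective only on tame points and is extended to permutations later.\<close>

definition \<rho> where "\<rho> h v = \<sigma> (l h (\<phi>\<^sub>0 v)) v"

lemma \<phi>\<^sub>0_X: "v \<in> V \<Longrightarrow> \<phi>\<^sub>0 v \<in> X"
  using \<Omega>[OF \<phi>\<^sub>0] .

lemma FF_H: "h \<in> FF \<Longrightarrow> h \<in> carrier H" and F_FF: "h \<in> F \<Longrightarrow> h \<in> FF"
  using F by auto

lemma \<rho>_closed: "h \<in> carrier H \<Longrightarrow> v \<in> V \<Longrightarrow> \<rho> h v \<in> V"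
  unfolding \<rho>_def using \<sigma>_closed[OF l_closed] \<phi>\<^sub>0_X by blast

lemma l_\<rho>:
  assumes v: "v \<in> tame" and t: "t \<in> FF" and s: "s \<in> FF \<union> m_inv H ` FF"
  shows "l s (\<phi>\<^sub>0 (\<rho> t v)) = l s (b t (\<phi>\<^sub>0 v))"
proof -
  have vV: "v \<in> V" using tameD(1)[OF v] .
  let ?g = "l t (\<phi>\<^sub>0 v)"
  have g: "?g \<in> words G B (C + 4)" by (rule word_le[OF l_words[OF t \<phi>\<^sub>0_X[OF vV]]]) simp
  have "d (\<phi>\<^sub>0 (\<sigma> ?g v)) (\<alpha> ?g (\<phi>\<^sub>0 v)) < \<tau>" by (rule eqv[OF \<phi>\<^sub>0 vV tameD(2)[OF v] g])
  then have "d (\<phi>\<^sub>0 (\<rho> t v)) (b t (\<phi>\<^sub>0 v)) < \<tau>" using \<alpha>_l[OF FF_H[OF t] \<phi>\<^sub>0_X[OF vV]] by (simp add: \<rho>_def)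
  then show ?thesis
    using \<tau>_l[OF s] \<phi>\<^sub>0_X[OF \<rho>_closed[OF FF_H[OF t] vV]] b_closed[OF FF_H[OF t] \<phi>\<^sub>0_X[OF vV]] by blast
qed

lemma \<rho>_inv:
  assumes v: "v \<in> tame" and h: "h \<in> FF"
  shows "\<rho> (inv\<^bsub>H\<^esub> h) (\<rho> h v) = v"
proof -
  have vV: "v \<in> V" using tameD(1)[OF v] .
  have "\<rho> (inv\<^bsub>H\<^esub> h) (\<rho> h v) = \<sigma> (l (inv\<^bsub>H\<^esub> h) (b h (\<phi>\<^sub>0 v))) (\<rho> h v)"
    unfolding \<rho>_def[of "inv\<^bsub>H\<^esub> h"] using l_\<rho>[OF v h] h by simp
  also have "\<dots> = \<sigma> (inv (l h (\<phi>\<^sub>0 v))) (\<sigma> (l h (\<phi>\<^sub>0 v)) v)"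
    using l_inv[OF FF_H[OF h] \<phi>\<^sub>0_X[OF vV]] by (simp add: \<rho>_def)
  also have "\<dots> = v"
    by (rule good_words_inv(1)[OF tameD(3)[OF v] l_words[OF h \<phi>\<^sub>0_X[OF vV]] _ B]) simp
  finally show ?thesis .
qed

lemma \<rho>_inj: "h \<in> FF \<Longrightarrow> inj_on (\<rho> h) tame"
  by (rule inj_on_inverseI[of _ "\<rho> (inv\<^bsub>H\<^esub> h)"]) (rule \<rho>_inv)

text \<open>This is the cocycle identity of \<open>l\<close>: local constancy allows
  \<open>\<phi>\<^sub>0 (\<rho> t v)\<close> to be replaced by
  \<open>b t (\<phi>\<^sub>0 v)\<close>.\<close>

lemma \<rho>_mult:
  assumes v: "v \<in> tame" and st: "s \<in> F" "t \<in> F"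
  shows "\<rho> s (\<rho> t v) = \<rho> (s \<otimes>\<^bsub>H\<^esub> t) v"
proof -
  have vV: "v \<in> V" using tameD(1)[OF v] .
  have FFs: "s \<in> FF" "t \<in> FF" using st F_FF by auto
  note x = \<phi>\<^sub>0_X[OF vV]
  have bx: "b t (\<phi>\<^sub>0 v) \<in> X" using b_closed[OF FF_H[OF FFs(2)] x] .
  have "\<rho> s (\<rho> t v) = \<sigma> (l s (b t (\<phi>\<^sub>0 v))) (\<sigma> (l t (\<phi>\<^sub>0 v)) v)"
    unfolding \<rho>_def[of s] using l_\<rho>[OF v FFs(2), of s] FFs by (simp add: \<rho>_def)
  also have "\<dots> = \<sigma> (l s (b t (\<phi>\<^sub>0 v)) \<otimes> l t (\<phi>\<^sub>0 v)) v"
    by (rule good_words_mult[OF tameD(3)[OF v] l_words[OF FFs(1) bx] l_words[OF FFs(2) x]]) simp_all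
  also have "l s (b t (\<phi>\<^sub>0 v)) \<otimes> l t (\<phi>\<^sub>0 v) = l (s \<otimes>\<^bsub>H\<^esub> t) (\<phi>\<^sub>0 v)"
    by (rule l_mult[OF FF_H[OF FFs(1)] FF_H[OF FFs(2)] x, symmetric])
  finally show ?thesis by (simp add: \<rho>_def)
qed

lemma \<rho>_eqD:
  assumes v: "v \<in> tame" and st: "s \<in> FF" "t \<in> FF" "\<rho> s v = \<rho> t v"
  shows "s = t"
proof -
  have vV: "v \<in> V" using tameD(1)[OF v] .
  note x = \<phi>\<^sub>0_X[OF vV]
  have "l s (\<phi>\<^sub>0 v) = l t (\<phi>\<^sub>0 v)"
    by (rule good_words_inj[OF tameD(3)[OF v] l_words[OF st(1) x] l_words[OF st(2) x]])
      (use st(3) in \<open>auto simp: \<rho>_def\<close>)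
  then show ?thesis using \<kappa>_l[OF FF_H[OF st(1)] x] \<kappa>_l[OF FF_H[OF st(2)] x] by metis
qed

definition covered where "covered = (\<Union>s\<in>S. \<sigma> s ` (W \<inter> tame))"
definition sw where "sw v = (SOME p. fst p \<in> S \<and> snd p \<in> W \<inter> tame \<and> v = \<sigma> (fst p) (snd p))"
definition hv where "hv v = \<kappa> (fst (sw v)) (\<phi>\<^sub>0 (snd (sw v)))"
text \<open>For each covered v one pair (s, w) with v = s w is fixed, and v gets the label
  \<open>hv v\<close>, the value of \<open>\<kappa> s\<close> at the reference model, which is the
  same for all models. The new model takes at v the H-translate by this label of the value at w.
  Composing \<open>\<phi>\<close> with \<open>\<Phi>\<close> would not do, since the cocycle of
  \<open>\<phi>\<close> at v need not agree with that of \<open>\<phi>\<^sub>0\<close>.\<close>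

definition model where "model \<phi> = (\<lambda>v\<in>V. if v \<in> covered then \<Phi> (b (hv v) (\<phi> (snd (sw v)))) else \<Phi> (\<phi> v))"

lemma sw:
  assumes "v \<in> covered"
  shows "fst (sw v) \<in> S" "snd (sw v) \<in> W" "snd (sw v) \<in> tame" "\<sigma> (fst (sw v)) (snd (sw v)) = v"
proof -
  have "\<exists>p. fst p \<in> S \<and> snd p \<in> W \<inter> tame \<and> v = \<sigma> (fst p) (snd p)"
    using assms by (auto simp: covered_def)
  then have "fst (sw v) \<in> S \<and> snd (sw v) \<in> W \<inter> tame \<and> v = \<sigma> (fst (sw v)) (snd (sw v))"
    unfolding sw_def by (rule someI_ex)
  then show "fst (sw v) \<in> S" "snd (sw v) \<in> W" "snd (sw v) \<in> tame" "\<sigma> (fst (sw v)) (snd (sw v)) = v"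
    by auto
qed

lemma hv:
  assumes "v \<in> covered" shows "hv v \<in> HS" "hv v \<in> carrier H"
proof -
  show "hv v \<in> HS" unfolding hv_def by (rule HS(2)[OF sw(1)[OF assms] \<phi>\<^sub>0_X[OF tameD(1)[OF sw(3)[OF assms]]]])
  then show "hv v \<in> carrier H" using HS(1) by blast
qed

lemma model_in:
  assumes "\<phi> \<in> \<Omega>" shows "model \<phi> \<in> V \<rightarrow>\<^sub>E Y"
proof -
  have "\<Phi> (b (hv v) (\<phi> (snd (sw v)))) \<in> Y" if "v \<in> covered" for v
    by (intro \<Phi>_closed b_closed hv(2)[OF that] \<Omega>[OF assms] tameD(1)[OF sw(3)[OF that]])
  then show ?thesis using \<Phi>_closed \<Omega>[OF assms] by (auto simp: model_def)
qed

text \<open>Let v = s1 w1 and f v = s2 w2. Then w2 = g w1 with g in T, and at the reference model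
  \<open>\<kappa> g\<close> has the value h = inv h2 f h1. Both w1 and w2 are net points, so every
  model has this value, whence \<open>\<phi> w2\<close> is close to \<open>b h (\<phi> w1)\<close>.
  Applying h2 gives equivariance at v, as h2 h = f h1.\<close>

lemma model_equivariant:
  assumes \<phi>: "\<phi> \<in> \<Omega>" and v: "v \<in> V" "v \<in> covered" and f: "f \<in> F" and v2: "\<rho> f v \<in> covered"
  shows "d' (model \<phi> (\<rho> f v)) (\<beta> f (model \<phi> v)) < \<delta>"
proof -
  define s1 w1 s2 w2 where "s1 = fst (sw v)" and "w1 = snd (sw v)"
    and "s2 = fst (sw (\<rho> f v))" and "w2 = snd (sw (\<rho> f v))"
  define h1 h2 where "h1 = hv v" and "h2 = hv (\<rho> f v)"
  define x0 where "x0 = \<phi>\<^sub>0 w1"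
  have fH: "f \<in> carrier H" "f \<in> FF" using f F by auto
  have s1: "s1 \<in> S" "s1 \<in> words G B 1" and w1: "w1 \<in> W" "w1 \<in> tame" "\<sigma> s1 w1 = v"
    using sw[OF v(2)] sub by (auto simp: s1_def w1_def)
  have s2: "s2 \<in> S" "s2 \<in> words G B 1" and w2: "w2 \<in> W" "w2 \<in> tame" "\<sigma> s2 w2 = \<rho> f v"
    using sw[OF v2] sub by (auto simp: s2_def w2_def)
  have h1: "h1 = \<kappa> s1 x0" "h1 \<in> HS" "h1 \<in> carrier H"
    using hv[OF v(2)] by (simp_all add: h1_def hv_def s1_def w1_def x0_def)
  have h2: "h2 = \<kappa> s2 (\<phi>\<^sub>0 w2)" "h2 \<in> HS" "h2 \<in> carrier H"
    using hv[OF v2] by (simp_all add: h2_def hv_def s2_def w2_def)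
  have s1c: "s1 \<in> carrier G" and s2c: "s2 \<in> carrier G" using wordc s1 s2 by auto
  have x0: "x0 \<in> X" and y0: "\<phi>\<^sub>0 w2 \<in> X" using \<phi>\<^sub>0_X tameD(1) w1 w2 by (auto simp: x0_def)
  have ls1: "l h1 x0 = s1" using l_\<kappa>[OF s1c x0] h1 by simp
  have bs1: "b h1 x0 = \<alpha> s1 x0" using b_\<kappa>[OF s1c x0] h1 by simp
  have "d (\<phi>\<^sub>0 (\<sigma> s1 w1)) (\<alpha> s1 x0) < \<tau>" unfolding x0_def
    by (rule eqv[OF \<phi>\<^sub>0 tameD(1)[OF w1(2)] tameD(2)[OF w1(2)] word_le[OF s1(2)]]) simp
  then have "d (\<phi>\<^sub>0 v) (b h1 x0) < \<tau>" using w1 bs1 by simp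
  then have lf: "l f (\<phi>\<^sub>0 v) = l f (b h1 x0)"
    using \<tau>_l[of f] fH \<phi>\<^sub>0_X[OF v(1)] b_closed[OF h1(3) x0] by simp
  define g' where "g' = l f (\<phi>\<^sub>0 v)"
  have g': "g' \<in> words G B 1" unfolding g'_def by (rule l_words[OF fH(2) \<phi>\<^sub>0_X[OF v(1)]])
  have g's1: "g' \<otimes> s1 = l (f \<otimes>\<^bsub>H\<^esub> h1) x0"
    unfolding g'_def lf using l_mult[OF fH(1) h1(3) x0] ls1 by simp
  have gs2: "g' \<otimes> s1 \<in> words G B 2" by (rule words_mult_le[OF B g' s1(2)]) simp
  have gs4: "g' \<otimes> s1 \<in> words G B (C + 4)" by (rule word_le[OF gs2]) simp
  have v2eq: "\<rho> f v = \<sigma> (g' \<otimes> s1) w1"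
  proof -
    have "\<rho> f v = \<sigma> g' (\<sigma> s1 w1)" using w1(3) by (simp add: \<rho>_def g'_def)
    also have "\<dots> = \<sigma> (g' \<otimes> s1) w1"
      by (rule good_words_mult[OF tameD(3)[OF w1(2)] g' s1(2)]) simp_all
    finally show ?thesis .
  qed
  define g where "g = inv s2 \<otimes> (g' \<otimes> s1)"
  have is2: "inv s2 \<in> words G B 1" using words_inv[OF B s2(2)] .
  have gw: "g \<in> words G B 3" unfolding g_def by (rule words_mult_le[OF B is2 gs2]) simp
  have w2eq: "w2 = \<sigma> g w1"
  proof -
    have "w2 = \<sigma> (inv s2) (\<sigma> s2 w2)"
      by (rule good_words_inv(1)[OF tameD(3)[OF w2(2)] s2(2) _ B, symmetric]) simp
    also have "\<dots> = \<sigma> (inv s2) (\<sigma> (g' \<otimes> s1) w1)" using w2(3) v2eq by simp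
    also have "\<dots> = \<sigma> g w1"
      unfolding g_def by (rule good_words_mult[OF tameD(3)[OF w1(2)] is2 gs2]) simp_all
    finally show ?thesis .
  qed
  have gs1c: "g' \<otimes> s1 \<in> carrier G" using wordc[OF gs2] .
  have is4: "inv s2 \<in> words G B (C + 4)" by (rule word_le[OF is2]) simp
  have s24: "s2 \<in> words G B (C + 4)" by (rule word_le[OF s2(2)]) simp
  \<comment> \<open>The points reached from x0 by g' s1 and from \<open>\<phi>\<^sub>0 w2\<close> by
    s2 are both near the value of the reference model at f v, and \<open>\<kappa> (inv s2)\<close>
    does not distinguish points this close.\<close>
  have "\<kappa> (inv s2) (\<alpha> (g' \<otimes> s1) x0) = \<kappa> (inv s2) (\<phi>\<^sub>0 (\<rho> f v))"
    unfolding v2eq x0_def by (rule \<kappa>_model[OF \<phi>\<^sub>0 w1(2) gs4 is4])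
  also have "\<dots> = \<kappa> (inv s2) (\<alpha> s2 (\<phi>\<^sub>0 w2))"
    using \<kappa>_model[OF \<phi>\<^sub>0 w2(2) s24 is4] w2(3) by simp
  also have "\<dots> = inv\<^bsub>H\<^esub> h2" using \<kappa>_inv[OF s2c y0] h2 by simp
  finally have ks2: "\<kappa> (inv s2) (\<alpha> (g' \<otimes> s1) x0) = inv\<^bsub>H\<^esub> h2" .
  define h where "h = inv\<^bsub>H\<^esub> h2 \<otimes>\<^bsub>H\<^esub> (f \<otimes>\<^bsub>H\<^esub> h1)"
  have hH: "h \<in> carrier H" using h1 h2 fH by (simp add: h_def)
  have kg: "\<kappa> g x0 = h"
  proof -
    have "\<kappa> (g' \<otimes> s1) x0 = f \<otimes>\<^bsub>H\<^esub> h1" unfolding g's1 using \<kappa>_l x0 fH h1 by simp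
    then show ?thesis unfolding g_def h_def using \<kappa>_mult[OF _ gs1c x0, of "inv s2"] s2c ks2 by simp
  qed
  have gc: "g \<in> carrier G" using wordc[OF gw] .
  have "g = l h x0" using l_\<kappa>[OF gc x0] kg by simp
  then have gT: "g \<in> T" using l_T[OF h1(2) h2(2) f x0] by (simp add: h_def)
  have y: "\<phi> w1 \<in> X" "\<phi> w2 \<in> X" using \<Omega>[OF \<phi>] tameD(1) w1 w2 by auto
  \<comment> \<open>Here the linking of the net enters: an arbitrary model has the cocycle value of
    the reference model.\<close>
  have k: "\<kappa> g (\<phi> w1) = h"
    using \<kappa>_known[OF w1(2,1) gT _ \<phi>] w2eq w2(1) kg by (simp add: x0_def)
  have "d (\<phi> (\<sigma> g w1)) (\<alpha> g (\<phi> w1)) < \<tau>"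
    by (rule eqv[OF \<phi> tameD(1)[OF w1(2)] tameD(2)[OF w1(2)] word_le[OF gw]]) simp
  then have "d (\<phi> w2) (b h (\<phi> w1)) < \<tau>" using w2eq b_\<kappa>[OF gc y(1)] k by simp
  then have "d' (\<Phi> (b h2 (\<phi> w2))) (\<Phi> (b h2 (b h (\<phi> w1)))) < \<delta>"
    using \<tau>_\<Phi>[OF h2(2)] y b_closed[OF hH y(1)] by blast
  moreover have "b h2 (b h (\<phi> w1)) = b f (b h1 (\<phi> w1))"
  proof -
    have "h2 \<otimes>\<^bsub>H\<^esub> h = f \<otimes>\<^bsub>H\<^esub> h1" using h1 h2 fH by (simp add: h_def H.m_assoc[symmetric])
    then show ?thesis using b_mult[OF h2(3) hH y(1)] b_mult[OF fH(1) h1(3) y(1)] by simp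
  qed
  moreover have "\<beta> f (\<Phi> (b h1 (\<phi> w1))) = \<Phi> (b f (b h1 (\<phi> w1)))"
    by (rule \<beta>_\<Phi>[OF fH(1) b_closed[OF h1(3) y(1)]])
  moreover have "model \<phi> v = \<Phi> (b h1 (\<phi> w1))" using v by (simp add: model_def h1_def w1_def)
  moreover have "model \<phi> (\<rho> f v) = \<Phi> (b h2 (\<phi> w2))"
    using v2 \<rho>_closed[OF fH(1) v(1)] by (simp add: model_def h2_def w2_def)
  ultimately show ?thesis by simp
qed

text \<open>The label at v is common to both models, so closeness in Y passes back to their values
  at w and, after applying s, to v. Three errors below \<epsilon> / 4 add up to less than
  \<epsilon>.\<close>

lemma model_separated:
  assumes \<phi>: "\<phi> \<in> \<Omega>" "\<psi> \<in> \<Omega>" and v: "v \<in> V" "v \<in> covered" and close: "d' (model \<phi> v) (model \<psi> v) < \<epsilon>'"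
  shows "d (\<phi> v) (\<psi> v) < \<epsilon>"
proof -
  define s w where "s = fst (sw v)" and "w = snd (sw v)"
  have s: "s \<in> S" "s \<in> words G B 1" and w: "w \<in> tame" "\<sigma> s w = v"
    using sw[OF v(2)] sub by (auto simp: s_def w_def)
  have x: "\<phi> w \<in> X" "\<psi> w \<in> X" "\<phi> v \<in> X" "\<psi> v \<in> X" using \<Omega> \<phi> tameD(1)[OF w(1)] v(1) by auto
  have ax: "\<alpha> s (\<phi> w) \<in> X" "\<alpha> s (\<psi> w) \<in> X" using \<alpha>_closed[OF wordc[OF s(2)]] x by auto
  have "d' (\<Phi> (b (hv v) (\<phi> w))) (\<Phi> (b (hv v) (\<psi> w))) < \<epsilon>'"
    using close v by (simp add: model_def w_def)
  then have a: "d (\<alpha> s (\<phi> w)) (\<alpha> s (\<psi> w)) < \<epsilon> / 4" by (rule \<epsilon>'[OF hv(1)[OF v(2)] s(1) x(1,2)])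
  have e: "d (\<phi>' v) (\<alpha> s (\<phi>' w)) < \<epsilon> / 4" if "\<phi>' \<in> \<Omega>" for \<phi>'
  proof -
    have "d (\<phi>' (\<sigma> s w)) (\<alpha> s (\<phi>' w)) < \<tau>"
      by (rule eqv[OF that tameD(1)[OF w(1)] tameD(2)[OF w(1)] word_le[OF s(2)]]) simp
    then show ?thesis using w(2) \<tau>_\<epsilon> by simp
  qed
  have "d (\<phi> v) (\<psi> v) \<le> d (\<phi> v) (\<alpha> s (\<phi> w)) + d (\<alpha> s (\<phi> w)) (\<psi> v)"
    by (rule MX.triangle[OF x(3) ax(1) x(4)])
  moreover have "d (\<alpha> s (\<phi> w)) (\<psi> v) \<le> d (\<alpha> s (\<phi> w)) (\<alpha> s (\<psi> w)) + d (\<alpha> s (\<psi> w)) (\<psi> v)"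
    by (rule MX.triangle[OF ax x(4)])
  moreover have "d (\<alpha> s (\<psi> w)) (\<psi> v) = d (\<psi> v) (\<alpha> s (\<psi> w))" by (rule MX.commute)
  moreover have "0 \<le> d (\<phi> v) (\<alpha> s (\<phi> w))" by (rule MX.nonneg)
  ultimately show ?thesis using a e[OF \<phi>(1)] e[OF \<phi>(2)] by linarith
qed

end

section \<open>Counting\<close>

lemma sum_Pow_power_card:
  assumes "finite V"
  shows "(\<Sum>A\<in>Pow V. x ^ card A) = (1 + x :: real) ^ card V"
  using assms
proof (induction V rule: finite_induct)
  case (insert v V)
  have inj: "inj_on (insert v) (Pow V)" using insert.hyps(2) by (auto simp: inj_on_def)
  have "Pow V \<inter> insert v ` Pow V = {}" using insert.hyps(2) by auto
  then have "(\<Sum>A\<in>Pow (insert v V). x ^ card A) = (\<Sum>A\<in>Pow V. x ^ card A) + (\<Sum>A\<in>insert v ` Pow V. x ^ card A)"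
    unfolding Pow_insert using insert.hyps(1) by (intro sum.union_disjoint) auto
  also have "(\<Sum>A\<in>insert v ` Pow V. x ^ card A) = (\<Sum>A\<in>Pow V. x ^ card (insert v A))"
    by (rule sum.reindex_cong[OF inj]) auto
  also have "\<dots> = (\<Sum>A\<in>Pow V. x * x ^ card A)"
  proof (rule sum.cong[OF refl])
    fix A assume "A \<in> Pow V"
    then have "v \<notin> A" "finite A" using insert.hyps finite_subset by auto
    then show "x ^ card (insert v A) = x * x ^ card A" by simp
  qed
  also have "\<dots> = x * (\<Sum>A\<in>Pow V. x ^ card A)" by (rule sum_distrib_left[symmetric])
  finally show ?case using insert by (simp add: algebra_simps)
qed simp

text \<open>Give A the weight x^|A|. The weights of all subsets of an n-element set sum to (1 +
  x)^n, at most exp (\<eta> n / 2), and a set of size at most \<rho> n has weight at least exp (-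
  \<eta> n / 2); \<rho> is defined by this last requirement.\<close>

lemma card_small_subsets:
  assumes \<eta>: "0 < \<eta>"
  shows "\<exists>\<rho>>0. \<forall>V :: 'v set. finite V \<longrightarrow>
    real (card {A. A \<subseteq> V \<and> real (card A) \<le> \<rho> * real (card V)}) \<le> exp (\<eta> * real (card V))"
proof -
  define x where "x = min (1 / 2) (\<eta> / 2)"
  have x: "0 < x" "x < 1" "x \<le> \<eta> / 2" using \<eta> by (auto simp: x_def)
  have lx: "ln x < 0" using x by simp
  define \<rho> where "\<rho> = \<eta> / 2 / (- ln x)"
  have \<rho>: "0 < \<rho>" "\<rho> * (- ln x) = \<eta> / 2"
  proof -
    have "0 < - ln x" using lx by simp
    then show "0 < \<rho>" unfolding \<rho>_def using \<eta> by (intro divide_pos_pos) auto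
    show "\<rho> * (- ln x) = \<eta> / 2" unfolding \<rho>_def using \<open>0 < - ln x\<close> by simp
  qed
  have "real (card {A. A \<subseteq> V \<and> real (card A) \<le> \<rho> * real (card V)}) \<le> exp (\<eta> * real (card V))"
    if V: "finite V" for V :: "'v set"
  proof -
    define n where "n = real (card V)"
    define t where "t = \<eta> / 2 * n"
    define S where "S = {A. A \<subseteq> V \<and> real (card A) \<le> \<rho> * n}"
    have "real (card S) * exp (- t) = (\<Sum>A\<in>S. exp (- t))" by simp
    also have "\<dots> \<le> (\<Sum>A\<in>S. x ^ card A)"
    proof (rule sum_mono)
      fix A assume A: "A \<in> S"
      have "- t = - (\<rho> * (- ln x)) * n" unfolding \<rho>(2) t_def by simp
      also have "\<dots> = \<rho> * n * ln x" by (simp add: algebra_simps)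
      also have "\<dots> \<le> real (card A) * ln x" using A lx by (intro mult_right_mono_neg) (auto simp: S_def)
      finally have "exp (- t) \<le> exp (real (card A) * ln x)" by simp
      also have "\<dots> = x ^ card A" using x by (simp add: exp_of_nat_mult)
      finally show "exp (- t) \<le> x ^ card A" .
    qed
    also have "\<dots> \<le> (\<Sum>A\<in>Pow V. x ^ card A)" using V x by (intro sum_mono2) (auto simp: S_def)
    also have "\<dots> = (1 + x) ^ card V" by (rule sum_Pow_power_card[OF V])
    also have "\<dots> \<le> exp x ^ card V" using x by (intro power_mono exp_ge_add_one_self) auto
    also have "\<dots> = exp (n * x)" by (simp add: exp_of_nat_mult n_def)
    also have "\<dots> \<le> exp t"
    proof -
      have "n * x \<le> n * (\<eta> / 2)" using x(3) by (rule mult_left_mono) (simp add: n_def)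
      then show ?thesis by (simp add: t_def mult.commute)
    qed
    finally have "real (card S) * exp (- t) * exp t \<le> exp t * exp t" by (rule mult_right_mono) simp
    moreover have "real (card S) * exp (- t) * exp t = real (card S)"
      unfolding mult.assoc exp_add[symmetric] by simp
    moreover have "exp t * exp t = exp (\<eta> * n)" unfolding exp_add[symmetric] by (simp add: t_def)
    ultimately have "real (card S) \<le> exp (\<eta> * n)" by simp
    then show ?thesis by (simp only: S_def n_def)
  qed
  then show ?thesis using \<rho>(1) by blast
qed

lemma pigeonhole_exp:
  assumes \<Omega>: "finite \<Omega>" and A: "finite A" "f ` \<Omega> \<subseteq> A" and s: "exp s \<le> real (card \<Omega>)" and u: "real (card A) \<le> exp u"
  shows "\<exists>y\<in>A. exp (s - u) \<le> real (card {\<omega>\<in>\<Omega>. f \<omega> = y})"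
proof (rule ccontr)
  assume "\<not> ?thesis"
  then have less: "real (card {\<omega>\<in>\<Omega>. f \<omega> = y}) < exp (s - u)" if "y \<in> A" for y using that by (auto simp: not_le)
  have "\<Omega> \<noteq> {}" using s by (metis card.empty exp_gt_zero not_le of_nat_0)
  then have Ane: "A \<noteq> {}" using A by auto
  have eq: "(\<Union>y\<in>A. {\<omega>\<in>\<Omega>. f \<omega> = y}) = \<Omega>" using A by auto
  have "card \<Omega> \<le> (\<Sum>y\<in>A. card {\<omega>\<in>\<Omega>. f \<omega> = y})"
    using card_UN_le[OF A(1), of "\<lambda>y. {\<omega>\<in>\<Omega>. f \<omega> = y}"] unfolding eq .
  then have "real (card \<Omega>) \<le> real (\<Sum>y\<in>A. card {\<omega>\<in>\<Omega>. f \<omega> = y})" by (rule of_nat_mono)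
  also have "\<dots> = (\<Sum>y\<in>A. real (card {\<omega>\<in>\<Omega>. f \<omega> = y}))" by (rule of_nat_sum)
  also have "\<dots> < (\<Sum>y\<in>A. exp (s - u))" by (rule sum_strict_mono[OF A(1) Ane less])
  also have "\<dots> = real (card A) * exp (s - u)" by simp
  also have "\<dots> \<le> exp u * exp (s - u)" using u by (intro mult_right_mono) auto
  also have "\<dots> = exp s" by (simp add: exp_add[symmetric])
  finally show False using s by simp
qed

text \<open>Chebyshev's inequality for the normalized counting measure on V.\<close>

lemma card_far_le:
  assumes V: "finite V" "V \<noteq> {}" and \<tau>: "0 < \<tau>" and le: "dist_2 d V \<phi> \<psi> \<le> \<delta>"
  shows "real (card {v\<in>V. \<tau> \<le> d (\<phi> v) (\<psi> v)}) \<le> \<delta>\<^sup>2 / \<tau>\<^sup>2 * real (card V)"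
proof -
  define n where "n = real (card V)"
  have n: "n > 0" using V by (simp add: n_def card_gt_0_iff)
  let ?s = "\<Sum>v\<in>V. (d (\<phi> v) (\<psi> v))\<^sup>2"
  have s0: "0 \<le> ?s" by (rule sum_nonneg) simp
  have "sqrt (1 / n * ?s) \<le> \<delta>" using le by (simp add: dist_2_def n_def)
  moreover have "0 \<le> sqrt (1 / n * ?s)" using s0 n by simp
  ultimately have "(sqrt (1 / n * ?s))\<^sup>2 \<le> \<delta>\<^sup>2" by (intro power_mono)
  then have "1 / n * ?s \<le> \<delta>\<^sup>2" using s0 n by simp
  then have s: "?s \<le> \<delta>\<^sup>2 * n" using n by (simp add: pos_divide_le_eq)
  let ?A = "{v\<in>V. \<tau> \<le> d (\<phi> v) (\<psi> v)}"
  have "real (card ?A) * \<tau>\<^sup>2 = (\<Sum>v\<in>?A. \<tau>\<^sup>2)" by simp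
  also have "\<dots> \<le> (\<Sum>v\<in>?A. (d (\<phi> v) (\<psi> v))\<^sup>2)" using \<tau> by (intro sum_mono power_mono) auto
  also have "\<dots> \<le> ?s" using V by (intro sum_mono2) auto
  finally have "real (card ?A) * \<tau>\<^sup>2 \<le> \<delta>\<^sup>2 * n" using s by simp
  then show ?thesis using \<tau> by (simp add: n_def field_simps)
qed

text \<open>The points off Z contribute at most \<delta>^2 / 4 to the mean square, those of Z at
  most \<delta>^2 / 2.\<close>

lemma dist_2_le:
  assumes V: "finite V" "V \<noteq> {}" and Z: "Z \<subseteq> V" and \<delta>: "0 < \<delta>"
    and good: "\<And>v. v \<in> V - Z \<Longrightarrow> 0 \<le> d (\<phi> v) (\<psi> v) \<and> d (\<phi> v) (\<psi> v) \<le> \<delta> / 2"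
    and bad: "\<And>v. v \<in> Z \<Longrightarrow> 0 \<le> d (\<phi> v) (\<psi> v) \<and> d (\<phi> v) (\<psi> v) \<le> M"
    and card: "real (card Z) * M\<^sup>2 \<le> 1 / 2 * \<delta>\<^sup>2 * real (card V)"
  shows "dist_2 d V \<phi> \<psi> \<le> \<delta>"
proof -
  define n where "n = real (card V)"
  have n: "n > 0" using V by (simp add: n_def card_gt_0_iff)
  let ?e = "\<lambda>v. (d (\<phi> v) (\<psi> v))\<^sup>2"
  have "sum ?e V = sum ?e (V - Z) + sum ?e Z" by (rule sum.subset_diff[OF Z V(1)])
  also have "sum ?e (V - Z) \<le> (\<Sum>v\<in>V - Z. (\<delta> / 2)\<^sup>2)" by (intro sum_mono power_mono) (use good in auto)
  also have "\<dots> \<le> n * (\<delta> / 2)\<^sup>2"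
    using V card_mono[of V "V - Z"] by (simp add: n_def mult_right_mono)
  also have "sum ?e Z \<le> (\<Sum>v\<in>Z. M\<^sup>2)" by (intro sum_mono power_mono) (use bad in auto)
  also have "\<dots> \<le> 1 / 2 * \<delta>\<^sup>2 * n" using card by (simp add: n_def)
  finally have "sum ?e V \<le> n * (\<delta> / 2)\<^sup>2 + 1 / 2 * \<delta>\<^sup>2 * n" by simp
  also have "\<dots> = 3 / 4 * (n * \<delta>\<^sup>2)" by (simp add: power2_eq_square)
  also have "\<dots> \<le> 1 * (n * \<delta>\<^sup>2)" using n by (intro mult_right_mono) auto
  finally have "1 / n * sum ?e V \<le> \<delta>\<^sup>2" using n by (simp add: pos_divide_le_eq mult.commute)
  then have "sqrt (1 / n * sum ?e V) \<le> sqrt (\<delta>\<^sup>2)" by (rule real_sqrt_le_mono)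
  then show ?thesis using \<delta> by (simp add: dist_2_def n_def)
qed

lemma finite_common_threshold:
  assumes "finite Q" "\<And>q. q \<in> Q \<Longrightarrow> \<exists>\<tau>>0::real. P q \<tau>" "\<And>q \<tau> \<tau>'. P q \<tau> \<Longrightarrow> \<tau>' \<le> \<tau> \<Longrightarrow> P q \<tau>'"
  shows "\<exists>\<tau>>0. \<forall>q\<in>Q. P q \<tau>"
  using assms(1,2)
proof (induction Q rule: finite_induct)
  case empty then show ?case by (intro exI[of _ 1]) simp
next
  case (insert q Q)
  obtain \<tau> where \<tau>: "\<tau> > 0" "\<forall>q\<in>Q. P q \<tau>" using insert.IH insert.prems by auto
  obtain \<tau>' where \<tau>': "\<tau>' > 0" "P q \<tau>'" using insert.prems by auto
  have "P q (min \<tau> \<tau>')" using assms(3)[OF \<tau>'(2)] by simp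
  moreover have "\<forall>r\<in>Q. P r (min \<tau> \<tau>')" using assms(3) \<tau>(2) by (meson min.cobounded1)
  ultimately show ?case using \<tau>(1) \<tau>'(1) by (intro exI[of _ "min \<tau> \<tau>'"]) auto
qed

section \<open>Permutations and models for H\<close>

context transfer
begin

interpretation MY: Metric_space Y d' by (rule MY)

lemma model_\<Phi>:
  assumes "\<phi> \<in> \<Omega>" "v \<in> V" shows "\<exists>y\<in>X. model \<phi> v = \<Phi> y"
proof (cases "v \<in> covered")
  case True
  have "b (hv v) (\<phi> (snd (sw v))) \<in> X"
    by (intro b_closed hv(2)[OF True] \<Omega>[OF assms(1)] tameD(1)[OF sw(3)[OF True]])
  then show ?thesis using True assms by (auto simp: model_def)
next
  case False
  then show ?thesis using \<Omega>[OF assms] assms by (auto simp: model_def)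
qed

text \<open>Each \<open>\<rho> h\<close> is injective on tame points and so extends to a
  permutation. A product relation can fail at v only if v or its image under \<open>\<pi> t\<close>
  is not tame, hence the factor 2 before r; equivariance needs v tame and both v and its image
  covered, hence \<open>r + 2 * u\<close>. On the exceptional set only the diameter bound M is
  available.\<close>

lemma exists_transferred_approximation:
  assumes \<delta>': "0 < \<delta>'" "\<delta> = \<delta>' / 2" and M: "\<And>x y. x \<in> X \<Longrightarrow> y \<in> X \<Longrightarrow> d' (\<Phi> x) (\<Phi> y) \<le> M"
    and r: "real (card (V - tame)) \<le> r * real (card V)" "2 * r \<le> \<delta>'"
    and u: "real (card (V - covered)) \<le> u * real (card V)" and ru: "(r + 2 * u) * M\<^sup>2 \<le> 1 / 2 * \<delta>'\<^sup>2"
  shows "\<exists>\<pi>. sofic_approximation H V \<pi> \<and> good_approximation H F \<delta>' V \<pi> \<and>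
    model ` \<Omega> \<subseteq> approx_maps Y d' \<beta> F \<delta>' V \<pi>"
proof -
  define n where "n = real (card V)"
  have n: "n > 0" using card_V_pos by (simp add: n_def)
  have tV: "tame \<subseteq> V" using tameD(1) by blast
  have "\<exists>p. p permutes V \<and> (\<forall>v\<in>tame. p v = \<rho> h v)" if h: "h \<in> FF" for h
  proof (rule exists_permutation_extending[OF finite_V tV _ \<rho>_inj[OF h]])
    show "\<rho> h ` tame \<subseteq> V" using \<rho>_closed[OF FF_H[OF h]] tV by blast
  qed
  then have ex: "\<exists>p. p permutes V \<and> (h \<in> FF \<longrightarrow> (\<forall>v\<in>tame. p v = \<rho> h v))" for h
    using permutes_id by (cases "h \<in> FF") blast+
  define \<pi> where "\<pi> h = (SOME p. p permutes V \<and> (h \<in> FF \<longrightarrow> (\<forall>v\<in>tame. p v = \<rho> h v)))" for h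
  have \<pi>: "\<pi> h permutes V \<and> (h \<in> FF \<longrightarrow> (\<forall>v\<in>tame. \<pi> h v = \<rho> h v))" for h
    unfolding \<pi>_def by (rule someI_ex[OF ex])
  have perm: "\<pi> h permutes V" for h using \<pi> by blast
  have \<pi>\<rho>: "\<pi> h v = \<rho> h v" if "h \<in> FF" "v \<in> tame" for h v using \<pi>[of h] that by blast
  have pre: "card {v\<in>V. \<pi> h v \<notin> A} \<le> card (V - A)" for h A
  proof (rule card_inj_on_le)
    show "inj_on (\<pi> h) {v\<in>V. \<pi> h v \<notin> A}" using permutes_inj[OF perm] by (rule inj_on_subset) simp
    show "\<pi> h ` {v\<in>V. \<pi> h v \<notin> A} \<subseteq> V - A" using permutes_in_image[OF perm] by auto
  qed (use finite_V in simp)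
  have sa: "sofic_approximation H V \<pi>" using perm finite_V V_nonempty by (simp add: sofic_approximation_def)
  have "hamming_dist V (\<pi> (s \<otimes>\<^bsub>H\<^esub> t)) (\<pi> s \<circ> \<pi> t) \<le> \<delta>'" if st: "s \<in> F" "t \<in> F" for s t
  proof -
    have "{v\<in>V. \<pi> (s \<otimes>\<^bsub>H\<^esub> t) v \<noteq> (\<pi> s \<circ> \<pi> t) v} \<subseteq> (V - tame) \<union> {v\<in>V. \<pi> t v \<notin> tame}"
    proof
      fix v assume v: "v \<in> {v\<in>V. \<pi> (s \<otimes>\<^bsub>H\<^esub> t) v \<noteq> (\<pi> s \<circ> \<pi> t) v}"
      show "v \<in> (V - tame) \<union> {v\<in>V. \<pi> t v \<notin> tame}"
      proof (rule ccontr)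
        assume "v \<notin> (V - tame) \<union> {v\<in>V. \<pi> t v \<notin> tame}"
        then have t: "v \<in> tame" "\<pi> t v \<in> tame" using v by auto
        then have "\<pi> s (\<pi> t v) = \<rho> s (\<rho> t v)" using \<pi>\<rho> F_FF st by simp
        also have "\<dots> = \<pi> (s \<otimes>\<^bsub>H\<^esub> t) v" using \<rho>_mult[OF t(1) st] \<pi>\<rho>[OF FF[OF st] t(1)] by simp
        finally show False using v by simp
      qed
    qed
    then have "card {v\<in>V. \<pi> (s \<otimes>\<^bsub>H\<^esub> t) v \<noteq> (\<pi> s \<circ> \<pi> t) v} \<le> card ((V - tame) \<union> {v\<in>V. \<pi> t v \<notin> tame})"
      using finite_V by (intro card_mono) auto
    also have "\<dots> \<le> card (V - tame) + card {v\<in>V. \<pi> t v \<notin> tame}" by (rule card_Un_le)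
    also have "\<dots> \<le> card (V - tame) + card (V - tame)" using pre by (intro add_left_mono)
    finally have "real (card {v\<in>V. \<pi> (s \<otimes>\<^bsub>H\<^esub> t) v \<noteq> (\<pi> s \<circ> \<pi> t) v}) \<le> 2 * (r * n)" using r by (simp add: n_def)
    also have "\<dots> \<le> \<delta>' * n" using r(2) n mult_right_mono[OF r(2), of n] by simp
    finally show ?thesis unfolding hamming_dist_def using n by (simp add: n_def pos_divide_le_eq)
  qed
  moreover have "1 - \<delta>' \<le> hamming_dist V (\<pi> s) (\<pi> t)" if st: "s \<in> F" "t \<in> F" "s \<noteq> t" for s t
  proof -
    have "tame \<subseteq> {v\<in>V. \<pi> s v \<noteq> \<pi> t v}"
    proof
      fix v assume v: "v \<in> tame"
      then show "v \<in> {v\<in>V. \<pi> s v \<noteq> \<pi> t v}"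
        using \<rho>_eqD[OF v F_FF[OF st(1)] F_FF[OF st(2)]] st(3) tV \<pi>\<rho>[OF F_FF[OF st(1)] v] \<pi>\<rho>[OF F_FF[OF st(2)] v]
        by auto
    qed
    then have "card tame \<le> card {v\<in>V. \<pi> s v \<noteq> \<pi> t v}" using finite_V by (intro card_mono) auto
    moreover have "card V = card tame + card (V - tame)"
      using card_Diff_subset[OF finite_subset[OF tV finite_V] tV] card_mono[OF finite_V tV] by simp
    ultimately have "n - r * n \<le> real (card {v\<in>V. \<pi> s v \<noteq> \<pi> t v})" using r(1) by (simp add: n_def)
    moreover have "(1 - \<delta>') * n \<le> n - r * n"
    proof -
      have "0 \<le> r * n" using r(1) order_trans of_nat_0_le_iff unfolding n_def by blast
      moreover have "2 * r * n \<le> \<delta>' * n" using r(2) n by (intro mult_right_mono) auto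
      ultimately show ?thesis by (simp add: left_diff_distrib)
    qed
    ultimately have "(1 - \<delta>') * n \<le> real (card {v\<in>V. \<pi> s v \<noteq> \<pi> t v})" by linarith
    then show ?thesis unfolding hamming_dist_def using n by (simp add: n_def pos_le_divide_eq)
  qed
  ultimately have ga: "good_approximation H F \<delta>' V \<pi>" by (simp add: good_approximation_def)
  have dist: "dist_2 d' V (model \<phi> \<circ> \<pi> f) (\<beta> f \<circ> model \<phi>) \<le> \<delta>'" if \<phi>: "\<phi> \<in> \<Omega>" and f: "f \<in> F" for \<phi> f
  proof -
    define Z where "Z = (V - tame) \<union> ((V - covered) \<union> {v\<in>V. \<pi> f v \<notin> covered})"
    have fH: "f \<in> carrier H" using f F by auto
    have form: "\<exists>x\<in>X. \<exists>y\<in>X. (model \<phi> \<circ> \<pi> f) v = \<Phi> x \<and> (\<beta> f \<circ> model \<phi>) v = \<Phi> y" if v: "v \<in> V" for v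
    proof -
      obtain x where x: "x \<in> X" "model \<phi> (\<pi> f v) = \<Phi> x"
        using model_\<Phi>[OF \<phi>] permutes_in_image[OF perm] v by metis
      obtain y where y: "y \<in> X" "model \<phi> v = \<Phi> y" using model_\<Phi>[OF \<phi> v] by blast
      then show ?thesis using x \<beta>_\<Phi>[OF fH y(1)] b_closed[OF fH y(1)] by auto
    qed
    show ?thesis
    proof (rule dist_2_le[OF finite_V V_nonempty _ \<delta>'(1)])
      show "Z \<subseteq> V" by (auto simp: Z_def)
      show "0 \<le> d' ((model \<phi> \<circ> \<pi> f) v) ((\<beta> f \<circ> model \<phi>) v) \<and> d' ((model \<phi> \<circ> \<pi> f) v) ((\<beta> f \<circ> model \<phi>) v) \<le> \<delta>' / 2"
        if v: "v \<in> V - Z" for v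
      proof -
        have "v \<in> V" "v \<in> tame" "v \<in> covered" "\<pi> f v \<in> covered" using v by (auto simp: Z_def)
        then have "d' (model \<phi> (\<pi> f v)) (\<beta> f (model \<phi> v)) < \<delta>"
          using model_equivariant[OF \<phi> _ _ f, of v] \<pi>\<rho>[OF F_FF[OF f]] by simp
        then show ?thesis using \<delta>'(2) MY.nonneg by simp
      qed
      show "0 \<le> d' ((model \<phi> \<circ> \<pi> f) v) ((\<beta> f \<circ> model \<phi>) v) \<and> d' ((model \<phi> \<circ> \<pi> f) v) ((\<beta> f \<circ> model \<phi>) v) \<le> M"
        if v: "v \<in> Z" for v
      proof -
        have "v \<in> V" using v by (auto simp: Z_def)
        then obtain x y where "x \<in> X" "y \<in> X" "(model \<phi> \<circ> \<pi> f) v = \<Phi> x" "(\<beta> f \<circ> model \<phi>) v = \<Phi> y"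
          using form by blast
        then show ?thesis using M MY.nonneg by simp
      qed
      have "card Z \<le> card (V - tame) + (card (V - covered) + card {v\<in>V. \<pi> f v \<notin> covered})"
        unfolding Z_def by (meson add_left_mono card_Un_le order_trans)
      also have "\<dots> \<le> card (V - tame) + (card (V - covered) + card (V - covered))"
        using pre by (intro add_left_mono)
      finally have "real (card Z) \<le> r * n + 2 * (u * n)" using r u by (simp add: n_def)
      then have "real (card Z) * M\<^sup>2 \<le> (r * n + 2 * (u * n)) * M\<^sup>2" by (intro mult_right_mono) auto
      also have "\<dots> = ((r + 2 * u) * M\<^sup>2) * n" by (simp add: algebra_simps)
      also have "\<dots> \<le> 1 / 2 * \<delta>'\<^sup>2 * n" using ru n by (intro mult_right_mono) auto
      finally show "real (card Z) * M\<^sup>2 \<le> 1 / 2 * \<delta>'\<^sup>2 * real (card V)" by (simp add: n_def)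
    qed
  qed
  have "model ` \<Omega> \<subseteq> approx_maps Y d' \<beta> F \<delta>' V \<pi>"
  proof (rule image_subsetI)
    fix \<phi> assume \<phi>: "\<phi> \<in> \<Omega>"
    show "model \<phi> \<in> approx_maps Y d' \<beta> F \<delta>' V \<pi>"
      unfolding approx_maps_def by (rule CollectI, intro conjI ballI model_in[OF \<phi>] dist[OF \<phi>])
  qed
  then show ?thesis using sa ga by blast
qed

end

text \<open>Pigeonhole: all but a small exponential proportion of the models can be assumed to share their
  bad set, their cocycle values along the sparse graph and their coarse values off the cover.\<close>

lemma exists_uniform_class:
  fixes \<kappa> :: "'a \<Rightarrow> 'x \<Rightarrow> 'b" and cell :: "'x \<Rightarrow> nat"
  assumes V: "finite V" and \<Omega>: "finite \<Omega>" "\<And>\<phi> v. \<phi> \<in> \<Omega> \<Longrightarrow> v \<in> V \<Longrightarrow> \<phi> v \<in> X"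
    and big: "exp (a * n) \<le> real (card \<Omega>)"
    and bad: "\<And>\<phi>. \<phi> \<in> \<Omega> \<Longrightarrow> bad \<phi> \<subseteq> V \<and> real (card (bad \<phi>)) \<le> \<rho> * n"
    and small: "real (card {A. A \<subseteq> V \<and> real (card A) \<le> \<rho> * n}) \<le> exp (\<eta> / 4 * n)"
    and D: "D \<subseteq> P \<times> V" "finite P" and \<kappa>: "\<And>g. g \<in> P \<Longrightarrow> finite (\<kappa> g ` X)" and X: "X \<noteq> {}"
    and cost: "(\<Sum>(g, v)\<in>D. ln (real (card (\<kappa> g ` X)))) \<le> \<eta> / 4 * n"
    and cell: "cell ` X \<subseteq> {..<m}"
    and U: "\<And>A. A \<subseteq> V \<Longrightarrow> real (card A) \<le> \<rho> * n \<Longrightarrow> U A \<subseteq> V \<and> real (card (U A)) * ln (real m) \<le> \<eta> / 4 * n"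
  shows "\<exists>A \<Omega>'. \<Omega>' \<subseteq> \<Omega> \<and> (\<forall>\<phi>\<in>\<Omega>'. bad \<phi> = A) \<and> A \<subseteq> V \<and> real (card A) \<le> \<rho> * n \<and>
    (\<forall>\<phi>\<in>\<Omega>'. \<forall>\<psi>\<in>\<Omega>'. (\<forall>(g, v)\<in>D. \<kappa> g (\<phi> v) = \<kappa> g (\<psi> v)) \<and> (\<forall>v\<in>U A. cell (\<phi> v) = cell (\<psi> v))) \<and>
    exp ((a - 3 / 4 * \<eta>) * n) \<le> real (card \<Omega>')"
proof -
  let ?S = "{A. A \<subseteq> V \<and> real (card A) \<le> \<rho> * n}"
  have finS: "finite ?S" by (rule finite_subset[of _ "Pow V"]) (use V in auto)
  have "\<exists>y\<in>?S. exp (a * n - \<eta> / 4 * n) \<le> real (card {\<phi>\<in>\<Omega>. bad \<phi> = y})"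
    by (rule pigeonhole_exp[OF \<Omega>(1) finS _ big small]) (use bad in auto)
  then obtain A where A: "A \<subseteq> V" "real (card A) \<le> \<rho> * n"
    and big1: "exp (a * n - \<eta> / 4 * n) \<le> real (card {\<phi>\<in>\<Omega>. bad \<phi> = A})" by blast
  define \<Omega>1 where "\<Omega>1 = {\<phi>\<in>\<Omega>. bad \<phi> = A}"
  have \<Omega>1: "finite \<Omega>1" "\<Omega>1 \<subseteq> \<Omega>" using \<Omega> by (auto simp: \<Omega>1_def)
  have finD: "finite D" using D V by (auto intro: finite_subset)
  let ?K = "PiE D (\<lambda>(g, v). \<kappa> g ` X)"
  have finK: "finite ?K" using finD D \<kappa> by (intro finite_PiE) auto
  have pos: "0 < card (\<kappa> g ` X)" if "g \<in> P" for g using \<kappa>[OF that] X by (simp add: card_gt_0_iff)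
  have cardK: "real (card ?K) \<le> exp (\<eta> / 4 * n)"
  proof -
    have "real (card ?K) = (\<Prod>(g, v)\<in>D. real (card (\<kappa> g ` X)))"
      using finD by (simp add: card_PiE split_beta)
    also have "\<dots> = (\<Prod>(g, v)\<in>D. exp (ln (real (card (\<kappa> g ` X)))))"
      using D pos by (intro prod.cong) auto
    also have "\<dots> = exp (\<Sum>(g, v)\<in>D. ln (real (card (\<kappa> g ` X))))"
      using finD by (simp add: exp_sum split_beta)
    also have "\<dots> \<le> exp (\<eta> / 4 * n)" using cost by simp
    finally show ?thesis .
  qed
  let ?f = "\<lambda>\<phi>. restrict (\<lambda>(g, v). \<kappa> g (\<phi> v)) D"
  have im: "?f ` \<Omega>1 \<subseteq> ?K" using \<Omega>(2) \<Omega>1(2) D by (fastforce simp: PiE_iff)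
  have "\<exists>y\<in>?K. exp (a * n - \<eta> / 4 * n - \<eta> / 4 * n) \<le> real (card {\<phi>\<in>\<Omega>1. ?f \<phi> = y})"
    by (rule pigeonhole_exp[OF \<Omega>1(1) finK im _ cardK]) (use big1 in \<open>simp add: \<Omega>1_def\<close>)
  then obtain y where big2: "exp (a * n - \<eta> / 4 * n - \<eta> / 4 * n) \<le> real (card {\<phi>\<in>\<Omega>1. ?f \<phi> = y})" by blast
  define \<Omega>2 where "\<Omega>2 = {\<phi>\<in>\<Omega>1. ?f \<phi> = y}"
  have \<Omega>2: "finite \<Omega>2" "\<Omega>2 \<subseteq> \<Omega>1" using \<Omega>1 by (auto simp: \<Omega>2_def)
  have UA: "U A \<subseteq> V" "real (card (U A)) * ln (real m) \<le> \<eta> / 4 * n" using U[OF A] by auto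
  have finU: "finite (U A)" using UA(1) V by (rule finite_subset)
  have m: "0 < m" using cell X by auto
  let ?L = "PiE (U A) (\<lambda>_. {..<m})"
  have finL: "finite ?L" using finU by (intro finite_PiE) auto
  have cardL: "real (card ?L) \<le> exp (\<eta> / 4 * n)"
  proof -
    have "real (card ?L) = real m ^ card (U A)" using finU by (simp add: card_PiE)
    also have "\<dots> = exp (real (card (U A)) * ln (real m))" using m by (simp add: exp_of_nat_mult)
    also have "\<dots> \<le> exp (\<eta> / 4 * n)" using UA(2) by simp
    finally show ?thesis .
  qed
  let ?g = "\<lambda>\<phi>. restrict (\<lambda>v. cell (\<phi> v)) (U A)"
  have im': "?g ` \<Omega>2 \<subseteq> ?L" using \<Omega>(2) \<Omega>1(2) \<Omega>2(2) UA(1) cell by (fastforce simp: PiE_iff)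
  have "\<exists>z\<in>?L. exp (a * n - \<eta> / 4 * n - \<eta> / 4 * n - \<eta> / 4 * n) \<le> real (card {\<phi>\<in>\<Omega>2. ?g \<phi> = z})"
    by (rule pigeonhole_exp[OF \<Omega>2(1) finL im' _ cardL]) (use big2 in \<open>simp add: \<Omega>2_def\<close>)
  then obtain z where big3: "exp (a * n - \<eta> / 4 * n - \<eta> / 4 * n - \<eta> / 4 * n) \<le> real (card {\<phi>\<in>\<Omega>2. ?g \<phi> = z})" by blast
  define \<Omega>3 where "\<Omega>3 = {\<phi>\<in>\<Omega>2. ?g \<phi> = z}"
  have sub3: "\<Omega>3 \<subseteq> \<Omega>" and bad3: "\<forall>\<phi>\<in>\<Omega>3. bad \<phi> = A" by (auto simp: \<Omega>3_def \<Omega>2_def \<Omega>1_def)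
  have same: "(\<forall>(g, v)\<in>D. \<kappa> g (\<phi> v) = \<kappa> g (\<psi> v)) \<and> (\<forall>v\<in>U A. cell (\<phi> v) = cell (\<psi> v))"
    if "\<phi> \<in> \<Omega>3" "\<psi> \<in> \<Omega>3" for \<phi> \<psi>
  proof -
    have f: "?f \<phi> = ?f \<psi>" and g: "?g \<phi> = ?g \<psi>" using that by (simp_all add: \<Omega>3_def \<Omega>2_def)
    have "\<kappa> g (\<phi> v) = \<kappa> g (\<psi> v)" if "(g, v) \<in> D" for g v
      using fun_cong[OF f, of "(g, v)"] that by simp
    moreover have "cell (\<phi> v) = cell (\<psi> v)" if "v \<in> U A" for v
      using fun_cong[OF g, of v] that by simp
    ultimately show ?thesis by auto
  qed
  have "a * n - \<eta> / 4 * n - \<eta> / 4 * n - \<eta> / 4 * n = (a - 3 / 4 * \<eta>) * n" by (simp add: algebra_simps)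
  then have big: "exp ((a - 3 / 4 * \<eta>) * n) \<le> real (card \<Omega>3)" using big3 by (simp only: \<Omega>3_def)
  show ?thesis
    by (intro exI[of _ A] exI[of _ \<Omega>3] conjI sub3 bad3 A big) (intro ballI same)
qed

text \<open>The topology that the counting needs, in metric form: compactness enters as uniform
  continuity, uniform local constancy, finite ranges, boundedness and finite partitions into small
  cells.\<close>

locale regular_pair = cocycle_pair G H X d Y d' \<alpha> \<beta> b \<Phi> \<kappa> l
  for G :: "('a, 'm) monoid_scheme" (structure) and H :: "('b, 'n) monoid_scheme"
    and X :: "'x set" and d and Y :: "'y set" and d' and \<alpha> \<beta> b \<Phi> \<kappa> l +
  assumes finite_\<kappa>: "\<And>g. g \<in> carrier G \<Longrightarrow> finite (\<kappa> g ` X)"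
    and finite_l: "\<And>h. h \<in> carrier H \<Longrightarrow> finite (l h ` X)"
    and \<kappa>_loc: "\<And>g. g \<in> carrier G \<Longrightarrow> \<exists>\<tau>>0. \<forall>x\<in>X. \<forall>y\<in>X. d x y < \<tau> \<longrightarrow> \<kappa> g x = \<kappa> g y"
    and l_loc: "\<And>h. h \<in> carrier H \<Longrightarrow> \<exists>\<tau>>0. \<forall>x\<in>X. \<forall>y\<in>X. d x y < \<tau> \<longrightarrow> l h x = l h y"
    and \<alpha>_unif: "\<And>g \<epsilon>. g \<in> carrier G \<Longrightarrow> 0 < \<epsilon> \<Longrightarrow> \<exists>\<tau>>0. \<forall>x\<in>X. \<forall>y\<in>X. d x y < \<tau> \<longrightarrow> d (\<alpha> g x) (\<alpha> g y) < \<epsilon>"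
    and \<Phi>_unif: "\<And>h \<epsilon>. h \<in> carrier H \<Longrightarrow> 0 < \<epsilon> \<Longrightarrow>
      \<exists>\<tau>>0. \<forall>x\<in>X. \<forall>y\<in>X. d x y < \<tau> \<longrightarrow> d' (\<Phi> (b h x)) (\<Phi> (b h y)) < \<epsilon>"
    and \<Phi>_inv_unif: "\<And>h \<epsilon>. h \<in> carrier H \<Longrightarrow> 0 < \<epsilon> \<Longrightarrow>
      \<exists>\<tau>>0. \<forall>x\<in>X. \<forall>y\<in>X. d' (\<Phi> (b h x)) (\<Phi> (b h y)) < \<tau> \<longrightarrow> d x y < \<epsilon>"
    and bounded: "\<exists>M>0. \<forall>x\<in>X. \<forall>y\<in>X. d' (\<Phi> x) (\<Phi> y) \<le> M"
    and cells: "\<And>\<epsilon>. 0 < \<epsilon> \<Longrightarrow> \<exists>(m :: nat) cell. cell ` X \<subseteq> {..<m} \<and> (\<forall>x\<in>X. \<forall>y\<in>X. cell x = cell y \<longrightarrow> d x y < \<epsilon>)"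
begin

lemma common_\<kappa>_loc:
  assumes "finite Q" "Q \<subseteq> carrier G"
  shows "\<exists>\<tau>>0. \<forall>g\<in>Q. \<forall>x\<in>X. \<forall>y\<in>X. d x y < \<tau> \<longrightarrow> \<kappa> g x = \<kappa> g y"
proof (rule finite_common_threshold[OF assms(1)])
  show "\<exists>\<tau>>0. \<forall>x\<in>X. \<forall>y\<in>X. d x y < \<tau> \<longrightarrow> \<kappa> q x = \<kappa> q y" if "q \<in> Q" for q
    using \<kappa>_loc that assms by blast
qed fastforce

lemma common_l_loc:
  assumes "finite Q" "Q \<subseteq> carrier H"
  shows "\<exists>\<tau>>0. \<forall>h\<in>Q. \<forall>x\<in>X. \<forall>y\<in>X. d x y < \<tau> \<longrightarrow> l h x = l h y"
proof (rule finite_common_threshold[OF assms(1)])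
  show "\<exists>\<tau>>0. \<forall>x\<in>X. \<forall>y\<in>X. d x y < \<tau> \<longrightarrow> l q x = l q y" if "q \<in> Q" for q
    using l_loc that assms by blast
qed fastforce

lemma common_\<Phi>_unif:
  assumes "finite Q" "Q \<subseteq> carrier H" and \<epsilon>: "0 < \<epsilon>"
  shows "\<exists>\<tau>>0. \<forall>h\<in>Q. \<forall>x\<in>X. \<forall>y\<in>X. d x y < \<tau> \<longrightarrow> d' (\<Phi> (b h x)) (\<Phi> (b h y)) < \<epsilon>"
proof (rule finite_common_threshold[OF assms(1)])
  show "\<exists>\<tau>>0. \<forall>x\<in>X. \<forall>y\<in>X. d x y < \<tau> \<longrightarrow> d' (\<Phi> (b q x)) (\<Phi> (b q y)) < \<epsilon>" if "q \<in> Q" for q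
    using \<Phi>_unif[OF _ \<epsilon>] that assms by blast
qed fastforce

lemma common_expansion:
  assumes Q: "finite Q" "Q \<subseteq> carrier H" and S: "finite S" "S \<subseteq> carrier G" and \<epsilon>: "0 < \<epsilon>"
  shows "\<exists>\<tau>>0. \<forall>p\<in>Q \<times> S. \<forall>x\<in>X. \<forall>y\<in>X. d' (\<Phi> (b (fst p) x)) (\<Phi> (b (fst p) y)) < \<tau> \<longrightarrow>
    d (\<alpha> (snd p) x) (\<alpha> (snd p) y) < \<epsilon>"
proof (rule finite_common_threshold)
  show "finite (Q \<times> S)" using Q S by simp
  show "\<exists>\<tau>>0. \<forall>x\<in>X. \<forall>y\<in>X. d' (\<Phi> (b (fst p) x)) (\<Phi> (b (fst p) y)) < \<tau> \<longrightarrow>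
    d (\<alpha> (snd p) x) (\<alpha> (snd p) y) < \<epsilon>" if "p \<in> Q \<times> S" for p
  proof -
    have p: "fst p \<in> carrier H" "snd p \<in> carrier G" using that Q S by auto
    obtain \<tau>1 where "\<tau>1 > 0" and 1: "\<forall>x\<in>X. \<forall>y\<in>X. d x y < \<tau>1 \<longrightarrow> d (\<alpha> (snd p) x) (\<alpha> (snd p) y) < \<epsilon>"
      using \<alpha>_unif[OF p(2) \<epsilon>] by blast
    obtain \<tau> where "\<tau> > 0" and 2: "\<forall>x\<in>X. \<forall>y\<in>X. d' (\<Phi> (b (fst p) x)) (\<Phi> (b (fst p) y)) < \<tau> \<longrightarrow> d x y < \<tau>1"
      using \<Phi>_inv_unif[OF p(1) \<open>\<tau>1 > 0\<close>] by blast
    then show ?thesis using 1 2 by (intro exI[of _ \<tau>]) simp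
  qed
qed fastforce

text \<open>The order of choices matters. S, the finite set \<open>HS\<close> of labels and then
  \<epsilon>' come from \<eta> and \<epsilon> before F and \<delta>' are given, so the separation of
  transferred models does not shrink as F grows. Afterwards T is built from \<open>HS\<close> and F;
  the graph, the window P and the thresholds follow. Finally k is taken among the infinitely many
  indices at which G has many models.\<close>

lemma transfer_entropy:
  fixes V :: "nat \<Rightarrow> nat set"
  assumes seq: "sofic_approximation_sequence G V \<sigma>" and sc: "sparsely_connected G V \<sigma>"
    and \<eta>: "0 < \<eta>" and \<epsilon>: "0 < \<epsilon>"
    and many: "\<And>P \<delta>. finite P \<Longrightarrow> P \<subseteq> carrier G \<Longrightarrow> 0 < \<delta> \<Longrightarrow> \<exists>\<^sub>F k in sequentially. \<exists>\<Omega>. finite \<Omega> \<and>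
      \<Omega> \<subseteq> approx_maps X d \<alpha> P \<delta> (V k) (\<sigma> k) \<and>
      (\<forall>\<phi>\<in>\<Omega>. \<forall>\<psi>\<in>\<Omega>. \<phi> \<noteq> \<psi> \<longrightarrow> \<epsilon> \<le> dist_inf d (V k) \<phi> \<psi>) \<and> exp (a * real (card (V k))) \<le> real (card \<Omega>)"
  shows "\<exists>\<epsilon>'>0. \<forall>F \<delta>'. finite F \<and> F \<subseteq> carrier H \<and> 0 < \<delta>' \<longrightarrow> (\<exists>k \<pi> \<Omega>.
      sofic_approximation H (V k) \<pi> \<and> good_approximation H F \<delta>' (V k) \<pi> \<and> finite \<Omega> \<and>
      \<Omega> \<subseteq> approx_maps Y d' \<beta> F \<delta>' (V k) \<pi> \<and>
      (\<forall>\<phi>\<in>\<Omega>. \<forall>\<psi>\<in>\<Omega>. \<phi> \<noteq> \<psi> \<longrightarrow> \<epsilon>' \<le> dist_inf d' (V k) \<phi> \<psi>) \<and>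
      exp ((a - \<eta>) * real (card (V k))) \<le> real (card \<Omega>))"
proof -
  have G: "group G" by (rule is_group)
  interpret MY: Metric_space Y d' by (rule MY)
  have Xne: "X \<noteq> {}"
  proof -
    have "\<exists>k. \<exists>\<Omega>. finite \<Omega> \<and> \<Omega> \<subseteq> approx_maps X d \<alpha> {} 1 (V k) (\<sigma> k) \<and>
      (\<forall>\<phi>\<in>\<Omega>. \<forall>\<psi>\<in>\<Omega>. \<phi> \<noteq> \<psi> \<longrightarrow> \<epsilon> \<le> dist_inf d (V k) \<phi> \<psi>) \<and> exp (a * real (card (V k))) \<le> real (card \<Omega>)"
      by (rule frequently_ex[OF many]) auto
    then obtain k \<Omega> where \<Omega>: "\<Omega> \<subseteq> approx_maps X d \<alpha> {} 1 (V k) (\<sigma> k)" "exp (a * real (card (V k))) \<le> real (card \<Omega>)"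
      by (elim exE conjE) (rule that)
    have "\<Omega> \<noteq> {}" using \<Omega>(2) by (metis card.empty exp_gt_zero not_le of_nat_0)
    then obtain \<phi> where "\<phi> \<in> V k \<rightarrow>\<^sub>E X" using \<Omega>(1) by (auto simp: approx_maps_def)
    moreover have "V k \<noteq> {}" using sofic_approx.V_nonempty[OF sofic_approx_of_sequence[OF G seq]] .
    ultimately show ?thesis by auto
  qed
  define c where "c g = ln (real (card (\<kappa> g ` X)))" for g
  have c: "0 \<le> c g" if "g \<in> carrier G" for g
  proof -
    have "0 < card (\<kappa> g ` X)" using finite_\<kappa>[OF that] Xne by (simp add: card_gt_0_iff)
    then show ?thesis by (simp add: c_def)
  qed
  \<comment> \<open>With the slack e at most \<eta> / 8, the cost of D will be at most \<eta> / 4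
    times |V|, the share allotted to fixing cocycle values. The other two shares go to the
    exceptional set and to the cells.\<close>
  have "\<exists>S. finite S \<and> S \<subseteq> carrier G \<and> sparsely_linked_on G V \<sigma> c (\<eta> / 8) S (carrier G)"
    using sc[unfolded sparsely_connected_def, THEN spec, THEN spec, of c "\<eta> / 8"] c \<eta> by simp
  then obtain S where S: "finite S" "S \<subseteq> carrier G" and PS: "sparsely_linked_on G V \<sigma> c (\<eta> / 8) S (carrier G)"
    by (elim exE conjE) (rule that)
  define HS where "HS = (\<Union>s\<in>S. \<kappa> s ` X)"
  have HS: "finite HS" "HS \<subseteq> carrier H" using S finite_\<kappa> \<kappa>_closed by (auto simp: HS_def)
  have "0 < \<epsilon> / 4" using \<epsilon> by simp
  obtain \<epsilon>' where \<epsilon>'_pos: "0 < \<epsilon>'" and exp: "\<forall>p\<in>HS \<times> S. \<forall>x\<in>X. \<forall>y\<in>X. d' (\<Phi> (b (fst p) x)) (\<Phi> (b (fst p) y)) < \<epsilon>' \<longrightarrow>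
    d (\<alpha> (snd p) x) (\<alpha> (snd p) y) < \<epsilon> / 4"
    using common_expansion[OF HS S \<open>0 < \<epsilon> / 4\<close>] by (elim exE conjE) (rule that)
  have "\<exists>k \<pi> \<Omega>. sofic_approximation H (V k) \<pi> \<and> good_approximation H F \<delta>' (V k) \<pi> \<and> finite \<Omega> \<and>
      \<Omega> \<subseteq> approx_maps Y d' \<beta> F \<delta>' (V k) \<pi> \<and>
      (\<forall>\<phi>\<in>\<Omega>. \<forall>\<psi>\<in>\<Omega>. \<phi> \<noteq> \<psi> \<longrightarrow> \<epsilon>' \<le> dist_inf d' (V k) \<phi> \<psi>) \<and>
      exp ((a - \<eta>) * real (card (V k))) \<le> real (card \<Omega>)"
    if F: "finite F" "F \<subseteq> carrier H" and \<delta>': "0 < \<delta>'" for F \<delta>'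
  proof -
    \<comment> \<open>If a net point has a translate with label h, and f maps it to a translate of
      another net point with label h', then inv h' f h leads from the first net point to the second;
      T lists the readings of these elements in G.\<close>
    define T where "T = (\<Union>h\<in>HS. \<Union>h'\<in>HS. \<Union>f\<in>F. l (inv\<^bsub>H\<^esub> h' \<otimes>\<^bsub>H\<^esub> (f \<otimes>\<^bsub>H\<^esub> h)) ` X)"
    have hc: "inv\<^bsub>H\<^esub> h' \<otimes>\<^bsub>H\<^esub> (f \<otimes>\<^bsub>H\<^esub> h) \<in> carrier H" if "h \<in> HS" "h' \<in> HS" "f \<in> F" for h h' f
      using that HS(2) F(2) by (simp add: subset_iff)
    have T: "finite T" "T \<subseteq> carrier G"
      using HS(1) F(1) finite_l[OF hc] l_closed[OF hc] by (auto simp: T_def)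
    define FF where "FF = F \<union> (\<lambda>(s, t). s \<otimes>\<^bsub>H\<^esub> t) ` (F \<times> F)"
    have FF: "finite FF" "FF \<subseteq> carrier H" using F by (auto simp: FF_def)
    define \<Lambda> where "\<Lambda> = (\<Union>h\<in>FF. l h ` X)"
    have \<Lambda>: "finite \<Lambda>" "\<Lambda> \<subseteq> carrier G" using FF finite_l l_closed by (auto simp: \<Lambda>_def)
    obtain M where M: "M > 0" "\<forall>x\<in>X. \<forall>y\<in>X. d' (\<Phi> x) (\<Phi> y) \<le> M" using bounded by blast
    obtain m :: nat and cell where cell: "cell ` X \<subseteq> {..<m}" "\<forall>x\<in>X. \<forall>y\<in>X. cell x = cell y \<longrightarrow> d x y < \<epsilon>"
      using cells[OF \<epsilon>] by (elim exE conjE) (rule that)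
    have m: "0 < m" using cell(1) Xne by auto
    then have lm: "0 \<le> ln (real m)" by simp
    \<comment> \<open>u bounds the density of uncovered points. The first bound pays for prescribing
      a cell at each of them, the second keeps their part of the mean square distance below the
      tolerance.\<close>
    define u where "u = min (\<eta> / 4 / (ln (real m) + 1)) (\<delta>'\<^sup>2 / (8 * M\<^sup>2))"
    have u: "0 < u" using \<eta> lm \<delta>' M by (auto simp: u_def)
    have um: "u * ln (real m) \<le> \<eta> / 4"
    proof -
      have "u * ln (real m) \<le> \<eta> / 4 / (ln (real m) + 1) * ln (real m)"
        using lm by (intro mult_right_mono) (simp_all add: u_def)
      also have "\<dots> \<le> \<eta> / 4" using lm \<eta> by (simp add: field_simps)
      finally show ?thesis .
    qed
    have uM: "3 * u * M\<^sup>2 \<le> 1 / 2 * \<delta>'\<^sup>2"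
    proof -
      have "u * M\<^sup>2 \<le> \<delta>'\<^sup>2 / (8 * M\<^sup>2) * M\<^sup>2" by (intro mult_right_mono) (simp_all add: u_def)
      also have "\<dots> = \<delta>'\<^sup>2 / 8" using M by simp
      finally have "3 * (u * M\<^sup>2) \<le> 3 * (\<delta>'\<^sup>2 / 8)" by simp
      moreover have "0 \<le> \<delta>'\<^sup>2" by simp
      ultimately show ?thesis by linarith
    qed
    \<comment> \<open>r bounds the density of points that are not tame. It is small compared with 1
      / |S|, since the loss of one net point can uncover |S| points.\<close>
    define r where "r = min (u / (2 * (real (card S) + 1))) (\<delta>' / 2)"
    have r: "0 < r" "2 * r \<le> \<delta>'" using u \<delta>' by (auto simp: r_def)
    have rS: "real (card S) * r \<le> u / 2" "r \<le> u"
    proof -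
      have le: "r \<le> u / (2 * (real (card S) + 1))" by (simp add: r_def)
      then have "(real (card S) + 1) * r \<le> (real (card S) + 1) * (u / (2 * (real (card S) + 1)))"
        by (intro mult_left_mono) auto
      also have "\<dots> = u / 2" by (simp add: field_simps)
      finally have a: "real (card S) * r + r \<le> u / 2" by (simp add: distrib_right)
      have "0 \<le> real (card S) * r" using r by simp
      then show "real (card S) * r \<le> u / 2" "r \<le> u" using a r u by linarith+
    qed
    define e where "e = min (u / 2) (\<eta> / 8)"
    have e: "0 < e" "e \<le> u / 2" "e \<le> \<eta> / 8" using u \<eta> by (auto simp: e_def)
    have "sparsely_linked G V \<sigma> c (\<eta> / 8) S T" using PS T by (simp add: sparsely_linked_on_def)
    then obtain E C where E: "finite E" "E \<subseteq> carrier G" and ev1: "\<forall>\<^sub>F k in sequentially. \<exists>W D. W \<subseteq> V k \<and> D \<subseteq> E \<times> V k \<and>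
          real (card (V k - (\<Union>s\<in>S. \<sigma> k s ` W))) \<le> e * real (card (V k)) \<and>
          (\<Sum>(g, v)\<in>D. c g) \<le> (\<eta> / 8 + e) * real (card (V k)) \<and>
          (\<forall>w\<in>W. \<forall>t\<in>T. \<sigma> k t w \<in> W \<longrightarrow> linked (\<sigma> k) D C w (\<sigma> k t w))"
      using e(1) by (rule sparsely_linkedE)
    define B where "B = E \<union> S \<union> T \<union> \<Lambda>"
    have B: "finite B" "B \<subseteq> carrier G" using E S T \<Lambda> by (auto simp: B_def)
    define P where "P = words G B (C + 4)"
    have P: "finite P" "P \<subseteq> carrier G" using finite_words[OF B(1)] words_closed[OF B(2)] by (auto simp: P_def)
    obtain \<tau>1 where \<tau>1: "\<tau>1 > 0" "\<forall>g\<in>P. \<forall>x\<in>X. \<forall>y\<in>X. d x y < \<tau>1 \<longrightarrow> \<kappa> g x = \<kappa> g y"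
      using common_\<kappa>_loc[OF P] by (elim exE conjE) (rule that)
    have "finite (FF \<union> m_inv H ` FF)" "FF \<union> m_inv H ` FF \<subseteq> carrier H" using FF by auto
    then obtain \<tau>2 where \<tau>2: "\<tau>2 > 0" "\<forall>h\<in>FF \<union> m_inv H ` FF. \<forall>x\<in>X. \<forall>y\<in>X. d x y < \<tau>2 \<longrightarrow> l h x = l h y"
      using common_l_loc[of "FF \<union> m_inv H ` FF"] by auto
    have "0 < \<delta>' / 2" using \<delta>' by simp
    then obtain \<tau>3 where \<tau>3: "\<tau>3 > 0" "\<forall>h\<in>HS. \<forall>x\<in>X. \<forall>y\<in>X. d x y < \<tau>3 \<longrightarrow> d' (\<Phi> (b h x)) (\<Phi> (b h y)) < \<delta>' / 2"
      using common_\<Phi>_unif[OF HS, of "\<delta>' / 2"] by auto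
    define \<tau> where "\<tau> = min (min \<tau>1 \<tau>2) (min \<tau>3 (\<epsilon> / 4))"
    have \<tau>: "0 < \<tau>" "\<tau> \<le> \<tau>1" "\<tau> \<le> \<tau>2" "\<tau> \<le> \<tau>3" "\<tau> \<le> \<epsilon> / 4" using \<tau>1 \<tau>2 \<tau>3 \<epsilon> by (auto simp: \<tau>_def)
    have "0 < \<eta> / 4" using \<eta> by simp
    then obtain \<rho>1 where \<rho>1: "\<rho>1 > 0" "\<forall>A :: nat set. finite A \<longrightarrow>
      real (card {A'. A' \<subseteq> A \<and> real (card A') \<le> \<rho>1 * real (card A)}) \<le> exp (\<eta> / 4 * real (card A))"
      using card_small_subsets[of "\<eta> / 4"] by auto
    define \<rho> where "\<rho> = min \<rho>1 (r / 2)"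
    have \<rho>: "0 < \<rho>" "\<rho> \<le> \<rho>1" "\<rho> \<le> r / 2" using \<rho>1 r by (auto simp: \<rho>_def)
    \<comment> \<open>By Chebyshev's inequality each g in P spoils at most (\<delta> / \<tau>)^2 |V|
      points of a model, so all of P together spoils at most \<rho> |V|.\<close>
    define \<delta> where "\<delta> = \<tau> * sqrt (\<rho> / (real (card P) + 1))"
    have \<delta>: "0 < \<delta>" "\<delta>\<^sup>2 / \<tau>\<^sup>2 = \<rho> / (real (card P) + 1)"
      using \<tau> \<rho> by (auto simp: \<delta>_def power_mult_distrib)
    have r2: "0 < r / 2" using r by simp
    note ev2 = eventually_good_points[OF seq P r2]
    have "\<exists>\<^sub>F k in sequentially. (\<exists>\<Omega>. finite \<Omega> \<and> \<Omega> \<subseteq> approx_maps X d \<alpha> P \<delta> (V k) (\<sigma> k) \<and>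
      (\<forall>\<phi>\<in>\<Omega>. \<forall>\<psi>\<in>\<Omega>. \<phi> \<noteq> \<psi> \<longrightarrow> \<epsilon> \<le> dist_inf d (V k) \<phi> \<psi>) \<and> exp (a * real (card (V k))) \<le> real (card \<Omega>)) \<and>
      (\<exists>W D. W \<subseteq> V k \<and> D \<subseteq> E \<times> V k \<and>
          real (card (V k - (\<Union>s\<in>S. \<sigma> k s ` W))) \<le> e * real (card (V k)) \<and>
          (\<Sum>(g, v)\<in>D. c g) \<le> (\<eta> / 8 + e) * real (card (V k)) \<and>
          (\<forall>w\<in>W. \<forall>t\<in>T. \<sigma> k t w \<in> W \<longrightarrow> linked (\<sigma> k) D C w (\<sigma> k t w))) \<and>
      real (card (V k - good_points G P (V k) (\<sigma> k))) \<le> r / 2 * real (card (V k))"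
      using frequently_eventually_conj[OF many[OF P \<delta>(1)] eventually_conj[OF ev1 ev2]]
      by (rule frequently_elim1) simp
    then obtain k where "(\<exists>\<Omega>. finite \<Omega> \<and> \<Omega> \<subseteq> approx_maps X d \<alpha> P \<delta> (V k) (\<sigma> k) \<and>
      (\<forall>\<phi>\<in>\<Omega>. \<forall>\<psi>\<in>\<Omega>. \<phi> \<noteq> \<psi> \<longrightarrow> \<epsilon> \<le> dist_inf d (V k) \<phi> \<psi>) \<and> exp (a * real (card (V k))) \<le> real (card \<Omega>)) \<and>
      (\<exists>W D. W \<subseteq> V k \<and> D \<subseteq> E \<times> V k \<and>
          real (card (V k - (\<Union>s\<in>S. \<sigma> k s ` W))) \<le> e * real (card (V k)) \<and>
          (\<Sum>(g, v)\<in>D. c g) \<le> (\<eta> / 8 + e) * real (card (V k)) \<and>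
          (\<forall>w\<in>W. \<forall>t\<in>T. \<sigma> k t w \<in> W \<longrightarrow> linked (\<sigma> k) D C w (\<sigma> k t w))) \<and>
      real (card (V k - good_points G P (V k) (\<sigma> k))) \<le> r / 2 * real (card (V k))"
      by (rule exE[OF frequently_ex]) (rule that)
    then obtain \<Omega> W D where \<Omega>: "finite \<Omega>" "\<Omega> \<subseteq> approx_maps X d \<alpha> P \<delta> (V k) (\<sigma> k)"
      and sep: "\<forall>\<phi>\<in>\<Omega>. \<forall>\<psi>\<in>\<Omega>. \<phi> \<noteq> \<psi> \<longrightarrow> \<epsilon> \<le> dist_inf d (V k) \<phi> \<psi>"
      and big: "exp (a * real (card (V k))) \<le> real (card \<Omega>)"
      and W: "W \<subseteq> V k" and D: "D \<subseteq> E \<times> V k"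
      and cov: "real (card (V k - (\<Union>s\<in>S. \<sigma> k s ` W))) \<le> e * real (card (V k))"
      and cost: "(\<Sum>(g, v)\<in>D. c g) \<le> (\<eta> / 8 + e) * real (card (V k))"
      and link: "\<forall>w\<in>W. \<forall>t\<in>T. \<sigma> k t w \<in> W \<longrightarrow> linked (\<sigma> k) D C w (\<sigma> k t w)"
      and gd: "real (card (V k - good_points G P (V k) (\<sigma> k))) \<le> r / 2 * real (card (V k))"
      by (elim exE conjE) (rule that)
    interpret sofic_approx G "V k" "\<sigma> k" by (rule sofic_approx_of_sequence[OF G seq])
    define n where "n = real (card (V k))"
    have n: "n > 0" using card_V_pos by (simp add: n_def)
    have \<Omega>X: "\<phi> v \<in> X" if "\<phi> \<in> \<Omega>" "v \<in> V k" for \<phi> v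
      using subsetD[OF \<Omega>(2) that(1)] that(2) by (auto simp: approx_maps_def)
    define bad where "bad \<phi> = {v\<in>V k. \<exists>g\<in>P. \<tau> \<le> d (\<phi> (\<sigma> k g v)) (\<alpha> g (\<phi> v))}" for \<phi>
    have bad: "bad \<phi> \<subseteq> V k \<and> real (card (bad \<phi>)) \<le> \<rho> * n" if \<phi>: "\<phi> \<in> \<Omega>" for \<phi>
    proof
      show "bad \<phi> \<subseteq> V k" by (auto simp: bad_def)
      have dist: "dist_2 d (V k) (\<phi> \<circ> \<sigma> k g) (\<alpha> g \<circ> \<phi>) \<le> \<delta>" if "g \<in> P" for g
        using subsetD[OF \<Omega>(2) \<phi>] that by (simp add: approx_maps_def)
      have eq: "bad \<phi> = (\<Union>g\<in>P. {v\<in>V k. \<tau> \<le> d ((\<phi> \<circ> \<sigma> k g) v) ((\<alpha> g \<circ> \<phi>) v)})" by (auto simp: bad_def)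
      have "card (bad \<phi>) \<le> (\<Sum>g\<in>P. card {v\<in>V k. \<tau> \<le> d ((\<phi> \<circ> \<sigma> k g) v) ((\<alpha> g \<circ> \<phi>) v)})"
        unfolding eq by (rule card_UN_le[OF P(1)])
      then have "real (card (bad \<phi>)) \<le> real (\<Sum>g\<in>P. card {v\<in>V k. \<tau> \<le> d ((\<phi> \<circ> \<sigma> k g) v) ((\<alpha> g \<circ> \<phi>) v)})"
        by (rule of_nat_mono)
      also have "\<dots> = (\<Sum>g\<in>P. real (card {v\<in>V k. \<tau> \<le> d ((\<phi> \<circ> \<sigma> k g) v) ((\<alpha> g \<circ> \<phi>) v)}))" by (rule of_nat_sum)
      also have "\<dots> \<le> (\<Sum>g\<in>P. \<delta>\<^sup>2 / \<tau>\<^sup>2 * n)"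
        unfolding n_def by (intro sum_mono card_far_le[OF finite_V V_nonempty \<tau>(1) dist])
      also have "\<dots> = real (card P) * (\<rho> / (real (card P) + 1)) * n" by (simp add: \<delta>(2))
      also have "\<dots> \<le> \<rho> * n"
      proof (rule mult_right_mono)
        show "real (card P) * (\<rho> / (real (card P) + 1)) \<le> \<rho>" using \<rho>(1) by (simp add: field_simps)
      qed (use n in simp)
      finally show "real (card (bad \<phi>)) \<le> \<rho> * n" .
    qed
    \<comment> \<open>The uncovered part depends on the exceptional set A, whose points are removed
      from the net. It is therefore known only after the models have been sorted by their
      exceptional sets.\<close>
    define U where "U A = V k - (\<Union>s\<in>S. \<sigma> k s ` (W \<inter> (good P - A)))" for A
    have tame_bound: "real (card (V k - (good P - A))) \<le> r * n" if A: "A \<subseteq> V k" "real (card A) \<le> \<rho> * n" for A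
    proof -
      have "card (V k - (good P - A)) \<le> card ((V k - good P) \<union> A)"
        using finite_V A finite_subset by (intro card_mono) auto
      also have "\<dots> \<le> card (V k - good P) + card A" by (rule card_Un_le)
      finally have "real (card (V k - (good P - A))) \<le> real (card (V k - good P)) + real (card A)" by linarith
      also have "\<dots> \<le> r / 2 * n + \<rho> * n" using gd A(2) by (simp add: n_def)
      also have "\<dots> \<le> r / 2 * n + r / 2 * n" using \<rho>(3) n by (intro add_left_mono mult_right_mono) auto
      finally show ?thesis by (simp add: mult.commute)
    qed
    have U_bound: "real (card (U A)) \<le> u * n" if A: "A \<subseteq> V k" "real (card A) \<le> \<rho> * n" for A
    proof -
      have "real (card (U A)) \<le> real (card (V k - (\<Union>s\<in>S. \<sigma> k s ` W)) + card S * card (V k - (good P - A)))"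
        unfolding U_def by (rule of_nat_mono[OF card_uncovered_Int_le[OF S W]])
      also have "\<dots> = real (card (V k - (\<Union>s\<in>S. \<sigma> k s ` W))) + real (card S) * real (card (V k - (good P - A)))"
        by simp
      also have "\<dots> \<le> e * n + real (card S) * (r * n)"
        using cov tame_bound[OF A] by (intro add_mono mult_left_mono) (auto simp: n_def)
      also have "\<dots> = (e + real (card S) * r) * n" by (simp add: algebra_simps)
      also have "\<dots> \<le> u * n" using e(2) rS(1) n by (intro mult_right_mono) auto
      finally show ?thesis .
    qed
    have U: "U A \<subseteq> V k \<and> real (card (U A)) * ln (real m) \<le> \<eta> / 4 * n"
      if A: "A \<subseteq> V k" "real (card A) \<le> \<rho> * n" for A
    proof
      show "U A \<subseteq> V k" by (auto simp: U_def)
      have "real (card (U A)) * ln (real m) \<le> u * n * ln (real m)"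
        using U_bound[OF A] lm by (rule mult_right_mono)
      also have "\<dots> = u * ln (real m) * n" by simp
      also have "\<dots> \<le> \<eta> / 4 * n" using um n by (intro mult_right_mono) auto
      finally show "real (card (U A)) * ln (real m) \<le> \<eta> / 4 * n" .
    qed
    have small: "real (card {A. A \<subseteq> V k \<and> real (card A) \<le> \<rho> * n}) \<le> exp (\<eta> / 4 * n)"
    proof -
      have "real (card {A. A \<subseteq> V k \<and> real (card A) \<le> \<rho> * n}) \<le> real (card {A. A \<subseteq> V k \<and> real (card A) \<le> \<rho>1 * n})"
      proof (intro of_nat_mono card_mono)
        show "finite {A. A \<subseteq> V k \<and> real (card A) \<le> \<rho>1 * n}" by (rule finite_subset[of _ "Pow (V k)"]) (use finite_V in auto)
        have "\<rho> * n \<le> \<rho>1 * n" using \<rho>(2) n by (intro mult_right_mono) auto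
        then show "{A. A \<subseteq> V k \<and> real (card A) \<le> \<rho> * n} \<subseteq> {A. A \<subseteq> V k \<and> real (card A) \<le> \<rho>1 * n}" by auto
      qed
      also have "\<dots> \<le> exp (\<eta> / 4 * n)" using \<rho>1(2) finite_V by (simp add: n_def)
      finally show ?thesis .
    qed
    have cost': "(\<Sum>(g, v)\<in>D. ln (real (card (\<kappa> g ` X)))) \<le> \<eta> / 4 * n"
    proof -
      have "(\<eta> / 8 + e) * n \<le> \<eta> / 4 * n" using e(3) n by (intro mult_right_mono) auto
      then show ?thesis using cost by (simp add: c_def n_def)
    qed
    have fin\<kappa>: "finite (\<kappa> g ` X)" if "g \<in> E" for g using finite_\<kappa> that E by blast
    have "\<exists>A \<Omega>'. \<Omega>' \<subseteq> \<Omega> \<and> (\<forall>\<phi>\<in>\<Omega>'. bad \<phi> = A) \<and> A \<subseteq> V k \<and> real (card A) \<le> \<rho> * n \<and>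
      (\<forall>\<phi>\<in>\<Omega>'. \<forall>\<psi>\<in>\<Omega>'. (\<forall>(g, v)\<in>D. \<kappa> g (\<phi> v) = \<kappa> g (\<psi> v)) \<and> (\<forall>v\<in>U A. cell (\<phi> v) = cell (\<psi> v))) \<and>
      exp ((a - 3 / 4 * \<eta>) * n) \<le> real (card \<Omega>')"
      by (rule exists_uniform_class[where V = "V k" and \<Omega> = \<Omega> and X = X and m = m and n = n and a = a and bad = bad and \<rho> = \<rho> and \<eta> = \<eta> and D = D and P = E and \<kappa> = \<kappa> and cell = cell and U = U, OF finite_V \<Omega>(1) _ _ bad small D E(1) fin\<kappa> Xne cost' cell(1) U])
        (use big \<Omega>X in \<open>simp_all add: n_def\<close>)
    then obtain A \<Omega>' where \<Omega>': "\<Omega>' \<subseteq> \<Omega>" and bad': "\<forall>\<phi>\<in>\<Omega>'. bad \<phi> = A"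
      and A: "A \<subseteq> V k" "real (card A) \<le> \<rho> * n"
      and same: "\<forall>\<phi>\<in>\<Omega>'. \<forall>\<psi>\<in>\<Omega>'. (\<forall>(g, v)\<in>D. \<kappa> g (\<phi> v) = \<kappa> g (\<psi> v)) \<and> (\<forall>v\<in>U A. cell (\<phi> v) = cell (\<psi> v))"
      and big': "exp ((a - 3 / 4 * \<eta>) * n) \<le> real (card \<Omega>')" by (elim exE conjE) (rule that)
    have "\<Omega>' \<noteq> {}" using big' by (metis card.empty exp_gt_zero not_le of_nat_0)
    then obtain \<phi>\<^sub>0 where \<phi>\<^sub>0: "\<phi>\<^sub>0 \<in> \<Omega>'" by blast
    have subw: "S \<subseteq> words G B 1" "T \<subseteq> words G B 1" "E \<subseteq> words G B 1" "\<Lambda> \<subseteq> words G B 1"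
      using in_words_1[OF B(2)] by (auto simp: B_def)
    interpret transfer G H X d Y d' \<alpha> \<beta> b \<Phi> \<kappa> l "V k" "\<sigma> k" B S T E F FF HS C \<tau> "\<delta>' / 2" \<epsilon> \<epsilon>' D W A \<Omega>' \<phi>\<^sub>0
    proof unfold_locales
      show "F \<subseteq> FF" by (auto simp: FF_def)
      show "s \<otimes>\<^bsub>H\<^esub> t \<in> FF" if "s \<in> F" "t \<in> F" for s t using that by (auto simp: FF_def)
      show "l h x \<in> words G B 1" if "h \<in> FF" "x \<in> X" for h x using that subw(4) by (auto simp: \<Lambda>_def)
      show "\<kappa> s x \<in> HS" if "s \<in> S" "x \<in> X" for s x using that by (auto simp: HS_def)
      show "l (inv\<^bsub>H\<^esub> h' \<otimes>\<^bsub>H\<^esub> (f \<otimes>\<^bsub>H\<^esub> h)) x \<in> T" if "h \<in> HS" "h' \<in> HS" "f \<in> F" "x \<in> X" for h h' f x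
        unfolding T_def using that by blast
      show "\<kappa> g x = \<kappa> g y" if "g \<in> words G B (C + 4)" "x \<in> X" "y \<in> X" "d x y < \<tau>" for g x y
        using \<tau>1(2) that \<tau>(2) unfolding P_def by (meson less_le_trans)
      show "l h x = l h y" if "h \<in> FF \<union> m_inv H ` FF" "x \<in> X" "y \<in> X" "d x y < \<tau>" for h x y
        using \<tau>2(2) that \<tau>(3) by (meson less_le_trans)
      show "d' (\<Phi> (b h x)) (\<Phi> (b h y)) < \<delta>' / 2" if "h \<in> HS" "x \<in> X" "y \<in> X" "d x y < \<tau>" for h x y
        using \<tau>3(2) that \<tau>(4) by (meson less_le_trans)
      show "d (\<alpha> s x) (\<alpha> s y) < \<epsilon> / 4"
        if "h \<in> HS" "s \<in> S" "x \<in> X" "y \<in> X" "d' (\<Phi> (b h x)) (\<Phi> (b h y)) < \<epsilon>'" for h s x y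
        using bspec[OF exp, of "(h, s)"] that by simp
      show "\<phi> v \<in> X" if "\<phi> \<in> \<Omega>'" "v \<in> V k" for \<phi> v using \<Omega>X that \<Omega>' by blast
      show "d (\<phi> (\<sigma> k g v)) (\<alpha> g (\<phi> v)) < \<tau>"
        if \<phi>: "\<phi> \<in> \<Omega>'" and v: "v \<in> V k" "v \<notin> A" and g: "g \<in> words G B (C + 4)" for \<phi> v g
      proof -
        have "v \<notin> bad \<phi>" using bad' \<phi> v by simp
        then show ?thesis using v g by (auto simp: bad_def P_def not_le)
      qed
      show "\<kappa> g (\<phi> v) = \<kappa> g (\<phi>\<^sub>0 v)" if "\<phi> \<in> \<Omega>'" "(g, v) \<in> D" for \<phi> g v
        using bspec[OF bspec[OF same that(1)] \<phi>\<^sub>0] that(2) by blast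
      show "linked (\<sigma> k) D C w (\<sigma> k t w)" if "w \<in> W" "t \<in> T" "\<sigma> k t w \<in> W" for w t
        using link that by blast
    qed (use B subw D W FF HS \<tau> \<phi>\<^sub>0 in auto)
    have tame_eq: "tame = good P - A" by (simp add: tame_def P_def)
    have cov_eq: "V k - covered = U A" by (simp add: covered_def U_def tame_eq)
    have "\<exists>\<pi>. sofic_approximation H (V k) \<pi> \<and> good_approximation H F \<delta>' (V k) \<pi> \<and>
      model ` \<Omega>' \<subseteq> approx_maps Y d' \<beta> F \<delta>' (V k) \<pi>"
    proof (rule exists_transferred_approximation[OF \<delta>' refl, of M r u])
      show "d' (\<Phi> x) (\<Phi> y) \<le> M" if "x \<in> X" "y \<in> X" for x y using M(2) that by blast
      show "real (card (V k - tame)) \<le> r * real (card (V k))"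
        using tame_bound[OF A] by (simp add: tame_eq n_def)
      show "real (card (V k - covered)) \<le> u * real (card (V k))"
        using U_bound[OF A] by (simp add: cov_eq n_def)
      have "(r + 2 * u) * M\<^sup>2 \<le> 3 * u * M\<^sup>2" using rS(2) by (intro mult_right_mono) auto
      then show "(r + 2 * u) * M\<^sup>2 \<le> 1 / 2 * \<delta>'\<^sup>2" using uM by linarith
    qed (rule r(2))
    then obtain \<pi> where \<pi>: "sofic_approximation H (V k) \<pi>" "good_approximation H F \<delta>' (V k) \<pi>"
      "model ` \<Omega>' \<subseteq> approx_maps Y d' \<beta> F \<delta>' (V k) \<pi>" by (elim exE conjE) (rule that)
    have far: "\<exists>v\<in>V k. \<epsilon>' \<le> d' (model \<phi> v) (model \<psi> v)" if \<phi>: "\<phi> \<in> \<Omega>'" "\<psi> \<in> \<Omega>'" "\<phi> \<noteq> \<psi>" for \<phi> \<psi>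
    proof -
      have "\<epsilon> \<le> dist_inf d (V k) \<phi> \<psi>" using sep \<phi> \<Omega>' by blast
      moreover have "dist_inf d (V k) \<phi> \<psi> \<in> (\<lambda>v. d (\<phi> v) (\<psi> v)) ` V k"
        unfolding dist_inf_def using finite_V V_nonempty by (intro Max_in) auto
      ultimately obtain v where v: "v \<in> V k" "\<epsilon> \<le> d (\<phi> v) (\<psi> v)" by auto
      \<comment> \<open>Off the cover both models take values in the same cell, hence at distance
        below \<epsilon>, so their separation occurs at a covered point.\<close>
      have "v \<in> covered"
      proof (rule ccontr)
        assume "v \<notin> covered"
        then have "v \<in> U A" using v cov_eq by blast
        then have "cell (\<phi> v) = cell (\<psi> v)" using bspec[OF bspec[OF same \<phi>(1)] \<phi>(2)] by blast
        then have "d (\<phi> v) (\<psi> v) < \<epsilon>" using cell(2) \<Omega>[OF \<phi>(1) v(1)] \<Omega>[OF \<phi>(2) v(1)] by blast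
        then show False using v(2) by simp
      qed
      then have "\<not> d' (model \<phi> v) (model \<psi> v) < \<epsilon>'" using model_separated[OF \<phi>(1,2) v(1)] v(2) by fastforce
      then show ?thesis using v(1) by (auto simp: not_less)
    qed
    have inj: "inj_on model \<Omega>'"
    proof (rule inj_onI, rule ccontr)
      fix \<phi> \<psi> assume \<phi>: "\<phi> \<in> \<Omega>'" "\<psi> \<in> \<Omega>'" "model \<phi> = model \<psi>" "\<phi> \<noteq> \<psi>"
      obtain v where v: "v \<in> V k" "\<epsilon>' \<le> d' (model \<phi> v) (model \<psi> v)" using far \<phi> by blast
      have "model \<psi> v \<in> Y" using model_in[OF \<phi>(2)] v(1) by auto
      then have "d' (model \<phi> v) (model \<psi> v) = 0" using \<phi>(3) by simp
      then show False using v(2) \<epsilon>'_pos by linarith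
    qed
    have sep': "\<forall>x\<in>model ` \<Omega>'. \<forall>y\<in>model ` \<Omega>'. x \<noteq> y \<longrightarrow> \<epsilon>' \<le> dist_inf d' (V k) x y"
    proof (intro ballI impI)
      fix x y assume "x \<in> model ` \<Omega>'" "y \<in> model ` \<Omega>'" "x \<noteq> y"
      then obtain \<phi> \<psi> where \<phi>: "\<phi> \<in> \<Omega>'" "\<psi> \<in> \<Omega>'" "\<phi> \<noteq> \<psi>" "x = model \<phi>" "y = model \<psi>" by blast
      then obtain v where v: "v \<in> V k" "\<epsilon>' \<le> d' (x v) (y v)" using far by blast
      have "d' (x v) (y v) \<le> dist_inf d' (V k) x y"
        unfolding dist_inf_def using finite_V v(1) by (intro Max_ge) auto
      then show "\<epsilon>' \<le> dist_inf d' (V k) x y" using v(2) by linarith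
    qed
    have fin': "finite (model ` \<Omega>')" using \<Omega>' \<open>finite \<Omega>\<close> finite_subset by blast
    have "(a - \<eta>) * n \<le> (a - 3 / 4 * \<eta>) * n" using \<eta> n by (intro mult_right_mono) auto
    then have "exp ((a - \<eta>) * n) \<le> exp ((a - 3 / 4 * \<eta>) * n)" by simp
    also have "\<dots> \<le> real (card (model ` \<Omega>'))" using big' by (simp add: card_image[OF inj])
    finally have large: "exp ((a - \<eta>) * real (card (V k))) \<le> real (card (model ` \<Omega>'))" by (simp add: n_def)
    show ?thesis
      by (intro exI[of _ k] exI[of _ \<pi>] exI[of _ "model ` \<Omega>'"] conjI \<pi> fin' sep' large)
  qed
  then show ?thesis using \<epsilon>'_pos by (intro exI[of _ \<epsilon>'] conjI allI impI) (assumption, elim conjE)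
qed

end

section \<open>Compact spaces and continuous orbit equivalences\<close>

lemma uniformly_continuous_compatible:
  assumes X: "compact_space X" "compatible_metric X d" and Y: "compatible_metric Y d'"
    and f: "continuous_map X Y f" and \<epsilon>: "0 < \<epsilon>"
  shows "\<exists>\<tau>>0. \<forall>x\<in>topspace X. \<forall>y\<in>topspace X. d x y < \<tau> \<longrightarrow> d' (f x) (f y) < \<epsilon>"
proof -
  interpret MX: Metric_space "topspace X" d using X(2) by (simp add: compatible_metric_def)
  interpret MY: Metric_space "topspace Y" d' using Y by (simp add: compatible_metric_def)
  have X': "mtopology_of (metric (topspace X, d)) = X" and Y': "mtopology_of (metric (topspace Y, d')) = Y"
    using X Y by (simp_all add: compatible_metric_def)
  have "uniformly_continuous_map (metric (topspace X, d)) (metric (topspace Y, d')) f"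
    using continuous_eq_uniformly_continuous_map[of "metric (topspace X, d)" "metric (topspace Y, d')" f] X f
    unfolding X' Y' by simp
  then have "\<exists>\<tau>>0. \<forall>x\<in>topspace X. \<forall>y\<in>topspace X. d y x < \<tau> \<longrightarrow> d' (f y) (f x) < \<epsilon>"
    using \<epsilon> by (simp add: uniformly_continuous_map_def)
  then show ?thesis by blast
qed

text \<open>Uniform continuity for the discrete metric, with tolerance 1.\<close>

lemma uniformly_locally_constant:
  assumes X: "compact_space X" "compatible_metric X d" and f: "continuous_map X (discrete_topology D) f"
  shows "\<exists>\<tau>>0. \<forall>x\<in>topspace X. \<forall>y\<in>topspace X. d x y < \<tau> \<longrightarrow> f x = f y"
proof -
  have D: "compatible_metric (discrete_topology D) discrete_metric.dd"
    by (simp add: compatible_metric_def metric_M_dd discrete_metric.mtopology_discrete_metric)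
  obtain \<tau> where "\<tau> > 0" and \<tau>: "\<forall>x\<in>topspace X. \<forall>y\<in>topspace X. d x y < \<tau> \<longrightarrow> discrete_metric.dd (f x) (f y) < 1"
    using uniformly_continuous_compatible[OF X D f, of 1] by auto
  then show ?thesis by (intro exI[of _ \<tau>]) (fastforce simp: discrete_metric.dd_def split: if_splits)
qed

lemma finite_range_discrete:
  assumes "compact_space X" and f: "continuous_map X (discrete_topology D) f"
  shows "finite (f ` topspace X)"
  using image_compactin[OF _ f, of "topspace X"] assms(1)
  by (simp add: compact_space_def compactin_discrete_topology)

lemma exists_cells:
  assumes X: "compact_space X" "compatible_metric X d" and \<epsilon>: "0 < \<epsilon>"
  shows "\<exists>(m :: nat) cell. cell ` topspace X \<subseteq> {..<m} \<and>
    (\<forall>x\<in>topspace X. \<forall>y\<in>topspace X. cell x = cell y \<longrightarrow> d x y < \<epsilon>)"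
proof -
  interpret Metric_space "topspace X" d using X(2) by (simp add: compatible_metric_def)
  have top: "mtopology = X" using X(2) by (simp add: compatible_metric_def)
  have "mtotally_bounded (topspace X)"
    using X(1) by (intro compactin_imp_mtotally_bounded) (simp add: compact_space_def top)
  then have "\<exists>K. finite K \<and> K \<subseteq> topspace X \<and> topspace X \<subseteq> (\<Union>x\<in>K. mball x (\<epsilon> / 2))"
    using \<epsilon> by (simp add: mtotally_bounded_def)
  then obtain K where K: "finite K" "K \<subseteq> topspace X" "topspace X \<subseteq> (\<Union>x\<in>K. mball x (\<epsilon> / 2))"
    by (elim exE conjE) (rule that)
  obtain idx :: "'a \<Rightarrow> nat" where idx: "bij_betw idx K {..<card K}"
    using ex_bij_betw_finite_nat[OF K(1)] by (auto simp: atLeast0LessThan)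
  have "\<exists>z\<in>K. x \<in> mball z (\<epsilon> / 2)" if "x \<in> topspace X" for x using subsetD[OF K(3) that] by simp
  then obtain c where c: "\<And>x. x \<in> topspace X \<Longrightarrow> c x \<in> K \<and> x \<in> mball (c x) (\<epsilon> / 2)" by metis
  have "d x y < \<epsilon>" if xy: "x \<in> topspace X" "y \<in> topspace X" "idx (c x) = idx (c y)" for x y
  proof -
    have eq: "c x = c y" using idx c xy by (metis bij_betw_imp_inj_on inj_onD)
    have cx: "c x \<in> topspace X" using c xy K by blast
    have "d (c x) x < \<epsilon> / 2" "d (c x) y < \<epsilon> / 2" using c[OF xy(1)] c[OF xy(2)] eq by (auto simp: in_mball)
    moreover have "d x y \<le> d x (c x) + d (c x) y" using triangle xy cx by blast
    ultimately show ?thesis using commute[of x "c x"] by linarith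
  qed
  moreover have "(\<lambda>x. idx (c x)) ` topspace X \<subseteq> {..<card K}" using idx c by (auto simp: bij_betw_def)
  ultimately show ?thesis by blast
qed

lemma bounded_compatible:
  assumes X: "compact_space X" "compatible_metric X d"
  shows "\<exists>M>0. \<forall>x\<in>topspace X. \<forall>y\<in>topspace X. d x y \<le> M"
proof -
  interpret Metric_space "topspace X" d using X(2) by (simp add: compatible_metric_def)
  have top: "mtopology = X" using X(2) by (simp add: compatible_metric_def)
  have "mbounded (topspace X)"
    using X(1) by (intro compactin_imp_mbounded) (simp add: compact_space_def top)
  then show ?thesis by (simp add: mbounded_alt_pos)
qed

lemma continuous_actionD:
  assumes "continuous_action G X \<alpha>"
  shows "group G"
    and "\<And>g x. g \<in> carrier G \<Longrightarrow> x \<in> topspace X \<Longrightarrow> \<alpha> g x \<in> topspace X"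
    and "\<And>x. x \<in> topspace X \<Longrightarrow> \<alpha> \<one>\<^bsub>G\<^esub> x = x"
    and "\<And>g h x. g \<in> carrier G \<Longrightarrow> h \<in> carrier G \<Longrightarrow> x \<in> topspace X \<Longrightarrow> \<alpha> (g \<otimes>\<^bsub>G\<^esub> h) x = \<alpha> g (\<alpha> h x)"
    and "\<And>g. g \<in> carrier G \<Longrightarrow> continuous_map X X (\<alpha> g)"
proof -
  have act: "group_action G (topspace X) \<alpha>" using assms by (simp add: continuous_action_def)
  show "group G" using group_action.group_hom[OF act] by (simp add: group_hom_def)
  show "\<alpha> \<one>\<^bsub>G\<^esub> x = x" if "x \<in> topspace X" for x
    using group_action.id_eq_one[OF act] that by (metis restrict_apply')
  show "\<alpha> g x \<in> topspace X" if "g \<in> carrier G" "x \<in> topspace X" for g x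
    using group_action.element_image[OF act that refl] .
  show "\<alpha> (g \<otimes>\<^bsub>G\<^esub> h) x = \<alpha> g (\<alpha> h x)" if "g \<in> carrier G" "h \<in> carrier G" "x \<in> topspace X" for g h x
    using group_action.composition_rule[OF act that(3,1,2)] .
  show "continuous_map X X (\<alpha> g)" if "g \<in> carrier G" for g
    using assms that by (simp add: continuous_action_def)
qed

text \<open>At points with trivial stabilizer the two group elements must agree. Such points are
  dense, and the set where two continuous maps into a discrete space agree is closed.\<close>

lemma eq_of_topologically_free:
  assumes act: "continuous_action H Y \<beta>" and free: "topologically_free H Y \<beta>"
    and hom: "homeomorphic_maps X Y \<Phi> \<Phi>'"
    and f: "continuous_map X (discrete_topology (carrier H)) f"
    and g: "continuous_map X (discrete_topology (carrier H)) g"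
    and eq: "\<And>x. x \<in> topspace X \<Longrightarrow> \<beta> (f x) (\<Phi> x) = \<beta> (g x) (\<Phi> x)"
    and x: "x \<in> topspace X"
  shows "f x = g x"
proof -
  interpret group H by (rule continuous_actionD(1)[OF act])
  define S where "S = {y\<in>topspace Y. \<forall>s\<in>carrier H - {\<one>\<^bsub>H\<^esub>}. \<beta> s y \<noteq> y}"
  have dense: "Y closure_of S = topspace Y" using free by (simp add: topologically_free_def S_def)
  have "homeomorphic_map Y X \<Phi>'" 
    using homeomorphic_maps_sym[THEN iffD1, OF hom] by (simp add: homeomorphic_maps_map)
  then have "X closure_of (\<Phi>' ` S) = \<Phi>' ` (Y closure_of S)"
    by (rule homeomorphic_map_closure_of) (auto simp: S_def)
  also have "\<dots> = topspace X"
    using \<open>homeomorphic_map Y X \<Phi>'\<close> dense by (simp add: homeomorphic_imp_surjective_map)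
  finally have "x \<in> X closure_of (\<Phi>' ` S)" using x by simp
  then show ?thesis
  proof (rule forall_in_closure_of_eq[OF _ _ f g])
    fix z assume "z \<in> \<Phi>' ` S"
    then obtain y where y: "y \<in> S" "z = \<Phi>' y" by blast
    have yt: "y \<in> topspace Y" using y by (simp add: S_def)
    then have z: "z \<in> topspace X" "\<Phi> z = y"
      using hom y unfolding homeomorphic_maps_def continuous_map_def by auto
    have c: "f z \<in> carrier H" "g z \<in> carrier H"
      using continuous_map_funspace[OF f] continuous_map_funspace[OF g] z(1) by (simp_all add: Pi_iff)
    have "\<beta> (inv\<^bsub>H\<^esub> g z \<otimes>\<^bsub>H\<^esub> f z) y = \<beta> (inv\<^bsub>H\<^esub> g z) (\<beta> (g z) y)"
      using continuous_actionD(4)[OF act _ _ yt] c eq[OF z(1)] z(2) by simp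
    also have "\<dots> = \<beta> (inv\<^bsub>H\<^esub> g z \<otimes>\<^bsub>H\<^esub> g z) y"
      by (rule continuous_actionD(4)[OF act _ _ yt, symmetric]) (use c in auto)
    also have "\<dots> = y" using continuous_actionD(3)[OF act yt] c by simp
    finally have "inv\<^bsub>H\<^esub> g z \<otimes>\<^bsub>H\<^esub> f z = \<one>\<^bsub>H\<^esub>" using y(1) c by (auto simp: S_def)
    then have "inv\<^bsub>H\<^esub> f z = inv\<^bsub>H\<^esub> g z" using c by (intro inv_equality) auto
    then show "f z = g z" using c by (metis inv_inv)
  qed (simp add: Hausdorff_space_discrete_topology)
qed

lemma continuously_orbit_equivalent_sym:
  assumes "continuously_orbit_equivalent G X \<alpha> H Y \<beta>"
  shows "continuously_orbit_equivalent H Y \<beta> G X \<alpha>"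
proof -
  obtain \<Phi> \<Phi>' \<kappa> \<theta> where "homeomorphic_maps X Y \<Phi> \<Phi>'"
    "continuous_map (prod_topology (discrete_topology (carrier G)) X) (discrete_topology (carrier H)) \<kappa>"
    "continuous_map (prod_topology (discrete_topology (carrier H)) Y) (discrete_topology (carrier G)) \<theta>"
    "\<forall>g\<in>carrier G. \<forall>x\<in>topspace X. \<Phi> (\<alpha> g x) = \<beta> (\<kappa> (g, x)) (\<Phi> x)"
    "\<forall>t\<in>carrier H. \<forall>y\<in>topspace Y. \<Phi>' (\<beta> t y) = \<alpha> (\<theta> (t, y)) (\<Phi>' y)"
    using assms unfolding continuously_orbit_equivalent_def by (elim exE conjE) (rule that)
  then show ?thesis
    unfolding continuously_orbit_equivalent_def homeomorphic_maps_sym[of Y]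
    by (intro exI[of _ \<Phi>'] exI[of _ \<Phi>] exI[of _ \<theta>] exI[of _ \<kappa>] conjI)
qed

text \<open>An orbit equivalence does not by definition come with a cocycle. The cocycle identity
  for \<open>\<kappa>\<close> and the fact that \<open>l\<close> inverts it follow from topological
  freeness, since both sides of each identity move the same point to the same place.\<close>

lemma exists_regular_pair:
  assumes X: "compact_space X" "compatible_metric X d" and Y: "compact_space Y" "compatible_metric Y d'"
    and \<alpha>: "continuous_action G X \<alpha>" "topologically_free G X \<alpha>"
    and \<beta>: "continuous_action H Y \<beta>" "topologically_free H Y \<beta>"
    and oe: "continuously_orbit_equivalent G X \<alpha> H Y \<beta>"
  shows "\<exists>b \<Phi> \<kappa> l. regular_pair G H (topspace X) d (topspace Y) d' \<alpha> \<beta> b \<Phi> \<kappa> l"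
proof -
  obtain \<Phi> \<Phi>' \<kappa> \<theta> where hom: "homeomorphic_maps X Y \<Phi> \<Phi>'"
    and \<kappa>: "continuous_map (prod_topology (discrete_topology (carrier G)) X) (discrete_topology (carrier H)) \<kappa>"
    and \<theta>: "continuous_map (prod_topology (discrete_topology (carrier H)) Y) (discrete_topology (carrier G)) \<theta>"
    and \<Phi>\<alpha>: "\<forall>g\<in>carrier G. \<forall>x\<in>topspace X. \<Phi> (\<alpha> g x) = \<beta> (\<kappa> (g, x)) (\<Phi> x)"
    and \<Phi>\<beta>: "\<forall>t\<in>carrier H. \<forall>y\<in>topspace Y. \<Phi>' (\<beta> t y) = \<alpha> (\<theta> (t, y)) (\<Phi>' y)"
    using oe unfolding continuously_orbit_equivalent_def by (elim exE conjE) (rule that)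
  have \<Phi>: "continuous_map X Y \<Phi>" "continuous_map Y X \<Phi>'"
    "\<And>x. x \<in> topspace X \<Longrightarrow> \<Phi>' (\<Phi> x) = x" "\<And>y. y \<in> topspace Y \<Longrightarrow> \<Phi> (\<Phi>' y) = y"
    using hom by (auto simp: homeomorphic_maps_def)
  have \<Phi>c: "\<Phi> x \<in> topspace Y" if "x \<in> topspace X" for x
    using \<Phi>(1) that by (auto simp: continuous_map_def)
  have \<Phi>'c: "\<Phi>' y \<in> topspace X" if "y \<in> topspace Y" for y
    using \<Phi>(2) that by (auto simp: continuous_map_def)
  interpret G: group G by (rule continuous_actionD(1)[OF \<alpha>(1)])
  interpret H: group H by (rule continuous_actionD(1)[OF \<beta>(1)])
  note A = continuous_actionD(2-5)[OF \<alpha>(1)] and B = continuous_actionD(2-5)[OF \<beta>(1)]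
  have cont_\<kappa>: "continuous_map X (discrete_topology (carrier H)) (\<lambda>z. \<kappa> (f z, g z))"
    if "continuous_map X (discrete_topology (carrier G)) f" "continuous_map X X g" for f g
    using continuous_map_compose[OF _ \<kappa>, of X "\<lambda>z. (f z, g z)"] that
    by (simp add: o_def continuous_map_pairedI)
  have cont_\<theta>: "continuous_map X (discrete_topology (carrier G)) (\<lambda>z. \<theta> (f z, g z))"
    if "continuous_map X (discrete_topology (carrier H)) f" "continuous_map X Y g" for f g
    using continuous_map_compose[OF _ \<theta>, of X "\<lambda>z. (f z, g z)"] that
    by (simp add: o_def continuous_map_pairedI)
  define b where "b h x = \<Phi>' (\<beta> h (\<Phi> x))" for h x
  define k where "k g x = \<kappa> (g, x)" for g x
  define l where "l h x = \<theta> (h, \<Phi> x)" for h x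
  have cont_k: "continuous_map X (discrete_topology (carrier H)) (k g)" if "g \<in> carrier G" for g
    unfolding k_def by (rule cont_\<kappa>) (use that in auto)
  have cont_l: "continuous_map X (discrete_topology (carrier G)) (l h)" if "h \<in> carrier H" for h
    unfolding l_def by (rule cont_\<theta>) (use that \<Phi>(1) in auto)
  have kc: "k g x \<in> carrier H" if "g \<in> carrier G" "x \<in> topspace X" for g x
    using cont_k[OF that(1)] that(2) by (auto simp: continuous_map_def)
  have lc: "l h x \<in> carrier G" if "h \<in> carrier H" "x \<in> topspace X" for h x
    using cont_l[OF that(1)] that(2) by (auto simp: continuous_map_def)
  have \<beta>k: "\<beta> (k g x) (\<Phi> x) = \<Phi> (\<alpha> g x)" if "g \<in> carrier G" "x \<in> topspace X" for g x
    using \<Phi>\<alpha> that by (simp add: k_def)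
  have \<alpha>l: "\<alpha> (l h x) x = b h x" if "h \<in> carrier H" "x \<in> topspace X" for h x
    using \<Phi>\<beta> that \<Phi>c \<Phi>(3) by (simp add: l_def b_def)
  have \<beta>\<Phi>: "\<beta> h (\<Phi> x) = \<Phi> (b h x)" if "h \<in> carrier H" "x \<in> topspace X" for h x
    using that \<Phi>(4) B(1) \<Phi>c by (simp add: b_def)
  interpret MX: Metric_space "topspace X" d using X by (simp add: compatible_metric_def)
  interpret MY: Metric_space "topspace Y" d' using Y by (simp add: compatible_metric_def)
  have idhom: "homeomorphic_maps X X id id" by (simp add: homeomorphic_maps_id)
  have "regular_pair G H (topspace X) d (topspace Y) d' \<alpha> \<beta> b \<Phi> k l"
  proof unfold_locales
    show "\<alpha> g x \<in> topspace X" if "g \<in> carrier G" "x \<in> topspace X" for g x using A(1) that .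
    show "\<alpha> \<one>\<^bsub>G\<^esub> x = x" if "x \<in> topspace X" for x using A(2) that .
    show "\<alpha> (g \<otimes>\<^bsub>G\<^esub> h) x = \<alpha> g (\<alpha> h x)" if "g \<in> carrier G" "h \<in> carrier G" "x \<in> topspace X" for g h x
      using A(3) that .
    show "b h x \<in> topspace X" if "h \<in> carrier H" "x \<in> topspace X" for h x
      using that by (simp add: b_def \<Phi>c \<Phi>'c B(1))
    show "b \<one>\<^bsub>H\<^esub> x = x" if "x \<in> topspace X" for x using that by (simp add: b_def \<Phi>c B(2) \<Phi>(3))
    show "b (g \<otimes>\<^bsub>H\<^esub> h) x = b g (b h x)" if "g \<in> carrier H" "h \<in> carrier H" "x \<in> topspace X" for g h x
      using that by (simp add: b_def \<Phi>c B(1,3) \<Phi>(4))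
    show "\<Phi> x \<in> topspace Y" if "x \<in> topspace X" for x using \<Phi>c that .
    show "\<beta> h (\<Phi> x) = \<Phi> (b h x)" if "h \<in> carrier H" "x \<in> topspace X" for h x using \<beta>\<Phi> that .
    show "k g x \<in> carrier H" if "g \<in> carrier G" "x \<in> topspace X" for g x using kc that .
    show "l h x \<in> carrier G" if "h \<in> carrier H" "x \<in> topspace X" for h x using lc that .
    show "k (g \<otimes>\<^bsub>G\<^esub> h) x = k g (\<alpha> h x) \<otimes>\<^bsub>H\<^esub> k h x"
      if g: "g \<in> carrier G" "h \<in> carrier G" and x: "x \<in> topspace X" for g h x
    proof (rule eq_of_topologically_free[OF \<beta> hom _ _ _ x])
      show "continuous_map X (discrete_topology (carrier H)) (k (g \<otimes>\<^bsub>G\<^esub> h))" using cont_k g by simp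
      have 1: "continuous_map X (discrete_topology (carrier H)) (\<lambda>x. k g (\<alpha> h x))"
        using continuous_map_compose[OF A(4)[OF g(2)] cont_k[OF g(1)]] by (simp add: o_def)
      have "continuous_map X (prod_topology (discrete_topology (carrier H)) (discrete_topology (carrier H)))
        (\<lambda>x. (k g (\<alpha> h x), k h x))"
        using 1 cont_k[OF g(2)] by (simp add: continuous_map_pairedI)
      then have "continuous_map X (discrete_topology (carrier H \<times> carrier H)) (\<lambda>x. (k g (\<alpha> h x), k h x))"
        by (simp add: prod_topology_discrete_topology)
      then show "continuous_map X (discrete_topology (carrier H)) (\<lambda>x. k g (\<alpha> h x) \<otimes>\<^bsub>H\<^esub> k h x)"
        using continuous_map_compose[of X "discrete_topology (carrier H \<times> carrier H)" "\<lambda>x. (k g (\<alpha> h x), k h x)"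
          "discrete_topology (carrier H)" "\<lambda>(s, t). s \<otimes>\<^bsub>H\<^esub> t"]
        by (simp add: o_def continuous_map_from_discrete_topology Pi_iff)
      show "\<beta> (k (g \<otimes>\<^bsub>G\<^esub> h) y) (\<Phi> y) = \<beta> (k g (\<alpha> h y) \<otimes>\<^bsub>H\<^esub> k h y) (\<Phi> y)" if "y \<in> topspace X" for y
        using that g by (simp add: \<beta>k A(1,3) B(3) kc \<Phi>c)
    qed
    show "b (k g x) x = \<alpha> g x" if "g \<in> carrier G" "x \<in> topspace X" for g x
      using that by (simp add: b_def \<beta>k \<Phi>(3) A(1))
    then have bk: "b (k g x) x = \<alpha> g x" if "g \<in> carrier G" "x \<in> topspace X" for g x using that .
    show "l (k g x) x = g" if g: "g \<in> carrier G" and x: "x \<in> topspace X" for g x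
    proof (rule eq_of_topologically_free[OF \<alpha> idhom _ _ _ x])
      show "continuous_map X (discrete_topology (carrier G)) (\<lambda>x. l (k g x) x)"
        unfolding l_def by (rule cont_\<theta>[OF cont_k[OF g] \<Phi>(1)])
      show "\<alpha> (l (k g y) y) (id y) = \<alpha> g (id y)" if "y \<in> topspace X" for y
        using that g by (simp add: \<alpha>l kc bk)
    qed (use g in simp)
    show "k (l h x) x = h" if h: "h \<in> carrier H" and x: "x \<in> topspace X" for h x
    proof (rule eq_of_topologically_free[OF \<beta> hom _ _ _ x])
      show "continuous_map X (discrete_topology (carrier H)) (\<lambda>x. k (l h x) x)"
        unfolding k_def by (rule cont_\<kappa>[OF cont_l[OF h] continuous_map_id[unfolded id_def]])
      show "\<beta> (k (l h y) y) (\<Phi> y) = \<beta> h (\<Phi> y)" if "y \<in> topspace X" for y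
        using that h by (simp add: \<beta>k lc \<alpha>l \<beta>\<Phi>)
    qed (use h in simp)
    show "finite (k g ` topspace X)" if "g \<in> carrier G" for g
      using finite_range_discrete[OF X(1) cont_k[OF that]] .
    show "finite (l h ` topspace X)" if "h \<in> carrier H" for h
      using finite_range_discrete[OF X(1) cont_l[OF that]] .
    show "\<exists>\<tau>>0. \<forall>x\<in>topspace X. \<forall>y\<in>topspace X. d x y < \<tau> \<longrightarrow> k g x = k g y" if "g \<in> carrier G" for g
      using uniformly_locally_constant[OF X cont_k[OF that]] .
    show "\<exists>\<tau>>0. \<forall>x\<in>topspace X. \<forall>y\<in>topspace X. d x y < \<tau> \<longrightarrow> l h x = l h y" if "h \<in> carrier H" for h
      using uniformly_locally_constant[OF X cont_l[OF that]] .
    show "\<exists>\<tau>>0. \<forall>x\<in>topspace X. \<forall>y\<in>topspace X. d x y < \<tau> \<longrightarrow> d (\<alpha> g x) (\<alpha> g y) < \<epsilon>"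
      if "g \<in> carrier G" "0 < \<epsilon>" for g \<epsilon>
      using uniformly_continuous_compatible[OF X X(2) A(4)[OF that(1)] that(2)] .
    show "\<exists>\<tau>>0. \<forall>x\<in>topspace X. \<forall>y\<in>topspace X. d x y < \<tau> \<longrightarrow> d' (\<Phi> (b h x)) (\<Phi> (b h y)) < \<epsilon>"
      if h: "h \<in> carrier H" and "0 < \<epsilon>" for h \<epsilon>
      using uniformly_continuous_compatible[OF X Y(2) continuous_map_compose[OF \<Phi>(1) B(4)[OF h]] \<open>0 < \<epsilon>\<close>]
      by (simp add: \<beta>\<Phi> h cong: ball_cong)
    show "\<exists>\<tau>>0. \<forall>x\<in>topspace X. \<forall>y\<in>topspace X. d' (\<Phi> (b h x)) (\<Phi> (b h y)) < \<tau> \<longrightarrow> d x y < \<epsilon>"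
      if h: "h \<in> carrier H" and "0 < \<epsilon>" for h \<epsilon>
    proof -
      have h': "inv\<^bsub>H\<^esub> h \<in> carrier H" using h by simp
      obtain \<tau> where "\<tau> > 0" and \<tau>: "\<forall>x\<in>topspace Y. \<forall>y\<in>topspace Y. d' x y < \<tau> \<longrightarrow>
        d ((\<Phi>' \<circ> \<beta> (inv\<^bsub>H\<^esub> h)) x) ((\<Phi>' \<circ> \<beta> (inv\<^bsub>H\<^esub> h)) y) < \<epsilon>"
        using uniformly_continuous_compatible[OF Y X(2) continuous_map_compose[OF B(4)[OF h'] \<Phi>(2)] \<open>0 < \<epsilon>\<close>]
        by (elim exE conjE) (rule that)
      have inv: "(\<Phi>' \<circ> \<beta> (inv\<^bsub>H\<^esub> h)) (\<Phi> (b h x)) = x" if x: "x \<in> topspace X" for x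
      proof -
        have "\<beta> (inv\<^bsub>H\<^esub> h) (\<beta> h (\<Phi> x)) = \<Phi> x"
          using B(3)[OF h' h \<Phi>c[OF x]] B(2)[OF \<Phi>c[OF x]] h by simp
        then show ?thesis using x \<Phi>(3) h by (simp add: \<beta>\<Phi>)
      qed
      have c: "\<Phi> (b h x) \<in> topspace Y" if "x \<in> topspace X" for x
        using that h by (simp add: \<beta>\<Phi>[symmetric] B(1) \<Phi>c)
      show ?thesis
      proof (intro exI[of _ \<tau>] conjI ballI impI \<open>\<tau> > 0\<close>)
        fix x y assume xy: "x \<in> topspace X" "y \<in> topspace X" "d' (\<Phi> (b h x)) (\<Phi> (b h y)) < \<tau>"
        then have "d ((\<Phi>' \<circ> \<beta> (inv\<^bsub>H\<^esub> h)) (\<Phi> (b h x))) ((\<Phi>' \<circ> \<beta> (inv\<^bsub>H\<^esub> h)) (\<Phi> (b h y))) < \<epsilon>"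
          using \<tau> c by blast
        then show "d x y < \<epsilon>" using inv xy by simp
      qed
    qed
    show "\<exists>M>0. \<forall>x\<in>topspace X. \<forall>y\<in>topspace X. d' (\<Phi> x) (\<Phi> y) \<le> M"
      using bounded_compatible[OF Y] \<Phi>c by blast
    show "\<exists>(m :: nat) cell. cell ` topspace X \<subseteq> {..<m} \<and>
      (\<forall>x\<in>topspace X. \<forall>y\<in>topspace X. cell x = cell y \<longrightarrow> d x y < \<epsilon>)" if "0 < \<epsilon>" for \<epsilon>
      using exists_cells[OF X that] .
  qed
  then show ?thesis by (intro exI)
qed

section \<open>Comparing entropies\<close>

text \<open>Maps with the same pattern of cells are closer than \<epsilon> at every point, so
  separated maps have different patterns. The bound makes the maximum in
  \<open>separation_number\<close> one over a finite set.\<close>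

lemma card_separated_maps_le:
  fixes cell :: "'x \<Rightarrow> nat"
  assumes V: "finite V" "V \<noteq> {}" and cell: "cell ` S \<subseteq> {..<m}"
    and small: "\<And>x y. x \<in> S \<Longrightarrow> y \<in> S \<Longrightarrow> cell x = cell y \<Longrightarrow> d x y < \<epsilon>"
    and \<Omega>: "\<Omega> \<subseteq> V \<rightarrow>\<^sub>E S" and sep: "\<forall>\<phi>\<in>\<Omega>. \<forall>\<psi>\<in>\<Omega>. \<phi> \<noteq> \<psi> \<longrightarrow> \<epsilon> \<le> dist_inf d V \<phi> \<psi>"
  shows "card \<Omega> \<le> m ^ card V"
proof -
  have inj: "inj_on (\<lambda>\<phi>. restrict (cell \<circ> \<phi>) V) \<Omega>"
  proof (rule inj_onI, rule ccontr)
    fix \<phi> \<psi> assume \<phi>: "\<phi> \<in> \<Omega>" and \<psi>: "\<psi> \<in> \<Omega>" and eq: "restrict (cell \<circ> \<phi>) V = restrict (cell \<circ> \<psi>) V" and "\<phi> \<noteq> \<psi>"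
    have "dist_inf d V \<phi> \<psi> \<in> (\<lambda>v. d (\<phi> v) (\<psi> v)) ` V"
      unfolding dist_inf_def using V by (intro Max_in) auto
    then obtain v where v: "v \<in> V" "dist_inf d V \<phi> \<psi> = d (\<phi> v) (\<psi> v)" by blast
    have "cell (\<phi> v) = cell (\<psi> v)" using fun_cong[OF eq, of v] v(1) by simp
    moreover have "\<phi> v \<in> S" "\<psi> v \<in> S" using \<Omega> \<phi> \<psi> v(1) by (auto dest: PiE_mem)
    ultimately have "d (\<phi> v) (\<psi> v) < \<epsilon>" using small by blast
    moreover have "\<epsilon> \<le> dist_inf d V \<phi> \<psi>" using sep \<phi> \<psi> \<open>\<phi> \<noteq> \<psi>\<close> by blast
    ultimately show False using v(2) by simp
  qed
  have "(\<lambda>\<phi>. restrict (cell \<circ> \<phi>) V) ` \<Omega> \<subseteq> V \<rightarrow>\<^sub>E {..<m}"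
  proof (rule image_subsetI)
    fix \<phi> assume "\<phi> \<in> \<Omega>"
    then have "\<phi> v \<in> S" if "v \<in> V" for v using \<Omega> that by (auto dest: PiE_mem)
    then show "restrict (cell \<circ> \<phi>) V \<in> V \<rightarrow>\<^sub>E {..<m}" using cell by (auto simp: image_subset_iff)
  qed
  then have "card \<Omega> \<le> card (V \<rightarrow>\<^sub>E {..<m})"
    using V(1) by (intro card_inj_on_le[OF inj]) (auto simp: finite_PiE)
  then show ?thesis using V(1) by (simp add: card_PiE)
qed

lemma separation_number:
  assumes bound: "\<And>A. A \<subseteq> \<Omega> \<Longrightarrow> finite A \<Longrightarrow> \<forall>x\<in>A. \<forall>y\<in>A. x \<noteq> y \<longrightarrow> \<epsilon> \<le> \<rho> x y \<Longrightarrow> card A \<le> N"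
  shows "\<exists>A. A \<subseteq> \<Omega> \<and> finite A \<and> (\<forall>x\<in>A. \<forall>y\<in>A. x \<noteq> y \<longrightarrow> \<epsilon> \<le> \<rho> x y) \<and> card A = separation_number \<epsilon> \<Omega> \<rho>"
    and "\<And>A. A \<subseteq> \<Omega> \<Longrightarrow> finite A \<Longrightarrow> \<forall>x\<in>A. \<forall>y\<in>A. x \<noteq> y \<longrightarrow> \<epsilon> \<le> \<rho> x y \<Longrightarrow>
      card A \<le> separation_number \<epsilon> \<Omega> \<rho>"
proof -
  define C where "C = {card A |A. A \<subseteq> \<Omega> \<and> finite A \<and> (\<forall>x\<in>A. \<forall>y\<in>A. x \<noteq> y \<longrightarrow> \<epsilon> \<le> \<rho> x y)}"
  have CE: thesis if "c \<in> C" and "\<And>A. c = card A \<Longrightarrow> A \<subseteq> \<Omega> \<Longrightarrow> finite A \<Longrightarrow>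
    \<forall>x\<in>A. \<forall>y\<in>A. x \<noteq> y \<longrightarrow> \<epsilon> \<le> \<rho> x y \<Longrightarrow> thesis" for c thesis
    using that(1) unfolding C_def mem_Collect_eq by (elim exE conjE) (rule that(2))
  have "C \<subseteq> {..N}"
  proof
    fix c assume "c \<in> C"
    then obtain A where "c = card A" "A \<subseteq> \<Omega>" "finite A" "\<forall>x\<in>A. \<forall>y\<in>A. x \<noteq> y \<longrightarrow> \<epsilon> \<le> \<rho> x y"
      by (rule CE)
    then show "c \<in> {..N}" using bound[of A] by simp
  qed
  then have fin: "finite C" by (rule finite_subset) simp
  have CI: "card A \<in> C" if "A \<subseteq> \<Omega>" "finite A" "\<forall>x\<in>A. \<forall>y\<in>A. x \<noteq> y \<longrightarrow> \<epsilon> \<le> \<rho> x y" for A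
    unfolding C_def mem_Collect_eq by (intro exI[of _ A] conjI refl that)
  have eq: "separation_number \<epsilon> \<Omega> \<rho> = Max C" by (simp add: separation_number_def C_def)
  have "0 \<in> C" using CI[of "{}"] by simp
  then have "Max C \<in> C" using fin by (intro Max_in) auto
  then obtain A where "Max C = card A" "A \<subseteq> \<Omega>" "finite A" "\<forall>x\<in>A. \<forall>y\<in>A. x \<noteq> y \<longrightarrow> \<epsilon> \<le> \<rho> x y"
    by (rule CE)
  then show "\<exists>A. A \<subseteq> \<Omega> \<and> finite A \<and> (\<forall>x\<in>A. \<forall>y\<in>A. x \<noteq> y \<longrightarrow> \<epsilon> \<le> \<rho> x y) \<and> card A = separation_number \<epsilon> \<Omega> \<rho>"
    unfolding eq by (intro exI[of _ A]) simp
  show "card A \<le> separation_number \<epsilon> \<Omega> \<rho>"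
    if "A \<subseteq> \<Omega>" "finite A" "\<forall>x\<in>A. \<forall>y\<in>A. x \<noteq> y \<longrightarrow> \<epsilon> \<le> \<rho> x y" for A
    unfolding eq using CI[OF that] fin by (rule Max_ge[rotated])
qed

lemma separation_number_approx_maps:
  assumes X: "compact_space X" "compatible_metric X d" and V: "finite V" "V \<noteq> {}" and \<epsilon>: "0 < \<epsilon>"
  shows "\<exists>\<Omega>. finite \<Omega> \<and> \<Omega> \<subseteq> approx_maps (topspace X) d \<alpha> F \<delta> V \<sigma> \<and>
      (\<forall>\<phi>\<in>\<Omega>. \<forall>\<psi>\<in>\<Omega>. \<phi> \<noteq> \<psi> \<longrightarrow> \<epsilon> \<le> dist_inf d V \<phi> \<psi>) \<and>
      card \<Omega> = separation_number \<epsilon> (approx_maps (topspace X) d \<alpha> F \<delta> V \<sigma>) (dist_inf d V)"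
    and "\<And>\<Omega>. finite \<Omega> \<Longrightarrow> \<Omega> \<subseteq> approx_maps (topspace X) d \<alpha> F \<delta> V \<sigma> \<Longrightarrow>
      \<forall>\<phi>\<in>\<Omega>. \<forall>\<psi>\<in>\<Omega>. \<phi> \<noteq> \<psi> \<longrightarrow> \<epsilon> \<le> dist_inf d V \<phi> \<psi> \<Longrightarrow>
      card \<Omega> \<le> separation_number \<epsilon> (approx_maps (topspace X) d \<alpha> F \<delta> V \<sigma>) (dist_inf d V)"
proof -
  obtain m :: nat and cell where cell: "cell ` topspace X \<subseteq> {..<m}"
    and small: "\<forall>x\<in>topspace X. \<forall>y\<in>topspace X. cell x = cell y \<longrightarrow> d x y < \<epsilon>"
    using exists_cells[OF X \<epsilon>] by (elim exE conjE) (rule that)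
  have bound: "card A \<le> m ^ card V"
    if A: "A \<subseteq> approx_maps (topspace X) d \<alpha> F \<delta> V \<sigma>" "finite A" and sep: "\<forall>\<phi>\<in>A. \<forall>\<psi>\<in>A. \<phi> \<noteq> \<psi> \<longrightarrow> \<epsilon> \<le> dist_inf d V \<phi> \<psi>" for A
  proof (rule card_separated_maps_le[OF V cell _ _ sep])
    show "A \<subseteq> V \<rightarrow>\<^sub>E topspace X" using A by (auto simp: approx_maps_def)
  qed (use small in blast)
  show "\<exists>\<Omega>. finite \<Omega> \<and> \<Omega> \<subseteq> approx_maps (topspace X) d \<alpha> F \<delta> V \<sigma> \<and>
      (\<forall>\<phi>\<in>\<Omega>. \<forall>\<psi>\<in>\<Omega>. \<phi> \<noteq> \<psi> \<longrightarrow> \<epsilon> \<le> dist_inf d V \<phi> \<psi>) \<and>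
      card \<Omega> = separation_number \<epsilon> (approx_maps (topspace X) d \<alpha> F \<delta> V \<sigma>) (dist_inf d V)"
  proof -
    have "\<exists>\<Omega>. \<Omega> \<subseteq> approx_maps (topspace X) d \<alpha> F \<delta> V \<sigma> \<and> finite \<Omega> \<and>
      (\<forall>\<phi>\<in>\<Omega>. \<forall>\<psi>\<in>\<Omega>. \<phi> \<noteq> \<psi> \<longrightarrow> \<epsilon> \<le> dist_inf d V \<phi> \<psi>) \<and>
      card \<Omega> = separation_number \<epsilon> (approx_maps (topspace X) d \<alpha> F \<delta> V \<sigma>) (dist_inf d V)"
      by (rule separation_number(1)) (rule bound)
    then show ?thesis by (elim exE conjE) (intro exI conjI, assumption+)
  qed
  show "card \<Omega> \<le> separation_number \<epsilon> (approx_maps (topspace X) d \<alpha> F \<delta> V \<sigma>) (dist_inf d V)"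
    if "finite \<Omega>" "\<Omega> \<subseteq> approx_maps (topspace X) d \<alpha> F \<delta> V \<sigma>"
      "\<forall>\<phi>\<in>\<Omega>. \<forall>\<psi>\<in>\<Omega>. \<phi> \<noteq> \<psi> \<longrightarrow> \<epsilon> \<le> dist_inf d V \<phi> \<psi>" for \<Omega>
    using bound that(2,1,3) by (rule separation_number(2))
qed

text \<open>For s = 0 both sides fail, as the logarithm is minus infinity and the exponential is
  positive.\<close>

lemma le_log_nat_iff:
  assumes "0 < n"
  shows "ereal a \<le> ereal (1 / real n) * log_nat s \<longleftrightarrow> exp (a * real n) \<le> real s"
proof (cases "s = 0")
  case True
  have "\<not> exp (a * real n) \<le> 0" by (simp add: not_le)
  then show ?thesis using True assms by (simp add: log_nat_def)
next
  case False
  have "ereal a \<le> ereal (1 / real n) * log_nat s \<longleftrightarrow> a * real n \<le> ln (real s)"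
    using False assms by (simp add: log_nat_def pos_le_divide_eq)
  also have "\<dots> \<longleftrightarrow> exp (a * real n) \<le> real s" using False by (intro ln_ge_iff) simp
  finally show ?thesis .
qed

lemma good_approximation_mono:
  assumes "good_approximation G F \<delta> V \<sigma>" "F' \<subseteq> F" "\<delta> \<le> \<delta>'"
  shows "good_approximation G F' \<delta>' V \<sigma>"
  unfolding good_approximation_def
proof (intro conjI ballI impI)
  fix s t assume "s \<in> F'" "t \<in> F'"
  then have st: "s \<in> F" "t \<in> F" using assms by auto
  have "hamming_dist V (\<sigma> (s \<otimes>\<^bsub>G\<^esub> t)) (\<sigma> s \<circ> \<sigma> t) \<le> \<delta>" using assms(1) st by (simp add: good_approximation_def)
  then show "hamming_dist V (\<sigma> (s \<otimes>\<^bsub>G\<^esub> t)) (\<sigma> s \<circ> \<sigma> t) \<le> \<delta>'" using assms(3) by linarith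
  assume "s \<noteq> t"
  then have "1 - \<delta> \<le> hamming_dist V (\<sigma> s) (\<sigma> t)" using assms(1) st by (simp add: good_approximation_def)
  then show "1 - \<delta>' \<le> hamming_dist V (\<sigma> s) (\<sigma> t)" using assms(3) by linarith
qed

lemma approx_maps_mono:
  assumes "F' \<subseteq> F" "\<delta> \<le> \<delta>'"
  shows "approx_maps S d \<alpha> F \<delta> V \<sigma> \<subseteq> approx_maps S d \<alpha> F' \<delta>' V \<sigma>"
  using assms by (fastforce simp: approx_maps_def)

text \<open>A number strictly below the supremum fixes one \<epsilon> that serves for all F and
  \<delta>, and a number strictly below a limsup is exceeded at infinitely many k.\<close>

lemma entropy_ge_imp_many:
  assumes X: "compact_space X" "compatible_metric X d" and G: "group G"
    and seq: "sofic_approximation_sequence G V \<sigma>" and a: "ereal a < sofic_entropy_along G X d \<alpha> V \<sigma>"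
  shows "\<exists>\<epsilon>>0. \<forall>F \<delta>. finite F \<and> F \<subseteq> carrier G \<and> 0 < \<delta> \<longrightarrow> (\<exists>\<^sub>F k in sequentially. \<exists>\<Omega>. finite \<Omega> \<and>
      \<Omega> \<subseteq> approx_maps (topspace X) d \<alpha> F \<delta> (V k) (\<sigma> k) \<and>
      (\<forall>\<phi>\<in>\<Omega>. \<forall>\<psi>\<in>\<Omega>. \<phi> \<noteq> \<psi> \<longrightarrow> \<epsilon> \<le> dist_inf d (V k) \<phi> \<psi>) \<and> exp (a * real (card (V k))) \<le> real (card \<Omega>))"
proof -
  define N where "N \<epsilon> F \<delta> k = separation_number \<epsilon> (approx_maps (topspace X) d \<alpha> F \<delta> (V k) (\<sigma> k)) (dist_inf d (V k))"
    for \<epsilon> F \<delta> k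
  have "\<exists>\<epsilon>\<in>{0<..}. ereal a < (INF F\<in>{F. finite F \<and> F \<subseteq> carrier G}. INF \<delta>\<in>{0<..}.
        limsup (\<lambda>k. ereal (1 / real (card (V k))) * log_nat (N \<epsilon> F \<delta> k)))"
    using a by (simp add: sofic_entropy_along_def less_SUP_iff N_def)
  then obtain \<epsilon> where "\<epsilon> \<in> {0<..}" and less: "ereal a < (INF F\<in>{F. finite F \<and> F \<subseteq> carrier G}. INF \<delta>\<in>{0<..}.
        limsup (\<lambda>k. ereal (1 / real (card (V k))) * log_nat (N \<epsilon> F \<delta> k)))" by (elim bexE) (rule that)
  then have \<epsilon>: "0 < \<epsilon>" by simp
  show ?thesis
  proof (intro exI[of _ \<epsilon>] conjI allI impI \<epsilon>)
    fix F \<delta> assume F: "finite F \<and> F \<subseteq> carrier G \<and> 0 < (\<delta> :: real)"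
    note less
    also have "(INF F\<in>{F. finite F \<and> F \<subseteq> carrier G}. INF \<delta>\<in>{0<..}.
        limsup (\<lambda>k. ereal (1 / real (card (V k))) * log_nat (N \<epsilon> F \<delta> k))) \<le>
      (INF \<delta>\<in>{0<..}. limsup (\<lambda>k. ereal (1 / real (card (V k))) * log_nat (N \<epsilon> F \<delta> k)))"
      by (rule INF_lower) (use F in simp)
    also have "\<dots> \<le> limsup (\<lambda>k. ereal (1 / real (card (V k))) * log_nat (N \<epsilon> F \<delta> k))"
      by (rule INF_lower) (use F in simp)
    finally have l: "ereal a < limsup (\<lambda>k. ereal (1 / real (card (V k))) * log_nat (N \<epsilon> F \<delta> k))" .
    have "\<exists>\<^sub>F k in sequentially. \<not> ereal (1 / real (card (V k))) * log_nat (N \<epsilon> F \<delta> k) \<le> ereal a"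
    proof (rule ccontr)
      assume "\<not> ?thesis"
      then have "limsup (\<lambda>k. ereal (1 / real (card (V k))) * log_nat (N \<epsilon> F \<delta> k)) \<le> ereal a"
        by (intro Limsup_bounded) (simp add: frequently_def)
      then show False using l by simp
    qed
    then show "\<exists>\<^sub>F k in sequentially. \<exists>\<Omega>. finite \<Omega> \<and> \<Omega> \<subseteq> approx_maps (topspace X) d \<alpha> F \<delta> (V k) (\<sigma> k) \<and>
      (\<forall>\<phi>\<in>\<Omega>. \<forall>\<psi>\<in>\<Omega>. \<phi> \<noteq> \<psi> \<longrightarrow> \<epsilon> \<le> dist_inf d (V k) \<phi> \<psi>) \<and> exp (a * real (card (V k))) \<le> real (card \<Omega>)"
    proof (rule frequently_elim1)
      fix k assume k: "\<not> ereal (1 / real (card (V k))) * log_nat (N \<epsilon> F \<delta> k) \<le> ereal a"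
      interpret sofic_approx G "V k" "\<sigma> k" by (rule sofic_approx_of_sequence[OF G seq])
      have "ereal a \<le> ereal (1 / real (card (V k))) * log_nat (N \<epsilon> F \<delta> k)" using k by simp
      then have "exp (a * real (card (V k))) \<le> real (N \<epsilon> F \<delta> k)" using card_V_pos by (subst (asm) le_log_nat_iff) simp_all
      moreover obtain \<Omega> where "finite \<Omega>" "\<Omega> \<subseteq> approx_maps (topspace X) d \<alpha> F \<delta> (V k) (\<sigma> k)"
        "\<forall>\<phi>\<in>\<Omega>. \<forall>\<psi>\<in>\<Omega>. \<phi> \<noteq> \<psi> \<longrightarrow> \<epsilon> \<le> dist_inf d (V k) \<phi> \<psi>" "card \<Omega> = N \<epsilon> F \<delta> k"
        using separation_number_approx_maps(1)[OF X finite_V V_nonempty \<epsilon>, of \<alpha> F \<delta> "\<sigma> k", folded N_def]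
        by (elim exE conjE) (rule that)
      ultimately show "\<exists>\<Omega>. finite \<Omega> \<and> \<Omega> \<subseteq> approx_maps (topspace X) d \<alpha> F \<delta> (V k) (\<sigma> k) \<and>
        (\<forall>\<phi>\<in>\<Omega>. \<forall>\<psi>\<in>\<Omega>. \<phi> \<noteq> \<psi> \<longrightarrow> \<epsilon> \<le> dist_inf d (V k) \<phi> \<psi>) \<and> exp (a * real (card (V k))) \<le> real (card \<Omega>)"
        by (intro exI[of _ \<Omega>]) simp
    qed
  qed
qed

text \<open>Diagonal choice: the countable group is exhausted by finite sets \<open>F m\<close>, the
  tolerance is 1 / (m + 1), and the approximations found for these data are collected into a new
  sequence. The indices \<open>k m\<close> need not increase, since \<open>W' m\<close> only has to
  be accurate for \<open>F m\<close> and \<open>e m\<close>. As \<epsilon> is the same throughout,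
  the entropy along the new sequence is at least a.\<close>

lemma max_sofic_entropy_ge:
  fixes W :: "nat \<Rightarrow> nat set"
  assumes Y: "compact_space Y" "compatible_metric Y d" and H: "group H" "countable (carrier H)" and \<epsilon>: "0 < \<epsilon>"
    and many: "\<forall>F \<delta>. finite F \<and> F \<subseteq> carrier H \<and> 0 < \<delta> \<longrightarrow> (\<exists>k \<pi> \<Omega>.
      sofic_approximation H (W k) \<pi> \<and> good_approximation H F \<delta> (W k) \<pi> \<and> finite \<Omega> \<and>
      \<Omega> \<subseteq> approx_maps (topspace Y) d \<beta> F \<delta> (W k) \<pi> \<and>
      (\<forall>\<phi>\<in>\<Omega>. \<forall>\<psi>\<in>\<Omega>. \<phi> \<noteq> \<psi> \<longrightarrow> \<epsilon> \<le> dist_inf d (W k) \<phi> \<psi>) \<and> exp (a * real (card (W k))) \<le> real (card \<Omega>))"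
  shows "ereal a \<le> max_sofic_entropy H Y d \<beta>"
proof -
  define F where "F m = from_nat_into (carrier H) ` {..m}" for m :: nat
  have ne: "carrier H \<noteq> {}" using monoid.one_closed[OF group.is_monoid[OF H(1)]] by blast
  have F: "finite (F m)" "F m \<subseteq> carrier H" for m using from_nat_into[OF ne] by (auto simp: F_def)
  have F_ev: "\<forall>\<^sub>F m in sequentially. A \<subseteq> F m" if A: "finite A" "A \<subseteq> carrier H" for A
  proof -
    define M where "M = Max (to_nat_on (carrier H) ` A)"
    have "A \<subseteq> F m" if "M \<le> m" for m
    proof
      fix x assume x: "x \<in> A"
      have "to_nat_on (carrier H) x \<le> M" unfolding M_def using A(1) x by (intro Max_ge) auto
      then have "to_nat_on (carrier H) x \<in> {..m}" using that by simp
      moreover have "from_nat_into (carrier H) (to_nat_on (carrier H) x) = x"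
        using H(2) A(2) x by (intro from_nat_into_to_nat_on) auto
      ultimately show "x \<in> F m" unfolding F_def by (metis imageI)
    qed
    then show ?thesis unfolding eventually_sequentially by blast
  qed
  define e where "e m = 1 / real (Suc m)" for m
  have e: "0 < e m" for m by (simp add: e_def)
  have e_ev: "\<forall>\<^sub>F m in sequentially. e m \<le> \<delta>" if \<delta>: "0 < \<delta>" for \<delta>
  proof -
    have "e \<longlonglongrightarrow> 0" unfolding e_def by (rule LIMSEQ_Suc[OF lim_1_over_n])
    then have "\<forall>\<^sub>F m in sequentially. e m < \<delta>" using \<delta> by (rule order_tendstoD)
    then show ?thesis by (rule eventually_mono) simp
  qed
  define P where "P m k \<pi> \<Omega> \<longleftrightarrow> sofic_approximation H (W k) \<pi> \<and> good_approximation H (F m) (e m) (W k) \<pi> \<and> finite \<Omega> \<and>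
      \<Omega> \<subseteq> approx_maps (topspace Y) d \<beta> (F m) (e m) (W k) \<pi> \<and>
      (\<forall>\<phi>\<in>\<Omega>. \<forall>\<psi>\<in>\<Omega>. \<phi> \<noteq> \<psi> \<longrightarrow> \<epsilon> \<le> dist_inf d (W k) \<phi> \<psi>) \<and> exp (a * real (card (W k))) \<le> real (card \<Omega>)"
    for m k \<pi> \<Omega>
  have "\<exists>k \<pi> \<Omega>. P m k \<pi> \<Omega>" for m
    unfolding P_def by (rule many[rule_format]) (use F e in simp)
  then obtain k \<pi> \<Omega> where P: "\<And>m. P m (k m) (\<pi> m) (\<Omega> m)" by metis
  define W' where "W' m = W (k m)" for m
  have sa: "sofic_approximation H (W' m) (\<pi> m)" and ga: "good_approximation H (F m) (e m) (W' m) (\<pi> m)"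
    and fin: "finite (\<Omega> m)" and sub: "\<Omega> m \<subseteq> approx_maps (topspace Y) d \<beta> (F m) (e m) (W' m) (\<pi> m)"
    and sep: "\<forall>\<phi>\<in>\<Omega> m. \<forall>\<psi>\<in>\<Omega> m. \<phi> \<noteq> \<psi> \<longrightarrow> \<epsilon> \<le> dist_inf d (W' m) \<phi> \<psi>"
    and big: "exp (a * real (card (W' m))) \<le> real (card (\<Omega> m))" for m
    using P[of m] by (simp_all add: P_def W'_def)
  have seq: "sofic_approximation_sequence H W' \<pi>"
    unfolding sofic_approximation_sequence_def
  proof (intro conjI allI impI sa)
    fix A \<delta> assume A: "finite A \<and> A \<subseteq> carrier H \<and> 0 < (\<delta> :: real)"
    have "\<forall>\<^sub>F m in sequentially. A \<subseteq> F m \<and> e m \<le> \<delta>" using F_ev e_ev A by (intro eventually_conj) auto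
    then show "\<forall>\<^sub>F m in sequentially. good_approximation H A \<delta> (W' m) (\<pi> m)"
      by (rule eventually_mono) (rule good_approximation_mono[OF ga], auto)
  qed
  have "ereal a \<le> limsup (\<lambda>m. ereal (1 / real (card (W' m))) *
      log_nat (separation_number \<epsilon> (approx_maps (topspace Y) d \<beta> A \<delta> (W' m) (\<pi> m)) (dist_inf d (W' m))))"
    if A: "finite A" "A \<subseteq> carrier H" and \<delta>: "0 < \<delta>" for A \<delta>
  proof (rule le_Limsup)
    have "\<forall>\<^sub>F m in sequentially. A \<subseteq> F m \<and> e m \<le> \<delta>" using F_ev e_ev A \<delta> by (intro eventually_conj) auto
    then show "\<forall>\<^sub>F m in sequentially. ereal a \<le> ereal (1 / real (card (W' m))) *
      log_nat (separation_number \<epsilon> (approx_maps (topspace Y) d \<beta> A \<delta> (W' m) (\<pi> m)) (dist_inf d (W' m)))"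
    proof (rule eventually_mono)
      fix m assume m: "A \<subseteq> F m \<and> e m \<le> \<delta>"
      interpret sofic_approx H "W' m" "\<pi> m" by (rule sofic_approx_of_sequence[OF H(1) seq])
      have "\<Omega> m \<subseteq> approx_maps (topspace Y) d \<beta> A \<delta> (W' m) (\<pi> m)"
        using sub approx_maps_mono[of A "F m" "e m" \<delta>] m by (meson order_trans)
      then have "card (\<Omega> m) \<le> separation_number \<epsilon> (approx_maps (topspace Y) d \<beta> A \<delta> (W' m) (\<pi> m)) (dist_inf d (W' m))"
        by (rule separation_number_approx_maps(2)[OF Y finite_V V_nonempty \<epsilon> fin _ sep])
      then have "exp (a * real (card (W' m))) \<le>
        real (separation_number \<epsilon> (approx_maps (topspace Y) d \<beta> A \<delta> (W' m) (\<pi> m)) (dist_inf d (W' m)))"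
        using big[of m] by linarith
      then show "ereal a \<le> ereal (1 / real (card (W' m))) *
        log_nat (separation_number \<epsilon> (approx_maps (topspace Y) d \<beta> A \<delta> (W' m) (\<pi> m)) (dist_inf d (W' m)))"
        using card_V_pos by (subst le_log_nat_iff) simp_all
    qed
  qed simp
  then have "ereal a \<le> sofic_entropy_along H Y d \<beta> W' \<pi>"
    unfolding sofic_entropy_along_def using \<epsilon> by (intro SUP_upper2[of \<epsilon>] INF_greatest) auto
  also have "\<dots> \<le> max_sofic_entropy H Y d \<beta>"
    unfolding max_sofic_entropy_def by (rule SUP_upper2[of "(W', \<pi>)"]) (use seq in auto)
  finally show ?thesis .
qed

lemma sofic_entropy_along_le_max:
  assumes X: "compact_space X" "compatible_metric X d" and Y: "compact_space Y" "compatible_metric Y d'"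
    and \<alpha>: "continuous_action G X \<alpha>" "topologically_free G X \<alpha>"
    and \<beta>: "continuous_action H Y \<beta>" "topologically_free H Y \<beta>"
    and oe: "continuously_orbit_equivalent G X \<alpha> H Y \<beta>" and H: "countable (carrier H)"
    and seq: "sofic_approximation_sequence G V \<sigma>" and sc: "sparsely_connected G V \<sigma>"
  shows "sofic_entropy_along G X d \<alpha> V \<sigma> \<le> max_sofic_entropy H Y d' \<beta>"
proof (rule ccontr)
  assume "\<not> ?thesis"
  then have "max_sofic_entropy H Y d' \<beta> < sofic_entropy_along G X d \<alpha> V \<sigma>" by simp
  \<comment> \<open>The entropies may be infinite, so two reals are placed between them; their
    difference \<open>a - a\<^sub>0\<close> is the loss granted to the transfer.\<close>
  from ereal_dense2[OF this] obtain a\<^sub>0 where a\<^sub>0: "max_sofic_entropy H Y d' \<beta> < ereal a\<^sub>0" "ereal a\<^sub>0 < sofic_entropy_along G X d \<alpha> V \<sigma>"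
    by (elim exE conjE) (rule that)
  from ereal_dense2[OF this(2)] obtain a where a: "ereal a\<^sub>0 < ereal a" "ereal a < sofic_entropy_along G X d \<alpha> V \<sigma>"
    by (elim exE conjE) (rule that)
  obtain b \<Phi> \<kappa> l where "regular_pair G H (topspace X) d (topspace Y) d' \<alpha> \<beta> b \<Phi> \<kappa> l"
    using exists_regular_pair[OF X Y \<alpha> \<beta> oe] by (elim exE) (rule that)
  then interpret regular_pair G H "topspace X" d "topspace Y" d' \<alpha> \<beta> b \<Phi> \<kappa> l .
  obtain \<epsilon> where \<epsilon>: "0 < \<epsilon>" and many: "\<forall>F \<delta>. finite F \<and> F \<subseteq> carrier G \<and> 0 < \<delta> \<longrightarrow>
      (\<exists>\<^sub>F k in sequentially. \<exists>\<Omega>. finite \<Omega> \<and> \<Omega> \<subseteq> approx_maps (topspace X) d \<alpha> F \<delta> (V k) (\<sigma> k) \<and>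
      (\<forall>\<phi>\<in>\<Omega>. \<forall>\<psi>\<in>\<Omega>. \<phi> \<noteq> \<psi> \<longrightarrow> \<epsilon> \<le> dist_inf d (V k) \<phi> \<psi>) \<and> exp (a * real (card (V k))) \<le> real (card \<Omega>))"
    using entropy_ge_imp_many[OF X is_group seq a(2)] by (elim exE conjE) (rule that)
  have "0 < a - a\<^sub>0" using a(1) by simp
  then obtain \<epsilon>' where \<epsilon>': "0 < \<epsilon>'" and many': "\<forall>F \<delta>'. finite F \<and> F \<subseteq> carrier H \<and> 0 < \<delta>' \<longrightarrow> (\<exists>k \<pi> \<Omega>.
      sofic_approximation H (V k) \<pi> \<and> good_approximation H F \<delta>' (V k) \<pi> \<and> finite \<Omega> \<and>
      \<Omega> \<subseteq> approx_maps (topspace Y) d' \<beta> F \<delta>' (V k) \<pi> \<and>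
      (\<forall>\<phi>\<in>\<Omega>. \<forall>\<psi>\<in>\<Omega>. \<phi> \<noteq> \<psi> \<longrightarrow> \<epsilon>' \<le> dist_inf d' (V k) \<phi> \<psi>) \<and>
      exp ((a - (a - a\<^sub>0)) * real (card (V k))) \<le> real (card \<Omega>))"
    using transfer_entropy[OF seq sc _ \<epsilon> many[rule_format], of "a - a\<^sub>0"] by auto
  have "ereal (a - (a - a\<^sub>0)) \<le> max_sofic_entropy H Y d' \<beta>"
    by (rule max_sofic_entropy_ge[OF Y H.is_group H \<epsilon>' many'])
  then show False using a\<^sub>0(1) by simp
qed

text \<open>Regularity replaces the maximum by the infimum, which lies below the entropy along the
  one sequence known to be sparsely connected; that entropy is what the transfer compares with
  H.\<close>

lemma max_sofic_entropy_le:
  assumes G: "sofic_group G" "has_w_normal_amenable_subgroup G \<or> is_product_of_infinite_sofic_groups G"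
    and X: "compact_space X" "compatible_metric X d" and Y: "compact_space Y" "compatible_metric Y d'"
    and \<alpha>: "continuous_action G X \<alpha>" "topologically_free G X \<alpha>"
    and \<beta>: "continuous_action H Y \<beta>" "topologically_free H Y \<beta>"
    and oe: "continuously_orbit_equivalent G X \<alpha> H Y \<beta>" and H: "countable (carrier H)"
    and reg: "entropy_regular G X d \<alpha>"
  shows "max_sofic_entropy G X d \<alpha> \<le> max_sofic_entropy H Y d' \<beta>"
proof -
  obtain V \<sigma> where seq: "sofic_approximation_sequence G V \<sigma>" and sc: "sparsely_connected G V \<sigma>"
    using exists_sparsely_connected_sequence[OF G] by (elim exE conjE) (rule that)
  have "max_sofic_entropy G X d \<alpha> = inf_sofic_entropy G X d \<alpha>" using reg by (simp add: entropy_regular_def)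
  also have "\<dots> \<le> sofic_entropy_along G X d \<alpha> V \<sigma>"
    unfolding inf_sofic_entropy_def by (rule INF_lower2[of "(V, \<sigma>)"]) (use seq in auto)
  also have "\<dots> \<le> max_sofic_entropy H Y d' \<beta>"
    by (rule sofic_entropy_along_le_max[OF X Y \<alpha> \<beta> oe H seq sc])
  finally show ?thesis .
qed

theorem theorem4:
  fixes G :: "('a, 'm) monoid_scheme" and H :: "('b, 'n) monoid_scheme"
    and X :: "'x topology" and Y :: "'y topology"
    and \<alpha> :: "'a \<Rightarrow> 'x \<Rightarrow> 'x" and \<beta> :: "'b \<Rightarrow> 'y \<Rightarrow> 'y"
    and d\<^sub>X :: "'x \<Rightarrow> 'x \<Rightarrow> real" and d\<^sub>Y :: "'y \<Rightarrow> 'y \<Rightarrow> real"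
  assumes "sofic_group G" and "countable (carrier G)"
    and "sofic_group H" and "countable (carrier H)"
    and "has_w_normal_amenable_subgroup G \<or> is_product_of_infinite_sofic_groups G"
    and "has_w_normal_amenable_subgroup H \<or> is_product_of_infinite_sofic_groups H"
    and "compact_space X" and "metrizable_space X" and "compatible_metric X d\<^sub>X"
    and "compact_space Y" and "metrizable_space Y" and "compatible_metric Y d\<^sub>Y"
    and "continuous_action G X \<alpha>" and "continuous_action H Y \<beta>"
    and "topologically_free G X \<alpha>" and "topologically_free H Y \<beta>"
    and "entropy_regular G X d\<^sub>X \<alpha>" and "entropy_regular H Y d\<^sub>Y \<beta>"
    and "continuously_orbit_equivalent G X \<alpha> H Y \<beta>"
  shows "max_sofic_entropy H Y d\<^sub>Y \<beta> = max_sofic_entropy G X d\<^sub>X \<alpha>"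
proof (rule antisym)
  show "max_sofic_entropy H Y d\<^sub>Y \<beta> \<le> max_sofic_entropy G X d\<^sub>X \<alpha>"
    by (rule max_sofic_entropy_le) (use assms continuously_orbit_equivalent_sym in blast)+
  show "max_sofic_entropy G X d\<^sub>X \<alpha> \<le> max_sofic_entropy H Y d\<^sub>Y \<beta>"
    by (rule max_sofic_entropy_le) (use assms in blast)+
qed

end
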